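(* Let $s\in(1,\infty)$, $\delta\in(0,1]$, $\theta\in\big[0,\frac{\delta}{i(\rho)+1}\big)$, and let $T$ be an $(s,\delta,\rho)$-Calderón–Zygmund operator. Then: (i) If $b\in\mathrm{BMO}_{\rho,\theta}(\mathcal X)$, then the commutator $[b,T]$ is bounded from $H^1_\rho(\mathcal X)$ into $L^{1,\infty}(\mathcal X)$. (ii) If $b\in\mathrm{BMO}^{\log}_{\rho,\theta}(\mathcal X)$, then the commutator $[b,T]$ is bounded from $H^1_\rho(\mathcal X)$ into $L^1(\mathcal X)$.
   Context: **Space.** $(\mathcal X,d,\mu)$ is a space of homogeneous type: $d:\mathcal X\times\mathcal X\to[0,\infty)$ is symmetric, $d(x,y)>0$ iff $x\neq y$, and $d(x,z)\le\kappa(d(x,y)+d(y,z))$ for some constant $\kappa\ge1$; $\mu$ is a regular Borel measure for which there is $C>1$ with $\mu(B(x,2r))\le C\mu(B(x,r))$ for all $x\in\mathcal X$, $r>0$, where $B(x,r)$ is the $d$-ball with center $x$ and radius $r$ (balls have positive finite measure). It is also assumed that there exist $\alpha_0\in(0,1]$ and $C>0$ with $|d(x,z)-d(y,z)|\le C(d(x,z)+d(y,z))^{1-\alpha_0}d(x,y)^{\alpha_0}$ for all $x,y,z$. **Admissible function.** $\rho:\mathcal X\to(0,\infty)$ is a fixed admissible function: there exist $k_0,c_0>0$ such that $\frac1{\rho(x)}\le\frac{c_0}{\rho(y)}\big(1+\frac{d(x,y)}{\rho(y)}\big)^{k_0}$ for all $x,y\in\mathcal X$. Its admissibility index $i(\rho)$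 is the infimum of all $k_0>0$ for which this holds with some $c_0=c_0(k_0)>0$. **Hardy space.** For $q\in(1,\infty]$, an $(H^1_\rho,q)$-atom related to a ball $B=B(x_0,r)$ with $0<r<\rho(x_0)$ is a measurable function $\mathfrak a$ with $\operatorname{supp}\mathfrak a\subset B$, $\|\mathfrak a\|_{L^q}\le\mu(B)^{1/q-1}$, and, if $0<r<\rho(x_0)/4$, $\int\mathfrak a\,d\mu=0$. $H^1_\rho(\mathcal X)$ is the space of $f\in L^1(\mathcal X)$ of the form $f=\sum_{j\ge1}\lambda_j\mathfrak a_j$ in $L^1$ with $(H^1_\rho,q)$-atoms $\mathfrak a_j$ and $(\lambda_j)\in\ell^1$, with norm the infimum of $\sum|\lambda_j|$ over such decompositions; the space does not depend on $q\in(1,\infty]$, up to equivalent norms. **BMO.** $f_B=\frac1{\mu(B)}\int_Bf\,d\mu$, $\mathrm{MO}(f,B)=\frac1{\mu(B)}\int_B|f-f_B|\,d\mu$. For $\theta\ge0$, $\mathrm{BMO}_{\rho,\theta}(\mathcal X)$ is the set of $f\in L^1_{\rm loc}(\mathcal X)$ with $\|f\|_{\mathrm{BMO}_{\rho,\theta}}=\sup_{B=B(x_0,r)}\big(1+\frac r{\rho(x_0)}\big)^{-\theta}\mathrm{MO}(f,B)<\infty$, and $\mathrm{BMO}^{\log}_{\rho,\theta}(\mathcal X)$ is the set of $f\in L^1_{\rm loc}(\mathcal X)$ with $\|f\|_{\mathrm{BMO}^{\log}_{\rho,\theta}}=\sup_{B=B(x_0,r)}\log\big(e+\frac{\rho(x_0)}r\big)\big(1+\frac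 r{\rho(x_0)}\big)^{-\theta}\mathrm{MO}(f,B)<\infty$. **$(s,\delta,\rho)$-Calderón–Zygmund operators.** For $s\in(1,\infty)$, $\delta\in(0,1]$, a linear operator $T$ with kernel $K(x,y)$ (i.e. $Tf(x)=\int K(x,y)f(y)\,d\mu(y)$ for $x\notin\operatorname{supp}f$, $f$ bounded with bounded support) is an $(s,\delta,\rho)$-Calderón–Zygmund operator if $T$ is bounded from $L^s(\mathcal X)$ into $L^{s,\infty}(\mathcal X)$ and: for each $N>0$ there is $C(N)>0$ such that, whenever $d(y,x_0)\le\frac R{2\kappa}$, $$\Big(\int_{R\le d(x,x_0)<2\kappa R}|K(x,y)|^s\,d\mu(x)\Big)^{1/s}\le\frac{C(N)}{\mu(B(x_0,R))^{1-1/s}}\Big(1+\frac R{\rho(x_0)}\Big)^{-N};$$ and there is $C>0$ such that, whenever $d(y,x_0)\le\frac R{2\kappa}$, $$\Big(\int_{R\le d(x,x_0)<2\kappa R}|K(x,y)-K(x,x_0)|^s\,d\mu(x)\Big)^{1/s}\le\Big[\frac{d(y,x_0)}R\Big]^\delta\frac{C}{\mu(B(x_0,R))^{1-1/s}}.$$ **Commutator.** $[b,T](f)=bTf-T(bf)$ for suitable $f$. *)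

theory Defs
  imports "HOL-Analysis.Analysis" "HOL-Probability.Essential_Supremum"
begin

section \<open>Spaces of homogeneous type\<close>

definition qball :: "('a \<Rightarrow> 'a \<Rightarrow> real) \<Rightarrow> 'a \<Rightarrow> real \<Rightarrow> 'a set" where
  "qball d x r = {y. d x y < r}"

definition qopen :: "('a \<Rightarrow> 'a \<Rightarrow> real) \<Rightarrow> 'a set \<Rightarrow> bool" where
  "qopen d U \<longleftrightarrow> (\<forall>x\<in>U. \<exists>r>0. qball d x r \<subseteq> U)"

text \<open>The underlying set is the whole type. Regularity is approximation by open sets from outside
  and by closed sets from inside, the weakest of the customary readings: inner regularity with
  respect to compact sets (which may fail if the space is not complete) is not assumed.\<close>

locale homogeneous_type_space =
  fixes d :: "'a \<Rightarrow> 'a \<Rightarrow> real" and \<kappa> :: real and M :: "'a measure"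
  assumes d_nonneg: "0 \<le> d x y"
    and d_sym: "d x y = d y x"
    and d_pos_iff: "0 < d x y \<longleftrightarrow> x \<noteq> y"
    and kappa_ge_1: "1 \<le> \<kappa>"
    and d_quasi_triangle: "d x z \<le> \<kappa> * (d x y + d y z)"
    and space_eq: "space M = UNIV"
    and sets_eq_borel: "sets M = sigma_sets UNIV {U. qopen d U}"
    and outer_regular: "A \<in> sets M \<Longrightarrow>
      emeasure M A = (INF U\<in>{U. A \<subseteq> U \<and> qopen d U}. emeasure M U)"
    and inner_regular: "A \<in> sets M \<Longrightarrow>
      emeasure M A = (SUP F\<in>{F. F \<subseteq> A \<and> qopen d (- F)}. emeasure M F)"
    and emeasure_ball_pos: "0 < r \<Longrightarrow> 0 < emeasure M (qball d x r)"
    and emeasure_ball_finite: "0 < r \<Longrightarrow> emeasure M (qball d x r) < \<infinity>"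
    and doubling: "\<exists>C>1. \<forall>x. \<forall>r>0. measure M (qball d x (2 * r)) \<le> C * measure M (qball d x r)"
    and d_Hoelder: "\<exists>\<alpha> C. 0 < \<alpha> \<and> \<alpha> \<le> 1 \<and> 0 < C \<and>
      (\<forall>x y z. \<bar>d x z - d y z\<bar> \<le> C * (d x z + d y z) powr (1 - \<alpha>) * d x y powr \<alpha>)"

section \<open>Admissible functions\<close>

definition admissible_with :: "('a \<Rightarrow> 'a \<Rightarrow> real) \<Rightarrow> ('a \<Rightarrow> real) \<Rightarrow> real \<Rightarrow> bool" where
  "admissible_with d \<rho> k \<longleftrightarrow>
     0 < k \<and> (\<exists>c>0. \<forall>x y. 1 / \<rho> x \<le> c / \<rho> y * (1 + d x y / \<rho> y) powr k)"

definition admissible :: "('a \<Rightarrow> 'a \<Rightarrow> real) \<Rightarrow> ('a \<Rightarrow> real) \<Rightarrow> bool" where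
  "admissible d \<rho> \<longleftrightarrow> (\<forall>x. 0 < \<rho> x) \<and> (\<exists>k. admissible_with d \<rho> k)"

definition admissibility_index :: "('a \<Rightarrow> 'a \<Rightarrow> real) \<Rightarrow> ('a \<Rightarrow> real) \<Rightarrow> real" where
  "admissibility_index d \<rho> = Inf {k. admissible_with d \<rho> k}"

section \<open>Lebesgue and weak Lebesgue spaces\<close>

text \<open>Real powers (with positive exponent) of extended nonnegative numbers.\<close>

definition enn_powr :: "ennreal \<Rightarrow> real \<Rightarrow> ennreal" where
  "enn_powr a p = (if a = top then top else ennreal (enn2real a powr p))"

definition Lp_norm :: "'a measure \<Rightarrow> ennreal \<Rightarrow> ('a \<Rightarrow> 'k::real_normed_vector) \<Rightarrow> ennreal" where
  "Lp_norm M p f =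
     (if p = top then esssup M (\<lambda>x. ennreal (norm (f x)))
      else enn_powr (\<integral>\<^sup>+ x. ennreal (norm (f x) powr enn2real p) \<partial>M) (1 / enn2real p))"

definition Lp :: "'a measure \<Rightarrow> ennreal \<Rightarrow> ('a \<Rightarrow> 'k::real_normed_vector) set" where
  "Lp M p = {f \<in> borel_measurable M. Lp_norm M p f < top}"

definition weak_Lp_norm :: "'a measure \<Rightarrow> real \<Rightarrow> ('a \<Rightarrow> 'k::real_normed_vector) \<Rightarrow> ennreal" where
  "weak_Lp_norm M p f =
     (SUP t\<in>{0<..}. ennreal t * enn_powr (emeasure M {x \<in> space M. t < norm (f x)}) (1 / p))"

text \<open>The closed support of a measurable function: the points none of whose neighbourhoods
  carries \<open>f = 0\<close> almost everywhere. It only depends on the almost-everywhere class of \<open>f\<close>.\<close>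

definition supp :: "('a \<Rightarrow> 'a \<Rightarrow> real) \<Rightarrow> 'a measure \<Rightarrow> ('a \<Rightarrow> 'k::real_normed_vector) \<Rightarrow> 'a set" where
  "supp d M f = {x. \<forall>r>0. 0 < emeasure M {y \<in> qball d x r. f y \<noteq> 0}}"

section \<open>The Hardy space\<close>

text \<open>For \<open>q = top\<close> the number \<open>enn2real (1 / q)\<close> is \<open>0\<close>.\<close>

definition H1_atom :: "('a \<Rightarrow> 'a \<Rightarrow> real) \<Rightarrow> 'a measure \<Rightarrow> ('a \<Rightarrow> real) \<Rightarrow> ennreal
    \<Rightarrow> 'a \<Rightarrow> real \<Rightarrow> ('a \<Rightarrow> 'k::{real_normed_field, banach, second_countable_topology}) \<Rightarrow> bool" where
  "H1_atom d M \<rho> q x0 r a \<longleftrightarrow>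
     0 < r \<and> r < \<rho> x0 \<and>
     a \<in> borel_measurable M \<and>
     supp d M a \<subseteq> qball d x0 r \<and>
     Lp_norm M q a \<le> ennreal (measure M (qball d x0 r) powr (enn2real (1 / q) - 1)) \<and>
     (r < \<rho> x0 / 4 \<longrightarrow> (\<integral>x. a x \<partial>M) = 0)"

definition H1_decomposition :: "('a \<Rightarrow> 'a \<Rightarrow> real) \<Rightarrow> 'a measure \<Rightarrow> ('a \<Rightarrow> real) \<Rightarrow> ennreal
    \<Rightarrow> ('a \<Rightarrow> 'k::{real_normed_field, banach, second_countable_topology})
    \<Rightarrow> (nat \<Rightarrow> 'k) \<Rightarrow> (nat \<Rightarrow> 'a \<Rightarrow> 'k) \<Rightarrow> bool" where
  "H1_decomposition d M \<rho> q f c a \<longleftrightarrow>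
     (\<forall>j. \<exists>x0 r. H1_atom d M \<rho> q x0 r (a j)) \<and>
     summable (\<lambda>j. norm (c j)) \<and>
     (\<lambda>n. Lp_norm M 1 (\<lambda>x. f x - (\<Sum>j<n. c j * a j x))) \<longlonglongrightarrow> 0"

definition H1 :: "('a \<Rightarrow> 'a \<Rightarrow> real) \<Rightarrow> 'a measure \<Rightarrow> ('a \<Rightarrow> real) \<Rightarrow> ennreal
    \<Rightarrow> ('a \<Rightarrow> 'k::{real_normed_field, banach, second_countable_topology}) set" where
  "H1 d M \<rho> q = {f \<in> Lp M 1. \<exists>c a. H1_decomposition d M \<rho> q f c a}"

definition H1_norm :: "('a \<Rightarrow> 'a \<Rightarrow> real) \<Rightarrow> 'a measure \<Rightarrow> ('a \<Rightarrow> real) \<Rightarrow> ennreal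
    \<Rightarrow> ('a \<Rightarrow> 'k::{real_normed_field, banach, second_countable_topology}) \<Rightarrow> real" where
  "H1_norm d M \<rho> q f = Inf {\<Sum>j. norm (c j) |c a. H1_decomposition d M \<rho> q f c a}"

section \<open>BMO spaces\<close>

definition L1_loc :: "('a \<Rightarrow> 'a \<Rightarrow> real) \<Rightarrow> 'a measure
    \<Rightarrow> ('a \<Rightarrow> 'k::{real_normed_field, banach, second_countable_topology}) set" where
  "L1_loc d M = {f \<in> borel_measurable M. \<forall>x r. set_integrable M (qball d x r) f}"

definition ball_mean :: "('a \<Rightarrow> 'a \<Rightarrow> real) \<Rightarrow> 'a measure
    \<Rightarrow> ('a \<Rightarrow> 'k::{real_normed_field, banach, second_countable_topology}) \<Rightarrow> 'a \<Rightarrow> real \<Rightarrow> 'k" where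
  "ball_mean d M f x r = (LINT y:qball d x r|M. f y) /\<^sub>R measure M (qball d x r)"

definition MO :: "('a \<Rightarrow> 'a \<Rightarrow> real) \<Rightarrow> 'a measure
    \<Rightarrow> ('a \<Rightarrow> 'k::{real_normed_field, banach, second_countable_topology}) \<Rightarrow> 'a \<Rightarrow> real \<Rightarrow> real" where
  "MO d M f x r =
     (LINT y:qball d x r|M. norm (f y - ball_mean d M f x r)) / measure M (qball d x r)"

definition BMO_norm :: "('a \<Rightarrow> 'a \<Rightarrow> real) \<Rightarrow> 'a measure \<Rightarrow> ('a \<Rightarrow> real) \<Rightarrow> real
    \<Rightarrow> ('a \<Rightarrow> 'k::{real_normed_field, banach, second_countable_topology}) \<Rightarrow> ennreal" where
  "BMO_norm d M \<rho> \<theta> f =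
     (SUP x. SUP r\<in>{0<..}. ennreal ((1 + r / \<rho> x) powr (- \<theta>) * MO d M f x r))"

definition BMO :: "('a \<Rightarrow> 'a \<Rightarrow> real) \<Rightarrow> 'a measure \<Rightarrow> ('a \<Rightarrow> real) \<Rightarrow> real
    \<Rightarrow> ('a \<Rightarrow> 'k::{real_normed_field, banach, second_countable_topology}) set" where
  "BMO d M \<rho> \<theta> = {f \<in> L1_loc d M. BMO_norm d M \<rho> \<theta> f < top}"

definition BMO_log_norm :: "('a \<Rightarrow> 'a \<Rightarrow> real) \<Rightarrow> 'a measure \<Rightarrow> ('a \<Rightarrow> real) \<Rightarrow> real
    \<Rightarrow> ('a \<Rightarrow> 'k::{real_normed_field, banach, second_countable_topology}) \<Rightarrow> ennreal" where
  "BMO_log_norm d M \<rho> \<theta> f =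
     (SUP x. SUP r\<in>{0<..}.
        ennreal (ln (exp 1 + \<rho> x / r) * (1 + r / \<rho> x) powr (- \<theta>) * MO d M f x r))"

definition BMO_log :: "('a \<Rightarrow> 'a \<Rightarrow> real) \<Rightarrow> 'a measure \<Rightarrow> ('a \<Rightarrow> real) \<Rightarrow> real
    \<Rightarrow> ('a \<Rightarrow> 'k::{real_normed_field, banach, second_countable_topology}) set" where
  "BMO_log d M \<rho> \<theta> = {f \<in> L1_loc d M. BMO_log_norm d M \<rho> \<theta> f < top}"

section \<open>Calderon-Zygmund operators\<close>

text \<open>Operators act on functions; as they are really operators on almost-everywhere classes, all
  identities between values of operators are required almost everywhere only. In particular
  linearity and boundedness imply that functions equal almost everywhere have images equal almost
  everywhere.\<close>

definition ae_linear_on :: "'a measure \<Rightarrow> ('a \<Rightarrow> 'k::real_normed_field) set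
    \<Rightarrow> (('a \<Rightarrow> 'k) \<Rightarrow> ('a \<Rightarrow> 'k)) \<Rightarrow> bool" where
  "ae_linear_on M S T \<longleftrightarrow>
     (\<forall>f\<in>S. \<forall>g\<in>S. \<forall>c. AE x in M. T (\<lambda>y. c * f y + g y) x = c * T f x + T g x)"

definition has_kernel :: "('a \<Rightarrow> 'a \<Rightarrow> real) \<Rightarrow> 'a measure
    \<Rightarrow> (('a \<Rightarrow> 'k::{real_normed_field, banach, second_countable_topology}) \<Rightarrow> ('a \<Rightarrow> 'k))
    \<Rightarrow> ('a \<Rightarrow> 'a \<Rightarrow> 'k) \<Rightarrow> bool" where
  "has_kernel d M T K \<longleftrightarrow>
     (\<lambda>(x, y). K x y) \<in> borel_measurable (M \<Otimes>\<^sub>M M) \<and>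
     (\<forall>f \<in> borel_measurable M. bounded (range f) \<and> (\<exists>x0 R. supp d M f \<subseteq> qball d x0 R) \<longrightarrow>
        (AE x in M. x \<notin> supp d M f \<longrightarrow> has_bochner_integral M (\<lambda>y. K x y * f y) (T f x)))"

definition CZ_operator :: "('a \<Rightarrow> 'a \<Rightarrow> real) \<Rightarrow> real \<Rightarrow> 'a measure \<Rightarrow> ('a \<Rightarrow> real) \<Rightarrow> real \<Rightarrow> real
    \<Rightarrow> (('a \<Rightarrow> 'k::{real_normed_field, banach, second_countable_topology}) \<Rightarrow> ('a \<Rightarrow> 'k)) \<Rightarrow> bool" where
  "CZ_operator d \<kappa> M \<rho> s \<delta> T \<longleftrightarrow>
     ae_linear_on M (Lp M (ennreal s)) T \<and>
     (\<exists>C. \<forall>f \<in> Lp M (ennreal s). T f \<in> borel_measurable M \<and>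
        weak_Lp_norm M s (T f) \<le> ennreal C * Lp_norm M (ennreal s) f) \<and>
     (\<exists>K. has_kernel d M T K \<and>
        (\<forall>N>0. \<exists>C>0. \<forall>x0 y R. 0 < R \<and> d y x0 \<le> R / (2 * \<kappa>) \<longrightarrow>
           enn_powr (\<integral>\<^sup>+ x\<in>{x. R \<le> d x x0 \<and> d x x0 < 2 * \<kappa> * R}. ennreal (norm (K x y) powr s) \<partial>M) (1 / s)
           \<le> ennreal (C / measure M (qball d x0 R) powr (1 - 1 / s) * (1 + R / \<rho> x0) powr (- N))) \<and>
        (\<exists>C>0. \<forall>x0 y R. 0 < R \<and> d y x0 \<le> R / (2 * \<kappa>) \<longrightarrow>
           enn_powr (\<integral>\<^sup>+ x\<in>{x. R \<le> d x x0 \<and> d x x0 < 2 * \<kappa> * R}.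
               ennreal (norm (K x y - K x x0) powr s) \<partial>M) (1 / s)
           \<le> ennreal ((d y x0 / R) powr \<delta> * (C / measure M (qball d x0 R) powr (1 - 1 / s)))))"

section \<open>Commutators\<close>

definition commutator :: "('a \<Rightarrow> 'k::real_normed_field) \<Rightarrow> (('a \<Rightarrow> 'k) \<Rightarrow> ('a \<Rightarrow> 'k))
    \<Rightarrow> ('a \<Rightarrow> 'k) \<Rightarrow> ('a \<Rightarrow> 'k)" where
  "commutator b T f = (\<lambda>x. b x * T f x - T (\<lambda>y. b y * f y) x)"

text \<open>For \<open>T\<close> defined on \<open>L\<^sup>s\<close>, the expression \<open>b T f - T (b f)\<close> makes sense as soon as both
  \<open>f\<close> and \<open>b f\<close> belong to \<open>L\<^sup>s\<close>.\<close>

definition commutator_domain :: "'a measure \<Rightarrow> real \<Rightarrow> ('a \<Rightarrow> 'k::real_normed_field)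
    \<Rightarrow> ('a \<Rightarrow> 'k) set" where
  "commutator_domain M s b = {f \<in> Lp M (ennreal s). (\<lambda>x. b x * f x) \<in> Lp M (ennreal s)}"

text \<open>Boundedness of \<open>[b, T]\<close> from \<open>H\<^sup>1\<close> into the space with (quasi-)norm \<open>tnorm\<close>: the commutator
  is defined on a dense subspace of \<open>H\<^sup>1\<close> and it extends to a bounded linear operator \<open>U\<close> on all
  of \<open>H\<^sup>1\<close>. By density the extension is unique (up to null sets).\<close>

definition commutator_bounded_from_H1 :: "('a \<Rightarrow> 'a \<Rightarrow> real) \<Rightarrow> 'a measure \<Rightarrow> ('a \<Rightarrow> real) \<Rightarrow> ennreal
    \<Rightarrow> real \<Rightarrow> ('a \<Rightarrow> 'k::{real_normed_field, banach, second_countable_topology})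
    \<Rightarrow> (('a \<Rightarrow> 'k) \<Rightarrow> ('a \<Rightarrow> 'k)) \<Rightarrow> (('a \<Rightarrow> 'k) \<Rightarrow> ennreal) \<Rightarrow> bool" where
  "commutator_bounded_from_H1 d M \<rho> q s b T tnorm \<longleftrightarrow>
     (\<forall>f \<in> H1 d M \<rho> q. \<forall>\<epsilon>>0. \<exists>g \<in> H1 d M \<rho> q \<inter> commutator_domain M s b.
        H1_norm d M \<rho> q (\<lambda>x. f x - g x) < \<epsilon>) \<and>
     (\<exists>U. ae_linear_on M (H1 d M \<rho> q) U \<and>
        (\<forall>f \<in> H1 d M \<rho> q \<inter> commutator_domain M s b. AE x in M. U f x = commutator b T f x) \<and>
        (\<exists>C. \<forall>f \<in> H1 d M \<rho> q. U f \<in> borel_measurable M \<and>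
           tnorm (U f) \<le> ennreal (C * H1_norm d M \<rho> q f)))"

end

theory Submission
  imports Defs
begin

text \<open>The operator \<open>T\<close> is of weak type \<open>(1,1)\<close> by a Calderon--Zygmund decomposition, and hence has
  an extension \<open>S\<close> to \<open>L\<^sup>1\<close>. If \<open>\<pi>\<^sub>n\<close> is the radial projection onto the ball of radius \<open>n\<close>, the
  truncated commutators \<open>U\<^sub>n f = (\<pi>\<^sub>n \<circ> b) S f - S ((\<pi>\<^sub>n \<circ> b) f)\<close> make sense for every integrable \<open>f\<close>.
  On an atom \<open>a\<close> supported in the ball \<open>B\<close> one may subtract the constant \<open>\<pi>\<^sub>n (b\<^sub>B)\<close> from \<open>\<pi>\<^sub>n \<circ> b\<close>, and as
  \<open>\<pi>\<^sub>n\<close> is \<open>2\<close>-Lipschitz, \<open>U\<^sub>n a\<close> is controlled, uniformly in \<open>n\<close>, by \<open>\<bar>b - b\<^sub>B\<bar> \<bar>S a\<bar>\<close> and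
  \<open>S\<close> applied to a function dominated by \<open>\<bar>b - b\<^sub>B\<bar> \<bar>a\<bar>\<close>.
  The John--Nirenberg inequality and admissibility bound the \<open>L\<^sup>p\<close> oscillation of \<open>b\<close> over
  \<open>(2\<kappa>)\<^sup>k B\<close> by \<open>(k + 1) (2\<kappa>)\<^bsup>k \<tau>\<^esup>\<close> with \<open>\<tau> = \<theta> (k\<^sub>0 + 1) < \<delta>\<close> for some admissible exponent \<open>k\<^sub>0\<close>,
  which the decay \<open>(2\<kappa>)\<^bsup>- k \<delta>\<^esup>\<close> of \<open>S a\<close> beats. So both products have \<open>L\<^sup>1\<close> norm at most a constant,
  the series over an atomic decomposition is dominated, the \<open>U\<^sub>n f\<close> converge in measure, and the
  limit agrees with \<open>[b, T] f\<close> where the latter is defined. Weak type \<open>(1,1)\<close> of \<open>S\<close> gives (i).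
  For (ii), \<open>(b - b\<^sub>B) a\<close> is a multiple of an atom up to its mean, whose size \<open>1 / ln (e + \<rho> / r)\<close>
  compensates the roughly \<open>ln (\<rho> / r)\<close> annuli on which \<open>S\<close> has no decay.\<close>

section \<open>Balls and coverings\<close>

context homogeneous_type_space
begin

text \<open>For \<open>f\<close> in \<open>H1\<close> neither product in
  \<open>b T f - T (b f)\<close> is under control: \<open>f\<close> need not lie in the domain of
  \<open>T\<close>, and \<open>b f\<close> need not be integrable. Nor does a uniform bound on
  single atoms define an operator on infinite sums. Truncation removes both obstacles: for fixed
  \<open>n\<close> the operator \<open>Ut n\<close> is continuous from L1 into convergence in
  measure, so it may be evaluated termwise on an atomic series. Unlike a cutoff of \<open>b\<close>
  at height \<open>n\<close>, the radial projection increases oscillation by at most a constant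
  factor.

  Weak L1 has no countable triangle inequality, so in (i) the images under \<open>S\<close> of
  infinitely many pieces cannot be added there. Instead the products with \<open>S a\<close> and
  with \<open>a\<close> are each summed in L1, and \<open>S\<close> is applied once, to the second
  sum.

  The exponent \<tau> arises because a ball of radius \<open>u \<le> 2 * \<kappa> * r\<close> with
  centre \<open>w\<close> within \<open>2 * \<kappa> * r\<close> of \<open>z\<close> has
  \<open>u / \<rho> w\<close> at most a constant times the power \<open>k\<^sub>0 + 1\<close> of
  \<open>1 + r / \<rho> z\<close>. The bound on \<theta> says exactly that some admissible
  \<open>k\<^sub>0\<close> makes \<tau> < \<delta>.\<close>

abbreviation "B \<equiv> qball d"

abbreviation V :: "'a \<Rightarrow> real \<Rightarrow> real" where "V x r \<equiv> measure M (B x r)"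

lemma mem_qball [simp]: "y \<in> B x r \<longleftrightarrow> d x y < r"
  by (simp add: qball_def)

lemma d_self [simp]: "d x x = 0"
  using d_pos_iff[of x x] d_nonneg[of x x] by simp

lemma qball_mono: "r \<le> r' \<Longrightarrow> B x r \<subseteq> B x r'"
  by auto

lemma qball_empty [simp]: "r \<le> 0 \<Longrightarrow> B x r = {}"
  using d_nonneg[of x] by (force simp: qball_def not_less intro: order_trans)

lemma kappa_pos: "0 < \<kappa>"
  using kappa_ge_1 by linarith

lemma qball_subset:
  assumes "\<kappa> * (d x y + r) \<le> r'"
  shows "B y r \<subseteq> B x r'"
proof
  fix z assume "z \<in> B y r"
  then have "\<kappa> * (d x y + d y z) < \<kappa> * (d x y + r)" using kappa_pos by simp
  then show "z \<in> B x r'" using d_quasi_triangle[of x z y] assms by simp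
qed

text \<open>A quasi-metric may be discontinuous and its balls may fail to be open; the Hoelder
  regularity of \<open>d\<close> excludes this. The quasi-triangle inequality first bounds
  \<open>d z x\<close> for \<open>z\<close> near \<open>y\<close>, which freezes the first factor of
  the Hoelder estimate into the constant \<open>D\<close>; the power in \<open>\<eta>\<close> then
  solves \<open>D * t powr \<alpha> = e\<close>.\<close>

lemma d_continuous:
  assumes "0 < e"
  shows "\<exists>\<eta>>0. \<forall>z. d y z < \<eta> \<longrightarrow> \<bar>d x z - d x y\<bar> < e"
proof -
  obtain \<alpha> C where a: "0 < \<alpha>" "\<alpha> \<le> 1" "0 < C"
    and H: "\<And>x y z. \<bar>d x z - d y z\<bar> \<le> C * (d x z + d y z) powr (1 - \<alpha>) * d x y powr \<alpha>"
    using d_Hoelder by blast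
  define D where "D = C * (\<kappa> * (1 + d y x) + d y x + 1) powr (1 - \<alpha>)"
  have "0 < D"
    using a kappa_pos d_nonneg[of y x] unfolding D_def
    by (smt (verit, best) mult_pos_pos powr_gt_zero)
  define \<eta> where "\<eta> = min 1 ((e / D) powr (1 / \<alpha>))"
  show ?thesis
  proof (intro exI conjI allI impI)
    show "0 < \<eta>" using \<open>0 < D\<close> assms by (simp add: \<eta>_def)
    fix z assume z: "d y z < \<eta>"
    have "d z x \<le> \<kappa> * (d z y + d y x)" by (rule d_quasi_triangle)
    also have "\<dots> \<le> \<kappa> * (1 + d y x)" 
      using z kappa_pos by (simp add: \<eta>_def d_sym)
    finally have zx: "d z x \<le> \<kappa> * (1 + d y x)" .
    have "\<bar>d z x - d y x\<bar> \<le> C * (d z x + d y x) powr (1 - \<alpha>) * d z y powr \<alpha>" by (rule H)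
    also have "\<dots> \<le> D * d z y powr \<alpha>"
      unfolding D_def using a zx d_nonneg
      by (intro mult_right_mono mult_left_mono powr_mono2) auto
    also have "\<dots> < D * (e / D)"
    proof (intro mult_strict_left_mono \<open>0 < D\<close>)
      have "d z y powr \<alpha> < \<eta> powr \<alpha>" using z a d_nonneg by (intro powr_less_mono2) (auto simp: d_sym)
      also have "\<dots> \<le> ((e / D) powr (1 / \<alpha>)) powr \<alpha>"
        using a \<open>0 < D\<close> assms by (intro powr_mono2) (auto simp: \<eta>_def)
      also have "\<dots> = e / D" using a \<open>0 < D\<close> assms by (simp add: powr_powr)
      finally show "d z y powr \<alpha> < e / D" .
    qed
    finally show "\<bar>d x z - d x y\<bar> < e" using \<open>0 < D\<close> by (simp add: d_sym)
  qed
qed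

section \<open>Open balls and measurability of the distance\<close>

lemma qopen_qball: "qopen d (B x r)"
  unfolding qopen_def
proof
  fix y assume "y \<in> B x r"
  then obtain \<eta> where "\<eta> > 0" "\<And>z. d y z < \<eta> \<Longrightarrow> \<bar>d x z - d x y\<bar> < r - d x y"
    using d_continuous[of "r - d x y" y x] by auto
  then show "\<exists>\<eta>>0. B y \<eta> \<subseteq> B x r" by (intro exI[of _ \<eta>]) fastforce
qed

lemma sets_qball [measurable, simp]: "B x r \<in> sets M"
  using qopen_qball[of x r] by (auto simp: sets_eq_borel intro: sigma_sets.Basic)

lemma sets_qopen: "qopen d U \<Longrightarrow> U \<in> sets M"
  by (auto simp: sets_eq_borel intro: sigma_sets.Basic)

lemma qopen_greater: "qopen d {y. r < d x y}"
  unfolding qopen_def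
proof
  fix y assume "y \<in> {y. r < d x y}"
  then obtain \<eta> where "\<eta> > 0" "\<And>z. d y z < \<eta> \<Longrightarrow> \<bar>d x z - d x y\<bar> < d x y - r"
    using d_continuous[of "d x y - r" y x] by auto
  then show "\<exists>\<eta>>0. B y \<eta> \<subseteq> {y. r < d x y}" by (intro exI[of _ \<eta>]) fastforce
qed

lemma d_measurable [measurable]: "(\<lambda>y. d x y) \<in> borel_measurable M"
  by (rule borel_measurable_iff_less[THEN iffD2])
    (use sets_qball[of x] in \<open>auto simp: space_eq qball_def\<close>)

lemma d_measurable' [measurable]: "(\<lambda>y. d y x) \<in> borel_measurable M"
  using d_measurable[of x] by (simp add: d_sym[of _ x])

section \<open>Volumes of balls and doubling\<close>

lemma emeasure_qball: "emeasure M (B x r) = ennreal (V x r)"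
  by (cases "0 < r") (use emeasure_ball_finite[of r x] in \<open>auto simp: emeasure_eq_ennreal_measure\<close>)

lemma emeasure_qball_finite [simp]: "emeasure M (B x r) < top"
  by (simp add: emeasure_qball)

lemma V_pos: "0 < r \<Longrightarrow> 0 < V x r"
  using emeasure_ball_pos[of r x] by (simp add: emeasure_qball)

lemma V_mono: "B x r \<subseteq> B y r' \<Longrightarrow> V x r \<le> V y r'"
  by (intro measure_mono_fmeasurable) (auto simp: fmeasurable_def emeasure_qball)

lemma doubling_dilate: "\<exists>C\<ge>1. \<forall>x. \<forall>r\<ge>0. V x (l * r) \<le> C * V x r"
proof -
  obtain C where C: "C > 1" "\<And>x r. 0 < r \<Longrightarrow> V x (2 * r) \<le> C * V x r"
    using doubling by auto
  have *: "V x (2 ^ n * r) \<le> C ^ n * V x r" if "0 < r" for n x r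
  proof (induction n)
    case (Suc n)
    have "V x (2 ^ Suc n * r) \<le> C * V x (2 ^ n * r)" using C(2)[of "2 ^ n * r" x] that by (simp add: mult.assoc)
    also have "\<dots> \<le> C * (C ^ n * V x r)" using C Suc by (intro mult_left_mono) auto
    finally show ?case by (simp add: mult.assoc)
  qed simp
  obtain n where n: "l < 2 ^ n" using real_arch_pow[of 2 l] by auto
  have "V x (l * r) \<le> C ^ n * V x r" if "0 \<le> r" for x r
  proof (cases "r = 0")
    case False
    then have "V x (l * r) \<le> V x (2 ^ n * r)" using n that by (intro V_mono qball_mono) simp
    then show ?thesis using *[of r x n] that False by linarith
  qed simp
  moreover have "C ^ n \<ge> 1" using C by simp
  ultimately show ?thesis by blast
qed

text \<open>One doubling constant is fixed for each dilation factor, so later constants can be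
  written out and are visibly independent of centre and radius. Radius 0 is allowed in
  \<open>V_dilate\<close>, both sides being 0 there, because covering families are padded with empty
  balls.\<close>

definition dbl :: "real \<Rightarrow> real" where
  "dbl l = (SOME C. C \<ge> 1 \<and> (\<forall>x. \<forall>r\<ge>0. V x (l * r) \<le> C * V x r))"

lemma dbl_ge_1: "1 \<le> dbl l" and V_dilate: "0 \<le> r \<Longrightarrow> V x (l * r) \<le> dbl l * V x r"
  using someI_ex[OF doubling_dilate[of l]] unfolding dbl_def by auto

lemma dbl_pos: "0 < dbl l"
  using dbl_ge_1[of l] by linarith

lemma V_le_dbl:
  assumes "\<kappa> * (d x y + r') \<le> l * r" "0 \<le> r"
  shows "V y r' \<le> dbl l * V x r"
  using V_mono[OF qball_subset[OF assms(1)]] V_dilate[OF assms(2), of x l] by linarith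

lemma UN_qball: "(\<Union>n::nat. B x (real n)) = UNIV"
  by (auto simp: reals_Archimedean2)

lemma sigma_finite_M: "sigma_finite_measure M"
  by (rule sigma_finite_measure.intro, rule exI[of _ "range (\<lambda>n::nat. B undefined (real n))"])
    (use UN_qball space_eq in \<open>auto simp: emeasure_qball\<close>)

text \<open>The constant of the Vitali covering lemma, see \<open>qball_subset_L\<close>.\<close>

definition L :: real where "L = 5 * \<kappa>\<^sup>2"

lemma L_ge: "5 * \<kappa> \<le> L" "5 \<le> L" "1 \<le> L" "0 < L"
proof -
  have "\<kappa> * 1 \<le> \<kappa> * \<kappa>" using kappa_ge_1 by (intro mult_left_mono) auto
  with kappa_ge_1 show "5 * \<kappa> \<le> L" "5 \<le> L" "1 \<le> L" "0 < L"
    unfolding L_def power2_eq_square by linarith+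
qed

text \<open>Through a common point \<open>w\<close>, every point of the first ball is within
  \<open>4 * \<kappa> * u\<close> of \<open>w\<close>, hence within
  \<open>\<kappa> * (\<kappa> * u + 4 * \<kappa> * u)\<close> of \<open>y\<close>; this is the
  origin of \<open>5 * \<kappa>\<^sup>2\<close>. The factor 2 between the radii is the loss in the
  Vitali selection.\<close>

lemma qball_subset_L:
  assumes "B x r \<inter> B y u \<noteq> {}" "r \<le> 2 * u"
  shows "B x r \<subseteq> B y (L * u)"
proof
  fix z assume z: "z \<in> B x r"
  obtain w where w: "d x w < r" "d y w < u" using assms(1) by auto
  have "0 < u" using w(2) d_nonneg[of y w] by linarith
  have "d w z \<le> \<kappa> * (d w x + d x z)" by (rule d_quasi_triangle)
  also have "\<dots> \<le> \<kappa> * (4 * u)" using w z assms(2) kappa_pos by (simp add: d_sym)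
  finally have "d y w + d w z < \<kappa> * u + 4 * \<kappa> * u"
    using w mult_right_mono[OF kappa_ge_1, of u] \<open>0 < u\<close> by (simp only: mult_1_left) linarith
  then have "\<kappa> * (d y w + d w z) < \<kappa> * (\<kappa> * u + 4 * \<kappa> * u)" using kappa_pos by simp
  also have "\<dots> = L * u" by (simp add: L_def power2_eq_square algebra_simps)
  finally show "z \<in> B y (L * u)" using d_quasi_triangle[of y z w] by simp
qed

text \<open>Disjoint balls inside one fixed ball have summable positive volumes, so there are only
  countably many of them, and every ball lies in some ball about the base point
  \<open>undefined\<close>.\<close>

lemma countable_disjoint_balls:
  assumes pos: "\<And>p. p \<in> G \<Longrightarrow> 0 < snd p"
    and disj: "\<And>p p'. p \<in> G \<Longrightarrow> p' \<in> G \<Longrightarrow> p \<noteq> p' \<Longrightarrow> B (fst p) (snd p) \<inter> B (fst p') (snd p') = {}"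
  shows "countable G"
proof -
  define H where "H n = {p \<in> G. B (fst p) (snd p) \<subseteq> B undefined (real n)}" for n
  have "countable (H n)" for n
  proof -
    have "(\<lambda>p. V (fst p) (snd p)) summable_on H n"
    proof (rule nonneg_bdd_above_summable_on)
      show "bdd_above (sum (\<lambda>p. V (fst p) (snd p)) ` {F. F \<subseteq> H n \<and> finite F})"
      proof (rule bdd_aboveI2[of _ _ "V undefined n"])
        fix F assume F: "F \<in> {F. F \<subseteq> H n \<and> finite F}"
        have "(\<Sum>p\<in>F. V (fst p) (snd p)) = measure M (\<Union>p\<in>F. B (fst p) (snd p))"
        proof (rule measure_finite_Union[symmetric])
          show "disjoint_family_on (\<lambda>p. B (fst p) (snd p)) F"
            using F disj unfolding disjoint_family_on_def H_def by blast
        qed (use F in \<open>auto simp: emeasure_qball\<close>)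
        also have "\<dots> \<le> V undefined n"
          using F by (intro measure_mono_fmeasurable) (auto simp: H_def fmeasurable_def emeasure_qball)
        finally show "(\<Sum>p\<in>F. V (fst p) (snd p)) \<le> V undefined n" .
      qed
    qed simp
    from summable_countable_real[OF this] show ?thesis
    proof (rule countable_subset[rotated], intro subsetI)
      fix p assume "p \<in> H n"
      moreover from this have "p \<in> G" by (simp add: H_def)
      ultimately show "p \<in> {p \<in> H n. V (fst p) (snd p) \<noteq> 0}"
        using V_pos[OF pos[of p], of "fst p"] by auto
    qed
  qed
  moreover have "G \<subseteq> (\<Union>n. H n)"
  proof
    fix p assume "p \<in> G"
    moreover obtain n :: nat where "\<kappa> * (d undefined (fst p) + snd p) \<le> real n" using real_arch_simple by blast
    ultimately show "p \<in> (\<Union>n. H n)" using qball_subset[of undefined "fst p" "snd p" n] by (auto simp: H_def)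
  qed
  ultimately show ?thesis by (meson countable_UN countable_subset countableI_type)
qed

text \<open>Zorn's lemma is applied to disjoint subfamilies \<open>G\<close> with one more property:
  a ball of \<open>F\<close> that meets \<open>G\<close> meets a member of at least half its radius.
  If some balls missed a maximal \<open>G\<close>, one of them with more than half their supremal
  radius could be added without destroying this property. Balls are kept as pairs because a set does
  not determine its centre and radius.\<close>

lemma vitali_pairs:
  assumes F: "\<And>p. p \<in> F \<Longrightarrow> 0 < snd p \<and> snd p \<le> R"
  shows "\<exists>G\<subseteq>F. countable G \<and>
    (\<forall>p\<in>G. \<forall>p'\<in>G. p \<noteq> p' \<longrightarrow> B (fst p) (snd p) \<inter> B (fst p') (snd p') = {}) \<and>
    (\<forall>p\<in>F. \<exists>g\<in>G. B (fst p) (snd p) \<subseteq> B (fst g) (L * snd g))"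
proof -
  let ?m = "\<lambda>p p'. B (fst p) (snd p) \<inter> B (fst p') (snd p') \<noteq> {}"
  define \<A> where "\<A> = {G. G \<subseteq> F \<and> (\<forall>p\<in>G. \<forall>p'\<in>G. p \<noteq> p' \<longrightarrow> \<not> ?m p p') \<and>
     (\<forall>p\<in>F. (\<exists>g\<in>G. ?m p g) \<longrightarrow> (\<exists>g\<in>G. ?m p g \<and> snd p \<le> 2 * snd g))}"
  have "\<exists>G\<in>\<A>. \<forall>X\<in>\<A>. G \<subseteq> X \<longrightarrow> X = G"
  proof (rule subset_Zorn_nonempty)
    show "\<A> \<noteq> {}" by (auto simp: \<A>_def)
    fix \<C> assume C: "\<C> \<noteq> {}" "subset.chain \<A> \<C>"
    then have sub: "\<And>G. G \<in> \<C> \<Longrightarrow> G \<in> \<A>" and ch: "\<And>G H. G \<in> \<C> \<Longrightarrow> H \<in> \<C> \<Longrightarrow> G \<subseteq> H \<or> H \<subseteq> G"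
      by (auto simp: subset_chain_def)
    show "\<Union>\<C> \<in> \<A>"
      unfolding \<A>_def
    proof (intro CollectI conjI ballI impI)
      show "\<Union>\<C> \<subseteq> F" using sub unfolding \<A>_def by blast
      fix p p' assume "p \<in> \<Union>\<C>" "p' \<in> \<Union>\<C>" and ne: "p \<noteq> p'"
      then obtain G H where "G \<in> \<C>" "H \<in> \<C>" "p \<in> G" "p' \<in> H" by blast
      then obtain K where "K \<in> \<C>" "p \<in> K" "p' \<in> K" using ch[of G H] by blast
      then show "\<not> ?m p p'" using sub[of K] ne unfolding \<A>_def by blast
    next
      fix p assume "p \<in> F" "\<exists>g\<in>\<Union>\<C>. ?m p g"
      then obtain G g where "G \<in> \<C>" "g \<in> G" "?m p g" by blast
      then show "\<exists>g\<in>\<Union>\<C>. ?m p g \<and> snd p \<le> 2 * snd g"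
        using sub[of G] \<open>p \<in> F\<close> unfolding \<A>_def by blast
    qed
  qed
  then obtain G where GA: "G \<in> \<A>" and max: "\<And>X. X \<in> \<A> \<Longrightarrow> G \<subseteq> X \<Longrightarrow> X = G" by blast
  have meets: "\<exists>g\<in>G. ?m p g" if "p \<in> F" for p
  proof (rule ccontr)
    define H where "H = {p\<in>F. \<forall>g\<in>G. \<not> ?m p g}"
    assume "\<not> (\<exists>g\<in>G. ?m p g)"
    then have "p \<in> H" using that by (auto simp: H_def)
    define S where "S = (SUP p\<in>H. snd p)"
    have bdd: "bdd_above (snd ` H)" using F by (intro bdd_aboveI2[of _ _ R]) (auto simp: H_def)
    have S_ge: "snd p \<le> S" if "p \<in> H" for p unfolding S_def using that bdd by (intro cSUP_upper)
    have "0 < S" using S_ge[OF \<open>p \<in> H\<close>] F[OF \<open>p \<in> F\<close>] by linarith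
    then have "\<exists>q\<in>H. S / 2 < snd q"
      using less_cSUP_iff[of H snd "S / 2"] bdd \<open>p \<in> H\<close> unfolding S_def by auto
    then obtain q where q: "q \<in> H" "S / 2 < snd q" by blast
    have "fst q \<in> B (fst q) (snd q)" using F[of q] q by (auto simp: H_def)
    then have qq: "?m q q" by blast
    have "insert q G \<in> \<A>"
      unfolding \<A>_def
    proof (intro CollectI conjI ballI impI)
      show "insert q G \<subseteq> F" using GA q by (auto simp: \<A>_def H_def)
      fix p p' assume pp: "p \<in> insert q G" "p' \<in> insert q G" "p \<noteq> p'"
      have "\<not> ?m q g" "\<not> ?m g q" if "g \<in> G" for g using q that by (auto simp: H_def Int_commute)
      then show "\<not> ?m p p'" using pp GA unfolding \<A>_def by blast
    next
      fix p assume p: "p \<in> F" "\<exists>g\<in>insert q G. ?m p g"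
      show "\<exists>g\<in>insert q G. ?m p g \<and> snd p \<le> 2 * snd g"
      proof (cases "\<exists>g\<in>G. ?m p g")
        case True
        then show ?thesis using GA p(1) unfolding \<A>_def by blast
      next
        case False
        then have "p \<in> H" "?m p q" using p by (auto simp: H_def)
        then show ?thesis using S_ge[of p] q by (intro bexI[of _ q]) auto
      qed
    qed
    then have "q \<in> G" using max[of "insert q G"] by blast
    moreover have "\<forall>g\<in>G. \<not> ?m q g" using q(1) unfolding H_def by blast
    ultimately show False using qq by blast
  qed
  have "\<forall>p\<in>F. \<exists>g\<in>G. B (fst p) (snd p) \<subseteq> B (fst g) (L * snd g)"
  proof
    fix p assume "p \<in> F"
    then obtain g where "g \<in> G" "?m p g" "snd p \<le> 2 * snd g"
      using meets[of p] GA unfolding \<A>_def by blast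
    then show "\<exists>g\<in>G. B (fst p) (snd p) \<subseteq> B (fst g) (L * snd g)"
      using qball_subset_L[of "fst p" "snd p" "fst g" "snd g"] by blast
  qed
  moreover have "countable G"
    using GA F by (intro countable_disjoint_balls) (auto simp: \<A>_def)
  moreover have "G \<subseteq> F" "\<forall>p\<in>G. \<forall>p'\<in>G. p \<noteq> p' \<longrightarrow> \<not> ?m p p'"
    using GA unfolding \<A>_def by blast+
  ultimately show ?thesis by (intro exI[of _ G] conjI) simp_all
qed

text \<open>Finite subfamilies are padded with the empty ball, which is the ball of radius \<open>0\<close>.\<close>

lemma vitali:
  assumes F: "\<And>x r. (x, r) \<in> F \<Longrightarrow> 0 < r \<and> r \<le> R"
  obtains x :: "nat \<Rightarrow> 'a" and u :: "nat \<Rightarrow> real" where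
    "\<And>i. 0 \<le> u i" "\<And>i. 0 < u i \<Longrightarrow> (x i, u i) \<in> F"
    "disjoint_family (\<lambda>i. B (x i) (u i))"
    "\<And>y r. (y, r) \<in> F \<Longrightarrow> \<exists>i. B y r \<subseteq> B (x i) (L * u i)"
proof -
  obtain G where G: "G \<subseteq> F" "countable G"
    "\<And>p p'. p \<in> G \<Longrightarrow> p' \<in> G \<Longrightarrow> p \<noteq> p' \<Longrightarrow> B (fst p) (snd p) \<inter> B (fst p') (snd p') = {}"
    "\<And>p. p \<in> F \<Longrightarrow> \<exists>g\<in>G. B (fst p) (snd p) \<subseteq> B (fst g) (L * snd g)"
    using vitali_pairs[of F R] F by (metis prod.collapse)
  define e where "e i = (if i \<in> to_nat_on G ` G then from_nat_into G i else (undefined, 0))" for i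
  have e_in: "e i \<in> G" if "e i \<noteq> (undefined, 0)" for i
    using that G(2) unfolding e_def by (auto split: if_splits)
  have e_pos: "e i \<in> G" if "0 < snd (e i)" for i using that e_in[of i] by fastforce
  have inj: "i = j" if "e i = e j" "e i \<in> G" "i \<in> to_nat_on G ` G" "j \<in> to_nat_on G ` G" for i j
    using that G(2) by (auto simp: e_def)
  have nn: "0 \<le> snd (e i)" for i
    by (cases "e i = (undefined, 0)") (use e_in[of i] G(1) F[of "fst (e i)" "snd (e i)"] in \<open>auto\<close>)
  show ?thesis
  proof (rule that[of "\<lambda>i. snd (e i)" "\<lambda>i. fst (e i)"])
    show "0 \<le> snd (e i)" for i by (rule nn)
    show "(fst (e i), snd (e i)) \<in> F" if "0 < snd (e i)" for i using e_pos[OF that] G(1) by auto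
    show "disjoint_family (\<lambda>i. B (fst (e i)) (snd (e i)))"
      unfolding disjoint_family_on_def
    proof (intro ballI impI)
      fix i j :: nat assume "i \<noteq> j"
      show "B (fst (e i)) (snd (e i)) \<inter> B (fst (e j)) (snd (e j)) = {}"
      proof (cases "0 < snd (e i) \<and> 0 < snd (e j)")
        case True
        then have m: "e i \<in> G" "e j \<in> G" using e_pos by auto
        have "i \<in> to_nat_on G ` G" "j \<in> to_nat_on G ` G"
          using True by (auto simp: e_def split: if_splits)
        then have "e i \<noteq> e j" using inj m \<open>i \<noteq> j\<close> by blast
        then show ?thesis using G(3) m by blast
      next
        case False
        then show ?thesis using qball_empty[of "snd (e i)"] qball_empty[of "snd (e j)"] by (metis inf_bot_left inf_bot_right not_less)
      qed
    qed
    show "\<exists>i. B y r \<subseteq> B (fst (e i)) (L * snd (e i))" if yr: "(y, r) \<in> F" for y r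
    proof -
      obtain g where g: "g \<in> G" "B y r \<subseteq> B (fst g) (L * snd g)" using G(4)[OF yr] by auto
      then have "e (to_nat_on G g) = g" using G(2) by (simp add: e_def)
      then show ?thesis using g(2) by (intro exI[of _ "to_nat_on G g"]) simp
    qed
  qed
qed

text \<open>Each point off the support has a neighbourhood on which \<open>f\<close> vanishes almost
  everywhere, but uncountably many such neighbourhoods could add up; the Vitali lemma reduces them
  to a countable cover by null pieces.\<close>

lemma AE_in_supp:
  assumes [measurable]: "f \<in> borel_measurable M"
  shows "AE x in M. f x \<noteq> 0 \<longrightarrow> x \<in> supp d M f"
proof -
  define N where "N r x \<longleftrightarrow> emeasure M {y \<in> B x r. f y \<noteq> 0} = 0" for r x
  \<comment> \<open>The null condition is imposed on the dilated ball, since it is the dilates of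
    the selected balls that cover.\<close>
  define F where "F = {(x, r). 0 < r \<and> r \<le> 1 \<and> N (L * r) x}"
  obtain x u where xu: "\<And>i. 0 \<le> u i" "\<And>i. 0 < u i \<Longrightarrow> (x i, u i) \<in> F"
    "\<And>y r. (y, r) \<in> F \<Longrightarrow> \<exists>i::nat. B y r \<subseteq> B (x i) (L * u i)"
    by (rule vitali[of F 1]) (auto simp: F_def)
  have "(\<Union>i. {y \<in> B (x i) (L * u i). f y \<noteq> 0}) \<in> null_sets M"
  proof (rule null_sets_UN)
    fix i
    have "{y \<in> B (x i) (L * u i). f y \<noteq> 0} = {y \<in> space M. d (x i) y < L * u i \<and> f y \<noteq> 0}"
      by (auto simp: space_eq)
    also have "\<dots> \<in> sets M" by measurable
    finally show "{y \<in> B (x i) (L * u i). f y \<noteq> 0} \<in> null_sets M"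
      using xu(1,2)[of i] by (cases "u i = 0") (auto simp: null_sets_def F_def N_def)
  qed
  then show ?thesis
  proof (rule AE_I', intro subsetI)
    fix y assume "y \<in> {x \<in> space M. \<not> (f x \<noteq> 0 \<longrightarrow> x \<in> supp d M f)}"
    then have y: "f y \<noteq> 0" "y \<notin> supp d M f" by auto
    then obtain r where r: "0 < r" "N r y" by (auto simp: supp_def N_def)
    define t where "t = min 1 (r / L)"
    have t: "0 < t" "t \<le> 1" "L * t \<le> r" using r L_ge by (auto simp: t_def min_def field_simps)
    have "N (L * t) y"
    proof -
      have "{z \<in> B y r. f z \<noteq> 0} = {z \<in> space M. d y z < r \<and> f z \<noteq> 0}"
        by (auto simp: space_eq)
      also have "\<dots> \<in> sets M" by measurable
      finally have "{z \<in> B y r. f z \<noteq> 0} \<in> sets M" .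
      then have "emeasure M {z \<in> B y (L * t). f z \<noteq> 0} \<le> emeasure M {z \<in> B y r. f z \<noteq> 0}"
        using t by (intro emeasure_mono) auto
      then show ?thesis using r(2) by (simp add: N_def)
    qed
    then have "(y, t) \<in> F" using t by (auto simp: F_def)
    then obtain i where i: "B y t \<subseteq> B (x i) (L * u i)" using xu(3) by blast
    show "y \<in> (\<Union>i. {y \<in> B (x i) (L * u i). f y \<noteq> 0})"
      using subsetD[OF i, of y] t(1) y(1) by auto
  qed
qed

end

section \<open>Ball averages and stopping balls\<close>

lemma nn_integral_UN_le:
  assumes [measurable]: "h \<in> borel_measurable M" "\<And>i. A i \<in> sets M"
  shows "(\<integral>\<^sup>+x\<in>(\<Union>i::nat. A i). h x \<partial>M) \<le> (\<Sum>i. \<integral>\<^sup>+x\<in>A i. h x \<partial>M)"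
  using emeasure_subadditive_countably[of A "density M h"] assms(2)
  by (auto simp: emeasure_density image_subset_iff)

lemma nn_integral_UN_disjoint:
  assumes [measurable]: "h \<in> borel_measurable M" "\<And>i. A i \<in> sets M" and "disjoint_family A"
  shows "(\<integral>\<^sup>+x\<in>(\<Union>i::nat. A i). h x \<partial>M) = (\<Sum>i. \<integral>\<^sup>+x\<in>A i. h x \<partial>M)"
  using suminf_emeasure[of A "density M h"] assms by (auto simp: emeasure_density image_subset_iff)

lemma nn_integral_mono_set:
  "A \<subseteq> A' \<Longrightarrow> (\<integral>\<^sup>+x\<in>A. h x \<partial>M) \<le> (\<integral>\<^sup>+x\<in>A'. h x \<partial>M)"
  by (intro nn_integral_mono mult_left_mono) (auto split: split_indicator)

context homogeneous_type_space
begin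

lemma suminf_V_dilate_le:
  assumes "\<And>i::nat. 0 \<le> u i" "disjoint_family (\<lambda>i. B (x i) (u i))"
  shows "(\<Sum>i. ennreal (V (x i) (l * u i))) \<le> ennreal (dbl l) * emeasure M (\<Union>i. B (x i) (u i))"
proof -
  have "(\<Sum>i. ennreal (V (x i) (l * u i))) \<le> (\<Sum>i. ennreal (dbl l) * emeasure M (B (x i) (u i)))"
  proof (intro suminf_le allI)
    show "ennreal (V (x i) (l * u i)) \<le> ennreal (dbl l) * emeasure M (B (x i) (u i))" for i
      using V_dilate[OF assms(1)[of i], where l = l] dbl_pos[of l]
      by (simp add: emeasure_qball ennreal_mult'[symmetric] ennreal_leI)
  qed auto
  also have "\<dots> = ennreal (dbl l) * emeasure M (\<Union>i. B (x i) (u i))"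
    using suminf_emeasure[of "\<lambda>i. B (x i) (u i)" M] assms(2) by (simp add: ennreal_suminf_cmult image_subset_iff)
  finally show ?thesis .
qed

text \<open>A substitute for Lebesgue differentiation, with a loss of constants. If \<open>h\<close>
  exceeded the bound on a bounded set of measure \<open>m > 0\<close>, outer regularity would give
  an open superset of measure below \<open>2 m\<close>, and a Vitali cover by balls inside it would
  bound the integral of \<open>h\<close> over the set by \<open>2 * dbl L * \<alpha> * m\<close>.
  The summand 1 in the constant makes this a contradiction.\<close>

lemma AE_le_of_ball_averages_le:
  fixes h :: "'a \<Rightarrow> ennreal"
  assumes h[measurable]: "h \<in> borel_measurable M" and E[measurable]: "E \<in> sets M"
    and "0 < R" "0 < \<alpha>"
    and avg: "\<And>x u. x \<in> E \<Longrightarrow> 0 < u \<Longrightarrow> u < R \<Longrightarrow> (\<integral>\<^sup>+y\<in>B x u. h y \<partial>M) \<le> ennreal (\<alpha> * V x u)"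
  shows "AE x in M. x \<in> E \<longrightarrow> h x \<le> ennreal ((2 * dbl L + 1) * \<alpha>)"
proof -
  define A where "A = 2 * dbl L + 1"
  have "0 < A" using dbl_pos[of L] by (simp add: A_def)
  define En where "En n = {x \<in> space M. x \<in> E \<and> d undefined x < real n \<and> ennreal (A * \<alpha>) < h x}" for n
  have [measurable]: "En n \<in> sets M" for n unfolding En_def by measurable
  have "emeasure M (En n) = 0" for n
  proof (rule ccontr)
    define m where "m = emeasure M (En n)"
    assume "emeasure M (En n) \<noteq> 0"
    then have "0 < m" by (simp add: m_def zero_less_iff_neq_zero)
    have "m \<le> emeasure M (B undefined (real n))"
      unfolding m_def by (intro emeasure_mono) (auto simp: En_def)
    then have "m < top" using emeasure_qball_finite[of undefined n] le_less_trans by blast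
    then obtain mr where mr: "m = ennreal mr" "0 < mr" using \<open>0 < m\<close> by (cases m) (auto simp: top_unique)
    have "(INF U\<in>{U. En n \<subseteq> U \<and> qopen d U}. emeasure M U) < ennreal (2 * mr)"
    proof -
      have "(INF U\<in>{U. En n \<subseteq> U \<and> qopen d U}. emeasure M U) = ennreal mr"
        using outer_regular[of "En n"] mr by (simp add: m_def)
      also have "\<dots> < ennreal (2 * mr)" using mr by (intro ennreal_lessI) auto
      finally show ?thesis .
    qed
    then obtain U where U: "En n \<subseteq> U" "qopen d U" "emeasure M U < ennreal (2 * mr)"
      by (auto simp: INF_less_iff)
    have [measurable]: "U \<in> sets M" using U sets_qopen by blast
    \<comment> \<open>With radii at most \<open>R / (2 * L)\<close> the dilates still have radius
      below \<open>R\<close>, so \<open>avg\<close> applies to them.\<close>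
    define F where "F = {(x, u). x \<in> En n \<and> 0 < u \<and> u \<le> R / (2 * L) \<and> B x u \<subseteq> U}"
    obtain x u where xu: "\<And>i. 0 \<le> u i" "\<And>i. 0 < u i \<Longrightarrow> (x i, u i) \<in> F"
      "disjoint_family (\<lambda>i. B (x i) (u i))"
      "\<And>y r. (y, r) \<in> F \<Longrightarrow> \<exists>i::nat. B y r \<subseteq> B (x i) (L * u i)"
      by (rule vitali[of F "R / (2 * L)"]) (auto simp: F_def)
    have cover: "En n \<subseteq> (\<Union>i. B (x i) (L * u i))"
    proof
      fix y assume y: "y \<in> En n"
      then obtain r where r: "r > 0" "B y r \<subseteq> U" using U unfolding qopen_def by blast
      define t where "t = min r (R / (2 * L))"
      have "0 < t" using r L_ge \<open>0 < R\<close> by (simp add: t_def)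
      moreover have "B y t \<subseteq> B y r" by (auto simp: t_def)
      ultimately have "(y, t) \<in> F" using y r by (auto simp: F_def t_def)
      from xu(4)[OF this] obtain i where "B y t \<subseteq> B (x i) (L * u i)" by blast
      moreover have "y \<in> B y t" using \<open>0 < t\<close> by simp
      ultimately show "y \<in> (\<Union>i. B (x i) (L * u i))" by blast
    qed
    have UNU: "(\<Union>i. B (x i) (u i)) \<subseteq> U"
    proof (rule UN_least)
      fix i show "B (x i) (u i) \<subseteq> U"
        using xu(1,2)[of i] by (cases "u i = 0") (auto simp: F_def)
    qed
    have "ennreal (A * \<alpha>) * m = (\<integral>\<^sup>+y\<in>En n. ennreal (A * \<alpha>) \<partial>M)"
      by (simp add: nn_integral_cmult_indicator m_def)
    also have "\<dots> \<le> (\<integral>\<^sup>+y\<in>En n. h y \<partial>M)"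
      by (intro nn_integral_mono) (auto simp: En_def split: split_indicator)
    also have "\<dots> \<le> (\<integral>\<^sup>+y\<in>(\<Union>i. B (x i) (L * u i)). h y \<partial>M)"
      using cover by (rule nn_integral_mono_set)
    also have "\<dots> \<le> (\<Sum>i. \<integral>\<^sup>+y\<in>B (x i) (L * u i). h y \<partial>M)"
      by (intro nn_integral_UN_le) auto
    also have "\<dots> \<le> (\<Sum>i. ennreal \<alpha> * ennreal (V (x i) (L * u i)))"
    proof (intro suminf_le allI)
      fix i show "(\<integral>\<^sup>+y\<in>B (x i) (L * u i). h y \<partial>M) \<le> ennreal \<alpha> * ennreal (V (x i) (L * u i))"
      proof (cases "u i = 0")
        case False
        then have u: "0 < u i" "(x i, u i) \<in> F" using xu(1,2)[of i] by auto
        then have "u i * L \<le> R / 2" using L_ge by (auto simp: F_def field_simps)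
        then have "L * u i < R" using \<open>0 < R\<close> by (simp add: mult.commute)
        then show ?thesis using avg[of "x i" "L * u i"] u L_ge \<open>0 < \<alpha>\<close> 
          by (auto simp: F_def En_def ennreal_mult')
      qed simp
    qed auto
    also have "\<dots> \<le> ennreal \<alpha> * (ennreal (dbl L) * emeasure M (\<Union>i. B (x i) (u i)))"
      unfolding ennreal_suminf_cmult by (intro mult_left_mono suminf_V_dilate_le xu) auto
    also have "\<dots> \<le> ennreal \<alpha> * (ennreal (dbl L) * ennreal (2 * mr))"
    proof (intro mult_left_mono)
      have "emeasure M (\<Union>i. B (x i) (u i)) \<le> emeasure M U" using UNU by (intro emeasure_mono) auto
      then show "emeasure M (\<Union>i. B (x i) (u i)) \<le> ennreal (2 * mr)" using U(3) by simp
    qed auto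
    finally have "A * \<alpha> * mr \<le> \<alpha> * (dbl L * (2 * mr))"
      using mr dbl_pos[of L] \<open>0 < A\<close> \<open>0 < \<alpha>\<close> by (simp add: ennreal_mult'[symmetric])
    also have "\<dots> = (A - 1) * \<alpha> * mr" by (simp add: A_def)
    finally show False using mult_pos_pos[OF \<open>0 < \<alpha>\<close> mr(2)] by (simp add: algebra_simps)
  qed
  then have "(\<Union>n. En n) \<in> null_sets M" by (intro null_sets_UN) auto
  then show ?thesis
  proof (rule AE_I', intro subsetI)
    fix x assume "x \<in> {x \<in> space M. \<not> (x \<in> E \<longrightarrow> h x \<le> ennreal ((2 * dbl L + 1) * \<alpha>))}"
    moreover obtain n :: nat where "d undefined x < real n" using reals_Archimedean2 by blast
    ultimately show "x \<in> (\<Union>n. En n)" by (auto simp: En_def A_def not_le intro!: exI[of _ n])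
  qed
qed

text \<open>The stopping-time selection behind both the Calderon--Zygmund decomposition and the
  John--Nirenberg inequality: balls on which the average of \<open>h\<close> exceeds \<open>\<alpha>\<close>, with radii that are
  maximal up to a factor \<open>2\<close>.\<close>

lemma stopping_balls:
  fixes h :: "'a \<Rightarrow> ennreal"
  assumes h[measurable]: "h \<in> borel_measurable M" and E[measurable]: "E \<in> sets M"
    and "0 < R" "0 < \<alpha>"
    and large: "\<And>x u. x \<in> E \<Longrightarrow> R \<le> u \<Longrightarrow> u \<le> L * R \<Longrightarrow> (\<integral>\<^sup>+y\<in>B x u. h y \<partial>M) \<le> ennreal (\<alpha> * V x u)"
  obtains x :: "nat \<Rightarrow> 'a" and u :: "nat \<Rightarrow> real" where
    "\<And>i. 0 \<le> u i" "\<And>i. u i < R" "\<And>i. 0 < u i \<Longrightarrow> x i \<in> E"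
    "disjoint_family (\<lambda>i. B (x i) (u i))"
    "\<And>i. ennreal (\<alpha> * V (x i) (u i)) \<le> (\<integral>\<^sup>+y\<in>B (x i) (u i). h y \<partial>M)"
    "\<And>i. (\<integral>\<^sup>+y\<in>B (x i) (L * u i). h y \<partial>M) \<le> ennreal (\<alpha> * V (x i) (L * u i))"
    "AE y in M. y \<in> E - (\<Union>i. B (x i) (L * u i)) \<longrightarrow> h y \<le> ennreal ((2 * dbl L + 1) * \<alpha>)"
proof -
  define P where "P x u \<longleftrightarrow> ennreal (\<alpha> * V x u) < (\<integral>\<^sup>+y\<in>B x u. h y \<partial>M)" for x u
  \<comment> \<open>The average is controlled at all radii from \<open>2 * u\<close> to
    \<open>L * R\<close>. As \<open>2 \<le> L\<close> and \<open>u < R\<close>, the dilate by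
    \<open>L\<close> is among them, which gives the upper bound on the dilated balls.\<close>
  define F where "F = {(x, u). x \<in> E \<and> 0 < u \<and> u < R \<and> P x u \<and> (\<forall>v. 2 * u \<le> v \<and> v \<le> L * R \<longrightarrow> \<not> P x v)}"
  obtain x u where xu: "\<And>i. 0 \<le> u i" "\<And>i. 0 < u i \<Longrightarrow> (x i, u i) \<in> F"
    "disjoint_family (\<lambda>i. B (x i) (u i))"
    "\<And>y r. (y, r) \<in> F \<Longrightarrow> \<exists>i::nat. B y r \<subseteq> B (x i) (L * u i)"
    by (rule vitali[of F R]) (auto simp: F_def)
  have pick: "\<exists>t. (y, t) \<in> F" if "y \<in> E" "0 < v" "v < R" "P y v" for y v
  proof -
    \<comment> \<open>Any exceptional radius above half of this supremum will do: no radius below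
      \<open>R\<close> and at least twice as large is exceptional, and from \<open>R\<close> on
      \<open>large\<close> takes over.\<close>
    define S where "S = Sup {v. 0 < v \<and> v < R \<and> P y v}"
    have bdd: "bdd_above {v. 0 < v \<and> v < R \<and> P y v}" by (rule bdd_aboveI[of _ R]) auto
    have ub: "w \<le> S" if "0 < w" "w < R" "P y w" for w
      unfolding S_def using bdd that by (intro cSup_upper) auto
    have "0 < S" using ub[of v] that by linarith
    then have "S / 2 < S" by simp
    moreover have "{v. 0 < v \<and> v < R \<and> P y v} \<noteq> {}" using that by blast
    ultimately have "\<exists>t\<in>{v. 0 < v \<and> v < R \<and> P y v}. S / 2 < t"
      using less_cSup_iff[OF _ bdd, of "S / 2"] unfolding S_def by blast
    then obtain t where t: "0 < t" "t < R" "P y t" "S / 2 < t" by blast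
    have "\<not> P y w" if w: "2 * t \<le> w" "w \<le> L * R" for w
    proof (cases "w < R")
      case True
      then show ?thesis using ub[of w] w t by fastforce
    next
      case False
      then show ?thesis using large[of y w] \<open>y \<in> E\<close> w by (simp add: P_def not_less)
    qed
    then show ?thesis using t \<open>y \<in> E\<close> by (auto simp: F_def)
  qed
  show ?thesis
  proof (rule that[of u x])
    show "0 \<le> u i" for i by (rule xu)
    show "u i < R" for i using xu(1,2)[of i] \<open>0 < R\<close> by (cases "u i = 0") (auto simp: F_def)
    show "x i \<in> E" if "0 < u i" for i using xu(2)[OF that] by (simp add: F_def)
    show "disjoint_family (\<lambda>i. B (x i) (u i))" by (rule xu)
    show "ennreal (\<alpha> * V (x i) (u i)) \<le> (\<integral>\<^sup>+y\<in>B (x i) (u i). h y \<partial>M)" for i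
      using xu(1,2)[of i] by (cases "u i = 0") (auto simp: F_def P_def)
    show "(\<integral>\<^sup>+y\<in>B (x i) (L * u i). h y \<partial>M) \<le> ennreal (\<alpha> * V (x i) (L * u i))" for i
    proof (cases "u i = 0")
      case False
      then have u: "0 < u i" "u i < R" "\<And>v. 2 * u i \<le> v \<Longrightarrow> v \<le> L * R \<Longrightarrow> \<not> P (x i) v"
        using xu(1,2)[of i] by (auto simp: F_def)
      have "\<not> P (x i) (L * u i)" using L_ge u by (intro u(3) mult_right_mono mult_left_mono) auto
      then show ?thesis by (simp add: P_def not_less)
    qed simp
    show "AE y in M. y \<in> E - (\<Union>i. B (x i) (L * u i)) \<longrightarrow> h y \<le> ennreal ((2 * dbl L + 1) * \<alpha>)"
    proof (rule AE_le_of_ball_averages_le[OF h _ \<open>0 < R\<close> \<open>0 < \<alpha>\<close>])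
      fix y v assume y: "y \<in> E - (\<Union>i. B (x i) (L * u i))" and v: "0 < v" "v < R"
      have "\<not> P y v"
      proof
        assume "P y v"
        then obtain t where t: "(y, t) \<in> F" using pick y v by blast
        then obtain i where "B y t \<subseteq> B (x i) (L * u i)" using xu(4) by blast
        moreover have "y \<in> B y t" using t by (simp add: F_def)
        ultimately show False using y by blast
      qed
      then show "(\<integral>\<^sup>+z\<in>B y v. h z \<partial>M) \<le> ennreal (\<alpha> * V y v)" by (simp add: P_def not_less)
    qed measurable
  qed
qed

end

section \<open>The John--Nirenberg inequality\<close>

text \<open>A discrete layer-cake bound: at a point whose first level above \<open>u x\<close> is
  \<open>t (Suc m)\<close>, the term with index \<open>m\<close> already dominates
  \<open>u x powr p\<close>. Arithmetic levels serve the John-Nirenberg inequality, dyadic ones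
  Kolmogorov's inequality.\<close>

lemma nn_integral_powr_le_levels:
  fixes u :: "'a \<Rightarrow> real" and t :: "nat \<Rightarrow> real"
  assumes [measurable]: "u \<in> borel_measurable M" "E \<in> sets M"
    and u: "\<And>x. 0 \<le> u x" and "0 \<le> p" and t: "\<And>x. \<exists>n. x \<le> t n"
  shows "(\<integral>\<^sup>+x\<in>E. ennreal (u x powr p) \<partial>M)
    \<le> ennreal (t 0 powr p) * emeasure M E
      + (\<Sum>n. ennreal (t (Suc n) powr p) * emeasure M {x \<in> E. t n < u x})"
proof -
  have [measurable]: "{x \<in> E. t n < u x} \<in> sets M" for n
    using sets.sets_into_space[OF assms(2)]
    by (rule_tac subst[where P = "\<lambda>A. A \<in> sets M", of "{x \<in> space M. x \<in> E \<and> t n < u x}"]) auto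
  have *: "ennreal (u x powr p) * indicator E x
      \<le> ennreal (t 0 powr p) * indicator E x
        + (\<Sum>n. ennreal (t (Suc n) powr p) * indicator {x \<in> E. t n < u x} x)" for x
  proof (cases "x \<in> E")
    case True
    define N where "N = (LEAST n. u x \<le> t n)"
    have N: "u x \<le> t N" unfolding N_def using t by (rule LeastI_ex)
    show ?thesis
    proof (cases N)
      case 0
      then have "u x powr p \<le> t 0 powr p" using N u assms by (intro powr_mono2) auto
      then show ?thesis using True by (simp add: add_increasing2 ennreal_leI)
    next
      case (Suc m)
      then have "t m < u x" using not_less_Least[of m "\<lambda>n. u x \<le> t n"] by (simp add: N_def[symmetric])
      have "ennreal (u x powr p) \<le> ennreal (t (Suc m) powr p) * indicator {x \<in> E. t m < u x} x"
        using N u assms Suc True \<open>t m < u x\<close> by (auto intro!: ennreal_leI powr_mono2)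
      also have "\<dots> \<le> (\<Sum>n. ennreal (t (Suc n) powr p) * indicator {x \<in> E. t n < u x} x)"
        using ennreal_suminf_lessD[of "\<lambda>n. ennreal (t (Suc n) powr p) * indicator {x \<in> E. t n < u x} x" _ m]
        by (meson not_le order_less_irrefl)
      finally show ?thesis using True by (simp add: add_increasing)
    qed
  qed simp
  have "(\<integral>\<^sup>+x\<in>E. ennreal (u x powr p) \<partial>M) \<le> (\<integral>\<^sup>+x. (ennreal (t 0 powr p) * indicator E x
        + (\<Sum>n. ennreal (t (Suc n) powr p) * indicator {x \<in> E. t n < u x} x)) \<partial>M)"
    using * by (intro nn_integral_mono)
  also have "\<dots> = ennreal (t 0 powr p) * emeasure M E
      + (\<Sum>n. ennreal (t (Suc n) powr p) * emeasure M {x \<in> E. t n < u x})"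
    by (subst nn_integral_add) (auto simp: nn_integral_suminf nn_integral_cmult_indicator)
  finally show ?thesis .
qed

lemma powr_le_exp:
  fixes x p e :: real
  assumes "0 \<le> x" "0 < p" "0 < e"
  shows "x powr p \<le> (p / e) powr p * exp (e * x)"
proof -
  have "x powr p = (p / e) powr p * (e * x / p) powr p"
    using assms by (simp add: powr_mult[symmetric])
  also have "(e * x / p) powr p \<le> exp (e * x / p) powr p"
    using assms by (intro powr_mono2 order.trans[OF _ exp_ge_add_one_self]) auto
  also have "\<dots> = exp (e * x)" using assms by (simp add: exp_powr_real)
  finally show ?thesis by (simp add: mult_left_mono)
qed

lemma summable_powr_over_power2:
  fixes p a :: real
  assumes "0 < p" "0 \<le> a"
  shows "summable (\<lambda>n. (real n + a) powr p / 2 ^ n)"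
proof (rule summable_comparison_test)
  \<comment> \<open>Growth by the factor 3/2 per step, divided by 2, leaves the convergent ratio
    3/4.\<close>
  define e where "e = ln (3 / 2 :: real)"
  have "0 < e" by (simp add: e_def)
  define C where "C = (p / e) powr p * exp (e * a)"
  show "summable (\<lambda>n. C * (3 / 4) ^ n)" by (intro summable_mult summable_geometric) auto
  have "(real n + a) powr p / 2 ^ n \<le> C * (3 / 4) ^ n" for n
  proof -
    have "(real n + a) powr p \<le> (p / e) powr p * exp (e * (real n + a))"
      using assms \<open>0 < e\<close> by (intro powr_le_exp) auto
    also have "\<dots> = C * exp e ^ n"
      by (simp add: C_def distrib_left exp_add exp_of_nat_mult[symmetric] mult_ac)
    also have "exp e = 3 / 2" by (simp add: e_def)
    finally have "(real n + a) powr p / 2 ^ n \<le> C * (3 / 2) ^ n / 2 ^ n" by (intro divide_right_mono) auto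
    then show ?thesis by (simp flip: power_divide times_divide_eq_right)
  qed
  then show "\<exists>N. \<forall>n\<ge>N. norm ((real n + a) powr p / 2 ^ n) \<le> C * (3 / 4) ^ n" by auto
qed

context homogeneous_type_space
begin

lemma L1_locD:
  assumes "b \<in> L1_loc d M"
  shows "b \<in> borel_measurable M" "set_integrable M (B x r) b"
  using assms by (auto simp: L1_loc_def)

lemma set_integrable_diff_const:
  fixes b :: "'a \<Rightarrow> 'k::{real_normed_field, banach, second_countable_topology}"
  assumes "b \<in> L1_loc d M"
  shows "set_integrable M (B x r) (\<lambda>y. b y - c)"
  using L1_locD(2)[OF assms] by (intro set_integral_diff) (auto intro!: integrable_indicator simp: set_integrable_def)

lemma nn_integral_MO:
  fixes b :: "'a \<Rightarrow> 'k::{real_normed_field, banach, second_countable_topology}"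
  assumes "b \<in> L1_loc d M"
  shows "(\<integral>\<^sup>+y\<in>B x r. ennreal (norm (b y - ball_mean d M b x r)) \<partial>M) = ennreal (MO d M b x r * V x r)"
proof (cases "0 < r")
  case True
  let ?f = "\<lambda>y. b y - ball_mean d M b x r"
  have "(\<integral>\<^sup>+y\<in>B x r. ennreal (norm (?f y)) \<partial>M) = (\<integral>\<^sup>+y. ennreal (norm (indicator (B x r) y *\<^sub>R ?f y)) \<partial>M)"
    by (intro nn_integral_cong) (auto split: split_indicator)
  also have "\<dots> = ennreal (\<integral>y. norm (indicator (B x r) y *\<^sub>R ?f y) \<partial>M)"
    using set_integrable_diff_const[OF assms, of x r "ball_mean d M b x r"]
    by (intro nn_integral_eq_integral integrable_norm) (auto simp: set_integrable_def simp del: norm_scaleR)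
  also have "(\<integral>y. norm (indicator (B x r) y *\<^sub>R ?f y) \<partial>M) = (LINT y:B x r|M. norm (?f y))"
    unfolding set_lebesgue_integral_def by (intro Bochner_Integration.integral_cong) (auto split: split_indicator)
  also have "\<dots> = MO d M b x r * V x r" using V_pos[OF True, of x] by (simp add: MO_def)
  finally show ?thesis .
qed simp

lemma norm_ball_mean_diff:
  fixes b :: "'a \<Rightarrow> 'k::{real_normed_field, banach, second_countable_topology}"
  assumes b: "b \<in> L1_loc d M" and "0 < r" "0 \<le> A"
    and le: "(\<integral>\<^sup>+y\<in>B x r. ennreal (norm (b y - c)) \<partial>M) \<le> ennreal (A * V x r)"
  shows "norm (ball_mean d M b x r - c) \<le> A"
proof -
  have I: "integrable M (\<lambda>y. indicator (B x r) y *\<^sub>R (b y - c))"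
    using set_integrable_diff_const[OF b] by (auto simp: set_integrable_def)
  have "(LINT y:B x r|M. b y - c) = (LINT y:B x r|M. b y) - (LINT y:B x r|M. c)"
    using L1_locD(2)[OF b] by (intro set_integral_diff) (auto intro!: integrable_indicator simp: set_integrable_def)
  also have "(LINT y:B x r|M. c) = V x r *\<^sub>R c" by (simp add: set_integral_const emeasure_qball)
  finally have "(LINT y:B x r|M. b y - c) = V x r *\<^sub>R (ball_mean d M b x r - c)"
    using V_pos[OF \<open>0 < r\<close>, of x] by (simp add: ball_mean_def scaleR_diff_right)
  then have "V x r * norm (ball_mean d M b x r - c) = norm (LINT y:B x r|M. b y - c)" by simp
  also have "\<dots> \<le> (\<integral>y. norm (indicator (B x r) y *\<^sub>R (b y - c)) \<partial>M)"
    unfolding set_lebesgue_integral_def by (rule integral_norm_bound)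
  also have "\<dots> \<le> A * V x r"
  proof -
    have "ennreal (\<integral>y. norm (indicator (B x r) y *\<^sub>R (b y - c)) \<partial>M)
        = (\<integral>\<^sup>+y. ennreal (norm (indicator (B x r) y *\<^sub>R (b y - c))) \<partial>M)"
      using I by (intro nn_integral_eq_integral[symmetric] integrable_norm) (auto simp del: norm_scaleR)
    also have "\<dots> = (\<integral>\<^sup>+y\<in>B x r. ennreal (norm (b y - c)) \<partial>M)"
      by (intro nn_integral_cong) (auto split: split_indicator)
    finally have "ennreal (\<integral>y. norm (indicator (B x r) y *\<^sub>R (b y - c)) \<partial>M) \<le> ennreal (A * V x r)"
      using le by simp
    then show ?thesis using \<open>0 \<le> A\<close> by (subst (asm) ennreal_le_iff) (auto simp del: norm_scaleR)
  qed
  finally show ?thesis using V_pos[OF \<open>0 < r\<close>, of x] by (simp add: mult.commute)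
qed

text \<open>The induction behind the John-Nirenberg inequality needs a hypothesis that passes to the
  stopping balls inside a given ball, so the bound is asked on all balls with centre and radius at
  the scale of \<open>R\<close>. It is tied to a scale because the admissible oscillation of
  \<open>b\<close> grows with the radius.\<close>

definition MO_le :: "('a \<Rightarrow> 'k::{real_normed_field, banach, second_countable_topology})
    \<Rightarrow> real \<Rightarrow> 'a \<Rightarrow> real \<Rightarrow> bool" where
  "MO_le b A x R \<longleftrightarrow> (\<forall>z u. d x z \<le> 2 * \<kappa> * R \<longrightarrow> 0 < u \<longrightarrow> u \<le> 2 * \<kappa> * R \<longrightarrow> MO d M b z u \<le> A)"

lemma MO_le_sub:
  assumes "MO_le b A x R" "d x z \<le> R" "2 * \<kappa> * t \<le> R"
  shows "MO_le b A z t"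
  unfolding MO_le_def
proof (intro allI impI)
  fix w u assume w: "d z w \<le> 2 * \<kappa> * t" "0 < u" "u \<le> 2 * \<kappa> * t"
  have "d x w \<le> \<kappa> * (d x z + d z w)" by (rule d_quasi_triangle)
  also have "\<dots> \<le> \<kappa> * (R + R)" using assms w kappa_pos by (intro mult_left_mono) auto
  finally have xw: "d x w \<le> 2 * \<kappa> * R" by simp
  have "R \<ge> 0" using assms(2) d_nonneg[of x z] by linarith
  then have "1 * R \<le> 2 * \<kappa> * R" using kappa_ge_1 by (intro mult_right_mono) auto
  then have "u \<le> 2 * \<kappa> * R" using w(3) assms(3) by linarith
  then show "MO d M b w u \<le> A"
    using assms w xw unfolding MO_le_def by auto
qed

text \<open>\<open>jn1\<close> collects one doubling for the return to \<open>V x R\<close> and one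
  for the comparison of two means. \<open>jn2\<close> is the stopping height in units of
  \<open>A\<close>: its first summand keeps averages over balls of radius between
  \<open>R / (2 * \<kappa> * L)\<close> and \<open>R / (2 * \<kappa>)\<close> below that height, its
  second makes the dilated stopping balls carry at most half the volume of the original
  ball.\<close>

definition jn1 :: real where "jn1 = dbl (2 * \<kappa>) * (1 + dbl (2 * \<kappa>))"
definition jn2 :: real where "jn2 = jn1 * dbl (4 * \<kappa>\<^sup>2 * L) + 2 * dbl L * jn1"

lemma jn1_pos: "0 < jn1" and jn2_pos: "0 < jn2"
  using dbl_pos[of "2 * \<kappa>"] dbl_pos[of L] dbl_pos[of "4 * \<kappa>\<^sup>2 * L"]
  by (auto simp: jn1_def jn2_def intro!: mult_pos_pos add_pos_pos)

text \<open>Stopping balls centred in \<open>B x R\<close> may stick out of it, so the deviation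
  from the mean over \<open>B x R\<close> has to be controlled on a larger ball. The means over the
  two balls are compared first.\<close>

lemma oscillation_enlarged_ball:
  fixes b :: "'a \<Rightarrow> 'k::{real_normed_field, banach, second_countable_topology}"
  assumes b: "b \<in> L1_loc d M" and "0 < A" "0 < R" and MO: "MO_le b A x R"
  shows "(\<integral>\<^sup>+y\<in>B x (2 * \<kappa> * R). ennreal (norm (b y - ball_mean d M b x R)) \<partial>M) \<le> ennreal (jn1 * A * V x R)"
proof -
  let ?R = "2 * \<kappa> * R" and ?D = "dbl (2 * \<kappa>)"
  have [measurable]: "b \<in> borel_measurable M" by (rule L1_locD[OF b])
  have R: "0 < ?R" "R \<le> ?R" using kappa_ge_1 \<open>0 < R\<close> by auto
  have V: "V x ?R \<le> ?D * V x R" using V_dilate[of R x "2 * \<kappa>"] \<open>0 < R\<close> by simp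
  have "MO d M b x ?R \<le> A" using MO R by (auto simp: MO_le_def)
  then have 1: "(\<integral>\<^sup>+y\<in>B x ?R. ennreal (norm (b y - ball_mean d M b x ?R)) \<partial>M) \<le> ennreal (A * V x ?R)"
    unfolding nn_integral_MO[OF b] by (intro ennreal_leI mult_right_mono) auto
  have "norm (ball_mean d M b x R - ball_mean d M b x ?R) \<le> ?D * A"
  proof (rule norm_ball_mean_diff[OF b \<open>0 < R\<close>])
    have "(\<integral>\<^sup>+y\<in>B x R. ennreal (norm (b y - ball_mean d M b x ?R)) \<partial>M) \<le> ennreal (A * V x ?R)"
      using nn_integral_mono_set[OF qball_mono[OF R(2)]] 1 by (rule order_trans)
    also have "\<dots> \<le> ennreal (?D * A * V x R)"
      using V \<open>0 < A\<close> by (intro ennreal_leI) (simp add: mult_ac mult_left_mono)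
    finally show "(\<integral>\<^sup>+y\<in>B x R. ennreal (norm (b y - ball_mean d M b x ?R)) \<partial>M) \<le> ennreal (?D * A * V x R)" .
  qed (use dbl_pos[of "2 * \<kappa>"] \<open>0 < A\<close> in auto)
  then have "norm (b y - ball_mean d M b x R) \<le> norm (b y - ball_mean d M b x ?R) + ?D * A" for y
    using norm_triangle_ineq[of "b y - ball_mean d M b x ?R" "ball_mean d M b x ?R - ball_mean d M b x R"]
    by (simp add: norm_minus_commute)
  then have "(\<integral>\<^sup>+y\<in>B x ?R. ennreal (norm (b y - ball_mean d M b x R)) \<partial>M)
      \<le> (\<integral>\<^sup>+y. ennreal (norm (b y - ball_mean d M b x ?R)) * indicator (B x ?R) y
          + ennreal (?D * A) * indicator (B x ?R) y \<partial>M)"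
    using dbl_pos[of "2 * \<kappa>"] \<open>0 < A\<close>
    by (intro nn_integral_mono) (auto simp: ennreal_plus[symmetric] simp del: ennreal_plus split: split_indicator intro!: ennreal_leI)
  also have "\<dots> = (\<integral>\<^sup>+y\<in>B x ?R. ennreal (norm (b y - ball_mean d M b x ?R)) \<partial>M) + ennreal (?D * A) * ennreal (V x ?R)"
    by (subst nn_integral_add) (auto simp: nn_integral_cmult_indicator emeasure_qball)
  also have "\<dots> \<le> ennreal (A * V x ?R) + ennreal (?D * A) * ennreal (V x ?R)"
    using 1 by (rule add_right_mono)
  also have "\<dots> = ennreal ((1 + ?D) * A * V x ?R)"
    using dbl_pos[of "2 * \<kappa>"] \<open>0 < A\<close>
    by (simp add: ennreal_mult'[symmetric] ennreal_plus[symmetric] algebra_simps del: ennreal_plus)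
  also have "\<dots> \<le> ennreal ((1 + ?D) * A * (?D * V x R))"
    using dbl_pos[of "2 * \<kappa>"] \<open>0 < A\<close> V by (intro ennreal_leI mult_left_mono) auto
  finally show ?thesis by (simp add: jn1_def mult_ac)
qed

text \<open>One stopping-time step halves the measure and lowers the level by one unit
  \<open>jn2 * A\<close>: the mean over a dilated stopping ball differs from the old mean by at most
  this unit, and outside the dilates the deviation is almost everywhere at most the offset
  \<open>2 * dbl L + 1\<close> units. The induction hypothesis is then applied on every
  dilate.\<close>

lemma John_Nirenberg_levels:
  fixes b :: "'a \<Rightarrow> 'k::{real_normed_field, banach, second_countable_topology}"
  assumes b: "b \<in> L1_loc d M" and A: "0 < A" and "0 < R" and "MO_le b A x R"
  shows "emeasure M {y \<in> B x R. (real n + (2 * dbl L + 1)) * (jn2 * A) < norm (b y - ball_mean d M b x R)}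
    \<le> ennreal (V x R / 2 ^ n)"
  using assms(3,4)
proof (induction n arbitrary: x R)
  case 0
  have [measurable]: "b \<in> borel_measurable M" by (rule L1_locD[OF b])
  show ?case unfolding emeasure_qball[symmetric] by (simp add: emeasure_qball[symmetric]) (intro emeasure_mono, auto)
next
  case (Suc n)
  note R = \<open>0 < R\<close>
  have bm[measurable]: "b \<in> borel_measurable M" by (rule L1_locD[OF b])
  define AA where "AA = 2 * dbl L + 1"
  define \<alpha> where "\<alpha> = jn2 * A"
  have "0 < \<alpha>" using jn2_pos A by (simp add: \<alpha>_def)
  define S where "S n x R = {y \<in> B x R. (real n + AA) * \<alpha> < norm (b y - ball_mean d M b x R)}" for n x R
  have [measurable]: "S n x R \<in> sets M" for n x R
  proof -
    have "S n x R = {y \<in> space M. d x y < R \<and> (real n + AA) * \<alpha> < norm (b y - ball_mean d M b x R)}"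
      by (auto simp: S_def space_eq)
    also have "\<dots> \<in> sets M" by measurable
    finally show ?thesis .
  qed
  define h where "h y = ennreal (norm (b y - ball_mean d M b x R))" for y
  have [measurable]: "h \<in> borel_measurable M" unfolding h_def by measurable
  \<comment> \<open>The upper bound for stopping radii is chosen so that a dilate of radius
    \<open>L * u\<close> still satisfies \<open>2 * \<kappa> * (L * u) \<le> R\<close>, which is
    what \<open>MO_le_sub\<close> requires.\<close>
  define R' where "R' = R / (2 * \<kappa> * L)"
  have R': "0 < R'" "2 * \<kappa> * (L * R') = R" using R kappa_pos L_ge by (auto simp: R'_def)
  have LR': "L * R' \<le> R"
    using R'(2) kappa_ge_1 mult_right_mono[of 1 "2 * \<kappa>" "L * R'"] L_ge R'(1) by simp
  have osc: "(\<integral>\<^sup>+y\<in>B x (2 * \<kappa> * R). h y \<partial>M) \<le> ennreal (jn1 * A * V x R)"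
    unfolding h_def by (rule oscillation_enlarged_ball[OF b A R Suc.prems(2)])
  have sub: "B z u \<subseteq> B x (2 * \<kappa> * R)" if "z \<in> B x R" "u \<le> R" for z u
    using that kappa_pos by (intro qball_subset) (auto simp: mult_ac intro!: mult_left_mono)
  obtain z u where zu: "\<And>i. 0 \<le> u i" "\<And>i. u i < R'" "\<And>i. 0 < u i \<Longrightarrow> z i \<in> B x R"
    "disjoint_family (\<lambda>i. B (z i) (u i))"
    "\<And>i::nat. ennreal (\<alpha> * V (z i) (u i)) \<le> (\<integral>\<^sup>+y\<in>B (z i) (u i). h y \<partial>M)"
    "\<And>i. (\<integral>\<^sup>+y\<in>B (z i) (L * u i). h y \<partial>M) \<le> ennreal (\<alpha> * V (z i) (L * u i))"
    "AE y in M. y \<in> B x R - (\<Union>i. B (z i) (L * u i)) \<longrightarrow> h y \<le> ennreal (AA * \<alpha>)"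
  proof (rule stopping_balls[of h "B x R" R' \<alpha>])
    fix y v assume y: "y \<in> B x R" and v: "R' \<le> v" "v \<le> L * R'"
    have v0: "0 < v" "v \<le> R" using v R' LR' by auto
    have "(\<integral>\<^sup>+w\<in>B y v. h w \<partial>M) \<le> ennreal (jn1 * A * V x R)"
      using nn_integral_mono_set[OF sub[OF y v0(2)]] osc by (rule order_trans)
    also have "\<dots> \<le> ennreal (jn1 * A * (dbl (4 * \<kappa>\<^sup>2 * L) * V y v))"
    proof (intro ennreal_leI mult_left_mono V_le_dbl)
      have "\<kappa> * (d y x + R) \<le> \<kappa> * (R + R)" using y kappa_pos by (simp add: d_sym)
      also have "\<dots> = 4 * \<kappa>\<^sup>2 * L * R'" unfolding R'(2)[symmetric] by (simp add: power2_eq_square)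
      also have "\<dots> \<le> 4 * \<kappa>\<^sup>2 * L * v" using v L_ge by (intro mult_left_mono) auto
      finally show "\<kappa> * (d y x + R) \<le> 4 * \<kappa>\<^sup>2 * L * v" .
    qed (use v0 jn1_pos A in auto)
    also have "\<dots> \<le> ennreal (\<alpha> * V y v)"
    proof -
      have "jn1 * dbl (4 * \<kappa>\<^sup>2 * L) \<le> jn2" unfolding jn2_def using jn1_pos dbl_pos[of L] by simp
      then have "(jn1 * dbl (4 * \<kappa>\<^sup>2 * L)) * (A * V y v) \<le> jn2 * (A * V y v)"
        using A by (intro mult_right_mono) auto
      then show ?thesis by (intro ennreal_leI) (simp add: \<alpha>_def mult_ac)
    qed
    finally show "(\<integral>\<^sup>+w\<in>B y v. h w \<partial>M) \<le> ennreal (\<alpha> * V y v)" .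
  qed (use R' \<open>0 < \<alpha>\<close> in \<open>auto simp: AA_def\<close>)
  have uR: "u i \<le> R" "2 * \<kappa> * (L * u i) \<le> R" for i
  proof -
    have "1 * R' \<le> L * R'" using R'(1) L_ge by (intro mult_right_mono) auto
    then have "u i \<le> L * R'" using zu(2)[of i] by linarith
    then show "u i \<le> R" using LR' by simp
    have "2 * \<kappa> * (L * u i) \<le> 2 * \<kappa> * (L * R')" using zu(2)[of i] kappa_pos L_ge by (intro mult_left_mono) auto
    then show "2 * \<kappa> * (L * u i) \<le> R" using R'(2) by simp
  qed
  define W where "W = (\<Union>i. B (z i) (u i))"
  have W: "ennreal \<alpha> * emeasure M W \<le> ennreal (jn1 * A * V x R)"
  proof -
    have "ennreal \<alpha> * emeasure M W = ennreal \<alpha> * (\<Sum>i. emeasure M (B (z i) (u i)))"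
      unfolding W_def using zu(4) by (subst suminf_emeasure) auto
    also have "\<dots> = (\<Sum>i. ennreal \<alpha> * emeasure M (B (z i) (u i)))"
      by (rule ennreal_suminf_cmult[symmetric])
    also have "\<dots> = (\<Sum>i. ennreal (\<alpha> * V (z i) (u i)))"
      using \<open>0 < \<alpha>\<close> by (simp only: emeasure_qball ennreal_mult')
    also have "\<dots> \<le> (\<Sum>i. \<integral>\<^sup>+y\<in>B (z i) (u i). h y \<partial>M)" by (intro suminf_le allI zu(5)) auto
    also have "\<dots> = (\<integral>\<^sup>+y\<in>W. h y \<partial>M)" unfolding W_def using zu(4) by (intro nn_integral_UN_disjoint[symmetric]) auto
    also have "\<dots> \<le> (\<integral>\<^sup>+y\<in>B x (2 * \<kappa> * R). h y \<partial>M)"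
    proof (intro nn_integral_mono_set)
      show "W \<subseteq> B x (2 * \<kappa> * R)" unfolding W_def
      proof (rule UN_least)
        fix i show "B (z i) (u i) \<subseteq> B x (2 * \<kappa> * R)"
          using sub[of "z i" "u i"] zu(1,3)[of i] uR(1)[of i] by (cases "u i = 0") auto
      qed
    qed
    finally show ?thesis using osc by (rule order_trans)
  qed
  have "emeasure M (S (Suc n) x R) \<le> emeasure M (\<Union>i. S n (z i) (L * u i))"
  proof (rule emeasure_mono_AE)
    show "AE y in M. y \<in> S (Suc n) x R \<longrightarrow> y \<in> (\<Union>i. S n (z i) (L * u i))"
      using zu(7)
    proof eventually_elim
      fix y assume y: "y \<in> B x R - (\<Union>i. B (z i) (L * u i)) \<longrightarrow> h y \<le> ennreal (AA * \<alpha>)"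
      show "y \<in> S (Suc n) x R \<longrightarrow> y \<in> (\<Union>i. S n (z i) (L * u i))"
      proof
        assume yS: "y \<in> S (Suc n) x R"
        then have gt: "(real n + 1 + AA) * \<alpha> < norm (b y - ball_mean d M b x R)" and yB: "y \<in> B x R"
          by (auto simp: S_def algebra_simps)
        have "0 < AA" using dbl_pos[of L] by (simp add: AA_def)
        then have "AA * \<alpha> \<le> (real n + 1 + AA) * \<alpha>" using \<open>0 < \<alpha>\<close> by (intro mult_right_mono) auto
        then have "AA * \<alpha> < norm (b y - ball_mean d M b x R)" using gt by (rule le_less_trans)
        moreover have "0 \<le> AA * \<alpha>" using \<open>0 < AA\<close> \<open>0 < \<alpha>\<close> by simp
        ultimately have "\<not> h y \<le> ennreal (AA * \<alpha>)" unfolding h_def by (simp only: ennreal_le_iff not_le)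
        then obtain i where i: "y \<in> B (z i) (L * u i)" using y yB by blast
        then have "0 < u i" using zu(1)[of i] d_nonneg[of "z i" y] by (cases "u i = 0") auto
        then have "norm (ball_mean d M b (z i) (L * u i) - ball_mean d M b x R) \<le> \<alpha>"
          using zu(6)[of i] L_ge \<open>0 < \<alpha>\<close> by (intro norm_ball_mean_diff[OF b]) (auto simp: h_def)
        moreover have "norm (b y - ball_mean d M b x R) \<le> norm (b y - ball_mean d M b (z i) (L * u i))
            + norm (ball_mean d M b (z i) (L * u i) - ball_mean d M b x R)"
          using norm_triangle_ineq[of "b y - ball_mean d M b (z i) (L * u i)" "ball_mean d M b (z i) (L * u i) - ball_mean d M b x R"] by simp
        ultimately have "(real n + AA) * \<alpha> < norm (b y - ball_mean d M b (z i) (L * u i))"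
          using gt by (simp add: algebra_simps)
        then show "y \<in> (\<Union>i. S n (z i) (L * u i))" using i by (auto simp: S_def)
      qed
    qed
  qed measurable
  also have "\<dots> \<le> (\<Sum>i. emeasure M (S n (z i) (L * u i)))"
    by (intro emeasure_subadditive_countably) auto
  also have "\<dots> \<le> (\<Sum>i. ennreal (1 / 2 ^ n) * ennreal (V (z i) (L * u i)))"
  proof (intro suminf_le allI)
    fix i show "emeasure M (S n (z i) (L * u i)) \<le> ennreal (1 / 2 ^ n) * ennreal (V (z i) (L * u i))"
    proof (cases "u i = 0")
      case False
      then have "0 < u i" using zu(1)[of i] by simp
      then have "MO_le b A (z i) (L * u i)"
        using zu(3)[of i] uR(2)[of i] by (intro MO_le_sub[OF Suc.prems(2)]) auto
      then have "emeasure M (S n (z i) (L * u i)) \<le> ennreal (V (z i) (L * u i) / 2 ^ n)"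
        using Suc.IH[of "L * u i" "z i"] L_ge \<open>0 < u i\<close> by (simp add: S_def AA_def \<alpha>_def)
      then show ?thesis by (simp add: ennreal_mult'[symmetric])
    qed (simp add: S_def)
  qed auto
  also have "\<dots> \<le> ennreal (1 / 2 ^ n) * (ennreal (dbl L) * emeasure M W)"
    unfolding ennreal_suminf_cmult W_def by (intro mult_left_mono suminf_V_dilate_le zu) auto
  also have "\<dots> \<le> ennreal (V x R / 2 ^ Suc n)"
  proof -
    have "emeasure M W < top"
      using W \<open>0 < \<alpha>\<close> by (cases "emeasure M W") (auto simp: ennreal_mult_top top_unique)
    then obtain w where w: "emeasure M W = ennreal w" "0 \<le> w" by (cases "emeasure M W") auto
    have "jn2 * A * w \<le> jn1 * A * V x R"
      using W w \<open>0 < \<alpha>\<close> jn1_pos A by (simp add: \<alpha>_def ennreal_mult'[symmetric])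
    then have "jn2 * w \<le> jn1 * V x R" using A by (simp add: mult_ac)
    moreover have "2 * dbl L * jn1 * w \<le> jn2 * w"
      using w jn1_pos dbl_pos[of "4 * \<kappa>\<^sup>2 * L"] by (intro mult_right_mono) (auto simp: jn2_def)
    ultimately have "jn1 * (2 * dbl L * w) \<le> jn1 * V x R" by (simp add: mult_ac)
    then have "2 * dbl L * w \<le> V x R" using jn1_pos by (simp add: mult_le_cancel_left_pos)
    then show ?thesis
      using w dbl_pos[of L] by (simp add: ennreal_mult'[symmetric] field_simps)
  qed
  finally show ?case by (simp add: S_def AA_def \<alpha>_def)
qed

text \<open>The measures of the level sets decay like \<open>1 / 2 ^ n\<close> while the levels grow
  only linearly, so the powers can be summed. The constant depends on \<open>p\<close> but neither
  on \<open>b\<close> nor on the ball.\<close>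

theorem John_Nirenberg:
  assumes "0 < p"
  shows "\<exists>C>0. \<forall>(b :: 'a \<Rightarrow> 'k::{real_normed_field, banach, second_countable_topology}) A x R.
    b \<in> L1_loc d M \<longrightarrow> 0 < A \<longrightarrow> 0 < R \<longrightarrow> MO_le b A x R \<longrightarrow>
    (\<integral>\<^sup>+y\<in>B x R. ennreal (norm (b y - ball_mean d M b x R) powr p) \<partial>M) \<le> ennreal (C * A powr p * V x R)"
proof -
  define AA where "AA = 2 * dbl L + 1"
  have "0 < AA" using dbl_pos[of L] by (simp add: AA_def)
  define s where "s n = (real n + (AA + 1)) powr p / 2 ^ n" for n :: nat
  have sum: "summable s" unfolding s_def using assms \<open>0 < AA\<close> by (intro summable_powr_over_power2) auto
  define C where "C = jn2 powr p * (AA powr p + suminf s)"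
  have "0 \<le> suminf s" by (intro suminf_nonneg[OF sum]) (auto simp: s_def)
  then have "0 < C" using jn2_pos \<open>0 < AA\<close> by (auto simp: C_def intro!: mult_pos_pos add_pos_nonneg)
  moreover have "(\<integral>\<^sup>+y\<in>B x R. ennreal (norm (b y - ball_mean d M b x R) powr p) \<partial>M) \<le> ennreal (C * A powr p * V x R)"
    if b: "b \<in> L1_loc d M" and A: "0 < A" and R: "0 < R" and MO: "MO_le b A x R"
    for b :: "'a \<Rightarrow> 'k" and A x R
  proof -
    define t where "t n = (real n + AA) * (jn2 * A)" for n :: nat
    have [measurable]: "b \<in> borel_measurable M" by (rule L1_locD[OF b])
    have pos: "0 < jn2 * A" using jn2_pos A by simp
    have "(\<integral>\<^sup>+y\<in>B x R. ennreal (norm (b y - ball_mean d M b x R) powr p) \<partial>M)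
      \<le> ennreal (t 0 powr p) * emeasure M (B x R)
        + (\<Sum>n. ennreal (t (Suc n) powr p) * emeasure M {y \<in> B x R. t n < norm (b y - ball_mean d M b x R)})"
    proof (rule nn_integral_powr_le_levels)
      fix y
      obtain n :: nat where "y / (jn2 * A) \<le> real n" using real_arch_simple by blast
      then have "y \<le> real n * (jn2 * A)" using pos by (simp add: pos_divide_le_eq)
      also have "\<dots> \<le> t n" unfolding t_def using pos \<open>0 < AA\<close> by (intro mult_right_mono) auto
      finally show "\<exists>n. y \<le> t n" ..
    qed (use assms in auto)
    also have "\<dots> \<le> ennreal (t 0 powr p) * ennreal (V x R)
        + (\<Sum>n. ennreal (((jn2 * A) powr p * V x R) * s n))"
    proof (intro add_mono suminf_le allI)
      fix n
      have "ennreal (t (Suc n) powr p) * emeasure M {y \<in> B x R. t n < norm (b y - ball_mean d M b x R)}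
        \<le> ennreal (t (Suc n) powr p) * ennreal (V x R / 2 ^ n)"
        using John_Nirenberg_levels[OF b A R MO, of n] by (intro mult_left_mono) (auto simp: t_def AA_def)
      also have "\<dots> = ennreal (((jn2 * A) powr p * V x R) * s n)"
        using pos \<open>0 < AA\<close> by (simp add: t_def s_def ennreal_mult'[symmetric] powr_mult mult_ac add_ac)
      finally show "ennreal (t (Suc n) powr p) * emeasure M {y \<in> B x R. t n < norm (b y - ball_mean d M b x R)}
        \<le> ennreal (((jn2 * A) powr p * V x R) * s n)" .
    qed (auto simp: emeasure_qball)
    also have "(\<Sum>n. ennreal (((jn2 * A) powr p * V x R) * s n)) = ennreal (((jn2 * A) powr p * V x R) * suminf s)"
    proof (subst suminf_ennreal2)
      show "0 \<le> (jn2 * A) powr p * V x R * s n" for n by (simp add: s_def)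
      show "summable (\<lambda>n. (jn2 * A) powr p * V x R * s n)" using sum by (rule summable_mult)
      show "ennreal (\<Sum>n. (jn2 * A) powr p * V x R * s n) = ennreal ((jn2 * A) powr p * V x R * suminf s)"
        using sum by (simp only: suminf_mult)
    qed
    also have "ennreal (t 0 powr p) * ennreal (V x R) + \<dots> = ennreal (C * A powr p * V x R)"
      using pos \<open>0 < AA\<close> \<open>0 \<le> suminf s\<close> jn2_pos A
      by (simp add: ennreal_mult'[symmetric] ennreal_plus[symmetric] C_def t_def powr_mult algebra_simps del: ennreal_plus)
    finally show ?thesis .
  qed
  ultimately show ?thesis by blast
qed

end

section \<open>Convergence in measure\<close>

text \<open>Weak-type estimates bound exactly these level sets, on the whole space. So this is the
  convergence for which the extended operator and its truncated commutators are continuous.\<close>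

definition conv_measure :: "'a measure \<Rightarrow> (nat \<Rightarrow> 'a \<Rightarrow> 'k::{real_normed_vector, second_countable_topology}) \<Rightarrow> ('a \<Rightarrow> 'k) \<Rightarrow> bool" where
  "conv_measure M F f \<longleftrightarrow>
     (\<forall>e>0. (\<lambda>n. emeasure M {x \<in> space M. e < norm (F n x - f x)}) \<longlonglongrightarrow> 0)"

lemma conv_measureD:
  "conv_measure M F f \<Longrightarrow> 0 < e \<Longrightarrow> (\<lambda>n. emeasure M {x \<in> space M. e < norm (F n x - f x)}) \<longlonglongrightarrow> 0"
  by (simp add: conv_measure_def)

lemma conv_measure_bound:
  assumes "\<And>e n. 0 < e \<Longrightarrow> emeasure M {x \<in> space M. e < norm (F n x - f x)} \<le> g e n"
    and "\<And>e. 0 < e \<Longrightarrow> g e \<longlonglongrightarrow> 0"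
  shows "conv_measure M F f"
  unfolding conv_measure_def
proof (intro allI impI)
  fix e :: real assume "0 < e"
  then show "(\<lambda>n. emeasure M {x \<in> space M. e < norm (F n x - f x)}) \<longlonglongrightarrow> 0"
    using assms by (intro tendsto_sandwich[OF _ _ tendsto_const assms(2)]) auto
qed

lemma conv_measure_cong_AE:
  assumes "conv_measure M F f"
    and [measurable]: "\<And>n. F n \<in> borel_measurable M" "f \<in> borel_measurable M"
      "\<And>n. F' n \<in> borel_measurable M" "f' \<in> borel_measurable M"
    and "\<And>n. AE x in M. F n x = F' n x" "AE x in M. f x = f' x"
  shows "conv_measure M F' f'"
proof (rule conv_measure_bound)
  fix e :: real and n assume "0 < e"
  show "emeasure M {x \<in> space M. e < norm (F' n x - f' x)} \<le> emeasure M {x \<in> space M. e < norm (F n x - f x)}"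
  proof (rule emeasure_mono_AE)
    show "AE x in M. x \<in> {x \<in> space M. e < norm (F' n x - f' x)} \<longrightarrow> x \<in> {x \<in> space M. e < norm (F n x - f x)}"
      using assms(6)[of n] assms(7) by eventually_elim auto
  qed measurable
qed (use assms(1) in \<open>auto intro: conv_measureD\<close>)

lemma emeasure_norm_add_le:
  fixes f g :: "'a \<Rightarrow> 'k::{real_normed_vector, second_countable_topology}"
  assumes [measurable]: "f \<in> borel_measurable M" "g \<in> borel_measurable M"
  shows "emeasure M {x \<in> space M. a + b < norm (f x + g x)}
    \<le> emeasure M {x \<in> space M. a < norm (f x)} + emeasure M {x \<in> space M. b < norm (g x)}"
proof -
  have "{x \<in> space M. a + b < norm (f x + g x)} \<subseteq> {x \<in> space M. a < norm (f x)} \<union> {x \<in> space M. b < norm (g x)}"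
  proof
    fix x assume "x \<in> {x \<in> space M. a + b < norm (f x + g x)}"
    then show "x \<in> {x \<in> space M. a < norm (f x)} \<union> {x \<in> space M. b < norm (g x)}"
      using norm_triangle_ineq[of "f x" "g x"] by auto
  qed
  then have "emeasure M {x \<in> space M. a + b < norm (f x + g x)}
      \<le> emeasure M ({x \<in> space M. a < norm (f x)} \<union> {x \<in> space M. b < norm (g x)})"
    by (rule emeasure_mono) measurable
  also have "\<dots> \<le> emeasure M {x \<in> space M. a < norm (f x)} + emeasure M {x \<in> space M. b < norm (g x)}"
    by (rule emeasure_subadditive) measurable
  finally show ?thesis .
qed

lemma conv_measure_add:
  fixes f :: "'a \<Rightarrow> 'k::{real_normed_vector, second_countable_topology}"
  assumes c: "conv_measure M F f" "conv_measure M G g"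
    and [measurable]: "\<And>n. F n \<in> borel_measurable M" "f \<in> borel_measurable M"
      "\<And>n. G n \<in> borel_measurable M" "g \<in> borel_measurable M"
  shows "conv_measure M (\<lambda>n x. F n x + G n x) (\<lambda>x. f x + g x)"
proof (rule conv_measure_bound)
  fix e :: real and n assume "0 < e"
  show "emeasure M {x \<in> space M. e < norm ((F n x + G n x) - (f x + g x))}
    \<le> emeasure M {x \<in> space M. e / 2 < norm (F n x - f x)} + emeasure M {x \<in> space M. e / 2 < norm (G n x - g x)}"
    using emeasure_norm_add_le[of "\<lambda>x. F n x - f x" M "\<lambda>x. G n x - g x" "e / 2" "e / 2"]
    by (simp add: algebra_simps)
next
  fix e :: real assume "0 < e"
  then show "(\<lambda>n. emeasure M {x \<in> space M. e / 2 < norm (F n x - f x)} + emeasure M {x \<in> space M. e / 2 < norm (G n x - g x)}) \<longlonglongrightarrow> 0"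
    using tendsto_add[OF conv_measureD[OF c(1), of "e / 2"] conv_measureD[OF c(2), of "e / 2"]] by simp
qed

lemma conv_measure_mult_bounded:
  fixes f :: "'a \<Rightarrow> 'k::{real_normed_field, second_countable_topology}"
  assumes c: "conv_measure M F f" and "\<And>x. norm (b x) \<le> C"
    and [measurable]: "\<And>n. F n \<in> borel_measurable M" "f \<in> borel_measurable M"
  shows "conv_measure M (\<lambda>n x. b x * F n x) (\<lambda>x. b x * f x)"
proof (rule conv_measure_bound)
  have "0 \<le> C" using assms(2) norm_ge_zero order_trans by blast
  fix e :: real and n assume "0 < e"
  show "emeasure M {x \<in> space M. e < norm (b x * F n x - b x * f x)}
    \<le> emeasure M {x \<in> space M. e / (C + 1) < norm (F n x - f x)}"
  proof (rule emeasure_mono)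
    show "{x \<in> space M. e < norm (b x * F n x - b x * f x)} \<subseteq> {x \<in> space M. e / (C + 1) < norm (F n x - f x)}"
    proof safe
      fix x assume "e < norm (b x * F n x - b x * f x)"
      also have "norm (b x * F n x - b x * f x) = norm (b x) * norm (F n x - f x)"
        by (simp flip: right_diff_distrib norm_mult)
      also have "\<dots> \<le> (C + 1) * norm (F n x - f x)"
        using assms(2)[of x] by (intro mult_right_mono) auto
      finally show "e / (C + 1) < norm (F n x - f x)" using \<open>0 \<le> C\<close> by (simp add: field_simps)
    qed
  qed measurable
next
  have "0 \<le> C" using assms(2) norm_ge_zero order_trans by blast
  fix e :: real assume "0 < e"
  then show "(\<lambda>n. emeasure M {x \<in> space M. e / (C + 1) < norm (F n x - f x)}) \<longlonglongrightarrow> 0"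
    using \<open>0 \<le> C\<close> by (intro conv_measureD[OF c]) auto
qed

lemma conv_measure_cmult:
  fixes f :: "'a \<Rightarrow> 'k::{real_normed_field, second_countable_topology}"
  assumes "conv_measure M F f"
    and "\<And>n. F n \<in> borel_measurable M" "f \<in> borel_measurable M"
  shows "conv_measure M (\<lambda>n x. c * F n x) (\<lambda>x. c * f x)"
  using conv_measure_mult_bounded[OF assms(1), of "\<lambda>_. c" "norm c"] assms by simp

lemma conv_measure_diff:
  fixes f :: "'a \<Rightarrow> 'k::{real_normed_field, second_countable_topology}"
  assumes c: "conv_measure M F f" "conv_measure M G g"
    and [measurable]: "\<And>n. F n \<in> borel_measurable M" "f \<in> borel_measurable M"
      "\<And>n. G n \<in> borel_measurable M" "g \<in> borel_measurable M"
  shows "conv_measure M (\<lambda>n x. F n x - G n x) (\<lambda>x. f x - g x)"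
  using conv_measure_add[OF c(1) conv_measure_cmult[OF c(2), of "-1"]] by simp

lemma AE_fast_in_measure:
  fixes F :: "nat \<Rightarrow> 'a \<Rightarrow> 'k::{real_normed_vector, second_countable_topology}"
  assumes [measurable]: "\<And>n. F n \<in> borel_measurable M"
    and "\<And>k. emeasure M {x \<in> space M. (1 / 2) ^ k < norm (F k x)} \<le> ennreal ((1 / 2) ^ k)"
  shows "AE x in M. \<forall>\<^sub>F k in sequentially. norm (F k x) \<le> (1 / 2) ^ k"
proof -
  define A where "A k = {x \<in> space M. (1 / 2) ^ k < norm (F k x)}" for k
  have fin: "emeasure M (A k) < \<infinity>" for k
    using assms(2)[of k] by (auto simp: A_def intro: le_less_trans)
  have "measure M (A k) \<le> (1 / 2) ^ k" for k
    using assms(2)[of k] fin[of k] by (simp add: A_def[symmetric] emeasure_eq_ennreal_measure)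
  then have "summable (\<lambda>k. measure M (A k))"
    by (intro summable_comparison_test[OF _ summable_geometric[of "1 / 2"]]) auto
  then have "AE x in M. eventually (\<lambda>k. x \<in> space M - A k) sequentially"
    using fin by (intro borel_cantelli_AE1) (auto simp: A_def)
  then show ?thesis
    by eventually_elim (auto elim!: eventually_mono simp: A_def not_less)
qed

lemma conv_measure_AE_subseq:
  fixes f :: "'a \<Rightarrow> 'k::{real_normed_vector, second_countable_topology}"
  assumes c: "conv_measure M F f"
    and [measurable]: "\<And>n. F n \<in> borel_measurable M" "f \<in> borel_measurable M"
  obtains r :: "nat \<Rightarrow> nat" where "strict_mono r" "AE x in M. (\<lambda>n. F (r n) x) \<longlonglongrightarrow> f x"
proof -
  have ev: "\<forall>\<^sub>F n in sequentially. emeasure M {x \<in> space M. (1 / 2) ^ k < norm (F n x - f x)} < ennreal ((1 / 2) ^ k)" for k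
    using order_tendstoD(2)[OF conv_measureD[OF c, of "(1 / 2) ^ k"]] by simp
  have "\<exists>r. \<forall>k. emeasure M {x \<in> space M. (1 / 2) ^ k < norm (F (r k) x - f x)} < ennreal ((1 / 2) ^ k) \<and> r k < r (Suc k)"
  proof (rule dependent_nat_choice)
    show "\<exists>n. emeasure M {x \<in> space M. (1 / 2) ^ 0 < norm (F n x - f x)} < ennreal ((1 / 2) ^ 0)"
      using ev[of 0] by (auto simp: eventually_sequentially)
    show "\<exists>n. emeasure M {x \<in> space M. (1 / 2) ^ Suc k < norm (F n x - f x)} < ennreal ((1 / 2) ^ Suc k) \<and> m < n" for m k
      using eventually_conj[OF ev[of "Suc k"] eventually_gt_at_top[of m]]
      by (auto simp: eventually_sequentially)
  qed
  then obtain r where r: "\<And>k. emeasure M {x \<in> space M. (1 / 2) ^ k < norm (F (r k) x - f x)} < ennreal ((1 / 2) ^ k)"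
    "\<And>k. r k < r (Suc k)" by blast
  have "AE x in M. \<forall>\<^sub>F k in sequentially. norm (F (r k) x - f x) \<le> (1 / 2) ^ k"
    using r(1) by (intro AE_fast_in_measure) (auto intro: less_imp_le)
  then have "AE x in M. (\<lambda>n. F (r n) x) \<longlonglongrightarrow> f x"
  proof eventually_elim
    fix x assume "\<forall>\<^sub>F k in sequentially. norm (F (r k) x - f x) \<le> (1 / 2) ^ k"
    moreover have "(\<lambda>k. (1 / 2 :: real) ^ k) \<longlonglongrightarrow> 0" by (intro LIMSEQ_realpow_zero) auto
    ultimately have "(\<lambda>n. F (r n) x - f x) \<longlonglongrightarrow> 0" by (rule Lim_null_comparison)
    then show "(\<lambda>n. F (r n) x) \<longlonglongrightarrow> f x" by (rule LIM_zero_cancel)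
  qed
  with r(2) show ?thesis by (intro that[of r]) (auto simp: strict_mono_Suc_iff)
qed

lemma conv_measure_subseq: "conv_measure M F f \<Longrightarrow> strict_mono r \<Longrightarrow> conv_measure M (\<lambda>n. F (r n)) f"
  unfolding conv_measure_def using LIMSEQ_subseq_LIMSEQ by (fastforce simp: comp_def)

lemma conv_measure_unique:
  fixes f :: "'a \<Rightarrow> 'k::{real_normed_vector, second_countable_topology}"
  assumes "conv_measure M F f" "conv_measure M F g"
    and "\<And>n. F n \<in> borel_measurable M" "f \<in> borel_measurable M" "g \<in> borel_measurable M"
  shows "AE x in M. f x = g x"
proof -
  obtain r where r: "strict_mono r" "AE x in M. (\<lambda>n. F (r n) x) \<longlonglongrightarrow> f x"
    by (rule conv_measure_AE_subseq[OF assms(1,3,4)])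
  obtain r' where r': "strict_mono r'" "AE x in M. (\<lambda>n. F (r (r' n)) x) \<longlonglongrightarrow> g x"
    by (rule conv_measure_AE_subseq[OF conv_measure_subseq[OF assms(2) r(1)]]) (use assms in auto)
  show ?thesis using r(2) r'(2)
  proof eventually_elim
    fix x assume "(\<lambda>n. F (r n) x) \<longlonglongrightarrow> f x" and g: "(\<lambda>n. F (r (r' n)) x) \<longlonglongrightarrow> g x"
    then have "(\<lambda>n. F (r (r' n)) x) \<longlonglongrightarrow> f x"
      using LIMSEQ_subseq_LIMSEQ[OF _ r'(1), of "\<lambda>n. F (r n) x"] by (simp add: comp_def)
    then show "f x = g x" using g by (rule LIMSEQ_unique)
  qed
qed

text \<open>Riesz's argument: along a subsequence with geometrically small increments, almost every
  point has summable increments, and the union of the exceptional sets from index \<open>k\<close>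
  on has measure at most \<open>2 * (1 / 2) ^ k\<close>. Hence the subsequence also converges in
  measure, and the Cauchy property carries this over to the full sequence.\<close>

lemma conv_measure_complete:
  fixes F :: "nat \<Rightarrow> 'a \<Rightarrow> 'k::{real_normed_vector, second_countable_topology, banach}"
  assumes [measurable]: "\<And>n. F n \<in> borel_measurable M"
    and Cauchy: "\<And>e \<eta>. 0 < e \<Longrightarrow> 0 < \<eta> \<Longrightarrow>
      \<exists>N. \<forall>m\<ge>N. \<forall>n\<ge>N. emeasure M {x \<in> space M. e < norm (F m x - F n x)} \<le> ennreal \<eta>"
  obtains f where "f \<in> borel_measurable M" "conv_measure M F f"
proof -
  define N where "N k = (SOME N. \<forall>m\<ge>N. \<forall>n\<ge>N. emeasure M {x \<in> space M. (1 / 2) ^ k < norm (F m x - F n x)} \<le> ennreal ((1 / 2) ^ k))" for k :: nat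
  have N: "emeasure M {x \<in> space M. (1 / 2) ^ k < norm (F m x - F n x)} \<le> ennreal ((1 / 2) ^ k)"
    if "N k \<le> m" "N k \<le> n" for k m n
    using someI_ex[OF Cauchy[of "(1 / 2) ^ k" "(1 / 2) ^ k"]] that unfolding N_def by simp
  \<comment> \<open>Summing the thresholds gives a monotone sequence that lies above each of
    them.\<close>
  define r where "r k = (\<Sum>i\<le>k. N i)" for k
  have r: "N k \<le> r k" "r k \<le> r (Suc k)" for k by (auto simp: r_def intro: member_le_sum)
  define D where "D k x = F (r (Suc k)) x - F (r k) x" for k x
  have [measurable]: "D k \<in> borel_measurable M" for k unfolding D_def by measurable
  have D: "emeasure M {x \<in> space M. (1 / 2) ^ k < norm (D k x)} \<le> ennreal ((1 / 2) ^ k)" for k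
    unfolding D_def using r[of k] by (intro N) auto
  define f where "f x = lim (\<lambda>k. F (r k) x)" for x
  have fm[measurable]: "f \<in> borel_measurable M" unfolding f_def by measurable
  have F_sum: "F (r k) x = F (r 0) x + (\<Sum>i<k. D i x)" for k x
    by (induction k) (auto simp: D_def)
  have AEf: "AE x in M. (\<lambda>k. F (r k) x) \<longlonglongrightarrow> f x"
    using AE_fast_in_measure[of D M, OF _ D]
  proof (rule AE_mp, simp, intro AE_I2 impI)
    fix x assume "\<forall>\<^sub>F k in sequentially. norm (D k x) \<le> (1 / 2) ^ k"
    then have "summable (\<lambda>k. norm (D k x))"
      by (intro summable_comparison_test_ev[OF _ summable_geometric[of "1 / 2 :: real"]]) auto
    then have "summable (\<lambda>k. D k x)" by (rule summable_norm_cancel)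
    then have "convergent (\<lambda>k. F (r 0) x + (\<Sum>i<k. D i x))"
      by (intro convergent_add convergent_const) (simp add: summable_iff_convergent)
    then have "convergent (\<lambda>k. F (r k) x)" by (simp only: F_sum[symmetric])
    then show "(\<lambda>k. F (r k) x) \<longlonglongrightarrow> f x" unfolding f_def by (simp add: convergent_LIMSEQ_iff)
  qed
  have tail: "emeasure M {x \<in> space M. 2 * (1 / 2) ^ k < norm (F (r k) x - f x)} \<le> ennreal (2 * (1 / 2) ^ k)" for k
  proof -
    have "emeasure M {x \<in> space M. 2 * (1 / 2) ^ k < norm (F (r k) x - f x)}
      \<le> emeasure M (\<Union>j. {x \<in> space M. (1 / 2) ^ (j + k) < norm (D (j + k) x)})"
    proof (rule emeasure_mono_AE)
      show "AE x in M. x \<in> {x \<in> space M. 2 * (1 / 2) ^ k < norm (F (r k) x - f x)} \<longrightarrow>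
        x \<in> (\<Union>j. {x \<in> space M. (1 / 2) ^ (j + k) < norm (D (j + k) x)})"
        using AEf
      proof (eventually_elim, intro impI)
        fix x assume x: "(\<lambda>k. F (r k) x) \<longlonglongrightarrow> f x"
          "x \<in> {x \<in> space M. 2 * (1 / 2) ^ k < norm (F (r k) x - f x)}"
        show "x \<in> (\<Union>j. {x \<in> space M. (1 / 2) ^ (j + k) < norm (D (j + k) x)})"
        proof (rule ccontr)
        assume "x \<notin> (\<Union>j. {x \<in> space M. (1 / 2) ^ (j + k) < norm (D (j + k) x)})"
        then have le: "norm (D (j + k) x) \<le> (1 / 2) ^ (j + k)" for j using x(2) by (auto simp: not_less)
        have "norm (F (r (n + k)) x - F (r k) x) \<le> 2 * (1 / 2) ^ k" for n
        proof -
          have "F (r (n + k)) x - F (r k) x = (\<Sum>j<n. D (j + k) x)"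
            by (induction n) (auto simp: D_def algebra_simps)
          also have "norm \<dots> \<le> (\<Sum>j<n. (1 / 2) ^ (j + k))" using le by (rule sum_norm_le)
          also have "\<dots> = (1 / 2) ^ k * (\<Sum>j<n. (1 / 2) ^ j)" by (simp add: power_add sum_distrib_left mult.commute)
          also have "\<dots> \<le> (1 / 2) ^ k * 2"
            by (intro mult_left_mono) (auto simp: sum_gp_strict)
          finally show ?thesis by simp
        qed
        moreover have "(\<lambda>n. norm (F (r (n + k)) x - F (r k) x)) \<longlonglongrightarrow> norm (f x - F (r k) x)"
          by (intro tendsto_intros LIMSEQ_ignore_initial_segment[OF x(1)])
        ultimately have "norm (f x - F (r k) x) \<le> 2 * (1 / 2) ^ k" by (intro LIMSEQ_le_const2) auto
        then show False using x(2) by (simp add: norm_minus_commute)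
        qed
      qed
    qed measurable
    also have "\<dots> \<le> (\<Sum>j. emeasure M {x \<in> space M. (1 / 2) ^ (j + k) < norm (D (j + k) x)})"
      by (rule emeasure_subadditive_countably) auto
    also have "\<dots> \<le> (\<Sum>j. ennreal ((1 / 2) ^ (j + k)))"
      using D by (intro suminf_le) auto
    also have "\<dots> = ennreal (2 * (1 / 2) ^ k)"
    proof (rule suminf_ennreal_eq)
      show "(\<lambda>j. (1 / 2) ^ (j + k)) sums (2 * (1 / 2) ^ k :: real)"
        using sums_mult2[OF geometric_sums[of "1 / 2 :: real"], of "(1 / 2) ^ k"]
        by (simp add: power_add)
    qed auto
    finally show ?thesis .
  qed
  have "conv_measure M F f"
    unfolding conv_measure_def
  proof (intro allI impI)
    fix e :: real assume "0 < e"
    show "(\<lambda>n. emeasure M {x \<in> space M. e < norm (F n x - f x)}) \<longlonglongrightarrow> 0"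
    proof (rule order_tendstoI)
      fix a :: ennreal assume "0 < a"
      obtain \<eta> where \<eta>: "0 < \<eta>" "ennreal \<eta> < a"
      proof (cases a)
        case (real r)
        then show ?thesis using that[of "r / 2"] \<open>0 < a\<close> by (auto simp: ennreal_less_iff)
      next
        case top
        then show ?thesis using that[of 1] by simp
      qed
      have "(\<lambda>k. 3 * (1 / 2 :: real) ^ k) \<longlonglongrightarrow> 3 * 0" by (intro tendsto_intros LIMSEQ_realpow_zero) auto
      then have "\<forall>\<^sub>F k in sequentially. 3 * (1 / 2) ^ k < min e \<eta>"
        using \<open>0 < e\<close> \<eta> by (intro order_tendstoD(2)) auto
      then obtain k where k: "3 * (1 / 2) ^ k < e" "3 * (1 / 2) ^ k < \<eta>" by (auto simp: eventually_sequentially)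
      have "emeasure M {x \<in> space M. e < norm (F n x - f x)} < a" if n: "r k \<le> n" for n
      proof -
        have "emeasure M {x \<in> space M. e < norm (F n x - f x)}
          \<le> emeasure M {x \<in> space M. (1 / 2) ^ k + 2 * (1 / 2) ^ k < norm ((F n x - F (r k) x) + (F (r k) x - f x))}"
          using k by (intro emeasure_mono) auto
        also have "\<dots> \<le> emeasure M {x \<in> space M. (1 / 2) ^ k < norm (F n x - F (r k) x)}
            + emeasure M {x \<in> space M. 2 * (1 / 2) ^ k < norm (F (r k) x - f x)}"
          by (rule emeasure_norm_add_le) measurable
        also have "\<dots> \<le> ennreal ((1 / 2) ^ k) + ennreal (2 * (1 / 2) ^ k)"
          using r(1)[of k] n by (intro add_mono N tail) auto
        also have "\<dots> = ennreal (3 * (1 / 2) ^ k)" by (simp flip: ennreal_plus)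
        also have "\<dots> \<le> ennreal \<eta>" using k by (intro ennreal_leI) auto
        finally show ?thesis using \<eta> by simp
      qed
      then show "\<forall>\<^sub>F n in sequentially. emeasure M {x \<in> space M. e < norm (F n x - f x)} < a"
        by (auto simp: eventually_sequentially)
    qed auto
  qed
  with fm show ?thesis by (rule that)
qed

text \<open>Fatou's lemma along an almost everywhere convergent subsequence. It transfers weighted
  integral bounds to functions known only as limits in measure; the bounds \<open>c n\<close> may
  vary because the kernel estimate of a truncated function involves its own norm and mean.\<close>

lemma conv_measure_Fatou:
  fixes f :: "'a \<Rightarrow> 'k::{real_normed_vector, second_countable_topology}"
  assumes "conv_measure M F f"
    and [measurable]: "\<And>n. F n \<in> borel_measurable M" "f \<in> borel_measurable M" "w \<in> borel_measurable M" "A \<in> sets M"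
    and w: "\<And>x. 0 \<le> (w x :: real)"
    and le: "\<And>n. (\<integral>\<^sup>+x\<in>A. ennreal (w x * norm (F n x)) \<partial>M) \<le> c n" and c: "c \<longlonglongrightarrow> c0"
  shows "(\<integral>\<^sup>+x\<in>A. ennreal (w x * norm (f x)) \<partial>M) \<le> c0"
proof -
  obtain r where r: "strict_mono r" "AE x in M. (\<lambda>n. F (r n) x) \<longlonglongrightarrow> f x"
    by (rule conv_measure_AE_subseq[OF assms(1-3)])
  have "(\<integral>\<^sup>+x\<in>A. ennreal (w x * norm (f x)) \<partial>M)
      = (\<integral>\<^sup>+x. liminf (\<lambda>n. ennreal (w x * norm (F (r n) x)) * indicator A x) \<partial>M)"
  proof (rule nn_integral_cong_AE)
    show "AE x in M. ennreal (w x * norm (f x)) * indicator A x = liminf (\<lambda>n. ennreal (w x * norm (F (r n) x)) * indicator A x)"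
      using r(2)
    proof eventually_elim
      fix x assume "(\<lambda>n. F (r n) x) \<longlonglongrightarrow> f x"
      then have "(\<lambda>n. ennreal (w x * norm (F (r n) x))) \<longlonglongrightarrow> ennreal (w x * norm (f x))"
        by (intro tendsto_ennrealI tendsto_intros)
      then have "(\<lambda>n. ennreal (w x * norm (F (r n) x)) * indicator A x) \<longlonglongrightarrow> ennreal (w x * norm (f x)) * indicator A x"
        by (auto split: split_indicator)
      then show "ennreal (w x * norm (f x)) * indicator A x = liminf (\<lambda>n. ennreal (w x * norm (F (r n) x)) * indicator A x)"
        by (simp add: lim_imp_Liminf)
    qed
  qed
  also have "\<dots> \<le> liminf (\<lambda>n. \<integral>\<^sup>+x\<in>A. ennreal (w x * norm (F (r n) x)) \<partial>M)"
    by (rule nn_integral_liminf) measurable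
  also have "\<dots> \<le> liminf (\<lambda>n. c (r n))" by (intro Liminf_mono always_eventually allI le)
  also have "\<dots> = c0"
    using LIMSEQ_subseq_LIMSEQ[OF c r(1)] by (intro lim_imp_Liminf) (auto simp: comp_def)
  finally show ?thesis .
qed

lemma emeasure_norm_gt_le_nn_integral:
  fixes f :: "'a \<Rightarrow> 'k::{real_normed_vector, second_countable_topology}"
  assumes [measurable]: "f \<in> borel_measurable M" and "0 < t"
  shows "emeasure M {x \<in> space M. t < norm (f x)} \<le> ennreal (1 / t) * (\<integral>\<^sup>+x. ennreal (norm (f x)) \<partial>M)"
proof -
  have "emeasure M {x \<in> space M. t < norm (f x)} = (\<integral>\<^sup>+x. indicator {x \<in> space M. t < norm (f x)} x \<partial>M)"
    by (simp add: nn_integral_indicator)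
  also have "\<dots> \<le> (\<integral>\<^sup>+x. ennreal (1 / t) * ennreal (norm (f x)) \<partial>M)"
    using \<open>0 < t\<close>
    by (intro nn_integral_mono) (auto split: split_indicator simp: ennreal_mult'[symmetric] field_simps simp flip: ennreal_1 intro!: ennreal_leI)
  finally show ?thesis by (simp add: nn_integral_cmult)
qed

lemma conv_measure_L1:
  fixes f :: "'a \<Rightarrow> 'k::{real_normed_vector, second_countable_topology}"
  assumes [measurable]: "\<And>n. F n \<in> borel_measurable M" "f \<in> borel_measurable M"
    and "(\<lambda>n. \<integral>\<^sup>+x. ennreal (norm (F n x - f x)) \<partial>M) \<longlonglongrightarrow> 0"
  shows "conv_measure M F f"
proof (rule conv_measure_bound)
  fix e :: real and n assume "0 < e"
  then show "emeasure M {x \<in> space M. e < norm (F n x - f x)} \<le> ennreal (1 / e) * (\<integral>\<^sup>+x. ennreal (norm (F n x - f x)) \<partial>M)"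
    by (intro emeasure_norm_gt_le_nn_integral) auto
next
  fix e :: real assume "0 < e"
  then show "(\<lambda>n. ennreal (1 / e) * (\<integral>\<^sup>+x. ennreal (norm (F n x - f x)) \<partial>M)) \<longlonglongrightarrow> 0"
    using ennreal_tendsto_cmult[OF _ assms(3), of "ennreal (1 / e)"] by simp
qed

section \<open>Singular integrals away from the support\<close>

lemma Young_le:
  fixes a b p p' :: real
  assumes "0 \<le> a" "0 \<le> b" "1 < p" "1 < p'" "1 / p + 1 / p' = 1"
  shows "a * b \<le> a powr p + b powr p'"
proof -
  have "a * b \<le> a powr p / p + b powr p' / p'" using assms by (intro Youngs_inequality) auto
  also have "\<dots> \<le> a powr p / 1 + b powr p' / 1" using assms by (intro add_mono divide_left_mono) auto
  finally show ?thesis by simp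
qed

lemma conjugate_exponent:
  fixes p :: real
  assumes "1 < p"
  shows "1 < p / (p - 1)" "1 / (p / (p - 1)) + 1 / p = 1" "1 / p + 1 / (p / (p - 1)) = 1"
  using assms by (auto simp: field_simps)

text \<open>Hoelder's inequality with volume-normalised factors, where \<open>m\<close> will be the
  volume of a ball. Young's inequality for \<open>u / W\<close> and \<open>m / D * v\<close> makes
  each of the two terms integrate to at most \<open>W * D\<close>, hence the factor 2.\<close>

lemma Hoelder_normalized:
  fixes u v :: "'a \<Rightarrow> real"
  assumes [measurable]: "u \<in> borel_measurable M" "v \<in> borel_measurable M" "A \<in> sets M"
    and uv: "\<And>x. 0 \<le> u x" "\<And>x. 0 \<le> v x" and p: "1 < p" and pos: "0 < W" "0 < D" "0 < m"
    and u: "(\<integral>\<^sup>+x\<in>A. ennreal (u x powr (p / (p - 1))) \<partial>M) \<le> ennreal (W powr (p / (p - 1)) * m)"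
    and v: "(\<integral>\<^sup>+x\<in>A. ennreal (v x powr p) \<partial>M) \<le> ennreal (D powr p * m powr (1 - p))"
  shows "(\<integral>\<^sup>+x\<in>A. ennreal (u x * v x) \<partial>M) \<le> ennreal (2 * W * D)"
proof -
  define p' where "p' = p / (p - 1)"
  have p': "1 < p'" "1 / p' + 1 / p = 1" using conjugate_exponent[OF p] by (auto simp: p'_def)
  define a where "a = W * D / m * W powr (- p')"
  define c where "c = W * D / m * (m / D) powr p"
  have ac: "0 \<le> a" "0 \<le> c" using pos by (auto simp: a_def c_def)
  have "u x * v x \<le> a * u x powr p' + c * v x powr p" for x
  proof -
    have "u x * v x = W * D / m * ((u x / W) * (m / D * v x))" using pos by simp
    also have "\<dots> \<le> W * D / m * ((u x / W) powr p' + (m / D * v x) powr p)"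
      using pos uv p p' by (intro mult_left_mono Young_le) auto
    also have "\<dots> = a * u x powr p' + c * v x powr p"
      using pos uv by (simp add: a_def c_def powr_divide powr_mult powr_minus field_simps)
    finally show ?thesis .
  qed
  then have "(\<integral>\<^sup>+x\<in>A. ennreal (u x * v x) \<partial>M)
      \<le> (\<integral>\<^sup>+x. ennreal a * (ennreal (u x powr p') * indicator A x) + ennreal c * (ennreal (v x powr p) * indicator A x) \<partial>M)"
    using ac by (intro nn_integral_mono) (auto split: split_indicator simp: ennreal_mult'[symmetric] ennreal_plus[symmetric] simp del: ennreal_plus intro!: ennreal_leI)
  also have "\<dots> = ennreal a * (\<integral>\<^sup>+x\<in>A. ennreal (u x powr p') \<partial>M) + ennreal c * (\<integral>\<^sup>+x\<in>A. ennreal (v x powr p) \<partial>M)"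
    by (simp add: nn_integral_add nn_integral_cmult)
  also have "\<dots> \<le> ennreal a * ennreal (W powr p' * m) + ennreal c * ennreal (D powr p * m powr (1 - p))"
    using u v by (intro add_mono mult_left_mono) (auto simp: p'_def)
  also have "\<dots> = ennreal (a * (W powr p' * m) + c * (D powr p * m powr (1 - p)))"
    using ac pos by (simp add: ennreal_mult' ennreal_plus)
  also have "a * (W powr p' * m) = W * D" using pos by (simp add: a_def powr_minus field_simps)
  also have "c * (D powr p * m powr (1 - p)) = W * D / m * (m powr p * m powr (1 - p))"
    using pos by (simp add: c_def powr_divide)
  also have "m powr p * m powr (1 - p) = m" using pos by (simp add: powr_add[symmetric])
  also have "W * D / m * m = W * D" using pos by simp
  also have "W * D + W * D = 2 * W * D" by simp
  finally show ?thesis .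
qed

lemma Lp_iff:
  assumes "0 < s"
  shows "f \<in> Lp M (ennreal s) \<longleftrightarrow> f \<in> borel_measurable M \<and> (\<integral>\<^sup>+x. ennreal (norm (f x) powr s) \<partial>M) < top"
  using assms by (auto simp: Lp_def Lp_norm_def enn_powr_def less_top[symmetric])

lemma nn_integral_powr_add_finite:
  fixes f g :: "'a \<Rightarrow> 'k::{real_normed_vector, second_countable_topology}"
  assumes [measurable]: "f \<in> borel_measurable M" "g \<in> borel_measurable M" and "0 < s"
    and "(\<integral>\<^sup>+x. ennreal (norm (f x) powr s) \<partial>M) < top" "(\<integral>\<^sup>+x. ennreal (norm (g x) powr s) \<partial>M) < top"
  shows "(\<integral>\<^sup>+x. ennreal (norm (f x + g x) powr s) \<partial>M) < top"
proof -
  have "norm (f x + g x) powr s \<le> 2 powr s * norm (f x) powr s + 2 powr s * norm (g x) powr s" for x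
  proof -
    have "norm (f x + g x) \<le> 2 * max (norm (f x)) (norm (g x))"
      using norm_triangle_ineq[of "f x" "g x"] by simp
    then have "norm (f x + g x) powr s \<le> (2 * max (norm (f x)) (norm (g x))) powr s"
      using \<open>0 < s\<close> by (intro powr_mono2) auto
    also have "\<dots> \<le> 2 powr s * norm (f x) powr s + 2 powr s * norm (g x) powr s"
      by (auto simp: powr_mult max_def)
    finally show ?thesis .
  qed
  then have "(\<integral>\<^sup>+x. ennreal (norm (f x + g x) powr s) \<partial>M)
      \<le> (\<integral>\<^sup>+x. ennreal (2 powr s) * ennreal (norm (f x) powr s) + ennreal (2 powr s) * ennreal (norm (g x) powr s) \<partial>M)"
    by (intro nn_integral_mono) (simp add: ennreal_mult'[symmetric] ennreal_plus[symmetric] ennreal_leI del: ennreal_plus)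
  also have "\<dots> < top" using assms(4,5) by (simp add: nn_integral_add nn_integral_cmult ennreal_mult_less_top)
  finally show ?thesis .
qed

text \<open>The hypotheses on \<open>T\<close> with all constants fixed and all norms raised to the
  power \<open>s\<close>. In this form the two kernel bounds are literally the hypothesis on
  \<open>v\<close> in \<open>Hoelder_normalized\<close>, with the volume of the ball as
  \<open>m\<close>.\<close>

locale cz_operator = homogeneous_type_space d \<kappa> M
  for d :: "'a \<Rightarrow> 'a \<Rightarrow> real" and \<kappa> :: real and M :: "'a measure" +
  fixes \<rho> :: "'a \<Rightarrow> real" and s \<delta> :: real
    and T :: "('a \<Rightarrow> 'k::{real_normed_field, banach, second_countable_topology}) \<Rightarrow> ('a \<Rightarrow> 'k)"
    and K :: "'a \<Rightarrow> 'a \<Rightarrow> 'k" and CT C1 :: real and CN :: "real \<Rightarrow> real"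
  assumes rho_pos: "0 < \<rho> x" and s: "1 < s" and \<delta>: "0 < \<delta>"
    and T_linear: "ae_linear_on M (Lp M (ennreal s)) T"
    and T_meas: "f \<in> Lp M (ennreal s) \<Longrightarrow> T f \<in> borel_measurable M"
    and CT: "0 < CT"
    and T_weak: "f \<in> Lp M (ennreal s) \<Longrightarrow> 0 < t \<Longrightarrow> emeasure M {x \<in> space M. t < norm (T f x)}
      \<le> ennreal (CT / t powr s) * (\<integral>\<^sup>+x. ennreal (norm (f x) powr s) \<partial>M)"
    and kernel: "has_kernel d M T K"
    and C1: "0 < C1" and CN: "0 < N \<Longrightarrow> 0 < CN N"
    and size: "0 < N \<Longrightarrow> 0 < R \<Longrightarrow> d y z \<le> R / (2 * \<kappa>) \<Longrightarrow>
      (\<integral>\<^sup>+x\<in>{x. R \<le> d x z \<and> d x z < 2 * \<kappa> * R}. ennreal (norm (K x y) powr s) \<partial>M)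
      \<le> ennreal ((CN N * (1 + R / \<rho> z) powr (- N)) powr s * measure M (qball d z R) powr (1 - s))"
    and smooth: "0 < R \<Longrightarrow> d y z \<le> R / (2 * \<kappa>) \<Longrightarrow>
      (\<integral>\<^sup>+x\<in>{x. R \<le> d x z \<and> d x z < 2 * \<kappa> * R}. ennreal (norm (K x y - K x z) powr s) \<partial>M)
      \<le> ennreal ((C1 * (d y z / R) powr \<delta>) powr s * measure M (qball d z R) powr (1 - s))"
begin

definition ann :: "'a \<Rightarrow> real \<Rightarrow> 'a set" where
  "ann z R = {x. R \<le> d x z \<and> d x z < 2 * \<kappa> * R}"

lemma sets_ann [measurable]: "ann z R \<in> sets M"
proof -
  have "ann z R = {x \<in> space M. R \<le> d x z \<and> d x z < 2 * \<kappa> * R}" by (auto simp: ann_def space_eq)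
  also have "\<dots> \<in> sets M" by measurable
  finally show ?thesis .
qed

section \<open>Linearity and continuity of the operator on its domain\<close>

abbreviation Ls :: "('a \<Rightarrow> 'k) set" where "Ls \<equiv> Lp M (ennreal s)"

lemma s_pos: "0 < s" using s by simp

lemmas Ls_iff = Lp_iff[OF s_pos]

lemma Ls_add: "f \<in> Ls \<Longrightarrow> g \<in> Ls \<Longrightarrow> (\<lambda>x. f x + g x) \<in> Ls"
  using nn_integral_powr_add_finite[of f M g s] s_pos by (auto simp: Ls_iff)

lemma Ls_cmult: "f \<in> Ls \<Longrightarrow> (\<lambda>x. c * f x) \<in> Ls"
  by (auto simp: Ls_iff norm_mult powr_mult ennreal_mult' nn_integral_cmult ennreal_mult_less_top)

lemma Ls_diff: "f \<in> Ls \<Longrightarrow> g \<in> Ls \<Longrightarrow> (\<lambda>x. f x - g x) \<in> Ls"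
  using Ls_add[OF _ Ls_cmult[of g "-1"], of f] by simp

lemma Ls_zero: "(\<lambda>_. 0) \<in> Ls"
  by (simp add: Ls_iff)

lemma Ls_sum: "(\<And>i. i \<in> I \<Longrightarrow> f i \<in> Ls) \<Longrightarrow> (\<lambda>x. \<Sum>i\<in>I. f i x) \<in> Ls"
  by (induction I rule: infinite_finite_induct) (auto simp: Ls_zero intro: Ls_add)

lemma Ls_mono:
  assumes "f \<in> borel_measurable M" "g \<in> Ls" "\<And>x. norm (f x) \<le> norm (g x)"
  shows "f \<in> Ls"
proof -
  have "(\<integral>\<^sup>+x. ennreal (norm (f x) powr s) \<partial>M) \<le> (\<integral>\<^sup>+x. ennreal (norm (g x) powr s) \<partial>M)"
    using assms(3) s_pos by (intro nn_integral_mono ennreal_leI powr_mono2) auto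
  then show ?thesis using assms by (auto simp: Ls_iff)
qed

lemma T_lin: "f \<in> Ls \<Longrightarrow> g \<in> Ls \<Longrightarrow> AE x in M. T (\<lambda>y. c * f y + g y) x = c * T f x + T g x"
  using T_linear unfolding ae_linear_on_def by blast

lemma T_zero: "AE x in M. T (\<lambda>_. 0) x = 0"
  using T_lin[OF Ls_zero Ls_zero, of 1] by simp

lemma T_add: "f \<in> Ls \<Longrightarrow> g \<in> Ls \<Longrightarrow> AE x in M. T (\<lambda>y. f y + g y) x = T f x + T g x"
  using T_lin[of f g 1] by simp

lemma T_diff: "f \<in> Ls \<Longrightarrow> g \<in> Ls \<Longrightarrow> AE x in M. T (\<lambda>y. f y - g y) x = T f x - T g x"
  using T_lin[of g f "-1"] by simp

lemma T_sum:
  assumes "finite I" "\<And>i. i \<in> I \<Longrightarrow> f i \<in> Ls"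
  shows "AE x in M. T (\<lambda>y. \<Sum>i\<in>I. f i y) x = (\<Sum>i\<in>I. T (f i) x)"
  using assms
proof (induction I)
  case empty
  then show ?case using T_zero by simp
next
  case (insert i I)
  have "AE x in M. T (\<lambda>y. f i y + (\<Sum>i\<in>I. f i y)) x = T (f i) x + T (\<lambda>y. \<Sum>i\<in>I. f i y) x"
    using insert.prems by (intro T_add Ls_sum) auto
  moreover have "AE x in M. T (\<lambda>y. \<Sum>i\<in>I. f i y) x = (\<Sum>i\<in>I. T (f i) x)"
    using insert.prems by (intro insert.IH) auto
  ultimately show ?case by eventually_elim (use insert.hyps in simp)
qed

lemma T_conv_measure:
  assumes f: "\<And>n. f n \<in> Ls" "g \<in> Ls"
    and lim: "(\<lambda>n. \<integral>\<^sup>+x. ennreal (norm (f n x - g x) powr s) \<partial>M) \<longlonglongrightarrow> 0"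
  shows "conv_measure M (\<lambda>n. T (f n)) (T g)"
proof (rule conv_measure_bound)
  note [measurable] = T_meas[OF f(1)] T_meas[OF f(2)] T_meas[OF Ls_diff[OF f(1) f(2)]]
  fix e :: real and n assume "0 < e"
  have "emeasure M {x \<in> space M. e < norm (T (f n) x - T g x)} \<le> emeasure M {x \<in> space M. e < norm (T (\<lambda>y. f n y - g y) x)}"
  proof (rule emeasure_mono_AE)
    show "AE x in M. x \<in> {x \<in> space M. e < norm (T (f n) x - T g x)} \<longrightarrow> x \<in> {x \<in> space M. e < norm (T (\<lambda>y. f n y - g y) x)}"
      using T_diff[OF f(1) f(2), of n] by eventually_elim auto
  qed measurable
  also have "\<dots> \<le> ennreal (CT / e powr s) * (\<integral>\<^sup>+x. ennreal (norm (f n x - g x) powr s) \<partial>M)"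
    by (intro T_weak Ls_diff f \<open>0 < e\<close>)
  finally show "emeasure M {x \<in> space M. e < norm (T (f n) x - T g x)} \<le> ennreal (CT / e powr s) * (\<integral>\<^sup>+x. ennreal (norm (f n x - g x) powr s) \<partial>M)" .
next
  fix e :: real assume "0 < e"
  show "(\<lambda>n. ennreal (CT / e powr s) * (\<integral>\<^sup>+x. ennreal (norm (f n x - g x) powr s) \<partial>M)) \<longlonglongrightarrow> 0"
    using ennreal_tendsto_cmult[OF _ lim, of "ennreal (CT / e powr s)"] by simp
qed

definition bdd_on :: "'a \<Rightarrow> real \<Rightarrow> ('a \<Rightarrow> 'k) \<Rightarrow> bool" where
  "bdd_on z r f \<longleftrightarrow> f \<in> borel_measurable M \<and> (\<exists>c. \<forall>x. norm (f x) \<le> c) \<and> (\<forall>x. x \<notin> B z r \<longrightarrow> f x = 0)"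

lemma bdd_on_measurable: "bdd_on z r f \<Longrightarrow> f \<in> borel_measurable M"
  by (simp add: bdd_on_def)

lemma bdd_on_nn_integral_powr:
  assumes "bdd_on z r f" "0 < p"
  shows "(\<integral>\<^sup>+x. ennreal (norm (f x) powr p) \<partial>M) < top"
proof -
  obtain c where c: "\<And>x. norm (f x) \<le> c" "\<And>x. x \<notin> B z r \<Longrightarrow> f x = 0" using assms unfolding bdd_on_def by blast
  have "(\<integral>\<^sup>+x. ennreal (norm (f x) powr p) \<partial>M) \<le> (\<integral>\<^sup>+x\<in>B z r. ennreal (c powr p) \<partial>M)"
    using c \<open>0 < p\<close> by (intro nn_integral_mono) (auto split: split_indicator intro!: ennreal_leI powr_mono2)
  also have "\<dots> < top" by (simp add: nn_integral_cmult_indicator emeasure_qball ennreal_mult_less_top)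
  finally show ?thesis .
qed

lemma bdd_on_Ls: "bdd_on z r f \<Longrightarrow> f \<in> Ls"
  using bdd_on_nn_integral_powr[OF _ s_pos] by (auto simp: Ls_iff bdd_on_measurable)

lemma bdd_on_integrable: "bdd_on z r f \<Longrightarrow> integrable M f"
  using bdd_on_nn_integral_powr[of z r f 1] by (intro integrableI_bounded) (auto simp: bdd_on_measurable)

section \<open>Kernel representation off the support and estimates on annuli\<close>

lemma kernel_measurable: "(\<lambda>(x, y). K x y) \<in> borel_measurable (M \<Otimes>\<^sub>M M)"
  using kernel by (simp add: has_kernel_def)

lemma kernel_section_measurable [measurable]: "(\<lambda>x. K x z) \<in> borel_measurable M"
proof -
  have "(\<lambda>x. (x, z)) \<in> M \<rightarrow>\<^sub>M M \<Otimes>\<^sub>M M" using space_eq by (intro measurable_Pair2') simp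
  from measurable_compose[OF this kernel_measurable] show ?thesis by simp
qed

lemma kernel_section_measurable' [measurable]: "K x \<in> borel_measurable M"
  using measurable_compose[OF measurable_Pair1'[of x M M] kernel_measurable] space_eq by simp

text \<open>The support is closed and may touch the sphere \<open>d z x = r\<close>; hence the
  strict inequality in \<open>T_bdd_on_kernel\<close>.\<close>

lemma supp_bdd_on:
  assumes "bdd_on z r f"
  shows "supp d M f \<subseteq> {x. d z x \<le> r}"
proof (rule subsetI, rule ccontr)
  fix x assume x: "x \<in> supp d M f" "x \<notin> {x. d z x \<le> r}"
  then have "x \<in> {y. r < d z y}" by simp
  then obtain e where e: "0 < e" "B x e \<subseteq> {y. r < d z y}"
    using qopen_greater[of r z] unfolding qopen_def by blast
  have "f y = 0" if "y \<in> B x e" for y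
  proof -
    have "y \<notin> B z r" using subsetD[OF e(2) that] by simp
    then show ?thesis using assms by (simp add: bdd_on_def)
  qed
  then have "{y \<in> B x e. f y \<noteq> 0} = {}" by blast
  moreover have "0 < emeasure M {y \<in> B x e. f y \<noteq> 0}" using x(1) e(1) unfolding supp_def by blast
  ultimately show False by (simp only: emeasure_empty less_irrefl)
qed

lemma T_bdd_on_kernel:
  assumes "bdd_on z r f"
  shows "AE x in M. r < d z x \<longrightarrow> has_bochner_integral M (\<lambda>y. K x y * f y) (T f x)"
proof -
  \<comment> \<open>The kernel hypothesis speaks of an open ball around the support, so the radius
    is enlarged.\<close>
  have "supp d M f \<subseteq> B z (r + 1)"
    using supp_bdd_on[OF assms] by (rule order_trans) auto
  moreover have "bounded (range f)" using assms by (auto simp: bdd_on_def bounded_iff)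
  ultimately have "AE x in M. x \<notin> supp d M f \<longrightarrow> has_bochner_integral M (\<lambda>y. K x y * f y) (T f x)"
    using kernel bdd_on_measurable[OF assms] unfolding has_kernel_def by blast
  then show ?thesis
  proof eventually_elim
    fix x assume x: "x \<notin> supp d M f \<longrightarrow> has_bochner_integral M (\<lambda>y. K x y * f y) (T f x)"
    have "x \<notin> supp d M f" if "r < d z x"
      using subsetD[OF supp_bdd_on[OF assms], of x] that by auto
    then show "r < d z x \<longrightarrow> has_bochner_integral M (\<lambda>y. K x y * f y) (T f x)" using x by blast
  qed
qed

text \<open>Writing \<open>K x y\<close> as \<open>(K x y - K x z) + K x z\<close> separates
  cancellation from the mean: the difference gains \<open>(r / R) powr \<delta>\<close> by
  smoothness, and the integral of \<open>f\<close> meets only \<open>K x z\<close>, which decays in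
  \<open>R / \<rho> z\<close>. Exchanging the integrals leaves, for each fixed \<open>y\<close>, an
  annulus integral to which Hoelder's inequality applies. The weight \<open>w\<close> is later
  either 1 or the oscillation of \<open>b\<close>.\<close>

lemma annulus_bdd_on:
  assumes f: "bdd_on z r f" and r: "0 < r" "2 * \<kappa> * r \<le> R" and N: "0 < N"
    and [measurable]: "w \<in> borel_measurable M" and w: "\<And>x. 0 \<le> w x" and "0 < W"
    and wW: "(\<integral>\<^sup>+x\<in>ann z R. ennreal (w x powr (s / (s - 1))) \<partial>M) \<le> ennreal (W powr (s / (s - 1)) * V z R)"
  shows "(\<integral>\<^sup>+x\<in>ann z R. ennreal (w x * norm (T f x)) \<partial>M)
    \<le> ennreal (2 * W * (C1 * (r / R) powr \<delta> * (\<integral>x. norm (f x) \<partial>M)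
        + CN N * (1 + R / \<rho> z) powr (- N) * norm (\<integral>x. f x \<partial>M)))"
proof -
  interpret pair_sigma_finite M M
    using sigma_finite_M by (simp add: pair_sigma_finite_def)
  note [measurable] = kernel_measurable T_meas[OF bdd_on_Ls[OF f]]
  have fm[measurable]: "f \<in> borel_measurable M" by (rule bdd_on_measurable[OF f])
  have fi: "integrable M f" by (rule bdd_on_integrable[OF f])
  have "0 < 2 * \<kappa> * r" using kappa_pos r by simp
  then have R: "0 < R" using r by linarith
  have rR: "r \<le> R / (2 * \<kappa>)" using r kappa_pos by (simp add: field_simps)
  have "1 * r < 2 * \<kappa> * r" using kappa_ge_1 r by (intro mult_strict_right_mono) auto
  then have "r < R" using r(2) by linarith
  then have ann_far: "r < d z x" if "x \<in> ann z R" for x using that by (simp add: ann_def d_sym)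
  define m where "m = (\<integral>x. f x \<partial>M)"
  have VR: "0 < V z R" using R by (rule V_pos)
  define D where "D = C1 * (r / R) powr \<delta>"
  define E where "E = CN N * (1 + R / \<rho> z) powr (- N)"
  have "0 < 1 + R / \<rho> z" using R rho_pos[of z] by (simp add: add_pos_pos)
  then have DE: "0 < D" "0 < E" using C1 CN[OF N] r R by (auto simp: D_def E_def)
  have smooth': "(\<integral>\<^sup>+x\<in>ann z R. ennreal (w x * norm (K x y - K x z)) \<partial>M) \<le> ennreal (2 * W * D)" if "d z y < r" for y
  proof (rule Hoelder_normalized[OF _ _ _ w _ s \<open>0 < W\<close> DE(1) VR wW])
    have "(\<integral>\<^sup>+x\<in>ann z R. ennreal (norm (K x y - K x z) powr s) \<partial>M)
      \<le> ennreal ((C1 * (d y z / R) powr \<delta>) powr s * V z R powr (1 - s))"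
      unfolding ann_def using that rR R by (intro smooth) (auto simp: d_sym)
    also have "\<dots> \<le> ennreal (D powr s * V z R powr (1 - s))"
      unfolding D_def using that C1 R s_pos d_nonneg \<delta>
      by (intro ennreal_leI mult_right_mono powr_mono2 mult_left_mono divide_right_mono) (auto simp: d_sym)
    finally show "(\<integral>\<^sup>+x\<in>ann z R. ennreal (norm (K x y - K x z) powr s) \<partial>M) \<le> ennreal (D powr s * V z R powr (1 - s))" .
  qed auto
  have size': "(\<integral>\<^sup>+x\<in>ann z R. ennreal (w x * norm (K x z)) \<partial>M) \<le> ennreal (2 * W * E)"
    by (rule Hoelder_normalized[OF _ _ _ w _ s \<open>0 < W\<close> DE(2) VR wW])
      (use size[OF N R, of z z] R kappa_pos in \<open>auto simp: E_def simp flip: ann_def\<close>)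
  have "(\<integral>\<^sup>+x\<in>ann z R. ennreal (w x * norm (T f x)) \<partial>M)
    \<le> (\<integral>\<^sup>+x. (\<integral>\<^sup>+y. ennreal (w x * norm (K x y - K x z) * norm (f y)) * indicator (ann z R) x \<partial>M)
         + ennreal (norm m) * (ennreal (w x * norm (K x z)) * indicator (ann z R) x) \<partial>M)"
  proof (rule nn_integral_mono_AE)
    show "AE x in M. ennreal (w x * norm (T f x)) * indicator (ann z R) x
      \<le> (\<integral>\<^sup>+y. ennreal (w x * norm (K x y - K x z) * norm (f y)) * indicator (ann z R) x \<partial>M)
         + ennreal (norm m) * (ennreal (w x * norm (K x z)) * indicator (ann z R) x)"
      using T_bdd_on_kernel[OF f]
    proof eventually_elim
      fix x assume x: "r < d z x \<longrightarrow> has_bochner_integral M (\<lambda>y. K x y * f y) (T f x)"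
      show "ennreal (w x * norm (T f x)) * indicator (ann z R) x
      \<le> (\<integral>\<^sup>+y. ennreal (w x * norm (K x y - K x z) * norm (f y)) * indicator (ann z R) x \<partial>M)
         + ennreal (norm m) * (ennreal (w x * norm (K x z)) * indicator (ann z R) x)"
      proof (cases "x \<in> ann z R")
        case True
        then have I: "integrable M (\<lambda>y. K x y * f y)" and Tf: "T f x = (\<integral>y. K x y * f y \<partial>M)"
          using x ann_far by (auto simp: has_bochner_integral_iff)
        have J: "integrable M (\<lambda>y. (K x y - K x z) * f y)"
          unfolding left_diff_distrib using I fi by (intro Bochner_Integration.integrable_diff integrable_mult_right) auto
        have "T f x = (\<integral>y. (K x y - K x z) * f y + K x z * f y \<partial>M)"
          by (simp add: Tf left_diff_distrib)
        also have "\<dots> = (\<integral>y. (K x y - K x z) * f y \<partial>M) + K x z * m"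
          unfolding m_def using J fi by (subst Bochner_Integration.integral_add) auto
        finally have "norm (T f x) \<le> norm (\<integral>y. (K x y - K x z) * f y \<partial>M) + norm (K x z) * norm m"
          using norm_triangle_ineq norm_mult by metis
        from mult_left_mono[OF this w[of x]]
        have "w x * norm (T f x) \<le> w x * norm (\<integral>y. (K x y - K x z) * f y \<partial>M) + norm m * (w x * norm (K x z))"
          by (simp add: distrib_left mult_ac)
        then have "ennreal (w x * norm (T f x))
          \<le> ennreal (w x * norm (\<integral>y. (K x y - K x z) * f y \<partial>M) + norm m * (w x * norm (K x z)))"
          by (rule ennreal_leI)
        also have "\<dots> = ennreal (w x) * ennreal (norm (\<integral>y. (K x y - K x z) * f y \<partial>M)) + ennreal (norm m * (w x * norm (K x z)))"
          using w[of x] by (subst ennreal_plus) (auto simp: ennreal_mult)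
        also have "ennreal (norm (\<integral>y. (K x y - K x z) * f y \<partial>M)) \<le> (\<integral>\<^sup>+y. ennreal (norm ((K x y - K x z) * f y)) \<partial>M)"
          by (rule integral_norm_bound_ennreal[OF J])
        also have "ennreal (w x) * \<dots> = (\<integral>\<^sup>+y. ennreal (w x * norm (K x y - K x z) * norm (f y)) \<partial>M)"
          using w J by (subst nn_integral_cmult[symmetric]) (auto simp: ennreal_mult'[symmetric] norm_mult mult.assoc)
        finally show ?thesis using True by (simp add: ennreal_mult' add_right_mono mult_left_mono)
      qed simp
    qed
  qed
  also have "\<dots> = (\<integral>\<^sup>+x. (\<integral>\<^sup>+y. ennreal (w x * norm (K x y - K x z) * norm (f y)) * indicator (ann z R) x \<partial>M) \<partial>M)
      + ennreal (norm m) * (\<integral>\<^sup>+x\<in>ann z R. ennreal (w x * norm (K x z)) \<partial>M)"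
    by (subst nn_integral_add) (auto simp: nn_integral_cmult)
  finally have main: "(\<integral>\<^sup>+x\<in>ann z R. ennreal (w x * norm (T f x)) \<partial>M)
    \<le> (\<integral>\<^sup>+x. (\<integral>\<^sup>+y. ennreal (w x * norm (K x y - K x z) * norm (f y)) * indicator (ann z R) x \<partial>M) \<partial>M)
      + ennreal (norm m) * (\<integral>\<^sup>+x\<in>ann z R. ennreal (w x * norm (K x z)) \<partial>M)" .
  have "(\<integral>\<^sup>+x. (\<integral>\<^sup>+y. ennreal (w x * norm (K x y - K x z) * norm (f y)) * indicator (ann z R) x \<partial>M) \<partial>M)
     = (\<integral>\<^sup>+y. (\<integral>\<^sup>+x. ennreal (w x * norm (K x y - K x z) * norm (f y)) * indicator (ann z R) x \<partial>M) \<partial>M)"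
    by (rule Fubini'[symmetric]) measurable
  also have "\<dots> \<le> (\<integral>\<^sup>+y. ennreal (norm (f y)) * ennreal (2 * W * D) \<partial>M)"
  proof (rule nn_integral_mono)
    fix y
    show "(\<integral>\<^sup>+x. ennreal (w x * norm (K x y - K x z) * norm (f y)) * indicator (ann z R) x \<partial>M) \<le> ennreal (norm (f y)) * ennreal (2 * W * D)"
    proof (cases "d z y < r")
      case True
      have "(\<integral>\<^sup>+x. ennreal (w x * norm (K x y - K x z) * norm (f y)) * indicator (ann z R) x \<partial>M)
        = ennreal (norm (f y)) * (\<integral>\<^sup>+x\<in>ann z R. ennreal (w x * norm (K x y - K x z)) \<partial>M)"
        using w by (subst nn_integral_cmult[symmetric]) (auto simp: ennreal_mult' mult_ac)
      then show ?thesis using smooth'[OF True] by (simp add: mult_left_mono)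
    next
      case False
      then have "f y = 0" using f by (simp add: bdd_on_def)
      then show ?thesis by simp
    qed
  qed
  also have "\<dots> = (\<integral>\<^sup>+y. ennreal (norm (f y)) \<partial>M) * ennreal (2 * W * D)"
    by (rule nn_integral_multc) measurable
  also have "(\<integral>\<^sup>+y. ennreal (norm (f y)) \<partial>M) = ennreal (\<integral>y. norm (f y) \<partial>M)"
    using fi by (intro nn_integral_eq_integral integrable_norm) auto
  finally have "(\<integral>\<^sup>+x\<in>ann z R. ennreal (w x * norm (T f x)) \<partial>M)
      \<le> ennreal (\<integral>y. norm (f y) \<partial>M) * ennreal (2 * W * D) + ennreal (norm m) * ennreal (2 * W * E)"
    using size' by (intro order_trans[OF main] add_mono mult_left_mono) auto
  also have "\<dots> = ennreal (2 * W * (D * (\<integral>x. norm (f x) \<partial>M) + E * norm m))"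
    using \<open>0 < W\<close> DE by (simp add: ennreal_mult'[symmetric] ennreal_plus[symmetric] algebra_simps del: ennreal_plus)
  finally show ?thesis by (simp add: D_def E_def m_def)
qed

section \<open>Summation over annuli\<close>

lemma far_cover:
  assumes "0 < r"
  shows "{x. 2 * \<kappa> * r \<le> d x z} \<subseteq> (\<Union>k. ann z ((2 * \<kappa>) ^ Suc k * r))"
proof
  fix x assume "x \<in> {x. 2 * \<kappa> * r \<le> d x z}"
  then have x: "2 * \<kappa> * r \<le> d x z" by simp
  define k where "k = (LEAST k. d x z < (2 * \<kappa>) ^ k * r)"
  have "\<exists>k. d x z / r < (2 * \<kappa>) ^ k" using kappa_ge_1 by (intro real_arch_pow) auto
  then have "\<exists>k. d x z < (2 * \<kappa>) ^ k * r" using assms by (simp add: pos_divide_less_eq)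
  then have k: "d x z < (2 * \<kappa>) ^ k * r" unfolding k_def by (rule LeastI_ex)
  have min: "(2 * \<kappa>) ^ j * r \<le> d x z" if "j < k" for j
    using not_less_Least[of j "\<lambda>k. d x z < (2 * \<kappa>) ^ k * r"] that by (simp add: k_def not_less)
  have "1 * r \<le> 2 * \<kappa> * r" using kappa_ge_1 assms by (intro mult_right_mono) auto
  then have "r \<le> d x z" using x by linarith
  have "k \<noteq> 0"
  proof
    assume "k = 0"
    then show False using k \<open>r \<le> d x z\<close> by simp
  qed
  moreover have "k \<noteq> 1"
  proof
    assume "k = 1"
    then show False using k x by simp
  qed
  \<comment> \<open>Exponents 0 and 1 are excluded, so the inner radius of the annulus is at least
    \<open>2 * \<kappa> * r\<close>, as the kernel bounds demand for \<open>y\<close> in the ball of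
    radius \<open>r\<close>.\<close>
  ultimately obtain j where j: "k = Suc (Suc j)" by (metis One_nat_def not0_implies_Suc)
  have "x \<in> ann z ((2 * \<kappa>) ^ Suc j * r)" using k min[of "Suc j"] by (simp add: ann_def j mult.assoc)
  then show "x \<in> (\<Union>k. ann z ((2 * \<kappa>) ^ Suc k * r))" by blast
qed

lemma nn_integral_far_le:
  assumes [measurable]: "h \<in> borel_measurable M" and "0 < r"
  shows "(\<integral>\<^sup>+x\<in>{x. 2 * \<kappa> * r \<le> d x z}. h x \<partial>M) \<le> (\<Sum>k. \<integral>\<^sup>+x\<in>ann z ((2 * \<kappa>) ^ Suc k * r). h x \<partial>M)"
proof -
  have "(\<integral>\<^sup>+x\<in>{x. 2 * \<kappa> * r \<le> d x z}. h x \<partial>M) \<le> (\<integral>\<^sup>+x\<in>(\<Union>k. ann z ((2 * \<kappa>) ^ Suc k * r)). h x \<partial>M)"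
    by (rule nn_integral_mono_set[OF far_cover[OF assms(2)]])
  also have "\<dots> \<le> (\<Sum>k. \<integral>\<^sup>+x\<in>ann z ((2 * \<kappa>) ^ Suc k * r). h x \<partial>M)"
    by (rule nn_integral_UN_le) measurable
  finally show ?thesis .
qed

text \<open>The constant weight 1 satisfies the weight hypothesis of the annulus estimates with
  \<open>W = dbl (2 * \<kappa>)\<close>; the power does no harm because this constant is at least
  1.\<close>

lemma nn_integral_ann_one_le:
  assumes "0 \<le> R" "1 \<le> p"
  shows "(\<integral>\<^sup>+x\<in>ann z R. ennreal (1 powr p) \<partial>M) \<le> ennreal (dbl (2 * \<kappa>) powr p * V z R)"
proof -
  have "(\<integral>\<^sup>+x\<in>ann z R. ennreal (1 powr p) \<partial>M) = emeasure M (ann z R)" by simp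
  also have "\<dots> \<le> emeasure M (B z (2 * \<kappa> * R))" by (intro emeasure_mono) (auto simp: ann_def d_sym)
  also have "\<dots> \<le> ennreal (dbl (2 * \<kappa>) * V z R)" unfolding emeasure_qball by (intro ennreal_leI V_dilate assms)
  also have "\<dots> \<le> ennreal (dbl (2 * \<kappa>) powr p * V z R)"
    using powr_mono[of 1 p "dbl (2 * \<kappa>)"] assms dbl_ge_1[of "2 * \<kappa>"] by (intro ennreal_leI mult_right_mono) auto
  finally show ?thesis .
qed

end

section \<open>Weak type (1,1)\<close>

lemma disjoint_family_unique_index:
  assumes "disjoint_family A"
  obtains j where "\<And>i. i \<noteq> j \<Longrightarrow> x \<notin> A i"
proof (cases "\<exists>j. x \<in> A j")
  case True
  then obtain j where "x \<in> A j" by blast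
  moreover have "x \<notin> A i" if "i \<noteq> j" for i
    using assms that \<open>x \<in> A j\<close> unfolding disjoint_family_on_def by blast
  ultimately show ?thesis using that by blast
qed (use that in blast)

lemma sum_indicator_single:
  fixes y :: "nat \<Rightarrow> 'k::real_vector"
  assumes "\<And>i. i \<noteq> j \<Longrightarrow> x \<notin> A i"
  shows "(\<Sum>i<n. indicator (A i) x *\<^sub>R y i) = (if j < n then indicator (A j) x *\<^sub>R y j else 0)"
proof -
  have "(\<Sum>i<n. indicator (A i) x *\<^sub>R y i) = (\<Sum>i<n. if i = j then indicator (A j) x *\<^sub>R y j else 0)"
    using assms by (intro sum.cong) auto
  then show ?thesis by simp
qed

lemma suminf_split_bound:
  fixes f :: "nat \<Rightarrow> ennreal"
  shows "(\<Sum>i<n. f i) \<le> (\<Sum>i. f i)"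
  by (rule sum_le_suminf) auto

context cz_operator
begin

text \<open>The constant of Hoermander's condition: the smoothness gains of all annuli, added up as
  a geometric series.\<close>

definition CH :: real where
  "CH = 2 * dbl (2 * \<kappa>) * C1 * (\<Sum>k. ((2 * \<kappa>) powr (- \<delta>)) ^ Suc k)"

lemma decay_ratio: "0 < (2 * \<kappa>) powr (- \<delta>)" "(2 * \<kappa>) powr (- \<delta>) < 1"
proof -
  have "1 < 2 * \<kappa>" using kappa_ge_1 by simp
  then show "0 < (2 * \<kappa>) powr (- \<delta>)" "(2 * \<kappa>) powr (- \<delta>) < 1"
    using \<delta> by (auto intro!: powr_less_one)
qed

lemma annulus_ratio:
  assumes "0 < r"
  shows "(r / ((2 * \<kappa>) ^ n * r)) powr \<delta> = ((2 * \<kappa>) powr (- \<delta>)) ^ n"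
proof -
  have k: "0 < 2 * \<kappa>" using kappa_pos by simp
  have "r / ((2 * \<kappa>) ^ n * r) = (2 * \<kappa>) powr (- real n)"
    using assms k by (simp add: powr_minus powr_realpow divide_inverse)
  then have "(r / ((2 * \<kappa>) ^ n * r)) powr \<delta> = (2 * \<kappa>) powr (- real n * \<delta>)" by (simp add: powr_powr)
  also have "\<dots> = ((2 * \<kappa>) powr (- \<delta>)) powr real n" by (simp add: powr_powr mult.commute)
  also have "\<dots> = ((2 * \<kappa>) powr (- \<delta>)) ^ n" using decay_ratio(1) by (simp add: powr_realpow)
  finally show ?thesis .
qed

lemma annulus_radius_ge: "0 < r \<Longrightarrow> 2 * \<kappa> * r \<le> (2 * \<kappa>) ^ Suc k * r"
proof -
  assume "0 < r"
  have "1 \<le> (2 * \<kappa>) ^ k" using kappa_ge_1 by (intro one_le_power) auto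
  then have "2 * \<kappa> * r * 1 \<le> 2 * \<kappa> * r * (2 * \<kappa>) ^ k"
    using kappa_pos \<open>0 < r\<close> by (intro mult_left_mono) auto
  then show ?thesis by (simp add: mult_ac)
qed

lemma summable_decay: "summable (\<lambda>k. ((2 * \<kappa>) powr (- \<delta>)) ^ Suc k)"
  using decay_ratio by (subst summable_Suc_iff) (intro summable_geometric, simp)

lemma CH_pos: "0 < CH"
proof -
  have "0 < (\<Sum>k. ((2 * \<kappa>) powr (- \<delta>)) ^ Suc k)"
    using decay_ratio(1) by (intro suminf_pos summable_decay) auto
  then show ?thesis using dbl_pos C1 by (simp add: CH_def)
qed

text \<open>Only the smoothness of the kernel enters, as \<open>f\<close> has mean zero.\<close>

lemma T_far_from_mean_zero:
  assumes f: "bdd_on z r f" and r: "0 < r" and mean: "(\<integral>x. f x \<partial>M) = 0"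
  shows "(\<integral>\<^sup>+x\<in>{x. 2 * \<kappa> * r \<le> d x z}. ennreal (norm (T f x)) \<partial>M) \<le> ennreal (CH * (\<integral>x. norm (f x) \<partial>M))"
proof -
  let ?q = "(2 * \<kappa>) powr (- \<delta>)"
  define F where "F = (\<integral>x. norm (f x) \<partial>M)"
  have "0 \<le> F" by (simp add: F_def)
  note [measurable] = T_meas[OF bdd_on_Ls[OF f]]
  have "(\<integral>\<^sup>+x\<in>{x. 2 * \<kappa> * r \<le> d x z}. ennreal (norm (T f x)) \<partial>M)
    \<le> (\<Sum>k. \<integral>\<^sup>+x\<in>ann z ((2 * \<kappa>) ^ Suc k * r). ennreal (norm (T f x)) \<partial>M)"
    using r by (intro nn_integral_far_le) auto
  also have "\<dots> \<le> (\<Sum>k. ennreal (2 * dbl (2 * \<kappa>) * C1 * F * ?q ^ Suc k))"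
  proof (intro suminf_le allI)
    fix k
    let ?R = "(2 * \<kappa>) ^ Suc k * r"
    have R: "2 * \<kappa> * r \<le> ?R" by (rule annulus_radius_ge[OF r])
    have "0 < 2 * \<kappa> * r" using kappa_pos r by simp
    then have "0 \<le> ?R" using R by linarith
    have "1 \<le> s / (s - 1)" using conjugate_exponent(1)[OF s] by simp
    have "(\<integral>\<^sup>+x\<in>ann z ?R. ennreal (1 * norm (T f x)) \<partial>M)
      \<le> ennreal (2 * dbl (2 * \<kappa>) * (C1 * (r / ?R) powr \<delta> * F + CN 1 * (1 + ?R / \<rho> z) powr (- 1) * norm (\<integral>x. f x \<partial>M)))"
      unfolding F_def
      by (intro annulus_bdd_on[OF f r R] nn_integral_ann_one_le \<open>0 \<le> ?R\<close> \<open>1 \<le> s / (s - 1)\<close> dbl_pos) auto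
    then show "(\<integral>\<^sup>+x\<in>ann z ?R. ennreal (norm (T f x)) \<partial>M) \<le> ennreal (2 * dbl (2 * \<kappa>) * C1 * F * ?q ^ Suc k)"
      unfolding mean annulus_ratio[OF r] by (simp add: mult_ac)
  qed auto
  also have "\<dots> = ennreal (\<Sum>k. 2 * dbl (2 * \<kappa>) * C1 * F * ?q ^ Suc k)"
  proof (rule suminf_ennreal2)
    show "0 \<le> 2 * dbl (2 * \<kappa>) * C1 * F * ?q ^ Suc k" for k
      using dbl_pos[of "2 * \<kappa>"] C1 \<open>0 \<le> F\<close> by simp
    show "summable (\<lambda>k. 2 * dbl (2 * \<kappa>) * C1 * F * ?q ^ Suc k)"
      by (rule summable_mult[OF summable_decay])
  qed
  also have "(\<Sum>k. 2 * dbl (2 * \<kappa>) * C1 * F * ?q ^ Suc k) = 2 * dbl (2 * \<kappa>) * C1 * F * (\<Sum>k. ?q ^ Suc k)"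
    by (rule suminf_mult[OF summable_decay])
  finally show ?thesis by (simp only: CH_def F_def mult_ac)
qed

text \<open>The summands answer for the case of a space of small measure, for the good part, for the
  measure of the enlarged stopping balls, and for the bad part outside them.\<close>

definition C11 :: real where
  "C11 = dbl (3 * \<kappa>\<^sup>2) + CT * 2 powr s * (3 * dbl L + 1) powr (s - 1) * (dbl L + 1)
     + dbl (2 * \<kappa> * L) + 4 * CH"

lemma C11_pos: "0 < C11"
  using dbl_pos[of "3 * \<kappa>\<^sup>2"] dbl_pos[of "2 * \<kappa> * L"] dbl_pos[of L] CT CH_pos
  by (simp add: C11_def add_pos_pos add_pos_nonneg)

text \<open>A large ball that meets the support of \<open>f\<close> has volume comparable to that of
  a concentric ball about \<open>z\<close>, and the latter exceeds a multiple of the norm of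
  \<open>f\<close> over \<open>t\<close>. This provides the upper scale at which the stopping-time
  selection starts.\<close>

lemma ball_average_le_of_large_radius:
  assumes f: "bdd_on z n f" and "0 < t" and n: "n \<le> r0"
    and big: "dbl (3 * \<kappa>\<^sup>2) * (\<integral>y. norm (f y) \<partial>M) / t < V z r0" and "0 < r0" "r0 \<le> u"
  shows "(\<integral>\<^sup>+y\<in>B x u. ennreal (norm (f y)) \<partial>M) \<le> ennreal (t * V x u)"
proof (cases "\<exists>y \<in> B x u. f y \<noteq> 0")
  case True
  define F where "F = (\<integral>y. norm (f y) \<partial>M)"
  obtain y where y: "d x y < u" "f y \<noteq> 0" using True by auto
  then have "y \<in> B z n" using f by (auto simp: bdd_on_def)
  then have "d x z \<le> \<kappa> * (u + u)"
  proof -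
    assume "y \<in> B z n"
    then have "d x y + d y z \<le> u + u" using y assms by (simp add: d_sym[of y z])
    then have "\<kappa> * (d x y + d y z) \<le> \<kappa> * (u + u)" using kappa_pos by (intro mult_left_mono) auto
    then show ?thesis using d_quasi_triangle[of x z y] by linarith
  qed
  moreover have "1 * u \<le> \<kappa> * u" using kappa_ge_1 assms by (intro mult_right_mono) auto
  ultimately have "d x z + u \<le> \<kappa> * (2 * u) + \<kappa> * u" by simp
  then have "\<kappa> * (d x z + u) \<le> \<kappa> * (\<kappa> * (2 * u) + \<kappa> * u)" using kappa_pos by (intro mult_left_mono) auto
  also have "\<dots> = 3 * \<kappa>\<^sup>2 * u" by (simp add: power2_eq_square algebra_simps)
  finally have "V z u \<le> dbl (3 * \<kappa>\<^sup>2) * V x u" using assms by (intro V_le_dbl) auto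
  moreover have "V z r0 \<le> V z u" using assms by (intro V_mono qball_mono)
  ultimately have "dbl (3 * \<kappa>\<^sup>2) * F / t < dbl (3 * \<kappa>\<^sup>2) * V x u" using big by (simp add: F_def)
  then have "dbl (3 * \<kappa>\<^sup>2) * (F / t) < dbl (3 * \<kappa>\<^sup>2) * V x u" by simp
  then have "F / t < V x u" using dbl_pos[of "3 * \<kappa>\<^sup>2"] by (simp only: mult_less_cancel_left_pos)
  then have "F \<le> t * V x u" using \<open>0 < t\<close> by (simp add: field_simps)
  have "(\<integral>\<^sup>+y\<in>B x u. ennreal (norm (f y)) \<partial>M) \<le> (\<integral>\<^sup>+y. ennreal (norm (f y)) \<partial>M)"
    by (intro nn_integral_mono) (auto split: split_indicator)
  also have "\<dots> = ennreal F"
    unfolding F_def using bdd_on_integrable[OF f] by (intro nn_integral_eq_integral integrable_norm) auto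
  also have "\<dots> \<le> ennreal (t * V x u)" using \<open>F \<le> t * V x u\<close> by (rule ennreal_leI)
  finally show ?thesis .
next
  case False
  then have "(\<integral>\<^sup>+y\<in>B x u. ennreal (norm (f y)) \<partial>M) = (\<integral>\<^sup>+y. 0 \<partial>M)"
    by (intro nn_integral_cong) (auto split: split_indicator)
  then show ?thesis by simp
qed

text \<open>The Calderon--Zygmund decomposition is taken with the simplified bad parts
  \<open>f 1\<^bsub>Q i\<^esub> - (\<integral>\<^bsub>Q i\<^esub> f) 1\<^bsub>B i\<^esub> / \<mu>(B i)\<close>, where the \<open>Q i\<close> are disjoint and contained in
  dilates of the disjoint stopping balls \<open>B i\<close>.\<close>

lemma T_weak_11_bdd:
  assumes f: "bdd_on z n f" and t: "0 < t"
  shows "emeasure M {x \<in> space M. t < norm (T f x)} \<le> ennreal (C11 * (\<integral>x. norm (f x) \<partial>M) / t)"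
proof -
  define F where "F = (\<integral>x. norm (f x) \<partial>M)"
  have F0: "0 \<le> F" by (simp add: F_def)
  have fm[measurable]: "f \<in> borel_measurable M" by (rule bdd_on_measurable[OF f])
  have fLs: "f \<in> Ls" by (rule bdd_on_Ls[OF f])
  have fi: "integrable M f" by (rule bdd_on_integrable[OF f])
  have FI: "(\<integral>\<^sup>+x. ennreal (norm (f x)) \<partial>M) = ennreal F"
    unfolding F_def using fi by (intro nn_integral_eq_integral integrable_norm) auto
  define D where "D = dbl L"
  have D: "1 \<le> D" unfolding D_def by (rule dbl_ge_1)
  show ?thesis
  proof (cases "\<exists>k::nat. dbl (3 * \<kappa>\<^sup>2) * F / t < V z k")
    \<comment> \<open>The whole space then has measure at most a constant times
      \<open>F / t\<close>, so any level set obeys the bound. This covers spaces of finite measure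
      at low levels, where no ball is large enough to start the selection.\<close>
    case False
    then have le: "emeasure M (B z (real k)) \<le> ennreal (dbl (3 * \<kappa>\<^sup>2) * F / t)" for k
      unfolding emeasure_qball by (intro ennreal_leI) (simp add: not_less)
    have "emeasure M {x \<in> space M. t < norm (T f x)} \<le> emeasure M (\<Union>k. B z (real k))"
      using space_eq UN_qball[of z] sets.top[of M] by (intro emeasure_mono) auto
    also have "\<dots> = (SUP k. emeasure M (B z (real k)))"
      by (intro SUP_emeasure_incseq[symmetric]) (auto simp: incseq_def)
    also have "\<dots> \<le> ennreal (dbl (3 * \<kappa>\<^sup>2) * F / t)" by (intro SUP_least le)
    also have "\<dots> \<le> ennreal (C11 * F / t)"
    proof (intro ennreal_leI divide_right_mono mult_right_mono)
      show "dbl (3 * \<kappa>\<^sup>2) \<le> C11"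
        using dbl_pos[of "2 * \<kappa> * L"] CT CH_pos dbl_pos[of L] by (simp add: C11_def)
    qed (use F0 t in auto)
    finally show ?thesis by (simp add: F_def)
  next
    case True
    then obtain k :: nat where k: "dbl (3 * \<kappa>\<^sup>2) * F / t < V z k" by blast
    \<comment> \<open>At least \<open>n\<close>, so that the support of \<open>f\<close> lies in the
      ball about \<open>z\<close>, and at least 1, so that the radius is positive.\<close>
    define r0 where "r0 = max (real k) (max n 1)"
    have r0: "n \<le> r0" "0 < r0" by (auto simp: r0_def)
    have "V z k \<le> V z r0" by (intro V_mono qball_mono) (simp add: r0_def)
    then have big: "dbl (3 * \<kappa>\<^sup>2) * (\<integral>y. norm (f y) \<partial>M) / t < V z r0" using k by (simp add: F_def)
    define h where "h x = ennreal (norm (f x))" for x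
    have [measurable]: "h \<in> borel_measurable M" unfolding h_def by measurable
    obtain x u where xu: "\<And>i. 0 \<le> u i" "\<And>i. u i < r0" "\<And>i. 0 < u i \<Longrightarrow> x i \<in> UNIV"
      "disjoint_family (\<lambda>i. B (x i) (u i))"
      "\<And>i::nat. ennreal (t * V (x i) (u i)) \<le> (\<integral>\<^sup>+y\<in>B (x i) (u i). h y \<partial>M)"
      "\<And>i. (\<integral>\<^sup>+y\<in>B (x i) (L * u i). h y \<partial>M) \<le> ennreal (t * V (x i) (L * u i))"
      "AE y in M. y \<in> UNIV - (\<Union>i. B (x i) (L * u i)) \<longrightarrow> h y \<le> ennreal ((2 * dbl L + 1) * t)"
    proof (rule stopping_balls[of h UNIV r0 t])
      show "UNIV \<in> sets M" using sets.top[of M] space_eq by simp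
      show "(\<integral>\<^sup>+y\<in>B x u. h y \<partial>M) \<le> ennreal (t * V x u)" if "r0 \<le> u" for x u
        unfolding h_def using ball_average_le_of_large_radius[OF f t r0(1) big r0(2) that] .
    qed (use r0 t in auto)
    define W where "W = (\<Union>i. B (x i) (u i))"
    define Bs where "Bs i = B (x i) (L * u i)" for i
    have [measurable]: "W \<in> sets M" "\<And>i. Bs i \<in> sets M" by (auto simp: W_def Bs_def)
    define Q where "Q = disjointed Bs"
    have Q_disj: "disjoint_family Q" unfolding Q_def by (rule disjoint_family_disjointed)
    have Q_sub: "Q i \<subseteq> Bs i" for i unfolding Q_def by (rule disjointed_subset)
    have Q_UN: "(\<Union>i. Q i) = (\<Union>i. Bs i)" unfolding Q_def by (rule UN_disjointed_eq)
    have [measurable]: "Q i \<in> sets M" for i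
    proof -
      have "range Bs \<subseteq> sets M" by (auto simp: Bs_def)
      then show ?thesis unfolding Q_def using sets.range_disjointed_sets[of Bs M] by auto
    qed
    have B_sub: "B (x i) (u i) \<subseteq> Bs i" for i
      unfolding Bs_def
    proof (rule qball_mono)
      have "1 * u i \<le> L * u i" using L_ge xu(1)[of i] by (intro mult_right_mono) auto
      then show "u i \<le> L * u i" by linarith
    qed
    have W_measure: "ennreal t * emeasure M W \<le> ennreal F"
    proof -
      have "ennreal t * emeasure M W = ennreal t * (\<Sum>i. emeasure M (B (x i) (u i)))"
        unfolding W_def using xu(4) by (subst suminf_emeasure) auto
      also have "\<dots> = (\<Sum>i. ennreal t * emeasure M (B (x i) (u i)))"
        by (rule ennreal_suminf_cmult[symmetric])
      also have "\<dots> = (\<Sum>i. ennreal (t * V (x i) (u i)))"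
        using t by (simp only: emeasure_qball ennreal_mult')
      also have "\<dots> \<le> (\<Sum>i. \<integral>\<^sup>+y\<in>B (x i) (u i). h y \<partial>M)" by (intro suminf_le allI xu(5)) auto
      also have "\<dots> = (\<integral>\<^sup>+y\<in>W. h y \<partial>M)" unfolding W_def using xu(4) by (intro nn_integral_UN_disjoint[symmetric]) auto
      also have "\<dots> \<le> (\<integral>\<^sup>+y. h y \<partial>M)" by (intro nn_integral_mono) (auto split: split_indicator)
      finally show ?thesis using FI by (simp add: h_def)
    qed
    then have "emeasure M W < top" using t by (cases "emeasure M W") (auto simp: ennreal_mult_top top_unique)
    define m where "m i = (\<integral>y. indicator (Q i) y *\<^sub>R f y \<partial>M)" for i
    \<comment> \<open>The mass of \<open>Q i\<close> is divided by the volume of the stopping ball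
      and not of \<open>Q i\<close>, which may be tiny. This keeps \<open>c i\<close> below
      \<open>D * t\<close>, and as the stopping balls are disjoint, these constants do not
      accumulate.\<close>
    define c where "c i = m i /\<^sub>R V (x i) (u i)" for i
    have fQ: "integrable M (\<lambda>y. indicator (Q i) y *\<^sub>R f y)" for i
      using fi by (intro integrable_mult_indicator) auto
    have m_le: "ennreal (norm (m i)) \<le> (\<integral>\<^sup>+y\<in>Q i. h y \<partial>M)" for i
    proof -
      have "ennreal (norm (m i)) \<le> (\<integral>\<^sup>+y. ennreal (norm (indicator (Q i) y *\<^sub>R f y)) \<partial>M)"
        unfolding m_def by (rule integral_norm_bound_ennreal[OF fQ])
      also have "\<dots> = (\<integral>\<^sup>+y\<in>Q i. h y \<partial>M)" unfolding h_def by (intro nn_integral_cong) (auto split: split_indicator)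
      finally show ?thesis .
    qed
    have m_le': "norm (m i) \<le> t * (D * V (x i) (u i))" for i
    proof -
      have "ennreal (norm (m i)) \<le> (\<integral>\<^sup>+y\<in>Q i. h y \<partial>M)" by (rule m_le)
      also have "\<dots> \<le> (\<integral>\<^sup>+y\<in>Bs i. h y \<partial>M)" by (rule nn_integral_mono_set[OF Q_sub])
      also have "\<dots> \<le> ennreal (t * V (x i) (L * u i))" unfolding Bs_def by (rule xu(6))
      also have "\<dots> \<le> ennreal (t * (D * V (x i) (u i)))"
        unfolding D_def using t by (intro ennreal_leI mult_left_mono V_dilate xu) auto
      finally show ?thesis using t D by (subst (asm) ennreal_le_iff) auto
    qed
    have c_le: "norm (c i) \<le> D * t" for i
    proof (cases "0 < u i")
      case True
      then have "0 < V (x i) (u i)" by (rule V_pos)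
      then show ?thesis using m_le'[of i] by (simp add: c_def field_simps)
    next
      case False
      then show ?thesis using t D by (simp add: c_def)
    qed
    \<comment> \<open>For a padding index the volume is 0 and division by it gives
      \<open>c i = 0\<close>; the identity survives because \<open>m i\<close> vanishes as
      well.\<close>
    have Vc: "V (x i) (u i) *\<^sub>R c i = m i" for i
    proof (cases "0 < u i")
      case True
      then have "0 < V (x i) (u i)" by (rule V_pos)
      then show ?thesis by (simp add: c_def)
    next
      case False
      then have "u i = 0" using xu(1)[of i] by simp
      then have "m i = 0" using m_le'[of i] by simp
      then show ?thesis by (simp add: c_def)
    qed
    define b where "b i y = indicator (Q i) y *\<^sub>R f y - indicator (B (x i) (u i)) y *\<^sub>R c i" for i y
    have [measurable]: "b i \<in> borel_measurable M" for i unfolding b_def by measurable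
    obtain cf where cf: "\<And>y. norm (f y) \<le> cf" using f unfolding bdd_on_def by blast
    have b_bdd: "bdd_on (x i) (L * u i) (b i)" for i
      unfolding bdd_on_def
    proof (intro conjI exI allI impI)
      show "b i \<in> borel_measurable M" by measurable
      fix y
      have "norm (b i y) \<le> norm (indicator (Q i) y *\<^sub>R f y) + norm (indicator (B (x i) (u i)) y *\<^sub>R c i)"
        unfolding b_def by (rule norm_triangle_ineq4)
      also have "\<dots> \<le> norm (f y) + norm (c i)" by (intro add_mono) (auto split: split_indicator)
      also have "\<dots> \<le> cf + norm (c i)" using cf by simp
      finally show "norm (b i y) \<le> cf + norm (c i)" .
      show "b i y = 0" if "y \<notin> B (x i) (L * u i)"
      proof -
        have "y \<notin> Q i" "y \<notin> B (x i) (u i)" using that Q_sub[of i] B_sub[of i] by (auto simp: Bs_def)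
        then show ?thesis by (simp add: b_def)
      qed
    qed
    have b_Ls: "b i \<in> Ls" for i by (rule bdd_on_Ls[OF b_bdd])
    have b_mean: "(\<integral>y. b i y \<partial>M) = 0" for i
    proof -
      have "(\<integral>y. b i y \<partial>M) = m i - (\<integral>y. indicator (B (x i) (u i)) y *\<^sub>R c i \<partial>M)"
        unfolding b_def m_def using fQ emeasure_qball_finite
        by (intro Bochner_Integration.integral_diff integrable_scaleR_left integrable_real_indicator) auto
      also have "(\<integral>y. indicator (B (x i) (u i)) y *\<^sub>R c i \<partial>M) = V (x i) (u i) *\<^sub>R c i"
        using emeasure_qball_finite by (subst integral_scaleR_left) (auto simp: space_eq)
      finally show ?thesis by (simp add: Vc)
    qed
    have b_L1: "ennreal (\<integral>y. norm (b i y) \<partial>M) \<le> 2 * (\<integral>\<^sup>+y\<in>Q i. h y \<partial>M)" for i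
    proof -
      have "ennreal (\<integral>y. norm (b i y) \<partial>M) = (\<integral>\<^sup>+y. ennreal (norm (b i y)) \<partial>M)"
        using bdd_on_integrable[OF b_bdd[of i]] by (intro nn_integral_eq_integral[symmetric] integrable_norm) auto
      also have "\<dots> \<le> (\<integral>\<^sup>+y. h y * indicator (Q i) y + ennreal (norm (c i)) * indicator (B (x i) (u i)) y \<partial>M)"
      proof (rule nn_integral_mono)
        fix y
        have "norm (b i y) \<le> norm (indicator (Q i) y *\<^sub>R f y) + norm (indicator (B (x i) (u i)) y *\<^sub>R c i)"
          unfolding b_def by (rule norm_triangle_ineq4)
        then have "ennreal (norm (b i y)) \<le> ennreal (norm (indicator (Q i) y *\<^sub>R f y)) + ennreal (norm (indicator (B (x i) (u i)) y *\<^sub>R c i))"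
          by (simp add: ennreal_plus[symmetric] ennreal_leI del: ennreal_plus)
        also have "\<dots> = h y * indicator (Q i) y + ennreal (norm (c i)) * indicator (B (x i) (u i)) y"
          by (auto simp: h_def split: split_indicator)
        finally show "ennreal (norm (b i y)) \<le> h y * indicator (Q i) y + ennreal (norm (c i)) * indicator (B (x i) (u i)) y" .
      qed
      also have "\<dots> = (\<integral>\<^sup>+y\<in>Q i. h y \<partial>M) + ennreal (norm (c i)) * emeasure M (B (x i) (u i))"
        by (subst nn_integral_add) (auto simp: nn_integral_cmult_indicator)
      also have "ennreal (norm (c i)) * emeasure M (B (x i) (u i)) = ennreal (norm (m i))"
        unfolding emeasure_qball Vc[symmetric] by (simp add: ennreal_mult'[symmetric] mult.commute)
      also have "(\<integral>\<^sup>+y\<in>Q i. h y \<partial>M) + ennreal (norm (m i)) \<le> (\<integral>\<^sup>+y\<in>Q i. h y \<partial>M) + (\<integral>\<^sup>+y\<in>Q i. h y \<partial>M)"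
        by (rule add_left_mono[OF m_le])
      finally show ?thesis by (simp only: mult_2)
    qed
    have sum_b_L1: "(\<Sum>i. ennreal (\<integral>y. norm (b i y) \<partial>M)) \<le> 2 * ennreal F"
    proof -
      have "(\<Sum>i. \<integral>\<^sup>+y\<in>Q i. h y \<partial>M) = (\<integral>\<^sup>+y\<in>(\<Union>i. Q i). h y \<partial>M)"
        by (intro nn_integral_UN_disjoint[symmetric] Q_disj) auto
      also have "\<dots> \<le> (\<integral>\<^sup>+y. h y \<partial>M)" by (intro nn_integral_mono) (auto split: split_indicator)
      also have "\<dots> = ennreal F" using FI by (simp add: h_def)
      finally have le: "(\<Sum>i. \<integral>\<^sup>+y\<in>Q i. h y \<partial>M) \<le> ennreal F" .
      have "(\<Sum>i. ennreal (\<integral>y. norm (b i y) \<partial>M)) \<le> (\<Sum>i. 2 * (\<integral>\<^sup>+y\<in>Q i. h y \<partial>M))"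
        by (intro suminf_le allI b_L1) auto
      also have "\<dots> = 2 * (\<Sum>i. \<integral>\<^sup>+y\<in>Q i. h y \<partial>M)" by (rule ennreal_suminf_cmult)
      also have "\<dots> \<le> 2 * ennreal F" by (rule mult_left_mono[OF le]) simp
      finally show ?thesis .
    qed
    define S where "S n y = (\<Sum>i<n. b i y)" for n y
    have S_eq: "S n y = (if j < n then indicator (Q j) y *\<^sub>R f y else 0) - (if l < n then indicator (B (x l) (u l)) y *\<^sub>R c l else 0)"
      if "\<And>i. i \<noteq> j \<Longrightarrow> y \<notin> Q i" "\<And>i. i \<noteq> l \<Longrightarrow> y \<notin> B (x i) (u i)" for n y j l
      unfolding S_def b_def sum_subtractf
      using sum_indicator_single[of j y Q "\<lambda>_. f y" n, OF that(1)]
        sum_indicator_single[of l y "\<lambda>i. B (x i) (u i)" c n, OF that(2)] by simp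
    define bt where "bt y = lim (\<lambda>n. S n y)" for y
    have S_meas[measurable]: "S n \<in> borel_measurable M" for n unfolding S_def by measurable
    have bt_meas[measurable]: "bt \<in> borel_measurable M" unfolding bt_def by measurable
    \<comment> \<open>A common majorant of all partial sums of the bad parts. It lies in the domain
      of \<open>T\<close> because \<open>W\<close> has finite measure.\<close>
    define G where "G y = norm (f y) + D * t * indicator W y" for y
    have [measurable]: "G \<in> borel_measurable M" unfolding G_def by measurable
    \<comment> \<open>A point lies in at most one \<open>Q j\<close> and in at most one stopping
      ball, so the partial sums are eventually constant there.\<close>
    have point: "(\<lambda>n. S n y) \<longlonglongrightarrow> bt y \<and> (\<forall>n. norm (S n y) \<le> G y) \<and> norm (bt y) \<le> G y
      \<and> (y \<notin> (\<Union>i. Bs i) \<longrightarrow> bt y = 0) \<and> (y \<in> (\<Union>i. Bs i) \<longrightarrow> norm (f y - bt y) \<le> D * t * indicator W y)" for y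
    proof -
      obtain j where j: "\<And>i. i \<noteq> j \<Longrightarrow> y \<notin> Q i" using disjoint_family_unique_index[OF Q_disj, of y] by blast
      obtain l where l: "\<And>i. i \<noteq> l \<Longrightarrow> y \<notin> B (x i) (u i)" using disjoint_family_unique_index[OF xu(4), of y] by blast
      have Seq: "S n y = (if j < n then indicator (Q j) y *\<^sub>R f y else 0)
          - (if l < n then indicator (B (x l) (u l)) y *\<^sub>R c l else 0)" for n
        by (rule S_eq) (erule j, erule l)
      define v where "v = indicator (Q j) y *\<^sub>R f y - indicator (B (x l) (u l)) y *\<^sub>R c l"
      have "\<forall>\<^sub>F n in sequentially. v = S n y"
        using eventually_gt_at_top[of j] eventually_gt_at_top[of l]
        by eventually_elim (simp only: Seq v_def if_True)
      then have lim: "(\<lambda>n. S n y) \<longlonglongrightarrow> v" by (rule tendsto_eventually[OF eventually_mono]) simp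
      then have bt: "bt y = v" unfolding bt_def by (rule limI)
      have ind: "norm (indicator (B (x l) (u l)) y *\<^sub>R c l) \<le> D * t * indicator W y"
        using c_le[of l] D t by (auto simp: W_def split: split_indicator)
      have S_le: "norm (S n y) \<le> G y" for n
      proof -
        have "norm (S n y) \<le> norm (if j < n then indicator (Q j) y *\<^sub>R f y else 0) + norm (if l < n then indicator (B (x l) (u l)) y *\<^sub>R c l else 0)"
          unfolding Seq by (rule norm_triangle_ineq4)
        also have "\<dots> \<le> norm (f y) + norm (indicator (B (x l) (u l)) y *\<^sub>R c l)"
          by (intro add_mono) (auto split: split_indicator)
        also have "\<dots> \<le> G y" unfolding G_def using ind by (rule add_left_mono)
        finally show ?thesis .
      qed
      have bt_le: "norm (bt y) \<le> G y"
      proof -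
        have "norm (bt y) \<le> norm (indicator (Q j) y *\<^sub>R f y) + norm (indicator (B (x l) (u l)) y *\<^sub>R c l)"
          unfolding bt v_def by (rule norm_triangle_ineq4)
        also have "\<dots> \<le> norm (f y) + D * t * indicator W y" using ind by (intro add_mono) (auto split: split_indicator)
        finally show ?thesis by (simp add: G_def)
      qed
      have out: "bt y = 0" if "y \<notin> (\<Union>i. Bs i)"
      proof -
        have "y \<notin> Q j" "y \<notin> B (x l) (u l)" using that Q_UN B_sub[of l] by blast+
        then show ?thesis by (simp add: bt v_def)
      qed
      have inside: "norm (f y - bt y) \<le> D * t * indicator W y" if "y \<in> (\<Union>i. Bs i)"
      proof -
        have "y \<in> (\<Union>i. Q i)" using that Q_UN by simp
        then obtain i where "y \<in> Q i" by blast
        then have "y \<in> Q j" using j[of i] by (cases "i = j") auto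
        then have "f y - bt y = indicator (B (x l) (u l)) y *\<^sub>R c l" by (simp add: bt v_def)
        then show ?thesis using ind by simp
      qed
      from lim S_le bt_le out inside show ?thesis unfolding bt by blast
    qed
    define g where "g y = f y - bt y" for y
    have g_meas[measurable]: "g \<in> borel_measurable M" unfolding g_def by measurable
    have G_Ls: "(\<integral>\<^sup>+y. ennreal (norm (G y) powr s) \<partial>M) < top"
    proof -
      have "(\<integral>\<^sup>+y. ennreal (norm (D * t * indicator W y :: real) powr s) \<partial>M) = (\<integral>\<^sup>+y\<in>W. ennreal ((D * t) powr s) \<partial>M)"
        using D t by (intro nn_integral_cong) (auto split: split_indicator)
      also have "\<dots> < top" using \<open>emeasure M W < top\<close> by (simp add: nn_integral_cmult_indicator ennreal_mult_less_top)
      finally have 1: "(\<integral>\<^sup>+y. ennreal (norm (D * t * indicator W y :: real) powr s) \<partial>M) < top" .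
      have 2: "(\<integral>\<^sup>+y. ennreal (norm (norm (f y)) powr s) \<partial>M) < top" using fLs by (simp add: Ls_iff)
      show ?thesis unfolding G_def using s_pos 1 2 by (intro nn_integral_powr_add_finite) auto
    qed
    have G_dom: "w \<in> Ls" if [measurable]: "w \<in> borel_measurable M" and "\<And>y. norm (w y) \<le> G y" for w
    proof -
      have "norm (w y) powr s \<le> norm (G y) powr s" for y
        using that(2)[of y] s_pos by (intro powr_mono2) auto
      then have "(\<integral>\<^sup>+y. ennreal (norm (w y) powr s) \<partial>M) \<le> (\<integral>\<^sup>+y. ennreal (norm (G y) powr s) \<partial>M)"
        by (intro nn_integral_mono ennreal_leI)
      then show ?thesis using G_Ls that(1) by (auto simp: Ls_iff)
    qed
    have S_Ls: "S n \<in> Ls" for n using point by (intro G_dom) auto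
    have bt_Ls: "bt \<in> Ls" using point by (intro G_dom) auto
    have g_Ls: "g \<in> Ls" unfolding g_def by (rule Ls_diff[OF fLs bt_Ls])
    \<comment> \<open>Linearity handles finite sums only. Convergence of the partial sums with
      exponent \<open>s\<close> makes their images converge in measure, after which Fatou's lemma
      carries over the bound outside the enlarged balls.\<close>
    have S_lim: "(\<lambda>n. \<integral>\<^sup>+y. ennreal (norm (S n y - bt y) powr s) \<partial>M) \<longlonglongrightarrow> (\<integral>\<^sup>+y. ennreal 0 \<partial>M)"
    proof (rule nn_integral_dominated_convergence[where w = "\<lambda>y. ennreal (2 powr s) * ennreal (norm (G y) powr s)"])
      show "(\<integral>\<^sup>+y. ennreal (2 powr s) * ennreal (norm (G y) powr s) \<partial>M) < \<infinity>"
        using G_Ls by (simp add: nn_integral_cmult ennreal_mult_less_top)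
      fix n
      show "AE y in M. ennreal (norm (S n y - bt y) powr s) \<le> ennreal (2 powr s) * ennreal (norm (G y) powr s)"
      proof (rule AE_I2)
        fix y
        have "norm (S n y - bt y) \<le> norm (S n y) + norm (bt y)" by (rule norm_triangle_ineq4)
        also have "\<dots> \<le> 2 * norm (G y)" using point[of y] by (auto dest: spec[of _ n])
        finally have "norm (S n y - bt y) powr s \<le> (2 * norm (G y)) powr s" using s_pos by (intro powr_mono2) auto
        then show "ennreal (norm (S n y - bt y) powr s) \<le> ennreal (2 powr s) * ennreal (norm (G y) powr s)"
          by (simp add: ennreal_mult'[symmetric] powr_mult ennreal_leI)
      qed
    next
      show "AE y in M. (\<lambda>n. ennreal (norm (S n y - bt y) powr s)) \<longlonglongrightarrow> ennreal 0"
      proof (intro AE_I2 tendsto_ennrealI)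
        fix y
        have "(\<lambda>n. norm (S n y - bt y)) \<longlonglongrightarrow> 0" using point[of y] by (simp add: LIM_zero tendsto_norm_zero)
        then show "(\<lambda>n. norm (S n y - bt y) powr s) \<longlonglongrightarrow> 0"
          using s_pos by (intro tendsto_zero_powrI[OF _ tendsto_const]) auto
      qed
    qed auto
    then have conv: "conv_measure M (\<lambda>n. T (S n)) (T bt)"
      by (intro T_conv_measure S_Ls bt_Ls) simp
    \<comment> \<open>The extra factor \<open>2 * \<kappa>\<close> puts the complement into the
      region where \<open>T_far_from_mean_zero\<close> applies to functions supported in the
      dilates.\<close>
    define \<Omega> where "\<Omega> = (\<Union>i. B (x i) (2 * \<kappa> * L * u i))"
    have [measurable]: "\<Omega> \<in> sets M" unfolding \<Omega>_def by auto
    note T_meas' [measurable] = T_meas[OF bt_Ls] T_meas[OF g_Ls] T_meas[OF fLs] T_meas[OF S_Ls] T_meas[OF b_Ls]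
    have far: "(\<integral>\<^sup>+y\<in>space M - \<Omega>. ennreal (norm (T (b i) y)) \<partial>M) \<le> ennreal CH * ennreal (\<integral>y. norm (b i y) \<partial>M)" for i
    proof (cases "0 < u i")
      case True
      then have pos: "0 < L * u i" using L_ge by simp
      have "(\<integral>\<^sup>+y\<in>space M - \<Omega>. ennreal (norm (T (b i) y)) \<partial>M) \<le> (\<integral>\<^sup>+y\<in>{y. 2 * \<kappa> * (L * u i) \<le> d y (x i)}. ennreal (norm (T (b i) y)) \<partial>M)"
        by (intro nn_integral_mono_set) (auto simp: \<Omega>_def not_less d_sym mult.assoc)
      also have "\<dots> \<le> ennreal (CH * (\<integral>y. norm (b i y) \<partial>M))"
        by (rule T_far_from_mean_zero[OF b_bdd pos b_mean])
      finally show ?thesis using CH_pos by (simp add: ennreal_mult')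
    next
      case False
      have "b i y = 0" for y
      proof -
        have "y \<notin> B (x i) (L * u i)" using False L_ge by (simp add: not_less mult_nonneg_nonpos order.trans[OF _ d_nonneg])
        then show ?thesis using b_bdd[of i] by (simp add: bdd_on_def)
      qed
      then have "b i = (\<lambda>_. 0)" by auto
      then have "AE y in M. T (b i) y = 0" using T_zero by simp
      then have "(\<integral>\<^sup>+y\<in>space M - \<Omega>. ennreal (norm (T (b i) y)) \<partial>M) = (\<integral>\<^sup>+y. 0 \<partial>M)"
        by (intro nn_integral_cong_AE) (auto elim!: eventually_mono)
      then show ?thesis by simp
    qed
    have far_bt: "(\<integral>\<^sup>+y\<in>space M - \<Omega>. ennreal (1 * norm (T bt y)) \<partial>M) \<le> ennreal (2 * CH * F)"
    proof (rule conv_measure_Fatou[OF conv])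
      fix n
      have "(\<integral>\<^sup>+y\<in>space M - \<Omega>. ennreal (1 * norm (T (S n) y)) \<partial>M)
        \<le> (\<integral>\<^sup>+y. (\<Sum>i<n. ennreal (norm (T (b i) y)) * indicator (space M - \<Omega>) y) \<partial>M)"
      proof (rule nn_integral_mono_AE)
        have "AE y in M. T (S n) y = (\<Sum>i<n. T (b i) y)"
          using T_sum[of "{..<n}" b] b_Ls unfolding S_def by simp
        then show "AE y in M. ennreal (1 * norm (T (S n) y)) * indicator (space M - \<Omega>) y
          \<le> (\<Sum>i<n. ennreal (norm (T (b i) y)) * indicator (space M - \<Omega>) y)"
        proof eventually_elim
          fix y assume y: "T (S n) y = (\<Sum>i<n. T (b i) y)"
          have "ennreal (norm (\<Sum>i<n. T (b i) y)) \<le> (\<Sum>i<n. ennreal (norm (T (b i) y)))"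
            by (subst sum_ennreal) (auto intro: ennreal_leI norm_sum)
          then show "ennreal (1 * norm (T (S n) y)) * indicator (space M - \<Omega>) y
            \<le> (\<Sum>i<n. ennreal (norm (T (b i) y)) * indicator (space M - \<Omega>) y)"
            unfolding y sum_distrib_right[symmetric] mult_1_left by (rule mult_right_mono) simp
        qed
      qed
      also have "\<dots> = (\<Sum>i<n. \<integral>\<^sup>+y\<in>space M - \<Omega>. ennreal (norm (T (b i) y)) \<partial>M)"
        by (rule nn_integral_sum) measurable
      also have "\<dots> \<le> (\<Sum>i<n. ennreal CH * ennreal (\<integral>y. norm (b i y) \<partial>M))" by (intro sum_mono far)
      also have "\<dots> \<le> (\<Sum>i. ennreal CH * ennreal (\<integral>y. norm (b i y) \<partial>M))" by (rule suminf_split_bound)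
      also have "\<dots> = ennreal CH * (\<Sum>i. ennreal (\<integral>y. norm (b i y) \<partial>M))" by (rule ennreal_suminf_cmult)
      also have "\<dots> \<le> ennreal CH * (2 * ennreal F)" by (intro mult_left_mono sum_b_L1) auto
      also have "\<dots> = ennreal (2 * CH * F)"
        using CH_pos F0 by (simp add: ennreal_mult mult_ac)
      finally show "(\<integral>\<^sup>+y\<in>space M - \<Omega>. ennreal (1 * norm (T (S n) y)) \<partial>M) \<le> ennreal (2 * CH * F)" .
    qed auto
    have level_bt: "emeasure M {y \<in> space M. t / 2 < norm (T bt y)} \<le> ennreal ((dbl (2 * \<kappa> * L) + 4 * CH) * F / t)"
    proof -
      have "emeasure M {y \<in> space M. t / 2 < norm (T bt y)}
        \<le> emeasure M (\<Omega> \<union> {y \<in> space M. t / 2 < norm (indicator (space M - \<Omega>) y *\<^sub>R T bt y)})"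
        by (intro emeasure_mono) (auto split: split_indicator)
      also have "\<dots> \<le> emeasure M \<Omega> + emeasure M {y \<in> space M. t / 2 < norm (indicator (space M - \<Omega>) y *\<^sub>R T bt y)}"
        by (rule emeasure_subadditive) measurable
      also have "\<dots> \<le> ennreal (dbl (2 * \<kappa> * L) * F / t) + ennreal (4 * CH * F / t)"
      proof (rule add_mono)
        have "emeasure M \<Omega> \<le> (\<Sum>i. emeasure M (B (x i) (2 * \<kappa> * L * u i)))"
          unfolding \<Omega>_def by (rule emeasure_subadditive_countably) auto
        also have "\<dots> \<le> ennreal (dbl (2 * \<kappa> * L)) * emeasure M W"
          unfolding emeasure_qball W_def by (intro suminf_V_dilate_le xu)
        also have "\<dots> \<le> ennreal (dbl (2 * \<kappa> * L)) * ennreal (F / t)"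
        proof (rule mult_left_mono)
          obtain wr where wr: "emeasure M W = ennreal wr" "0 \<le> wr"
            using \<open>emeasure M W < top\<close> by (cases "emeasure M W") auto
          then have "t * wr \<le> F" using W_measure t F0 by (simp add: ennreal_mult'[symmetric])
          then have "wr \<le> F / t" using t by (simp add: field_simps)
          then show "emeasure M W \<le> ennreal (F / t)" using wr by (simp add: ennreal_leI)
        qed simp
        also have "\<dots> = ennreal (dbl (2 * \<kappa> * L) * F / t)"
          using dbl_pos[of "2 * \<kappa> * L"] by (simp add: ennreal_mult'[symmetric])
        finally show "emeasure M \<Omega> \<le> ennreal (dbl (2 * \<kappa> * L) * F / t)" .
        have "emeasure M {y \<in> space M. t / 2 < norm (indicator (space M - \<Omega>) y *\<^sub>R T bt y)}
          \<le> ennreal (1 / (t / 2)) * (\<integral>\<^sup>+y. ennreal (norm (indicator (space M - \<Omega>) y *\<^sub>R T bt y)) \<partial>M)"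
          using t by (intro emeasure_norm_gt_le_nn_integral) auto
        also have "(\<integral>\<^sup>+y. ennreal (norm (indicator (space M - \<Omega>) y *\<^sub>R T bt y)) \<partial>M) = (\<integral>\<^sup>+y\<in>space M - \<Omega>. ennreal (1 * norm (T bt y)) \<partial>M)"
          by (intro nn_integral_cong) (auto split: split_indicator)
        also have "ennreal (1 / (t / 2)) * \<dots> \<le> ennreal (1 / (t / 2)) * ennreal (2 * CH * F)"
          by (intro mult_left_mono far_bt) auto
        also have "\<dots> = ennreal (4 * CH * F / t)" using t CH_pos by (simp add: ennreal_mult'[symmetric] mult.assoc)
        finally show "emeasure M {y \<in> space M. t / 2 < norm (indicator (space M - \<Omega>) y *\<^sub>R T bt y)} \<le> ennreal (4 * CH * F / t)" .
      qed
      also have "\<dots> = ennreal ((dbl (2 * \<kappa> * L) + 4 * CH) * F / t)"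
        using dbl_pos[of "2 * \<kappa> * L"] CH_pos F0 t
        by (simp add: ennreal_plus[symmetric] add_divide_distrib distrib_right del: ennreal_plus)
      finally show ?thesis .
    qed
    have g_le: "AE y in M. norm (g y) \<le> (3 * D + 1) * t"
      using xu(7)
    proof eventually_elim
      fix y assume y: "y \<in> UNIV - (\<Union>i. B (x i) (L * u i)) \<longrightarrow> h y \<le> ennreal ((2 * dbl L + 1) * t)"
      have Dt: "0 \<le> D * t" using D t by simp
      show "norm (g y) \<le> (3 * D + 1) * t"
      proof (cases "y \<in> (\<Union>i. Bs i)")
        case True
        then have "norm (g y) \<le> D * t * indicator W y" unfolding g_def using point[of y] by blast
        also have "\<dots> \<le> D * t * 1" using Dt by (intro mult_left_mono) (auto split: split_indicator)
        also have "\<dots> \<le> (3 * D + 1) * t" using Dt t by (simp add: distrib_right)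
        finally show ?thesis .
      next
        case False
        then have "h y \<le> ennreal ((2 * D + 1) * t)" using y by (simp add: Bs_def D_def)
        moreover have "0 \<le> (2 * D + 1) * t" using D t by simp
        ultimately have "norm (f y) \<le> (2 * D + 1) * t" unfolding h_def by (simp only: ennreal_le_iff)
        moreover have "bt y = 0" using point[of y] False by blast
        ultimately show ?thesis using Dt by (simp add: g_def distrib_right)
      qed
    qed
    have g_L1: "(\<integral>\<^sup>+y. ennreal (norm (g y)) \<partial>M) \<le> ennreal ((D + 1) * F)"
    proof -
      have "(\<integral>\<^sup>+y. ennreal (norm (g y)) \<partial>M) \<le> (\<integral>\<^sup>+y. ennreal (norm (f y)) + ennreal D * (ennreal t * indicator W y) \<partial>M)"
      proof (rule nn_integral_mono)
        fix y
        have Dt: "0 \<le> D * t * indicator W y" using D t by simp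
        have "norm (g y) \<le> norm (f y) + D * t * indicator W y"
        proof (cases "y \<in> (\<Union>i. Bs i)")
          case True
          then have "norm (g y) \<le> D * t * indicator W y" unfolding g_def using point[of y] by blast
          then show ?thesis by (simp add: add_increasing)
        next
          case False
          then have "bt y = 0" using point[of y] by blast
          then show ?thesis using Dt by (simp add: g_def)
        qed
        then have "ennreal (norm (g y)) \<le> ennreal (norm (f y)) + ennreal (D * t * indicator W y)"
          using Dt by (simp add: ennreal_plus[symmetric] ennreal_leI del: ennreal_plus)
        also have "ennreal (D * t * indicator W y) = ennreal D * (ennreal t * indicator W y)"
          using D t by (auto simp: ennreal_mult split: split_indicator)
        finally show "ennreal (norm (g y)) \<le> ennreal (norm (f y)) + ennreal D * (ennreal t * indicator W y)" .
      qed
      also have "\<dots> = ennreal F + ennreal D * (ennreal t * emeasure M W)"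
        by (subst nn_integral_add) (auto simp: FI nn_integral_cmult nn_integral_cmult_indicator)
      also have "\<dots> \<le> ennreal F + ennreal D * ennreal F"
        by (intro add_left_mono mult_left_mono W_measure) simp
      also have "\<dots> = ennreal ((D + 1) * F)"
        using D F0 by (simp add: ennreal_mult'[symmetric] ennreal_plus[symmetric] algebra_simps del: ennreal_plus)
      finally show ?thesis .
    qed
    have level_g: "emeasure M {y \<in> space M. t / 2 < norm (T g y)}
      \<le> ennreal (CT * 2 powr s * (3 * D + 1) powr (s - 1) * (D + 1) * F / t)"
    proof -
      \<comment> \<open>The supremum bound on \<open>g\<close> to the power \<open>s - 1\<close>.
        Together with the L1 bound it controls the integral of the power \<open>s\<close> of
        \<open>g\<close>, and its dependence on \<open>t\<close> cancels all but one power in the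
        weak type \<open>(s, s)\<close> estimate.\<close>
      define H where "H = ((3 * D + 1) * t) powr (s - 1)"
      have "(\<integral>\<^sup>+y. ennreal (norm (g y) powr s) \<partial>M) \<le> (\<integral>\<^sup>+y. ennreal H * ennreal (norm (g y)) \<partial>M)"
      proof (rule nn_integral_mono_AE)
        show "AE y in M. ennreal (norm (g y) powr s) \<le> ennreal H * ennreal (norm (g y))"
          using g_le
        proof eventually_elim
          fix y assume y: "norm (g y) \<le> (3 * D + 1) * t"
          have "norm (g y) powr s = norm (g y) powr (s - 1) * norm (g y)"
            by (cases "g y = 0") (auto simp: powr_mult_base[symmetric] powr_diff)
          also have "\<dots> \<le> H * norm (g y)"
            unfolding H_def using y s by (intro mult_right_mono powr_mono2) auto
          finally show "ennreal (norm (g y) powr s) \<le> ennreal H * ennreal (norm (g y))"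
            by (simp add: H_def ennreal_mult'[symmetric] ennreal_leI)
        qed
      qed
      also have "\<dots> = ennreal H * (\<integral>\<^sup>+y. ennreal (norm (g y)) \<partial>M)" by (rule nn_integral_cmult) measurable
      also have "\<dots> \<le> ennreal H * ennreal ((D + 1) * F)" by (intro mult_left_mono g_L1) auto
      finally have gs: "(\<integral>\<^sup>+y. ennreal (norm (g y) powr s) \<partial>M) \<le> ennreal H * ennreal ((D + 1) * F)" .
      have "emeasure M {y \<in> space M. t / 2 < norm (T g y)} \<le> ennreal (CT / (t / 2) powr s) * (\<integral>\<^sup>+y. ennreal (norm (g y) powr s) \<partial>M)"
        using t by (intro T_weak g_Ls) auto
      also have "\<dots> \<le> ennreal (CT / (t / 2) powr s) * (ennreal H * ennreal ((D + 1) * F))"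
        by (intro mult_left_mono gs) auto
      also have "\<dots> = ennreal (CT / (t / 2) powr s * (H * ((D + 1) * F)))"
        using CT by (subst (1 2) ennreal_mult') (auto simp: H_def)
      also have "CT / (t / 2) powr s * (H * ((D + 1) * F)) = CT * 2 powr s * (3 * D + 1) powr (s - 1) * (D + 1) * F * (t powr (s - 1) / t powr s)"
        using t D by (simp add: H_def powr_mult powr_divide)
      also have "t powr (s - 1) / t powr s = 1 / t" using t by (simp add: powr_diff)
      finally show ?thesis by simp
    qed
    have "emeasure M {x \<in> space M. t < norm (T f x)} \<le> emeasure M {x \<in> space M. t / 2 + t / 2 < norm (T g x + T bt x)}"
    proof (rule emeasure_mono_AE)
      have "AE y in M. T (\<lambda>y. g y + bt y) y = T g y + T bt y" by (rule T_add[OF g_Ls bt_Ls])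
      then have "AE y in M. T f y = T g y + T bt y" by (simp add: g_def)
      then show "AE y in M. y \<in> {x \<in> space M. t < norm (T f x)} \<longrightarrow> y \<in> {x \<in> space M. t / 2 + t / 2 < norm (T g x + T bt x)}"
        by eventually_elim auto
    qed measurable
    also have "\<dots> \<le> emeasure M {y \<in> space M. t / 2 < norm (T g y)} + emeasure M {y \<in> space M. t / 2 < norm (T bt y)}"
      by (rule emeasure_norm_add_le) measurable
    also have "\<dots> \<le> ennreal (CT * 2 powr s * (3 * D + 1) powr (s - 1) * (D + 1) * F / t) + ennreal ((dbl (2 * \<kappa> * L) + 4 * CH) * F / t)"
      by (intro add_mono level_g level_bt)
    also have "\<dots> = ennreal (CT * 2 powr s * (3 * D + 1) powr (s - 1) * (D + 1) * F / t + (dbl (2 * \<kappa> * L) + 4 * CH) * F / t)"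
      using CT D F0 t CH_pos dbl_pos[of "2 * \<kappa> * L"] by (intro ennreal_plus[symmetric]) auto
    also have "\<dots> \<le> ennreal (C11 * F / t)"
    proof (rule ennreal_leI)
      have "CT * 2 powr s * (3 * D + 1) powr (s - 1) * (D + 1) + (dbl (2 * \<kappa> * L) + 4 * CH) \<le> C11"
        using dbl_pos[of "3 * \<kappa>\<^sup>2"] by (simp add: C11_def D_def)
      then have "(CT * 2 powr s * (3 * D + 1) powr (s - 1) * (D + 1) + (dbl (2 * \<kappa> * L) + 4 * CH)) * (F / t) \<le> C11 * (F / t)"
        using F0 t by (intro mult_right_mono) auto
      then show "CT * 2 powr s * (3 * D + 1) powr (s - 1) * (D + 1) * F / t + (dbl (2 * \<kappa> * L) + 4 * CH) * F / t \<le> C11 * F / t"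
        by (simp add: distrib_right add_divide_distrib)
    qed
    finally show ?thesis by (simp only: F_def)
  qed
qed

end

section \<open>Extension to integrable functions\<close>

text \<open>Weak integrability at exponent \<open>p\<close> gives strong integrability at any
  smaller exponent on a set of measure comparable to \<open>m\<close>. Values below 1 are paid for
  by the measure of the set, and the dyadic levels above 1 contribute a geometric series of ratio
  \<open>2 powr (p1 - p)\<close>.\<close>

lemma Kolmogorov_inequality:
  assumes "0 < p1" "p1 < p"
  shows "\<exists>C>0. \<forall>(u :: 'a \<Rightarrow> real) E m. u \<in> borel_measurable M \<longrightarrow> (\<forall>x. 0 \<le> u x) \<longrightarrow> E \<in> sets M \<longrightarrow> 0 \<le> m \<longrightarrow>
    emeasure M E \<le> ennreal (Q' * m) \<longrightarrow>
    (\<forall>t>0. emeasure M {x \<in> space M. t < u x} \<le> ennreal (Q * m / t powr p)) \<longrightarrow>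
    (\<integral>\<^sup>+x\<in>E. ennreal (u x powr p1) \<partial>M) \<le> ennreal (C * m)"
proof -
  define q where "q = (2::real) powr (p1 - p)"
  have q: "0 < q" "q < 1" using assms by (auto simp: q_def intro!: powr_less_one)
  \<comment> \<open>Absolute values, because no sign is prescribed for \<open>Q\<close> and
    \<open>Q'\<close> while \<open>C\<close> has to be positive.\<close>
  define C where "C = \<bar>Q'\<bar> + \<bar>Q\<bar> * 2 powr p1 * (\<Sum>n. q ^ n) + 1"
  have sq: "summable (\<lambda>n. q ^ n)" using q by (intro summable_geometric) auto
  have "0 \<le> (\<Sum>n. q ^ n)" using q by (intro suminf_nonneg sq) auto
  then have "0 < C" by (simp add: C_def add_nonneg_pos)
  moreover have "(\<integral>\<^sup>+x\<in>E. ennreal (u x powr p1) \<partial>M) \<le> ennreal (C * m)"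
    if [measurable]: "u \<in> borel_measurable M" "E \<in> sets M" and u: "\<And>x. 0 \<le> u x" and m: "0 \<le> m"
      and E: "emeasure M E \<le> ennreal (Q' * m)"
      and lev: "\<And>t. 0 < t \<Longrightarrow> emeasure M {x \<in> space M. t < u x} \<le> ennreal (Q * m / t powr p)"
    for u :: "'a \<Rightarrow> real" and E m
  proof -
    have "(\<integral>\<^sup>+x\<in>E. ennreal (u x powr p1) \<partial>M) \<le> ennreal ((2 ^ 0) powr p1) * emeasure M E
      + (\<Sum>n. ennreal ((2 ^ Suc n) powr p1) * emeasure M {x \<in> E. 2 ^ n < u x})"
    proof (rule nn_integral_powr_le_levels)
      show "\<exists>n. x \<le> 2 ^ n" for x :: real using real_arch_pow[of 2 x] by (auto intro: less_imp_le)
    qed (use assms u in auto)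
    also have "\<dots> \<le> ennreal (\<bar>Q'\<bar> * m) + (\<Sum>n. ennreal (\<bar>Q\<bar> * m * 2 powr p1 * q ^ n))"
    proof (intro add_mono suminf_le allI)
      have "emeasure M E \<le> ennreal (\<bar>Q'\<bar> * m)"
        using E m by (elim order_trans) (intro ennreal_leI mult_right_mono, auto)
      then show "ennreal ((2 ^ 0) powr p1) * emeasure M E \<le> ennreal (\<bar>Q'\<bar> * m)" by simp
      fix n :: nat
      have pow: "(2::real) ^ n = 2 powr real n" "(2::real) ^ Suc n = 2 powr (real n + 1)"
        by (simp_all add: powr_realpow powr_add)
      have "emeasure M {x \<in> E. 2 ^ n < u x} \<le> emeasure M {x \<in> space M. 2 ^ n < u x}"
        using sets.sets_into_space[OF that(2)] by (intro emeasure_mono) auto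
      also have "\<dots> \<le> ennreal (Q * m / (2 ^ n) powr p)" by (rule lev) simp
      also have "\<dots> \<le> ennreal (\<bar>Q\<bar> * m / (2 ^ n) powr p)"
        using m by (intro ennreal_leI divide_right_mono mult_right_mono) auto
      finally have "ennreal ((2 ^ Suc n) powr p1) * emeasure M {x \<in> E. 2 ^ n < u x}
        \<le> ennreal ((2 ^ Suc n) powr p1) * ennreal (\<bar>Q\<bar> * m / (2 ^ n) powr p)" by (rule mult_left_mono) simp
      also have "\<dots> = ennreal ((2 ^ Suc n) powr p1 * (\<bar>Q\<bar> * m / (2 ^ n) powr p))"
        by (rule ennreal_mult'[symmetric]) simp
      also have "(2 ^ Suc n) powr p1 * (\<bar>Q\<bar> * m / (2 ^ n) powr p) = \<bar>Q\<bar> * m * (2 powr ((real n + 1) * p1) / 2 powr (real n * p))"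
        unfolding pow powr_powr by simp
      also have "2 powr ((real n + 1) * p1) / 2 powr (real n * p) = 2 powr (p1 + real n * (p1 - p))"
        by (simp add: powr_diff[symmetric] algebra_simps)
      also have "\<dots> = 2 powr p1 * q ^ n"
        by (simp add: powr_add q_def powr_realpow[symmetric] powr_powr mult.commute)
      finally show "ennreal ((2 ^ Suc n) powr p1) * emeasure M {x \<in> E. 2 ^ n < u x} \<le> ennreal (\<bar>Q\<bar> * m * 2 powr p1 * q ^ n)"
        by (simp only: mult.assoc)
    qed auto
    also have "(\<Sum>n. ennreal (\<bar>Q\<bar> * m * 2 powr p1 * q ^ n)) = ennreal (\<Sum>n. \<bar>Q\<bar> * m * 2 powr p1 * q ^ n)"
      using m q by (intro suminf_ennreal2 summable_mult sq) auto
    also have "(\<Sum>n. \<bar>Q\<bar> * m * 2 powr p1 * q ^ n) = \<bar>Q\<bar> * m * 2 powr p1 * (\<Sum>n. q ^ n)"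
      by (rule suminf_mult[OF sq])
    also have "ennreal (\<bar>Q'\<bar> * m) + ennreal (\<bar>Q\<bar> * m * 2 powr p1 * (\<Sum>n. q ^ n)) = ennreal (\<bar>Q'\<bar> * m + \<bar>Q\<bar> * m * 2 powr p1 * (\<Sum>n. q ^ n))"
      using m \<open>0 \<le> (\<Sum>n. q ^ n)\<close> by (intro ennreal_plus[symmetric]) auto
    also have "\<dots> \<le> ennreal (C * m)"
      using m by (intro ennreal_leI) (simp add: C_def algebra_simps)
    finally show ?thesis .
  qed
  ultimately show ?thesis by blast
qed

context cz_operator
begin

text \<open>Here \<open>undefined\<close> is just some base point of the space.\<close>

definition tr :: "nat \<Rightarrow> ('a \<Rightarrow> 'k) \<Rightarrow> 'a \<Rightarrow> 'k" where
  "tr n f x = (if norm (f x) \<le> real n \<and> d undefined x < real n then f x else 0)"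

section \<open>Truncation to bounded functions supported in a ball\<close>

lemma tr_measurable [measurable]:
  assumes [measurable]: "f \<in> borel_measurable M"
  shows "tr n f \<in> borel_measurable M"
  unfolding tr_def by measurable

lemma norm_tr_le: "norm (tr n f x) \<le> norm (f x)"
  by (simp add: tr_def)

lemma tr_eventually: "\<forall>\<^sub>F n in sequentially. tr n f x = f x"
proof -
  obtain k :: nat where k: "max (norm (f x)) (d undefined x) < real k" using reals_Archimedean2 by blast
  show ?thesis using eventually_ge_at_top[of k]
  proof eventually_elim
    fix n assume "k \<le> n"
    then have "real k \<le> real n" by simp
    then show "tr n f x = f x" using k by (auto simp: tr_def)
  qed
qed

lemma tr_bdd_on: "f \<in> borel_measurable M \<Longrightarrow> bdd_on undefined (real n) (tr n f)"
  unfolding bdd_on_def by (auto simp: tr_def intro!: exI[of _ "real n"])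

lemma tr_bdd_on': "f \<in> borel_measurable M \<Longrightarrow> (\<And>x. x \<notin> B z r \<Longrightarrow> f x = 0) \<Longrightarrow> bdd_on z r (tr n f)"
  unfolding bdd_on_def by (auto simp: tr_def intro!: exI[of _ "real n"])

lemma bdd_on_lincomb:
  assumes "bdd_on z r f" "bdd_on z r' g"
  shows "bdd_on z (max r r') (\<lambda>x. c * f x + g x)"
proof -
  obtain C C' where "\<And>x. norm (f x) \<le> C" "\<And>x. norm (g x) \<le> C'" using assms unfolding bdd_on_def by blast
  then have "norm (c * f x + g x) \<le> norm c * C + C'" for x
    by (intro norm_triangle_le add_mono) (auto simp: norm_mult intro: mult_left_mono)
  then show ?thesis using assms unfolding bdd_on_def by auto
qed

lemma tr_tendsto:
  assumes [measurable]: "f \<in> borel_measurable M" and "0 < p"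
    and fin: "(\<integral>\<^sup>+x. ennreal (norm (f x) powr p) \<partial>M) < top"
  shows "(\<lambda>n. \<integral>\<^sup>+x. ennreal (norm (tr n f x - f x) powr p) \<partial>M) \<longlonglongrightarrow> 0"
proof -
  have "(\<lambda>n. \<integral>\<^sup>+x. ennreal (norm (tr n f x - f x) powr p) \<partial>M) \<longlonglongrightarrow> (\<integral>\<^sup>+x. 0 \<partial>M)"
  proof (rule nn_integral_dominated_convergence[where w = "\<lambda>x. ennreal (norm (f x) powr p)"])
    show "(\<integral>\<^sup>+x. ennreal (norm (f x) powr p) \<partial>M) < \<infinity>" using fin by simp
    show "AE x in M. ennreal (norm (tr n f x - f x) powr p) \<le> ennreal (norm (f x) powr p)" for n
      using \<open>0 < p\<close> by (intro AE_I2 ennreal_leI powr_mono2) (auto simp: tr_def)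
    show "AE x in M. (\<lambda>n. ennreal (norm (tr n f x - f x) powr p)) \<longlonglongrightarrow> 0"
    proof (rule AE_I2)
      fix x
      have "\<forall>\<^sub>F n in sequentially. ennreal (norm (tr n f x - f x) powr p) = 0"
        using tr_eventually[of f x] by eventually_elim (use \<open>0 < p\<close> in simp)
      then show "(\<lambda>n. ennreal (norm (tr n f x - f x) powr p)) \<longlonglongrightarrow> 0" by (rule tendsto_eventually)
    qed
  qed auto
  then show ?thesis by simp
qed

lemma tr_integrable: "f \<in> borel_measurable M \<Longrightarrow> integrable M (tr n f)"
  by (rule bdd_on_integrable[OF tr_bdd_on])

lemma tr_L1_tendsto:
  assumes f: "integrable M f"
  shows "(\<lambda>n. \<integral>x. norm (tr n f x - f x) \<partial>M) \<longlonglongrightarrow> 0"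
proof -
  have [measurable]: "f \<in> borel_measurable M" using f by auto
  have "(\<lambda>n. \<integral>\<^sup>+x. ennreal (norm (tr n f x - f x) powr 1) \<partial>M) \<longlonglongrightarrow> 0"
    using f by (intro tr_tendsto) (auto simp: integrable_iff_bounded)
  moreover have "(\<integral>\<^sup>+x. ennreal (norm (tr n f x - f x) powr 1) \<partial>M) = ennreal (\<integral>x. norm (tr n f x - f x) \<partial>M)" for n
    using f tr_integrable[of f n] by (subst nn_integral_eq_integral[symmetric]) auto
  ultimately show ?thesis by (simp add: tendsto_ennreal_iff[of _ _ 0, simplified])
qed

text \<open>The extension of \<open>T\<close> to L1. For integrable \<open>f\<close> the limit
  exists by \<open>S_exists\<close> and is unique up to null sets; otherwise the value is
  unspecified.\<close>

definition S :: "('a \<Rightarrow> 'k) \<Rightarrow> 'a \<Rightarrow> 'k" where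
  "S f = (SOME h. h \<in> borel_measurable M \<and> conv_measure M (\<lambda>n. T (tr n f)) h)"

lemma T_tr_measurable: "f \<in> borel_measurable M \<Longrightarrow> T (tr n f) \<in> borel_measurable M"
  by (intro T_meas bdd_on_Ls[OF tr_bdd_on])

lemma bdd_on_diff:
  assumes "bdd_on z r f" "bdd_on z r' g"
  shows "bdd_on z (max r r') (\<lambda>x. f x - g x)"
  using bdd_on_lincomb[OF assms(2,1), of "-1"] by (simp add: max.commute)

text \<open>Differences of truncations are small in L1, so by the weak type (1,1) bound their images
  are Cauchy in measure.\<close>

lemma S_exists:
  assumes f: "integrable M f"
  shows "\<exists>h. h \<in> borel_measurable M \<and> conv_measure M (\<lambda>n. T (tr n f)) h"
proof -
  have [measurable]: "f \<in> borel_measurable M" using f by auto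
  note [measurable] = T_tr_measurable
  define a where "a n = (\<integral>x. norm (tr n f x - f x) \<partial>M)" for n
  have a: "a \<longlonglongrightarrow> 0" unfolding a_def by (rule tr_L1_tendsto[OF f])
  show ?thesis
  proof (rule conv_measure_complete[of "\<lambda>n. T (tr n f)" M])
    fix e \<eta> :: real assume "0 < e" "0 < \<eta>"
    have "\<forall>\<^sub>F n in sequentially. a n < \<eta> * e / (2 * C11)"
      using \<open>0 < e\<close> \<open>0 < \<eta>\<close> C11_pos by (intro order_tendstoD(2)[OF a]) auto
    then obtain N where N: "\<And>n. N \<le> n \<Longrightarrow> a n < \<eta> * e / (2 * C11)" by (auto simp: eventually_sequentially)
    show "\<exists>N. \<forall>m\<ge>N. \<forall>n\<ge>N. emeasure M {x \<in> space M. e < norm (T (tr m f) x - T (tr n f) x)} \<le> ennreal \<eta>"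
    proof (intro exI allI impI)
      fix m n assume mn: "N \<le> m" "N \<le> n"
      let ?g = "\<lambda>x. tr m f x - tr n f x"
      have g: "bdd_on undefined (max (real m) (real n)) ?g" by (intro bdd_on_diff tr_bdd_on) auto
      have "emeasure M {x \<in> space M. e < norm (T (tr m f) x - T (tr n f) x)} \<le> emeasure M {x \<in> space M. e < norm (T ?g x)}"
      proof (rule emeasure_mono_AE)
        have "AE x in M. T ?g x = T (tr m f) x - T (tr n f) x"
          by (intro T_diff bdd_on_Ls[OF tr_bdd_on]) auto
        then show "AE x in M. x \<in> {x \<in> space M. e < norm (T (tr m f) x - T (tr n f) x)} \<longrightarrow> x \<in> {x \<in> space M. e < norm (T ?g x)}"
          by eventually_elim auto
        show "{x \<in> space M. e < norm (T ?g x)} \<in> sets M" using T_meas[OF bdd_on_Ls[OF g]] by measurable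
      qed
      also have "\<dots> \<le> ennreal (C11 * (\<integral>x. norm (?g x) \<partial>M) / e)" by (rule T_weak_11_bdd[OF g \<open>0 < e\<close>])
      also have "\<dots> \<le> ennreal (C11 * (a m + a n) / e)"
      proof (intro ennreal_leI divide_right_mono mult_left_mono)
        have "(\<integral>x. norm (?g x) \<partial>M) \<le> (\<integral>x. norm (tr m f x - f x) + norm (tr n f x - f x) \<partial>M)"
        proof (rule integral_mono)
          show "integrable M (\<lambda>x. norm (?g x))" using bdd_on_integrable[OF g] by simp
          have "integrable M (tr n f)" for n by (rule tr_integrable) measurable
          then show "integrable M (\<lambda>x. norm (tr m f x - f x) + norm (tr n f x - f x))" using f by simp
          show "norm (?g x) \<le> norm (tr m f x - f x) + norm (tr n f x - f x)" for x
            using norm_triangle_ineq4[of "tr m f x - f x" "tr n f x - f x"] by simp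
        qed
        also have "\<dots> = a m + a n" unfolding a_def using f tr_integrable[of f]
          by (intro Bochner_Integration.integral_add integrable_norm Bochner_Integration.integrable_diff) auto
        finally show "(\<integral>x. norm (?g x) \<partial>M) \<le> a m + a n" .
      qed (use C11_pos \<open>0 < e\<close> in auto)
      also have "\<dots> \<le> ennreal \<eta>"
      proof (rule ennreal_leI)
        have "a m + a n \<le> \<eta> * e / C11" using N[OF mn(1)] N[OF mn(2)] C11_pos by (simp add: field_simps)
        then show "C11 * (a m + a n) / e \<le> \<eta>" using C11_pos \<open>0 < e\<close> by (simp add: field_simps)
      qed
      finally show "emeasure M {x \<in> space M. e < norm (T (tr m f) x - T (tr n f) x)} \<le> ennreal \<eta>" .
    qed
  qed (auto intro: T_tr_measurable)
qed

lemma S_measurable: "integrable M f \<Longrightarrow> S f \<in> borel_measurable M"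
  and S_conv: "integrable M f \<Longrightarrow> conv_measure M (\<lambda>n. T (tr n f)) (S f)"
  using someI_ex[OF S_exists[of f]] unfolding S_def by auto

lemma T_small:
  assumes g: "\<And>n. bdd_on z (r n) (g n)" and lim: "(\<lambda>n. \<integral>x. norm (g n x) \<partial>M) \<longlonglongrightarrow> 0"
  shows "conv_measure M (\<lambda>n. T (g n)) (\<lambda>_. 0)"
proof (rule conv_measure_bound)
  fix e :: real and n assume "0 < e"
  then show "emeasure M {x \<in> space M. e < norm (T (g n) x - 0)} \<le> ennreal (C11 * (\<integral>x. norm (g n x) \<partial>M) / e)"
    using T_weak_11_bdd[OF g[of n]] by simp
next
  fix e :: real assume "0 < e"
  have "(\<lambda>n. C11 * (\<integral>x. norm (g n x) \<partial>M) / e) \<longlonglongrightarrow> C11 * 0 / e" by (intro tendsto_intros lim) (use \<open>0 < e\<close> in auto)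
  then show "(\<lambda>n. ennreal (C11 * (\<integral>x. norm (g n x) \<partial>M) / e)) \<longlonglongrightarrow> 0"
    using tendsto_ennrealI by fastforce
qed

text \<open>Truncation is not linear, but its defect \<open>e n\<close> tends to 0 in L1, and the
  weak type (1,1) bound makes its image vanish in the limit.\<close>

lemma S_lin:
  assumes f: "integrable M f" and g: "integrable M g"
  shows "AE x in M. S (\<lambda>y. c * f y + g y) x = c * S f x + S g x"
proof -
  have [measurable]: "f \<in> borel_measurable M" "g \<in> borel_measurable M" using f g by auto
  define h where "h y = c * f y + g y" for y
  have h: "integrable M h" unfolding h_def using f g by simp
  have [measurable]: "h \<in> borel_measurable M" using h by auto
  note meas = T_tr_measurable[of f] T_tr_measurable[of g] T_tr_measurable[of h] S_measurable[OF f] S_measurable[OF g] S_measurable[OF h]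
  define e where "e n y = tr n h y - (c * tr n f y + tr n g y)" for n y
  have lc: "bdd_on undefined (real n) (\<lambda>y. c * tr n f y + tr n g y)" for n
    using bdd_on_lincomb[OF tr_bdd_on[of f n] tr_bdd_on[of g n], of c] by simp
  have e: "bdd_on undefined (real n) (e n)" for n
    unfolding e_def using bdd_on_diff[OF tr_bdd_on[of h n] lc[of n]] by simp
  have "(\<lambda>n. \<integral>x. norm (e n x) \<partial>M) \<longlonglongrightarrow> 0"
  proof (rule tendsto_sandwich[of "\<lambda>_. 0"])
    have "(\<integral>x. norm (e n x) \<partial>M) \<le> (\<integral>x. norm (tr n h x - h x) \<partial>M) + norm c * (\<integral>x. norm (tr n f x - f x) \<partial>M) + (\<integral>x. norm (tr n g x - g x) \<partial>M)" for n
    proof -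
      have I: "integrable M (\<lambda>x. norm (tr n h x - h x))" "integrable M (\<lambda>x. norm (tr n f x - f x))" "integrable M (\<lambda>x. norm (tr n g x - g x))"
        using f g h tr_integrable by auto
      have "(\<integral>x. norm (e n x) \<partial>M) \<le> (\<integral>x. norm (tr n h x - h x) + norm c * norm (tr n f x - f x) + norm (tr n g x - g x) \<partial>M)"
      proof (rule integral_mono)
        show "integrable M (\<lambda>x. norm (e n x))" using bdd_on_integrable[OF e] by simp
        show "integrable M (\<lambda>x. norm (tr n h x - h x) + norm c * norm (tr n f x - f x) + norm (tr n g x - g x))" using I by simp
        fix x
        have "e n x = (tr n h x - h x) - c * (tr n f x - f x) - (tr n g x - g x)" by (simp add: e_def h_def algebra_simps)
        then have "norm (e n x) \<le> norm ((tr n h x - h x) - c * (tr n f x - f x)) + norm (tr n g x - g x)"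
          by (simp only: norm_triangle_ineq4)
        also have "norm ((tr n h x - h x) - c * (tr n f x - f x)) \<le> norm (tr n h x - h x) + norm (c * (tr n f x - f x))"
          by (rule norm_triangle_ineq4)
        finally show "norm (e n x) \<le> norm (tr n h x - h x) + norm c * norm (tr n f x - f x) + norm (tr n g x - g x)"
          by (simp add: norm_mult)
      qed
      then show ?thesis using I by simp
    qed
    then show "\<forall>\<^sub>F n in sequentially. (\<integral>x. norm (e n x) \<partial>M) \<le> (\<integral>x. norm (tr n h x - h x) \<partial>M) + norm c * (\<integral>x. norm (tr n f x - f x) \<partial>M) + (\<integral>x. norm (tr n g x - g x) \<partial>M)"
      by (rule always_eventually[OF allI])
    have "(\<lambda>n. (\<integral>x. norm (tr n h x - h x) \<partial>M) + norm c * (\<integral>x. norm (tr n f x - f x) \<partial>M) + (\<integral>x. norm (tr n g x - g x) \<partial>M)) \<longlonglongrightarrow> 0 + norm c * 0 + 0"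
      by (intro tendsto_intros tr_L1_tendsto f g h)
    then show "(\<lambda>n. (\<integral>x. norm (tr n h x - h x) \<partial>M) + norm c * (\<integral>x. norm (tr n f x - f x) \<partial>M) + (\<integral>x. norm (tr n g x - g x) \<partial>M)) \<longlonglongrightarrow> 0" by simp
  qed auto
  then have Te: "conv_measure M (\<lambda>n. T (e n)) (\<lambda>_. 0)" by (rule T_small[OF e])
  have Te_meas: "T (e n) \<in> borel_measurable M" for n by (intro T_meas bdd_on_Ls[OF e])
  have "conv_measure M (\<lambda>n x. T (e n) x + (c * T (tr n f) x + T (tr n g) x)) (\<lambda>x. 0 + (c * S f x + S g x))"
    using meas by (intro conv_measure_add conv_measure_cmult Te S_conv f g Te_meas borel_measurable_add borel_measurable_times) auto
  then have "conv_measure M (\<lambda>n. T (tr n h)) (\<lambda>x. c * S f x + S g x)"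
  proof (rule conv_measure_cong_AE)
    fix n
    have "AE x in M. T (\<lambda>y. c * tr n f y + tr n g y) x = c * T (tr n f) x + T (tr n g) x"
      by (intro T_lin bdd_on_Ls[OF tr_bdd_on]) auto
    moreover have "AE x in M. T (\<lambda>y. e n y + (c * tr n f y + tr n g y)) x = T (e n) x + T (\<lambda>y. c * tr n f y + tr n g y) x"
      by (intro T_add bdd_on_Ls[OF e] bdd_on_Ls[OF lc])
    ultimately show "AE x in M. T (e n) x + (c * T (tr n f) x + T (tr n g) x) = T (tr n h) x"
      by eventually_elim (simp add: e_def)
  qed (use meas Te_meas in auto)
  then have "AE x in M. c * S f x + S g x = S h x"
    by (rule conv_measure_unique[OF _ S_conv[OF h]]) (use meas in auto)
  then show ?thesis unfolding h_def by eventually_elim simp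
qed

lemma S_zero: "AE x in M. S (\<lambda>_. 0) x = 0"
  using S_lin[of "\<lambda>_. 0" "\<lambda>_. 0" 1] by simp

lemma S_add: "integrable M f \<Longrightarrow> integrable M g \<Longrightarrow> AE x in M. S (\<lambda>y. f y + g y) x = S f x + S g x"
  using S_lin[of f g 1] by simp

lemma S_diff: "integrable M f \<Longrightarrow> integrable M g \<Longrightarrow> AE x in M. S (\<lambda>y. f y - g y) x = S f x - S g x"
  using S_lin[of g f "-1"] by simp

lemma S_cmult: "integrable M f \<Longrightarrow> AE x in M. S (\<lambda>y. c * f y) x = c * S f x"
proof -
  assume f: "integrable M f"
  have "AE x in M. S (\<lambda>y. c * f y + 0) x = c * S f x + S (\<lambda>_. 0) x" by (rule S_lin) (use f in auto)
  then show ?thesis using S_zero by eventually_elim simp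
qed

lemma S_sum:
  assumes "finite I" "\<And>i. i \<in> I \<Longrightarrow> integrable M (f i)"
  shows "AE x in M. S (\<lambda>y. \<Sum>i\<in>I. c i * f i y) x = (\<Sum>i\<in>I. c i * S (f i) x)"
  using assms
proof (induction I)
  case empty
  then show ?case using S_zero by simp
next
  case (insert i I)
  have "AE x in M. S (\<lambda>y. c i * f i y + (\<Sum>i\<in>I. c i * f i y)) x = c i * S (f i) x + S (\<lambda>y. \<Sum>i\<in>I. c i * f i y) x"
    using insert.prems by (intro S_lin Bochner_Integration.integrable_sum integrable_mult_right) auto
  moreover have "AE x in M. S (\<lambda>y. \<Sum>i\<in>I. c i * f i y) x = (\<Sum>i\<in>I. c i * S (f i) x)"
    using insert.prems by (intro insert.IH) auto
  ultimately show ?case by eventually_elim (use insert.hyps in simp)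
qed

text \<open>The truncations of \<open>f\<close> converge in L1 and with exponent \<open>s\<close>
  simultaneously, so the two limits in measure coincide.\<close>

lemma S_eq_T:
  assumes f: "integrable M f" and fs: "f \<in> Ls"
  shows "AE x in M. S f x = T f x"
proof (rule conv_measure_unique[OF S_conv[OF f]])
  have fm: "f \<in> borel_measurable M" using f by auto
  show "conv_measure M (\<lambda>n. T (tr n f)) (T f)"
    using fs by (intro T_conv_measure fs bdd_on_Ls[OF tr_bdd_on] tr_tendsto s_pos fm) (auto simp: Ls_iff)
  show "T (tr n f) \<in> borel_measurable M" for n by (rule T_tr_measurable[OF fm])
qed (use T_meas[OF fs] S_measurable[OF f] in auto)

text \<open>The factor 2 pays for halving the level when the bound passes from truncations to their
  limit in measure.\<close>

definition CS :: real where "CS = 2 * C11"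

lemma CS_pos: "0 < CS" using C11_pos by (simp add: CS_def)

theorem S_weak_11:
  assumes f: "integrable M f" and t: "0 < t"
  shows "emeasure M {x \<in> space M. t < norm (S f x)} \<le> ennreal (CS * (\<integral>x. norm (f x) \<partial>M) / t)"
proof -
  have fm[measurable]: "f \<in> borel_measurable M" using f by auto
  note [measurable] = T_tr_measurable[OF fm] S_measurable[OF f]
  have le: "emeasure M {x \<in> space M. t < norm (S f x)}
    \<le> ennreal (CS * (\<integral>x. norm (f x) \<partial>M) / t) + emeasure M {x \<in> space M. t / 2 < norm (T (tr n f) x - S f x)}" for n
  proof -
    have "emeasure M {x \<in> space M. t < norm (S f x)} = emeasure M {x \<in> space M. t / 2 + t / 2 < norm (T (tr n f) x + (S f x - T (tr n f) x))}"
      by simp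
    also have "\<dots> \<le> emeasure M {x \<in> space M. t / 2 < norm (T (tr n f) x)} + emeasure M {x \<in> space M. t / 2 < norm (S f x - T (tr n f) x)}"
      by (rule emeasure_norm_add_le) measurable
    also have "emeasure M {x \<in> space M. t / 2 < norm (T (tr n f) x)} \<le> ennreal (C11 * (\<integral>x. norm (tr n f x) \<partial>M) / (t / 2))"
      using t by (intro T_weak_11_bdd[OF tr_bdd_on]) auto
    also have "\<dots> \<le> ennreal (C11 * (\<integral>x. norm (f x) \<partial>M) / (t / 2))"
      using t C11_pos f tr_integrable[OF fm] norm_tr_le
      by (intro ennreal_leI divide_right_mono mult_left_mono integral_mono) auto
    also have "C11 * (\<integral>x. norm (f x) \<partial>M) / (t / 2) = CS * (\<integral>x. norm (f x) \<partial>M) / t" by (simp add: CS_def)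
    finally show ?thesis by (simp add: add_right_mono norm_minus_commute)
  qed
  have "(\<lambda>n. ennreal (CS * (\<integral>x. norm (f x) \<partial>M) / t) + emeasure M {x \<in> space M. t / 2 < norm (T (tr n f) x - S f x)}) \<longlonglongrightarrow> ennreal (CS * (\<integral>x. norm (f x) \<partial>M) / t) + 0"
    using t by (intro tendsto_add tendsto_const conv_measureD[OF S_conv[OF f]]) auto
  then have "emeasure M {x \<in> space M. t < norm (S f x)} \<le> ennreal (CS * (\<integral>x. norm (f x) \<partial>M) / t) + 0"
    by (rule LIMSEQ_le_const) (intro exI allI impI le)
  then show ?thesis by simp
qed

lemma S_conv_measure:
  assumes f: "\<And>n. integrable M (f n)" "integrable M g"
    and lim: "(\<lambda>n. \<integral>x. norm (f n x - g x) \<partial>M) \<longlonglongrightarrow> 0"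
  shows "conv_measure M (\<lambda>n. S (f n)) (S g)"
proof (rule conv_measure_bound)
  have d: "integrable M (\<lambda>x. f n x - g x)" for n using f by auto
  note [measurable] = S_measurable[OF f(1)] S_measurable[OF f(2)] S_measurable[OF d]
  fix e :: real and n assume "0 < e"
  have "emeasure M {x \<in> space M. e < norm (S (f n) x - S g x)} \<le> emeasure M {x \<in> space M. e < norm (S (\<lambda>y. f n y - g y) x)}"
  proof (rule emeasure_mono_AE)
    show "AE x in M. x \<in> {x \<in> space M. e < norm (S (f n) x - S g x)} \<longrightarrow> x \<in> {x \<in> space M. e < norm (S (\<lambda>y. f n y - g y) x)}"
      using S_diff[OF f(1) f(2), of n] by eventually_elim auto
  qed measurable
  also have "\<dots> \<le> ennreal (CS * (\<integral>x. norm (f n x - g x) \<partial>M) / e)" by (rule S_weak_11[OF d \<open>0 < e\<close>])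
  finally show "emeasure M {x \<in> space M. e < norm (S (f n) x - S g x)} \<le> ennreal (CS * (\<integral>x. norm (f n x - g x) \<partial>M) / e)" .
next
  fix e :: real assume "0 < e"
  have "(\<lambda>n. CS * (\<integral>x. norm (f n x - g x) \<partial>M) / e) \<longlonglongrightarrow> CS * 0 / e" by (intro tendsto_intros lim) (use \<open>0 < e\<close> in auto)
  then show "(\<lambda>n. ennreal (CS * (\<integral>x. norm (f n x - g x) \<partial>M) / e)) \<longlonglongrightarrow> 0"
    using tendsto_ennrealI by fastforce
qed

definition Cpp :: real where "Cpp = 2 * CS + 2 powr s * CT"

text \<open>Marcinkiewicz splitting of \<open>f\<close> at its own height \<open>t\<close>: the
  large part has L1 norm at most \<open>t powr (1 - p) * P\<close> and falls under weak type (1,1),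
  the small part has finite norm with exponent \<open>s\<close> and falls under the original bound
  for \<open>T\<close>. One constant serves all exponents from 1 to \<open>s\<close>.\<close>

lemma S_weak_pp:
  assumes f: "integrable M f" and p: "1 \<le> p" "p \<le> s" and t: "0 < t" and P: "0 \<le> P"
    and fp: "(\<integral>\<^sup>+x. ennreal (norm (f x) powr p) \<partial>M) \<le> ennreal P"
  shows "emeasure M {x \<in> space M. t < norm (S f x)} \<le> ennreal (Cpp * P / t powr p)"
proof -
  have fm[measurable]: "f \<in> borel_measurable M" using f by auto
  define f1 where "f1 x = (if t < norm (f x) then f x else 0)" for x
  define f2 where "f2 x = (if t < norm (f x) then 0 else f x)" for x
  have [measurable]: "f1 \<in> borel_measurable M" "f2 \<in> borel_measurable M" unfolding f1_def f2_def by measurable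
  have i1: "integrable M f1" by (rule Bochner_Integration.integrable_bound[OF f]) (auto simp: f1_def)
  have i2: "integrable M f2" by (rule Bochner_Integration.integrable_bound[OF f]) (auto simp: f2_def)
  have "ennreal (\<integral>x. norm (f1 x) \<partial>M) = (\<integral>\<^sup>+x. ennreal (norm (f1 x)) \<partial>M)"
    using i1 by (intro nn_integral_eq_integral[symmetric] integrable_norm) auto
  also have "\<dots> \<le> (\<integral>\<^sup>+x. ennreal (t powr (1 - p)) * ennreal (norm (f x) powr p) \<partial>M)"
  proof (rule nn_integral_mono)
    fix x
    have "norm (f1 x) \<le> t powr (1 - p) * norm (f x) powr p"
    proof (cases "t < norm (f x)")
      case True
      then have "norm (f x) powr (1 - p) \<le> t powr (1 - p)" using t p by (intro powr_mono2') auto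
      then have "norm (f x) powr (1 - p) * norm (f x) powr p \<le> t powr (1 - p) * norm (f x) powr p" by (rule mult_right_mono) simp
      then show ?thesis using True t by (simp add: f1_def powr_add[symmetric])
    qed (simp add: f1_def)
    then show "ennreal (norm (f1 x)) \<le> ennreal (t powr (1 - p)) * ennreal (norm (f x) powr p)"
      by (simp add: ennreal_mult'[symmetric] ennreal_leI)
  qed
  also have "\<dots> = ennreal (t powr (1 - p)) * (\<integral>\<^sup>+x. ennreal (norm (f x) powr p) \<partial>M)" by (rule nn_integral_cmult) measurable
  also have "\<dots> \<le> ennreal (t powr (1 - p)) * ennreal P" by (rule mult_left_mono[OF fp]) simp
  also have "\<dots> = ennreal (t powr (1 - p) * P)" by (simp add: ennreal_mult')
  finally have L1: "(\<integral>x. norm (f1 x) \<partial>M) \<le> t powr (1 - p) * P" using P by simp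
  have "(\<integral>\<^sup>+x. ennreal (norm (f2 x) powr s) \<partial>M) \<le> (\<integral>\<^sup>+x. ennreal (t powr (s - p)) * ennreal (norm (f x) powr p) \<partial>M)"
  proof (rule nn_integral_mono)
    fix x
    have "norm (f2 x) powr s \<le> t powr (s - p) * norm (f x) powr p"
    proof (cases "t < norm (f x)")
      case False
      then have "norm (f x) powr (s - p) \<le> t powr (s - p)" using t p by (intro powr_mono2) auto
      then have "norm (f x) powr (s - p) * norm (f x) powr p \<le> t powr (s - p) * norm (f x) powr p" by (rule mult_right_mono) simp
      then show ?thesis using False t by (simp add: f2_def powr_add[symmetric])
    qed (use s in \<open>simp add: f2_def\<close>)
    then show "ennreal (norm (f2 x) powr s) \<le> ennreal (t powr (s - p)) * ennreal (norm (f x) powr p)"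
      by (simp add: ennreal_mult'[symmetric] ennreal_leI)
  qed
  also have "\<dots> = ennreal (t powr (s - p)) * (\<integral>\<^sup>+x. ennreal (norm (f x) powr p) \<partial>M)" by (rule nn_integral_cmult) measurable
  also have "\<dots> \<le> ennreal (t powr (s - p)) * ennreal P" by (rule mult_left_mono[OF fp]) simp
  also have "\<dots> = ennreal (t powr (s - p) * P)" by (simp add: ennreal_mult')
  finally have L2: "(\<integral>\<^sup>+x. ennreal (norm (f2 x) powr s) \<partial>M) \<le> ennreal (t powr (s - p) * P)" .
  then have f2s: "f2 \<in> Ls" by (auto simp: Ls_iff intro: le_less_trans)
  note [measurable] = S_measurable[OF f] S_measurable[OF i1] S_measurable[OF i2] T_meas[OF f2s]
  have "emeasure M {x \<in> space M. t < norm (S f x)} \<le> emeasure M {x \<in> space M. t / 2 + t / 2 < norm (S f1 x + T f2 x)}"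
  proof (rule emeasure_mono_AE)
    have "AE x in M. S (\<lambda>y. f1 y + f2 y) x = S f1 x + S f2 x" by (rule S_add[OF i1 i2])
    moreover have "(\<lambda>y. f1 y + f2 y) = f" by (auto simp: f1_def f2_def)
    ultimately have "AE x in M. S f x = S f1 x + S f2 x" by simp
    then show "AE x in M. x \<in> {x \<in> space M. t < norm (S f x)} \<longrightarrow> x \<in> {x \<in> space M. t / 2 + t / 2 < norm (S f1 x + T f2 x)}"
      using S_eq_T[OF i2 f2s] by eventually_elim auto
  qed measurable
  also have "\<dots> \<le> emeasure M {x \<in> space M. t / 2 < norm (S f1 x)} + emeasure M {x \<in> space M. t / 2 < norm (T f2 x)}"
    by (rule emeasure_norm_add_le) measurable
  also have "\<dots> \<le> ennreal (2 * CS * P / t powr p) + ennreal (2 powr s * CT * P / t powr p)"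
  proof (rule add_mono)
    have "emeasure M {x \<in> space M. t / 2 < norm (S f1 x)} \<le> ennreal (CS * (\<integral>x. norm (f1 x) \<partial>M) / (t / 2))"
      using t by (intro S_weak_11 i1) auto
    also have "\<dots> \<le> ennreal (CS * (t powr (1 - p) * P) / (t / 2))"
      using t CS_pos L1 by (intro ennreal_leI divide_right_mono mult_left_mono) auto
    also have "CS * (t powr (1 - p) * P) / (t / 2) = 2 * CS * P * (t powr (1 - p) / t)" by simp
    also have "t powr (1 - p) / t = 1 / t powr p" using t by (simp add: powr_diff)
    finally show "emeasure M {x \<in> space M. t / 2 < norm (S f1 x)} \<le> ennreal (2 * CS * P / t powr p)" by simp
    have "emeasure M {x \<in> space M. t / 2 < norm (T f2 x)} \<le> ennreal (CT / (t / 2) powr s) * (\<integral>\<^sup>+x. ennreal (norm (f2 x) powr s) \<partial>M)"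
      using t by (intro T_weak f2s) auto
    also have "\<dots> \<le> ennreal (CT / (t / 2) powr s) * ennreal (t powr (s - p) * P)" by (rule mult_left_mono[OF L2]) simp
    also have "\<dots> = ennreal (CT / (t / 2) powr s * (t powr (s - p) * P))"
      by (rule ennreal_mult'[symmetric]) (use CT in auto)
    also have "CT / (t / 2) powr s * (t powr (s - p) * P) = 2 powr s * CT * P * (t powr (s - p) / t powr s)"
      using t by (simp add: powr_divide)
    also have "t powr (s - p) / t powr s = 1 / t powr p" using t by (simp add: powr_diff)
    finally show "emeasure M {x \<in> space M. t / 2 < norm (T f2 x)} \<le> ennreal (2 powr s * CT * P / t powr p)" by simp
  qed
  also have "\<dots> = ennreal (2 * CS * P / t powr p + 2 powr s * CT * P / t powr p)"
    using CS_pos CT P by (intro ennreal_plus[symmetric]) auto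
  also have "2 * CS * P / t powr p + 2 powr s * CT * P / t powr p = Cpp * P / t powr p"
    by (simp add: Cpp_def add_divide_distrib distrib_right)
  finally show ?thesis .
qed

text \<open>Truncation keeps the function supported in the ball, and dominated convergence carries
  its norm and mean to those of \<open>f\<close>. So the annulus bounds for the truncations
  converge, and Fatou's lemma applies.\<close>

lemma S_annulus:
  assumes f: "integrable M f" "\<And>x. x \<notin> B z r \<Longrightarrow> f x = 0" and r: "0 < r" "2 * \<kappa> * r \<le> R" and N: "0 < N"
    and w[measurable]: "w \<in> borel_measurable M" and w0: "\<And>x. 0 \<le> w x" and "0 < W"
    and wW: "(\<integral>\<^sup>+x\<in>ann z R. ennreal (w x powr (s / (s - 1))) \<partial>M) \<le> ennreal (W powr (s / (s - 1)) * V z R)"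
  shows "(\<integral>\<^sup>+x\<in>ann z R. ennreal (w x * norm (S f x)) \<partial>M)
    \<le> ennreal (2 * W * (C1 * (r / R) powr \<delta> * (\<integral>x. norm (f x) \<partial>M)
        + CN N * (1 + R / \<rho> z) powr (- N) * norm (\<integral>x. f x \<partial>M)))"
proof -
  have fm[measurable]: "f \<in> borel_measurable M" using f by auto
  show ?thesis
  proof (rule conv_measure_Fatou[OF S_conv[OF f(1)] _ _ w sets_ann w0])
    show "T (tr n f) \<in> borel_measurable M" for n by (rule T_tr_measurable[OF fm])
    show "S f \<in> borel_measurable M" by (rule S_measurable[OF f(1)])
    show "(\<integral>\<^sup>+x\<in>ann z R. ennreal (w x * norm (T (tr n f) x)) \<partial>M)
      \<le> ennreal (2 * W * (C1 * (r / R) powr \<delta> * (\<integral>x. norm (tr n f x) \<partial>M)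
        + CN N * (1 + R / \<rho> z) powr (- N) * norm (\<integral>x. tr n f x \<partial>M)))" for n
      by (rule annulus_bdd_on[OF tr_bdd_on'[OF fm f(2)] r N w w0 \<open>0 < W\<close> wW])
    have L: "(\<lambda>n. \<integral>x. tr n f x \<partial>M) \<longlonglongrightarrow> (\<integral>x. f x \<partial>M)"
    proof (rule integral_dominated_convergence[where w = "\<lambda>x. norm (f x)"])
      show "AE x in M. (\<lambda>n. tr n f x) \<longlonglongrightarrow> f x"
        by (intro AE_I2 tendsto_eventually tr_eventually)
    qed (use f norm_tr_le in auto)
    have L': "(\<lambda>n. \<integral>x. norm (tr n f x) \<partial>M) \<longlonglongrightarrow> (\<integral>x. norm (f x) \<partial>M)"
    proof (rule integral_dominated_convergence[where w = "\<lambda>x. norm (f x)"])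
      show "AE x in M. (\<lambda>n. norm (tr n f x)) \<longlonglongrightarrow> norm (f x)"
        by (intro AE_I2 tendsto_norm tendsto_eventually tr_eventually)
    qed (use f norm_tr_le in auto)
    show "(\<lambda>n. ennreal (2 * W * (C1 * (r / R) powr \<delta> * (\<integral>x. norm (tr n f x) \<partial>M)
        + CN N * (1 + R / \<rho> z) powr (- N) * norm (\<integral>x. tr n f x \<partial>M))))
      \<longlonglongrightarrow> ennreal (2 * W * (C1 * (r / R) powr \<delta> * (\<integral>x. norm (f x) \<partial>M)
        + CN N * (1 + R / \<rho> z) powr (- N) * norm (\<integral>x. f x \<partial>M)))"
      by (intro tendsto_ennrealI tendsto_intros L L')
  qed
qed

lemma S_far:
  assumes f: "integrable M f" "\<And>x. x \<notin> B z r \<Longrightarrow> f x = 0" and r: "0 < r" and N: "0 < N"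
    and w[measurable]: "w \<in> borel_measurable M" and w0: "\<And>x. 0 \<le> w x" and W: "\<And>k. 0 < W k"
    and wW: "\<And>k. (\<integral>\<^sup>+x\<in>ann z ((2 * \<kappa>) ^ Suc k * r). ennreal (w x powr (s / (s - 1))) \<partial>M)
      \<le> ennreal (W k powr (s / (s - 1)) * V z ((2 * \<kappa>) ^ Suc k * r))"
  shows "(\<integral>\<^sup>+x\<in>{x. 2 * \<kappa> * r \<le> d x z}. ennreal (w x * norm (S f x)) \<partial>M)
    \<le> (\<Sum>k. ennreal (2 * W k * (C1 * ((2 * \<kappa>) powr (- \<delta>)) ^ Suc k * (\<integral>x. norm (f x) \<partial>M)
        + CN N * (1 + (2 * \<kappa>) ^ Suc k * r / \<rho> z) powr (- N) * norm (\<integral>x. f x \<partial>M))))"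
proof -
  note [measurable] = S_measurable[OF f(1)]
  have "(\<integral>\<^sup>+x\<in>{x. 2 * \<kappa> * r \<le> d x z}. ennreal (w x * norm (S f x)) \<partial>M)
    \<le> (\<Sum>k. \<integral>\<^sup>+x\<in>ann z ((2 * \<kappa>) ^ Suc k * r). ennreal (w x * norm (S f x)) \<partial>M)"
    using r by (intro nn_integral_far_le) auto
  also have "\<dots> \<le> (\<Sum>k. ennreal (2 * W k * (C1 * ((2 * \<kappa>) powr (- \<delta>)) ^ Suc k * (\<integral>x. norm (f x) \<partial>M)
        + CN N * (1 + (2 * \<kappa>) ^ Suc k * r / \<rho> z) powr (- N) * norm (\<integral>x. f x \<partial>M))))"
    unfolding annulus_ratio[OF r, symmetric]
    by (intro suminf_le allI S_annulus[OF f r annulus_radius_ge[OF r] N w w0 W wW]) auto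
  finally show ?thesis .
qed

end

section \<open>Growth of the oscillation\<close>

lemma powr_sum_le:
  fixes x y p :: real
  assumes "0 \<le> x" "0 \<le> y" "0 < p"
  shows "(x + y) powr p \<le> 2 powr p * (x powr p + y powr p)"
proof -
  have "(x + y) powr p \<le> (2 * max x y) powr p" using assms by (intro powr_mono2) auto
  also have "\<dots> \<le> 2 powr p * (x powr p + y powr p)" using assms by (auto simp: powr_mult max_def)
  finally show ?thesis .
qed

lemma power_powr_swap: "0 < (c::real) \<Longrightarrow> (c ^ k) powr t = (c powr t) ^ k"
  by (simp add: powr_realpow[symmetric] powr_powr mult.commute)

lemma summable_linear_times_power:
  fixes g :: real
  assumes "0 \<le> g" "g < 1"
  shows "summable (\<lambda>k. (real k + 3) * g ^ Suc k)"
proof -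
  have "summable (\<lambda>k. real (Suc k) * g ^ k)"
    using geometric_deriv_sums[of g] assms by (auto simp: sums_iff)
  then have "summable (\<lambda>k. 3 * (real (Suc k) * g ^ k))" by (rule summable_mult)
  then show ?thesis
  proof (rule summable_comparison_test[rotated], intro exI[of _ 0] allI impI)
    fix k :: nat
    have "g ^ Suc k \<le> g ^ k" using assms by (intro power_decreasing) auto
    then have "(real k + 3) * g ^ Suc k \<le> (3 * real (Suc k)) * g ^ k"
      using assms by (intro mult_mono) auto
    moreover have "0 \<le> (real k + 3) * g ^ Suc k" using assms by simp
    ultimately show "norm ((real k + 3) * g ^ Suc k) \<le> 3 * (real (Suc k) * g ^ k)"
      by (simp only: real_norm_def abs_of_nonneg mult.assoc)
  qed
qed

text \<open>The geometric terms below \<open>1 / x\<close> number about \<open>ln (1 / x)\<close>; this is the logarithm that the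
  \<open>BMO_log\<close> weight has to absorb.\<close>

lemma sum_inverse_geometric_le_ln:
  fixes x c :: real
  assumes x: "0 < x" "x \<le> 1" and c: "2 \<le> c"
  shows "(\<Sum>k<n. 1 / (1 + c ^ Suc k * x)) \<le> 4 * ln (exp 1 + 1 / x)"
proof -
  \<comment> \<open>From index \<open>m\<close> on one has \<open>1 \<le> 2 ^ m * x\<close>, and the
    terms decay geometrically; each of the first \<open>m\<close> terms is at most 1.\<close>
  define m where "m = nat \<lceil>log 2 (1 / x)\<rceil>"
  have lx: "0 \<le> log 2 (1 / x)" using x by (intro zero_le_log_cancel_iff[THEN iffD2]) auto
  have m1: "log 2 (1 / x) \<le> real m" unfolding m_def by linarith
  have m2: "real m \<le> log 2 (1 / x) + 1" unfolding m_def using lx by linarith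
  have "1 / x = 2 powr log 2 (1 / x)" using x by simp
  also have "\<dots> \<le> 2 powr real m" using m1 by (intro powr_mono) auto
  finally have xm: "1 / x \<le> 2 ^ m" by (simp add: powr_realpow)
  have term1: "1 / (1 + c ^ Suc k * x) \<le> 1" for k
  proof -
    have "0 \<le> c ^ Suc k * x" using x c by simp
    then show ?thesis by (simp only: divide_le_eq_1) linarith
  qed
  have term2: "1 / (1 + c ^ Suc (k + m) * x) \<le> (1 / 2) ^ Suc k" for k
  proof -
    have "2 ^ Suc k = 2 ^ Suc (k + m) * (1 / 2 ^ m :: real)" by (simp add: power_add)
    also have "\<dots> \<le> 2 ^ Suc (k + m) * x"
      using xm x by (intro mult_left_mono) (auto simp: field_simps)
    also have "\<dots> \<le> c ^ Suc (k + m) * x" using c x by (intro mult_right_mono power_mono) auto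
    also have "\<dots> \<le> 1 + c ^ Suc (k + m) * x" by simp
    finally have "inverse (1 + c ^ Suc (k + m) * x) \<le> inverse (2 ^ Suc k)" by (rule le_imp_inverse_le) simp
    then have "1 / (1 + c ^ Suc (k + m) * x) \<le> 1 / 2 ^ Suc k" by (simp only: inverse_eq_divide)
    then show ?thesis by (simp add: power_one_over)
  qed
  have nonneg: "0 \<le> 1 / (1 + c ^ Suc k * x)" for k using x c by simp
  have "(\<Sum>k<n. 1 / (1 + c ^ Suc k * x)) \<le> (\<Sum>k<m + n. 1 / (1 + c ^ Suc k * x))"
    using nonneg by (intro sum_mono2) auto
  also have "\<dots> = (\<Sum>k<m. 1 / (1 + c ^ Suc k * x)) + (\<Sum>k<n. 1 / (1 + c ^ Suc (k + m) * x))"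
    by (induction n) (auto simp: add.commute)
  also have "\<dots> \<le> (\<Sum>k<m. 1) + (\<Sum>k<n. (1 / 2) ^ Suc k)"
    by (intro add_mono sum_mono term1 term2)
  also have "(\<Sum>k<n. (1 / 2 :: real) ^ Suc k) \<le> 1"
  proof -
    have "(\<Sum>k<n. (1 / 2 :: real) ^ Suc k) = 1 - (1 / 2) ^ n" by (induction n) auto
    then show ?thesis by simp
  qed
  also have "(\<Sum>k<m. 1) + (1::real) = real m + 1" by simp
  also have "\<dots> \<le> log 2 (1 / x) + 2" using m2 by simp
  also have "log 2 (1 / x) \<le> 2 * ln (1 / x)"
  proof -
    have "1 = ln (exp (1::real))" by simp
    also have "\<dots> \<le> ln 4" using exp_le by (intro ln_mono) (auto intro: order_trans)
    also have "ln 4 = 2 * ln (2::real)" using ln_mult[of 2 "2::real"] by simp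
    finally have ln2: "1 \<le> 2 * ln (2::real)" .
    have "0 \<le> ln (1 / x)" using x by (intro ln_ge_zero) auto
    then have "ln (1 / x) * 1 \<le> ln (1 / x) * (2 * ln 2)" using ln2 by (intro mult_left_mono)
    moreover have "0 < ln (2::real)" by simp
    ultimately show ?thesis by (simp add: log_def pos_divide_le_eq mult_ac)
  qed
  also have "2 * ln (1 / x) + 2 \<le> 2 * ln (exp 1 + 1 / x) + 2 * ln (exp 1 + 1 / x)"
  proof (intro add_mono)
    show "2 * ln (1 / x) \<le> 2 * ln (exp 1 + 1 / x)" using x by (simp add: ln_mono)
    have "ln (exp 1) \<le> ln (exp 1 + 1 / x)" using x by (intro ln_mono) auto
    then show "2 \<le> 2 * ln (exp 1 + 1 / x)" by simp
  qed
  finally show ?thesis by simp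
qed

lemma (in homogeneous_type_space) MO_le_self:
  assumes "MO_le b A z R" "0 < R"
  shows "MO d M b z R \<le> A"
proof -
  have "1 * R \<le> 2 * \<kappa> * R" using kappa_ge_1 assms(2) by (intro mult_right_mono) auto
  then have "R \<le> 2 * \<kappa> * R" "d z z \<le> 2 * \<kappa> * R" using assms(2) by auto
  then show ?thesis using assms unfolding MO_le_def by blast
qed

text \<open>The symbol \<open>b\<close> enters only through the growth condition, which both
  function spaces will be shown to imply. The exponent \<open>p\<close> is the common integrability
  to which all atoms are reduced; it will be chosen at most \<open>q\<close>, and lies below
  \<open>s\<close> so that \<open>S\<close> is of weak type at \<open>p\<close>.\<close>

locale cz_commutator = cz_operator d \<kappa> M \<rho> s \<delta> T K CT C1 CN
  for d :: "'a \<Rightarrow> 'a \<Rightarrow> real" and \<kappa> :: real and M :: "'a measure" and \<rho> s \<delta>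
    and T :: "('a \<Rightarrow> 'k::{real_normed_field, banach, second_countable_topology}) \<Rightarrow> ('a \<Rightarrow> 'k)"
    and K CT C1 CN +
  fixes b :: "'a \<Rightarrow> 'k" and \<tau> A0 p :: real
  assumes b: "b \<in> L1_loc d M" and \<tau>: "0 \<le> \<tau>" "\<tau> < \<delta>" and A0: "0 < A0"
    and MO_growth: "0 < r \<Longrightarrow> MO_le b (A0 * (1 + r / \<rho> z) powr \<tau>) z r"
    and p: "1 < p" "p < s"
begin

lemma b_measurable [measurable]: "b \<in> borel_measurable M"
  by (rule L1_locD[OF b])

abbreviation osc :: "'a \<Rightarrow> real \<Rightarrow> 'a \<Rightarrow> real" where
  "osc z r y \<equiv> norm (b y - ball_mean d M b z r)"

abbreviation rad :: "real \<Rightarrow> nat \<Rightarrow> real" where "rad r k \<equiv> (2 * \<kappa>) ^ k * r"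

lemma rad_pos: "0 < r \<Longrightarrow> 0 < rad r k"
  using kappa_pos by simp

lemma rad_Suc_ge: "0 < r \<Longrightarrow> rad r k \<le> rad r (Suc k)"
proof -
  assume "0 < r"
  then have "1 * rad r k \<le> (2 * \<kappa>) * rad r k" using kappa_ge_1 rad_pos[of r k] by (intro mult_right_mono) auto
  then show ?thesis by (simp add: mult.assoc)
qed

text \<open>Telescoping over successive dilations costs one oscillation per step, which is the
  source of the linear factor \<open>k\<close>.\<close>

lemma ball_mean_rad_diff:
  assumes r: "0 < r"
  shows "norm (ball_mean d M b z (rad r k) - ball_mean d M b z r)
    \<le> real k * dbl (2 * \<kappa>) * (A0 * (1 + rad r k / \<rho> z) powr \<tau>)"
proof (induction k)
  case (Suc k)
  let ?A = "\<lambda>k. A0 * (1 + rad r k / \<rho> z) powr \<tau>"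
  have le: "rad r k \<le> rad r (Suc k)" by (rule rad_Suc_ge[OF r])
  have A: "?A k \<le> ?A (Suc k)" "0 \<le> ?A (Suc k)"
    using A0 \<tau> le rho_pos[of z] rad_pos[OF r, of k] rad_pos[OF r, of "Suc k"]
    by (auto intro!: mult_left_mono powr_mono2 add_left_mono divide_right_mono add_nonneg_nonneg divide_nonneg_nonneg)
  have "norm (ball_mean d M b z (rad r k) - ball_mean d M b z (rad r (Suc k))) \<le> dbl (2 * \<kappa>) * ?A (Suc k)"
  proof (rule norm_ball_mean_diff[OF b rad_pos[OF r]])
    show "0 \<le> dbl (2 * \<kappa>) * ?A (Suc k)" using A dbl_pos[of "2 * \<kappa>"] by simp
    have "(\<integral>\<^sup>+y\<in>B z (rad r k). ennreal (osc z (rad r (Suc k)) y) \<partial>M)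
        \<le> (\<integral>\<^sup>+y\<in>B z (rad r (Suc k)). ennreal (osc z (rad r (Suc k)) y) \<partial>M)"
      by (intro nn_integral_mono_set qball_mono le)
    also have "\<dots> = ennreal (MO d M b z (rad r (Suc k)) * V z (rad r (Suc k)))" by (rule nn_integral_MO[OF b])
    also have "\<dots> \<le> ennreal (?A (Suc k) * (dbl (2 * \<kappa>) * V z (rad r k)))"
    proof (intro ennreal_leI mult_mono A)
      show "MO d M b z (rad r (Suc k)) \<le> ?A (Suc k)"
        by (rule MO_le_self[OF MO_growth[OF rad_pos[OF r]] rad_pos[OF r]])
      show "V z (rad r (Suc k)) \<le> dbl (2 * \<kappa>) * V z (rad r k)"
        using V_dilate[of "rad r k" z "2 * \<kappa>"] rad_pos[OF r, of k] by (simp add: mult.assoc)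
    qed auto
    finally show "(\<integral>\<^sup>+y\<in>B z (rad r k). ennreal (osc z (rad r (Suc k)) y) \<partial>M) \<le> ennreal (dbl (2 * \<kappa>) * ?A (Suc k) * V z (rad r k))"
      by (simp only: mult_ac)
  qed
  then have 1: "norm (ball_mean d M b z (rad r (Suc k)) - ball_mean d M b z (rad r k)) \<le> dbl (2 * \<kappa>) * ?A (Suc k)"
    by (simp only: norm_minus_commute)
  have 2: "norm (ball_mean d M b z (rad r k) - ball_mean d M b z r) \<le> real k * dbl (2 * \<kappa>) * ?A (Suc k)"
  proof -
    have "0 \<le> real k * dbl (2 * \<kappa>)" using dbl_pos[of "2 * \<kappa>"] by simp
    from order_trans[OF Suc.IH mult_left_mono[OF A(1) this]] show ?thesis .
  qed
  have "norm (ball_mean d M b z (rad r (Suc k)) - ball_mean d M b z r)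
    \<le> norm (ball_mean d M b z (rad r (Suc k)) - ball_mean d M b z (rad r k)) + norm (ball_mean d M b z (rad r k) - ball_mean d M b z r)"
    using norm_triangle_ineq[of "ball_mean d M b z (rad r (Suc k)) - ball_mean d M b z (rad r k)" "ball_mean d M b z (rad r k) - ball_mean d M b z r"] by simp
  also have "\<dots> \<le> dbl (2 * \<kappa>) * ?A (Suc k) + real k * dbl (2 * \<kappa>) * ?A (Suc k)" by (rule add_mono[OF 1 2])
  finally show ?case by (simp add: algebra_simps)
qed simp

text \<open>The deviation from the small-ball mean is split into the deviation from the large-ball
  mean, bounded by the John-Nirenberg inequality, and the telescoped difference of means. As
  \<open>r < \<rho> z\<close>, the growth factor satisfies
  \<open>1 + rad r k / \<rho> z \<le> 2 * (2 * \<kappa>) ^ k\<close>, so the final bound no longer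
  involves \<rho>.\<close>

lemma oscillation_growth:
  assumes e: "1 \<le> e"
  obtains C where "0 < C" "\<And>z r k. 0 < r \<Longrightarrow> r < \<rho> z \<Longrightarrow>
    (\<integral>\<^sup>+y\<in>B z (rad r k). ennreal (osc z r y powr e) \<partial>M)
    \<le> ennreal ((C * (real k + 1) * ((2 * \<kappa>) powr \<tau>) ^ k) powr e * V z (rad r k))"
proof -
  obtain CJ where CJ: "0 < CJ" "\<And>A x R. 0 < A \<Longrightarrow> 0 < R \<Longrightarrow> MO_le b A x R \<Longrightarrow>
    (\<integral>\<^sup>+y\<in>B x R. ennreal (norm (b y - ball_mean d M b x R) powr e) \<partial>M) \<le> ennreal (CJ * A powr e * V x R)"
    using John_Nirenberg[of e, where 'k = 'k] b e by (auto dest!: less_le_trans[OF zero_less_one])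
  define D where "D = dbl (2 * \<kappa>)"
  have D: "0 < D" unfolding D_def by (rule dbl_pos)
  define Q where "Q = CJ powr (1 / e) + D"
  have Q: "0 < Q" using D by (simp add: Q_def add_nonneg_pos)
  have Qe: "CJ = (CJ powr (1 / e)) powr e" using CJ e by (simp add: powr_powr)
  \<comment> \<open>One factor 2 comes from raising a sum to the power \<open>e\<close>, the other
    from adding two equal bounds; \<open>2 powr \<tau>\<close> comes from the bound on
    \<open>1 + rad r k / \<rho> z\<close>.\<close>
  define C where "C = 4 * Q * A0 * 2 powr \<tau>"
  have "0 < C" using Q A0 by (simp add: C_def)
  moreover have "(\<integral>\<^sup>+y\<in>B z (rad r k). ennreal (osc z r y powr e) \<partial>M)
    \<le> ennreal ((C * (real k + 1) * ((2 * \<kappa>) powr \<tau>) ^ k) powr e * V z (rad r k))"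
    if r: "0 < r" "r < \<rho> z" for z r k
  proof -
    define A where "A = A0 * (1 + rad r k / \<rho> z) powr \<tau>"
    have R: "0 < rad r k" by (rule rad_pos[OF r(1)])
    have "0 < 1 + rad r k / \<rho> z" using R rho_pos[of z] by (simp add: add_pos_pos)
    then have A: "0 < A" using A0 by (simp add: A_def)
    have AC: "4 * Q * A * (real k + 1) \<le> C * (real k + 1) * ((2 * \<kappa>) powr \<tau>) ^ k"
    proof -
      have "1 \<le> (2 * \<kappa>) ^ k" using kappa_ge_1 by (intro one_le_power) auto
      moreover have "rad r k / \<rho> z \<le> (2 * \<kappa>) ^ k"
        using r rho_pos[of z] kappa_pos by (simp add: pos_divide_le_eq mult_left_mono)
      ultimately have "1 + rad r k / \<rho> z \<le> 2 * (2 * \<kappa>) ^ k" by simp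
      then have "(1 + rad r k / \<rho> z) powr \<tau> \<le> (2 * (2 * \<kappa>) ^ k) powr \<tau>"
        using \<tau> R rho_pos[of z] by (intro powr_mono2) (auto intro: add_nonneg_nonneg)
      also have "\<dots> = 2 powr \<tau> * ((2 * \<kappa>) powr \<tau>) ^ k"
      proof -
        have "(2 * (2 * \<kappa>) ^ k) powr \<tau> = 2 powr \<tau> * ((2 * \<kappa>) ^ k) powr \<tau>" using kappa_pos by (simp add: powr_mult)
        also have "((2 * \<kappa>) ^ k) powr \<tau> = ((2 * \<kappa>) powr \<tau>) ^ k"
          using kappa_pos by (intro power_powr_swap) simp
        finally show ?thesis .
      qed
      finally have "A \<le> A0 * (2 powr \<tau> * ((2 * \<kappa>) powr \<tau>) ^ k)" unfolding A_def using A0 by (intro mult_left_mono) auto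
      then have "4 * Q * (real k + 1) * A \<le> 4 * Q * (real k + 1) * (A0 * (2 powr \<tau> * ((2 * \<kappa>) powr \<tau>) ^ k))"
        using Q by (intro mult_left_mono) auto
      also have "\<dots> = C * (real k + 1) * ((2 * \<kappa>) powr \<tau>) ^ k" unfolding C_def by (simp only: mult_ac)
      also have "4 * Q * (real k + 1) * A = 4 * Q * A * (real k + 1)" by (simp only: mult_ac)
      finally show ?thesis .
    qed
    define c where "c = norm (ball_mean d M b z (rad r k) - ball_mean d M b z r)"
    have c: "c \<le> real k * D * A" unfolding c_def D_def A_def by (rule ball_mean_rad_diff[OF r(1)])
    have "(\<integral>\<^sup>+y\<in>B z (rad r k). ennreal (osc z r y powr e) \<partial>M)
      \<le> (\<integral>\<^sup>+y. ennreal (2 powr e) * (ennreal (osc z (rad r k) y powr e) * indicator (B z (rad r k)) y + ennreal (c powr e) * indicator (B z (rad r k)) y) \<partial>M)"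
    proof (rule nn_integral_mono)
      fix y
      have "osc z r y \<le> osc z (rad r k) y + c"
        unfolding c_def using norm_triangle_ineq[of "b y - ball_mean d M b z (rad r k)" "ball_mean d M b z (rad r k) - ball_mean d M b z r"] by simp
      then have "osc z r y powr e \<le> (osc z (rad r k) y + c) powr e" using e by (intro powr_mono2) auto
      also have "\<dots> \<le> 2 powr e * (osc z (rad r k) y powr e + c powr e)" using e by (intro powr_sum_le) (auto simp: c_def)
      finally have "ennreal (osc z r y powr e) \<le> ennreal (2 powr e * (osc z (rad r k) y powr e + c powr e))" by (rule ennreal_leI)
      also have "\<dots> = ennreal (2 powr e) * (ennreal (osc z (rad r k) y powr e) + ennreal (c powr e))"
        by (subst ennreal_mult') (auto simp: ennreal_plus)
      finally show "ennreal (osc z r y powr e) * indicator (B z (rad r k)) y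
        \<le> ennreal (2 powr e) * (ennreal (osc z (rad r k) y powr e) * indicator (B z (rad r k)) y + ennreal (c powr e) * indicator (B z (rad r k)) y)"
        by (auto split: split_indicator)
    qed
    also have "\<dots> = ennreal (2 powr e) * ((\<integral>\<^sup>+y\<in>B z (rad r k). ennreal (osc z (rad r k) y powr e) \<partial>M) + ennreal (c powr e) * ennreal (V z (rad r k)))"
      by (subst nn_integral_cmult, measurable, subst nn_integral_add) (auto simp: nn_integral_cmult_indicator emeasure_qball)
    also have "\<dots> \<le> ennreal (2 powr e) * (ennreal (CJ * A powr e * V z (rad r k)) + ennreal (c powr e) * ennreal (V z (rad r k)))"
      using CJ(2)[OF A R] MO_growth[OF R, of z] by (intro mult_left_mono add_right_mono) (auto simp: A_def)
    also have "\<dots> = ennreal (2 powr e * (CJ * A powr e * V z (rad r k) + c powr e * V z (rad r k)))"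
      using CJ(1) by (subst ennreal_mult') (auto simp: ennreal_plus ennreal_mult')
    also have "\<dots> \<le> ennreal ((C * (real k + 1) * ((2 * \<kappa>) powr \<tau>) ^ k) powr e * V z (rad r k))"
    proof (rule ennreal_leI)
      have "CJ * A powr e + c powr e \<le> 2 powr e * (Q * A * (real k + 1)) powr e"
      proof -
        have "CJ * A powr e = (CJ powr (1 / e) * A) powr e" using CJ(1) A by (subst Qe) (simp add: powr_mult)
        also have "\<dots> \<le> (Q * A * (real k + 1)) powr e"
        proof (intro powr_mono2)
          have "CJ powr (1 / e) * A * 1 \<le> Q * A * (real k + 1)"
            using D A Q by (intro mult_mono) (auto simp: Q_def)
          then show "CJ powr (1 / e) * A \<le> Q * A * (real k + 1)" by simp
        qed (use e A in auto)
        finally have 1: "CJ * A powr e \<le> (Q * A * (real k + 1)) powr e" .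
        have "real k * D * A \<le> (real k + 1) * Q * A" using D A by (intro mult_right_mono mult_mono) (auto simp: Q_def)
        then have "c \<le> Q * A * (real k + 1)" using c by (simp add: mult_ac)
        then have 2: "c powr e \<le> (Q * A * (real k + 1)) powr e" using e by (intro powr_mono2) (auto simp: c_def)
        have "(2::real) powr 1 \<le> 2 powr e" using e by (intro powr_mono) auto
        then have "2 * (Q * A * (real k + 1)) powr e \<le> 2 powr e * (Q * A * (real k + 1)) powr e" by (intro mult_right_mono) auto
        then show ?thesis using 1 2 by linarith
      qed
      then have "2 powr e * (CJ * A powr e + c powr e) \<le> 2 powr e * (2 powr e * (Q * A * (real k + 1)) powr e)"
        by (rule mult_left_mono) simp
      also have "\<dots> = (4 * Q * A * (real k + 1)) powr e"
      proof -
        have "2 powr e * (2 powr e * (Q * A * (real k + 1)) powr e) = (2 * (2 * (Q * A * (real k + 1)))) powr e"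
          using Q A by (simp only: powr_mult)
        also have "2 * (2 * (Q * A * (real k + 1))) = 4 * Q * A * (real k + 1)" by simp
        finally show ?thesis .
      qed
      also have "\<dots> \<le> (C * (real k + 1) * ((2 * \<kappa>) powr \<tau>) ^ k) powr e"
        using AC e Q A by (intro powr_mono2) auto
      finally have "2 powr e * (CJ * A powr e + c powr e) * V z (rad r k) \<le> (C * (real k + 1) * ((2 * \<kappa>) powr \<tau>) ^ k) powr e * V z (rad r k)"
        by (rule mult_right_mono) simp
      then show "2 powr e * (CJ * A powr e * V z (rad r k) + c powr e * V z (rad r k)) \<le> (C * (real k + 1) * ((2 * \<kappa>) powr \<tau>) ^ k) powr e * V z (rad r k)"
        by (simp add: distrib_right mult.assoc)
    qed
    finally show ?thesis .
  qed
  ultimately show ?thesis by (rule that)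
qed

end

section \<open>Atoms\<close>

lemma nn_integral_unscale:
  assumes [measurable]: "g \<in> borel_measurable M" and "0 < v"
    and le: "(\<integral>\<^sup>+x\<in>A. ennreal (v * g x) \<partial>M) \<le> ennreal (c * v)" and [measurable]: "A \<in> sets M"
  shows "(\<integral>\<^sup>+x\<in>A. ennreal (g x) \<partial>M) \<le> ennreal c"
proof -
  have "(\<integral>\<^sup>+x\<in>A. ennreal (g x) \<partial>M) = (\<integral>\<^sup>+x. ennreal (1 / v) * (ennreal (v * g x) * indicator A x) \<partial>M)"
    using \<open>0 < v\<close> by (intro nn_integral_cong) (auto simp: ennreal_mult'[symmetric] split: split_indicator)
  also have "\<dots> = ennreal (1 / v) * (\<integral>\<^sup>+x\<in>A. ennreal (v * g x) \<partial>M)" by (rule nn_integral_cmult) measurable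
  also have "\<dots> \<le> ennreal (1 / v) * ennreal (c * v)" by (rule mult_left_mono[OF le]) simp
  also have "\<dots> = ennreal c" using \<open>0 < v\<close> by (subst ennreal_mult'[symmetric]) auto
  finally show ?thesis .
qed

lemma nn_integral_Un_le:
  assumes [measurable]: "h \<in> borel_measurable M" "A \<in> sets M" "A' \<in> sets M" and "space M \<subseteq> A \<union> A'"
  shows "(\<integral>\<^sup>+x. h x \<partial>M) \<le> (\<integral>\<^sup>+x\<in>A. h x \<partial>M) + (\<integral>\<^sup>+x\<in>A'. h x \<partial>M)"
proof -
  have "(\<integral>\<^sup>+x. h x \<partial>M) \<le> (\<integral>\<^sup>+x. h x * indicator A x + h x * indicator A' x \<partial>M)"
    using assms(4) by (intro nn_integral_mono) (auto split: split_indicator)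
  then show ?thesis by (simp add: nn_integral_add)
qed

lemma ennreal_suminf_le:
  assumes "\<And>k. 0 \<le> f k" "summable f" "suminf f \<le> c"
  shows "(\<Sum>k. ennreal (f k)) \<le> ennreal c"
  using assms by (simp add: suminf_ennreal2 ennreal_leI)

context cz_commutator
begin

text \<open>The factor \<open>2\<close> comes from comparing exponents by \<open>t\<^sup>p \<le> 1 + t\<^sup>q\<close> instead of Hoelder's inequality.\<close>

definition natom :: "'a \<Rightarrow> real \<Rightarrow> ('a \<Rightarrow> 'k) \<Rightarrow> bool" where
  "natom z r a \<longleftrightarrow> a \<in> borel_measurable M \<and> (\<forall>x. x \<notin> B z r \<longrightarrow> a x = 0) \<and> 0 < r \<and> r < \<rho> z \<and>
    (\<integral>\<^sup>+x. ennreal ((V z r * norm (a x)) powr p) \<partial>M) \<le> ennreal (2 * V z r) \<and>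
    (r < \<rho> z / 4 \<longrightarrow> (\<integral>x. a x \<partial>M) = 0)"

text \<open>After multiplication by the volume both factors are dimensionless, and Young's
  inequality needs only their averages over the ball: that of the weight with the conjugate exponent
  and that of the scaled atom with exponent \<open>p\<close>.\<close>

lemma natom_product:
  assumes a: "natom z r a" and [measurable]: "w \<in> borel_measurable M" and w: "\<And>x. 0 \<le> w x" and Q: "0 \<le> Q"
    and wQ: "(\<integral>\<^sup>+x\<in>B z r. ennreal (w x powr (p / (p - 1))) \<partial>M) \<le> ennreal (Q * V z r)"
  shows "(\<integral>\<^sup>+x. ennreal (w x * norm (a x)) \<partial>M) \<le> ennreal (Q + 2)"
proof -
  let ?V = "V z r"
  have [measurable]: "a \<in> borel_measurable M" and r: "0 < r" and out: "\<And>x. x \<notin> B z r \<Longrightarrow> a x = 0"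
    and ap: "(\<integral>\<^sup>+x. ennreal ((?V * norm (a x)) powr p) \<partial>M) \<le> ennreal (2 * ?V)"
    using a unfolding natom_def by blast+
  have V: "0 < ?V" by (rule V_pos[OF r])
  have "(\<integral>\<^sup>+x\<in>space M. ennreal (?V * (w x * norm (a x))) \<partial>M)
    \<le> (\<integral>\<^sup>+x. ennreal (w x powr (p / (p - 1))) * indicator (B z r) x + ennreal ((?V * norm (a x)) powr p) \<partial>M)"
  proof (rule nn_integral_mono)
    fix x
    show "ennreal (?V * (w x * norm (a x))) * indicator (space M) x
      \<le> ennreal (w x powr (p / (p - 1))) * indicator (B z r) x + ennreal ((?V * norm (a x)) powr p)"
    proof (cases "x \<in> B z r")
      case True
      have "w x * (?V * norm (a x)) \<le> w x powr (p / (p - 1)) + (?V * norm (a x)) powr p"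
        using w V p conjugate_exponent[OF p(1)] by (intro Young_le) auto
      then have "ennreal (?V * (w x * norm (a x))) \<le> ennreal (w x powr (p / (p - 1)) + (?V * norm (a x)) powr p)"
        by (intro ennreal_leI) (simp only: mult.left_commute)
      then show ?thesis using True by (simp add: ennreal_plus space_eq)
    next
      case False
      then show ?thesis using out by simp
    qed
  qed
  also have "\<dots> = (\<integral>\<^sup>+x\<in>B z r. ennreal (w x powr (p / (p - 1))) \<partial>M) + (\<integral>\<^sup>+x. ennreal ((?V * norm (a x)) powr p) \<partial>M)"
    by (rule nn_integral_add) measurable
  also have "\<dots> \<le> ennreal (Q * ?V) + ennreal (2 * ?V)" by (rule add_mono[OF wQ ap])
  also have "\<dots> = ennreal ((Q + 2) * ?V)" using Q V by (simp add: ennreal_plus[symmetric] distrib_right del: ennreal_plus)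
  finally have scaled: "(\<integral>\<^sup>+x\<in>space M. ennreal (?V * (w x * norm (a x))) \<partial>M) \<le> ennreal ((Q + 2) * ?V)" .
  have "(\<integral>\<^sup>+x\<in>space M. ennreal (w x * norm (a x)) \<partial>M) \<le> ennreal (Q + 2)"
    by (rule nn_integral_unscale[OF _ V scaled]) measurable
  then show ?thesis by (simp add: space_eq)
qed

lemma natom_integrable:
  assumes a: "natom z r a"
  shows "integrable M a" "(\<integral>x. norm (a x) \<partial>M) \<le> 3"
proof -
  have am: "a \<in> borel_measurable M" using a unfolding natom_def by blast
  have "(\<integral>\<^sup>+x. ennreal (1 * norm (a x)) \<partial>M) \<le> ennreal (1 + 2)"
    by (rule natom_product[OF a]) (auto simp: emeasure_qball)
  then have le: "(\<integral>\<^sup>+x. ennreal (norm (a x)) \<partial>M) \<le> ennreal 3" by simp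
  then show i: "integrable M a" using am by (intro integrableI_bounded) (auto intro: le_less_trans)
  have "ennreal (\<integral>x. norm (a x) \<partial>M) = (\<integral>\<^sup>+x. ennreal (norm (a x)) \<partial>M)"
    using i by (intro nn_integral_eq_integral[symmetric] integrable_norm) auto
  then have "ennreal (\<integral>x. norm (a x) \<partial>M) \<le> ennreal 3" using le by (simp only:)
  then show "(\<integral>x. norm (a x) \<partial>M) \<le> 3" by (subst (asm) ennreal_le_iff) auto
qed

text \<open>\<open>S\<close> is available with weak-type bounds. On a fixed dilate of the ball
  Kolmogorov's inequality turns these into strong integrability with a slightly smaller
  exponent.\<close>

lemma S_near:
  assumes e: "1 \<le> e" "e \<le> s" and e1: "0 < e1" "e1 < e" and Q: "0 \<le> Q"
  obtains C where "0 < C" "\<And>z r f. 0 < r \<Longrightarrow> integrable M f \<Longrightarrow>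
    (\<integral>\<^sup>+x. ennreal ((V z r * norm (f x)) powr e) \<partial>M) \<le> ennreal (Q * V z r) \<Longrightarrow>
    (\<integral>\<^sup>+x\<in>B z (2 * \<kappa> * r). ennreal ((V z r * norm (S f x)) powr e1) \<partial>M) \<le> ennreal (C * V z r)"
proof -
  obtain C where C: "0 < C" "\<And>(u :: 'a \<Rightarrow> real) E m. u \<in> borel_measurable M \<Longrightarrow> (\<And>x. 0 \<le> u x) \<Longrightarrow> E \<in> sets M \<Longrightarrow> 0 \<le> m \<Longrightarrow>
    emeasure M E \<le> ennreal (dbl (2 * \<kappa>) * m) \<Longrightarrow>
    (\<And>t. 0 < t \<Longrightarrow> emeasure M {x \<in> space M. t < u x} \<le> ennreal (Cpp * Q * m / t powr e)) \<Longrightarrow>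
    (\<integral>\<^sup>+x\<in>E. ennreal (u x powr e1) \<partial>M) \<le> ennreal (C * m)"
    using Kolmogorov_inequality[OF e1, of M "dbl (2 * \<kappa>)" "Cpp * Q"] by blast
  have "(\<integral>\<^sup>+x\<in>B z (2 * \<kappa> * r). ennreal ((V z r * norm (S f x)) powr e1) \<partial>M) \<le> ennreal (C * V z r)"
    if r: "0 < r" and f: "integrable M f" and fQ: "(\<integral>\<^sup>+x. ennreal ((V z r * norm (f x)) powr e) \<partial>M) \<le> ennreal (Q * V z r)"
    for z r f
  proof (rule C(2))
    let ?V = "V z r"
    have V: "0 < ?V" by (rule V_pos[OF r])
    have [measurable]: "f \<in> borel_measurable M" using f by auto
    show "(\<lambda>x. ?V * norm (S f x)) \<in> borel_measurable M" using S_measurable[OF f] by measurable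
    show "0 \<le> ?V * norm (S f x)" for x using V by simp
    show "emeasure M (B z (2 * \<kappa> * r)) \<le> ennreal (dbl (2 * \<kappa>) * ?V)"
      unfolding emeasure_qball using r by (intro ennreal_leI V_dilate) auto
    fix t :: real assume t: "0 < t"
    have VV: "?V powr (1 - e) * ?V powr e = ?V" using V by (simp add: powr_add[symmetric])
    have scaled: "(\<integral>\<^sup>+x\<in>space M. ennreal (?V powr e * norm (f x) powr e) \<partial>M) \<le> ennreal ((Q * ?V powr (1 - e)) * ?V powr e)"
      using fQ unfolding mult.assoc VV powr_mult by (simp add: space_eq)
    have "0 < ?V powr e" using V by simp
    have "(\<integral>\<^sup>+x\<in>space M. ennreal (norm (f x) powr e) \<partial>M) \<le> ennreal (Q * ?V powr (1 - e))"
      by (rule nn_integral_unscale[OF _ \<open>0 < ?V powr e\<close> scaled]) measurable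
    then have fe: "(\<integral>\<^sup>+x. ennreal (norm (f x) powr e) \<partial>M) \<le> ennreal (Q * ?V powr (1 - e))"
      by (simp add: space_eq)
    have "{x \<in> space M. t < ?V * norm (S f x)} = {x \<in> space M. t / ?V < norm (S f x)}"
      using V by (auto simp: pos_divide_less_eq mult.commute)
    then have "emeasure M {x \<in> space M. t < ?V * norm (S f x)} \<le> ennreal (Cpp * (Q * ?V powr (1 - e)) / (t / ?V) powr e)"
      using S_weak_pp[OF f e _ _ fe, of "t / ?V"] t V Q by simp
    also have "Cpp * (Q * ?V powr (1 - e)) / (t / ?V) powr e = Cpp * Q * (?V powr (1 - e) * ?V powr e) / t powr e"
      using t V by (simp add: powr_divide)
    also note VV
    finally show "emeasure M {x \<in> space M. t < ?V * norm (S f x)} \<le> ennreal (Cpp * Q * ?V / t powr e)" .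
  qed simp_all
  with C(1) show ?thesis by (rule that)
qed

lemma cover_near_far: "space M \<subseteq> B z (2 * \<kappa> * r) \<union> {x. 2 * \<kappa> * r \<le> d x z}"
  by (auto simp: d_sym not_less)

lemma sets_far [measurable]: "{x. c \<le> d x z} \<in> sets M"
proof -
  have "{x. c \<le> d x z} = {x \<in> space M. c \<le> d x z}" by (simp add: space_eq)
  also have "\<dots> \<in> sets M" by measurable
  finally show ?thesis .
qed

text \<open>An atom without cancellation has \<open>r\<close> at least \<open>\<rho> z / 4\<close>,
  so decay in the distance over \<open>\<rho> z\<close> is as good as decay in the distance over
  \<open>r\<close>. With exponent \<delta> the size bound thus imitates the smoothness gain; 3
  bounds the L1 norm of the atom and \<open>4 powr \<delta>\<close> pays for the ratio of
  \<open>r\<close> and \<open>\<rho> z\<close>.\<close>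

lemma decay_bound_noncancelling:
  assumes a: "natom z r a"
  shows "(1 + rad r (Suc k) / \<rho> z) powr (- \<delta>) * norm (\<integral>x. a x \<partial>M) \<le> 3 * 4 powr \<delta> * ((2 * \<kappa>) powr (- \<delta>)) ^ Suc k"
proof (cases "r < \<rho> z / 4")
  case True
  then have "(\<integral>x. a x \<partial>M) = 0" using a unfolding natom_def by blast
  then show ?thesis by simp
next
  case False
  have r: "0 < r" using a unfolding natom_def by blast
  have m: "norm (\<integral>x. a x \<partial>M) \<le> 3"
    using integral_norm_bound[of M a] natom_integrable(2)[OF a] by linarith
  have c: "0 < 2 * \<kappa>" using kappa_pos by simp
  have "(2 * \<kappa>) ^ Suc k * (1 / 4) \<le> (2 * \<kappa>) ^ Suc k * (r / \<rho> z)"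
    using False rho_pos[of z] c by (intro mult_left_mono) (auto simp: field_simps)
  also have "\<dots> \<le> 1 + rad r (Suc k) / \<rho> z" by simp
  finally have "(1 + rad r (Suc k) / \<rho> z) powr (- \<delta>) \<le> ((2 * \<kappa>) ^ Suc k * (1 / 4)) powr (- \<delta>)"
    using \<delta> c by (intro powr_mono2') auto
  also have "\<dots> = ((2 * \<kappa>) ^ Suc k) powr (- \<delta>) * (1 / 4) powr (- \<delta>)" by (rule powr_mult)
  also have "((2 * \<kappa>) ^ Suc k) powr (- \<delta>) = ((2 * \<kappa>) powr (- \<delta>)) ^ Suc k" by (rule power_powr_swap[OF c])
  also have "(1 / 4 :: real) powr (- \<delta>) = 4 powr \<delta>" by (simp add: powr_minus_divide powr_divide)
  finally have "(1 + rad r (Suc k) / \<rho> z) powr (- \<delta>) * norm (\<integral>x. a x \<partial>M) \<le> (((2 * \<kappa>) powr (- \<delta>)) ^ Suc k * 4 powr \<delta>) * 3"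
    using m by (intro mult_mono) auto
  then show ?thesis by (simp only: mult_ac)
qed

text \<open>The annulus with inner index \<open>Suc k\<close> lies in the ball with index
  \<open>Suc (Suc k)\<close>, which explains \<open>k + 3\<close>; the additional factor of growth
  and one doubling go into the constant. The exponent is conjugate to that of the kernel
  bounds.\<close>

lemma oscillation_annulus:
  obtains C where "0 < C" "\<And>z r k. 0 < r \<Longrightarrow> r < \<rho> z \<Longrightarrow>
    (\<integral>\<^sup>+y\<in>ann z (rad r (Suc k)). ennreal (osc z r y powr (s / (s - 1))) \<partial>M)
    \<le> ennreal ((C * (real k + 3) * ((2 * \<kappa>) powr \<tau>) ^ Suc k) powr (s / (s - 1)) * V z (rad r (Suc k)))"
proof -
  define e where "e = s / (s - 1)"
  have e: "1 < e" using conjugate_exponent(1)[OF s] by (simp add: e_def)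
  obtain C where C: "0 < C" "\<And>z r k. 0 < r \<Longrightarrow> r < \<rho> z \<Longrightarrow>
    (\<integral>\<^sup>+y\<in>B z (rad r k). ennreal (osc z r y powr e) \<partial>M)
    \<le> ennreal ((C * (real k + 1) * ((2 * \<kappa>) powr \<tau>) ^ k) powr e * V z (rad r k))"
    by (rule oscillation_growth[OF less_imp_le[OF e]]) blast
  define h where "h = (2 * \<kappa>) powr \<tau>"
  have h: "0 < h" using kappa_pos by (simp add: h_def)
  define D where "D = dbl (2 * \<kappa>)"
  have D: "1 \<le> D" unfolding D_def by (rule dbl_ge_1)
  have "(\<integral>\<^sup>+y\<in>ann z (rad r (Suc k)). ennreal (osc z r y powr e) \<partial>M)
    \<le> ennreal ((D * C * h * (real k + 3) * h ^ Suc k) powr e * V z (rad r (Suc k)))"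
    if r: "0 < r" "r < \<rho> z" for z r k
  proof -
    have R: "0 < rad r (Suc k)" by (rule rad_pos[OF r(1)])
    have "(\<integral>\<^sup>+y\<in>ann z (rad r (Suc k)). ennreal (osc z r y powr e) \<partial>M) \<le> (\<integral>\<^sup>+y\<in>B z (rad r (Suc (Suc k))). ennreal (osc z r y powr e) \<partial>M)"
      by (intro nn_integral_mono_set) (auto simp: ann_def d_sym mult.assoc)
    also have "\<dots> \<le> ennreal ((C * (real (Suc (Suc k)) + 1) * h ^ Suc (Suc k)) powr e * V z (rad r (Suc (Suc k))))"
      unfolding h_def by (rule C(2)[OF r])
    also have "\<dots> \<le> ennreal ((C * (real (Suc (Suc k)) + 1) * h ^ Suc (Suc k)) powr e * (D powr e * V z (rad r (Suc k))))"
    proof (intro ennreal_leI mult_left_mono)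
      have "V z (rad r (Suc (Suc k))) \<le> D * V z (rad r (Suc k))"
        unfolding D_def using V_dilate[of "rad r (Suc k)" z "2 * \<kappa>"] R by (simp add: mult.assoc)
      also have "\<dots> \<le> D powr e * V z (rad r (Suc k))"
        using powr_mono[of 1 e D] D e by (intro mult_right_mono) auto
      finally show "V z (rad r (Suc (Suc k))) \<le> D powr e * V z (rad r (Suc k))" .
    qed simp
    also have "(C * (real (Suc (Suc k)) + 1) * h ^ Suc (Suc k)) powr e * (D powr e * V z (rad r (Suc k)))
      = (C * (real (Suc (Suc k)) + 1) * h ^ Suc (Suc k) * D) powr e * V z (rad r (Suc k))"
      by (simp only: powr_mult mult.assoc)
    also have "C * (real (Suc (Suc k)) + 1) * h ^ Suc (Suc k) * D = D * C * h * (real k + 3) * h ^ Suc k"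
      by (simp add: algebra_simps)
    finally show ?thesis .
  qed
  then show ?thesis using that[of "D * C * h"] D C(1) h unfolding e_def h_def by auto
qed

text \<open>Near the ball the oscillation is paired with \<open>S a\<close> by Young's inequality.
  Far away the annulus estimate, weighted by the oscillation, gives the terms
  \<open>(k + 3) * (h * q) ^ Suc k\<close>, in which \<open>h\<close> is the growth and
  \<open>q\<close> the decay per annulus.\<close>

theorem atom_bounds:
  obtains C where "0 < C"
    "\<And>z r a. natom z r a \<Longrightarrow> (\<integral>\<^sup>+x. ennreal (osc z r x * norm (a x)) \<partial>M) \<le> ennreal C"
    "\<And>z r a. natom z r a \<Longrightarrow> (\<integral>\<^sup>+x. ennreal (osc z r x * norm (S a x)) \<partial>M) \<le> ennreal C"
proof -
  define p' where "p' = p / (p - 1)"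
  have p': "1 < p'" using conjugate_exponent(1)[OF p(1)] by (simp add: p'_def)
  obtain Cp where Cp: "0 < Cp" "\<And>z r k. 0 < r \<Longrightarrow> r < \<rho> z \<Longrightarrow>
    (\<integral>\<^sup>+y\<in>B z (rad r k). ennreal (osc z r y powr p') \<partial>M)
    \<le> ennreal ((Cp * (real k + 1) * ((2 * \<kappa>) powr \<tau>) ^ k) powr p' * V z (rad r k))"
    by (rule oscillation_growth[OF less_imp_le[OF p']]) blast
  \<comment> \<open>A point strictly between 1 and \<open>p\<close>: below \<open>p\<close> because
    \<open>S_near\<close> loses some integrability, above 1 so that the oscillation is needed only
    with a finite conjugate exponent.\<close>
  define e where "e = (1 + p) / 2"
  have e: "1 < e" "e < p" using p by (auto simp: e_def)
  define e' where "e' = e / (e - 1)"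
  have e': "1 < e'" using conjugate_exponent(1)[OF e(1)] by (simp add: e'_def)
  obtain Ce where Ce: "0 < Ce" "\<And>z r k. 0 < r \<Longrightarrow> r < \<rho> z \<Longrightarrow>
    (\<integral>\<^sup>+y\<in>B z (rad r k). ennreal (osc z r y powr e') \<partial>M)
    \<le> ennreal ((Ce * (real k + 1) * ((2 * \<kappa>) powr \<tau>) ^ k) powr e' * V z (rad r k))"
    by (rule oscillation_growth[OF less_imp_le[OF e']]) blast
  obtain Cn where Cn: "0 < Cn" "\<And>z r f. 0 < r \<Longrightarrow> integrable M f \<Longrightarrow>
    (\<integral>\<^sup>+x. ennreal ((V z r * norm (f x)) powr p) \<partial>M) \<le> ennreal (2 * V z r) \<Longrightarrow>
    (\<integral>\<^sup>+x\<in>B z (2 * \<kappa> * r). ennreal ((V z r * norm (S f x)) powr e) \<partial>M) \<le> ennreal (Cn * V z r)"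
    by (rule S_near[of p e 2]) (use p e in auto)
  obtain Cs where Cs: "0 < Cs" "\<And>z r k. 0 < r \<Longrightarrow> r < \<rho> z \<Longrightarrow>
    (\<integral>\<^sup>+y\<in>ann z (rad r (Suc k)). ennreal (osc z r y powr (s / (s - 1))) \<partial>M)
    \<le> ennreal ((Cs * (real k + 3) * ((2 * \<kappa>) powr \<tau>) ^ Suc k) powr (s / (s - 1)) * V z (rad r (Suc k)))"
    by (rule oscillation_annulus) blast
  define h where "h = (2 * \<kappa>) powr \<tau>"
  define q where "q = (2 * \<kappa>) powr (- \<delta>)"
  have hq: "0 < h" "0 < q" using kappa_pos by (auto simp: h_def q_def)
  have "1 < 2 * \<kappa>" using kappa_ge_1 by simp
  \<comment> \<open>The point where \<tau> < \<delta> decides convergence.\<close>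
  then have hq1: "h * q < 1" unfolding h_def q_def powr_add[symmetric] using \<tau> by (intro powr_less_one) auto
  define Ca where "Ca = Cp powr p' + 2"
  define Q1 where "Q1 = (Ce * 2 * h) powr e' * dbl (2 * \<kappa>)"
  have Q1: "0 \<le> Q1" using dbl_pos[of "2 * \<kappa>"] by (simp add: Q1_def)
  \<comment> \<open>2 is the constant of Hoelder's inequality, 3 bounds the L1 norm of an atom, and
    the two terms in parentheses account for the smoothness and the size of the kernel.\<close>
  define G where "G = 2 * Cs * 3 * (C1 + CN \<delta> * 4 powr \<delta>)"
  have G: "0 < G" using Cs(1) C1 CN[OF \<delta>] by (simp add: G_def add_pos_pos)
  have sum: "summable (\<lambda>k. (real k + 3) * (h * q) ^ Suc k)"
    using hq hq1 by (intro summable_linear_times_power) auto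
  define Cf where "Cf = G * (\<Sum>k. (real k + 3) * (h * q) ^ Suc k)"
  have Cf: "0 \<le> Cf" unfolding Cf_def using G hq by (intro mult_nonneg_nonneg suminf_nonneg sum) auto
  define C where "C = Ca + (Q1 + Cn + Cf)"
  have "0 < Ca" by (simp add: Ca_def add_nonneg_pos)
  then have "0 < C" using Q1 Cn(1) Cf by (simp add: C_def)
  show ?thesis
  proof (rule that[OF \<open>0 < C\<close>])
    fix z r a assume a: "natom z r a"
    have am[measurable]: "a \<in> borel_measurable M" and r: "0 < r" "r < \<rho> z"
      and out: "\<And>x. x \<notin> B z r \<Longrightarrow> a x = 0"
      and ap: "(\<integral>\<^sup>+x. ennreal ((V z r * norm (a x)) powr p) \<partial>M) \<le> ennreal (2 * V z r)"
      using a unfolding natom_def by blast+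
    have ai: "integrable M a" and a3: "(\<integral>x. norm (a x) \<partial>M) \<le> 3" using natom_integrable[OF a] by auto
    have V: "0 < V z r" by (rule V_pos[OF r(1)])
    note [measurable] = S_measurable[OF ai]
    have "(\<integral>\<^sup>+x. ennreal (osc z r x * norm (a x)) \<partial>M) \<le> ennreal (Cp powr p' + 2)"
    proof (rule natom_product[OF a])
      show "(\<integral>\<^sup>+x\<in>B z r. ennreal (osc z r x powr (p / (p - 1))) \<partial>M) \<le> ennreal (Cp powr p' * V z r)"
        using Cp(2)[OF r, of 0] by (simp add: p'_def)
    qed auto
    also have "\<dots> \<le> ennreal C" using Q1 Cn(1) Cf by (intro ennreal_leI) (simp add: C_def Ca_def)
    finally show "(\<integral>\<^sup>+x. ennreal (osc z r x * norm (a x)) \<partial>M) \<le> ennreal C" .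
    have near: "(\<integral>\<^sup>+x\<in>B z (2 * \<kappa> * r). ennreal (osc z r x * norm (S a x)) \<partial>M) \<le> ennreal (Q1 + Cn)"
    proof (rule nn_integral_unscale[OF _ V])
      have "(\<integral>\<^sup>+x\<in>B z (2 * \<kappa> * r). ennreal (V z r * (osc z r x * norm (S a x))) \<partial>M)
        \<le> (\<integral>\<^sup>+x. ennreal (osc z r x powr e') * indicator (B z (2 * \<kappa> * r)) x + ennreal ((V z r * norm (S a x)) powr e) * indicator (B z (2 * \<kappa> * r)) x \<partial>M)"
      proof (rule nn_integral_mono)
        fix x
        have "osc z r x * (V z r * norm (S a x)) \<le> osc z r x powr e' + (V z r * norm (S a x)) powr e"
          using V e(1) e' conjugate_exponent[OF e(1)] by (intro Young_le) (auto simp: e'_def)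
        then have "ennreal (V z r * (osc z r x * norm (S a x))) \<le> ennreal (osc z r x powr e' + (V z r * norm (S a x)) powr e)"
          by (intro ennreal_leI) (simp only: mult.left_commute)
        then show "ennreal (V z r * (osc z r x * norm (S a x))) * indicator (B z (2 * \<kappa> * r)) x
          \<le> ennreal (osc z r x powr e') * indicator (B z (2 * \<kappa> * r)) x + ennreal ((V z r * norm (S a x)) powr e) * indicator (B z (2 * \<kappa> * r)) x"
          by (auto simp: ennreal_plus split: split_indicator)
      qed
      also have "\<dots> = (\<integral>\<^sup>+x\<in>B z (2 * \<kappa> * r). ennreal (osc z r x powr e') \<partial>M) + (\<integral>\<^sup>+x\<in>B z (2 * \<kappa> * r). ennreal ((V z r * norm (S a x)) powr e) \<partial>M)"
        by (rule nn_integral_add) measurable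
      also have "\<dots> \<le> ennreal (Q1 * V z r) + ennreal (Cn * V z r)"
      proof (rule add_mono)
        have "(\<integral>\<^sup>+x\<in>B z (2 * \<kappa> * r). ennreal (osc z r x powr e') \<partial>M) \<le> ennreal ((Ce * 2 * h) powr e' * V z (2 * \<kappa> * r))"
          using Ce(2)[OF r, of 1] by (simp add: h_def)
        also have "\<dots> \<le> ennreal ((Ce * 2 * h) powr e' * (dbl (2 * \<kappa>) * V z r))"
          using r by (intro ennreal_leI mult_left_mono V_dilate) auto
        finally show "(\<integral>\<^sup>+x\<in>B z (2 * \<kappa> * r). ennreal (osc z r x powr e') \<partial>M) \<le> ennreal (Q1 * V z r)"
          by (simp only: Q1_def mult.assoc)
      qed (rule Cn(2)[OF r(1) ai ap])
      also have "\<dots> = ennreal ((Q1 + Cn) * V z r)"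
        using Q1 Cn(1) V by (simp add: ennreal_plus[symmetric] distrib_right del: ennreal_plus)
      finally show "(\<integral>\<^sup>+x\<in>B z (2 * \<kappa> * r). ennreal (V z r * (osc z r x * norm (S a x))) \<partial>M) \<le> ennreal ((Q1 + Cn) * V z r)" .
    qed measurable
    have far: "(\<integral>\<^sup>+x\<in>{x. 2 * \<kappa> * r \<le> d x z}. ennreal (osc z r x * norm (S a x)) \<partial>M) \<le> ennreal Cf"
    proof -
      have "(\<integral>\<^sup>+x\<in>{x. 2 * \<kappa> * r \<le> d x z}. ennreal (osc z r x * norm (S a x)) \<partial>M)
        \<le> (\<Sum>k. ennreal (2 * (Cs * (real k + 3) * h ^ Suc k) * (C1 * q ^ Suc k * (\<integral>x. norm (a x) \<partial>M)
          + CN \<delta> * (1 + rad r (Suc k) / \<rho> z) powr (- \<delta>) * norm (\<integral>x. a x \<partial>M))))"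
        unfolding q_def
      proof (rule S_far[OF ai out r(1) \<delta>])
        show "0 < Cs * (real k + 3) * h ^ Suc k" for k using Cs(1) hq by simp
        show "(\<integral>\<^sup>+x\<in>ann z (rad r (Suc k)). ennreal (osc z r x powr (s / (s - 1))) \<partial>M)
          \<le> ennreal ((Cs * (real k + 3) * h ^ Suc k) powr (s / (s - 1)) * V z (rad r (Suc k)))" for k
          unfolding h_def by (rule Cs(2)[OF r])
      qed auto
      also have "\<dots> \<le> (\<Sum>k. ennreal (G * ((real k + 3) * (h * q) ^ Suc k)))"
      proof (intro suminf_le allI ennreal_leI)
        fix k
        have "C1 * q ^ Suc k * (\<integral>x. norm (a x) \<partial>M) \<le> C1 * q ^ Suc k * 3"
          using a3 C1 hq by (intro mult_left_mono) auto
        moreover have "CN \<delta> * ((1 + rad r (Suc k) / \<rho> z) powr (- \<delta>) * norm (\<integral>x. a x \<partial>M)) \<le> CN \<delta> * (3 * 4 powr \<delta> * q ^ Suc k)"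
          using CN[OF \<delta>] decay_bound_noncancelling[OF a, of k] unfolding q_def by (intro mult_left_mono) auto
        ultimately have "C1 * q ^ Suc k * (\<integral>x. norm (a x) \<partial>M) + CN \<delta> * (1 + rad r (Suc k) / \<rho> z) powr (- \<delta>) * norm (\<integral>x. a x \<partial>M)
          \<le> 3 * (C1 + CN \<delta> * 4 powr \<delta>) * q ^ Suc k" by (simp add: algebra_simps)
        moreover have "0 \<le> 2 * (Cs * (real k + 3) * h ^ Suc k)" using Cs(1) hq by simp
        ultimately have "2 * (Cs * (real k + 3) * h ^ Suc k) * (C1 * q ^ Suc k * (\<integral>x. norm (a x) \<partial>M) + CN \<delta> * (1 + rad r (Suc k) / \<rho> z) powr (- \<delta>) * norm (\<integral>x. a x \<partial>M))
          \<le> 2 * (Cs * (real k + 3) * h ^ Suc k) * (3 * (C1 + CN \<delta> * 4 powr \<delta>) * q ^ Suc k)" by (rule mult_left_mono)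
        also have "\<dots> = G * ((real k + 3) * (h * q) ^ Suc k)" unfolding G_def power_mult_distrib by (simp only: mult_ac)
        finally show "2 * (Cs * (real k + 3) * h ^ Suc k) * (C1 * q ^ Suc k * (\<integral>x. norm (a x) \<partial>M) + CN \<delta> * (1 + rad r (Suc k) / \<rho> z) powr (- \<delta>) * norm (\<integral>x. a x \<partial>M))
          \<le> G * ((real k + 3) * (h * q) ^ Suc k)" .
      qed auto
      also have "\<dots> \<le> ennreal Cf"
      proof (rule ennreal_suminf_le)
        show "0 \<le> G * ((real k + 3) * (h * q) ^ Suc k)" for k using G hq by simp
        show "summable (\<lambda>k. G * ((real k + 3) * (h * q) ^ Suc k))" by (rule summable_mult[OF sum])
        show "(\<Sum>k. G * ((real k + 3) * (h * q) ^ Suc k)) \<le> Cf" unfolding Cf_def by (rule eq_refl[OF suminf_mult[OF sum]])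
      qed
      finally show ?thesis .
    qed
    have "(\<integral>\<^sup>+x. ennreal (osc z r x * norm (S a x)) \<partial>M)
      \<le> (\<integral>\<^sup>+x\<in>B z (2 * \<kappa> * r). ennreal (osc z r x * norm (S a x)) \<partial>M) + (\<integral>\<^sup>+x\<in>{x. 2 * \<kappa> * r \<le> d x z}. ennreal (osc z r x * norm (S a x)) \<partial>M)"
      by (intro nn_integral_Un_le cover_near_far) measurable
    also have "\<dots> \<le> ennreal (Q1 + Cn) + ennreal Cf" by (rule add_mono[OF near far])
    also have "\<dots> = ennreal (Q1 + Cn + Cf)" using Q1 Cn(1) Cf by (intro ennreal_plus[symmetric]) auto
    also have "\<dots> \<le> ennreal C" using \<open>0 < Ca\<close> by (intro ennreal_leI) (simp add: C_def)
    finally show "(\<integral>\<^sup>+x. ennreal (osc z r x * norm (S a x)) \<partial>M) \<le> ennreal C" .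
  qed
qed

text \<open>The condition on \<open>v\<close> covers \<open>b\<close> minus its mean as well as the
  difference of their images under the 2-Lipschitz map \<open>pr n\<close>, so one estimate serves
  the truncations and their limit.\<close>

lemma natom_times_integrable:
  assumes a: "natom z r a" and [measurable]: "v \<in> borel_measurable M" and v: "\<And>x. norm (v x) \<le> 2 * osc z r x"
    and C: "0 \<le> C" "(\<integral>\<^sup>+x. ennreal (osc z r x * norm (a x)) \<partial>M) \<le> ennreal C"
  shows "integrable M (\<lambda>x. v x * a x)" "(\<integral>x. norm (v x * a x) \<partial>M) \<le> 2 * C"
proof -
  have [measurable]: "a \<in> borel_measurable M" using a unfolding natom_def by blast
  have "(\<integral>\<^sup>+x. ennreal (norm (v x * a x)) \<partial>M) \<le> (\<integral>\<^sup>+x. 2 * ennreal (osc z r x * norm (a x)) \<partial>M)"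
  proof (rule nn_integral_mono)
    fix x
    have "norm (v x * a x) \<le> 2 * (osc z r x * norm (a x))"
      using mult_right_mono[OF v[of x], of "norm (a x)"] by (simp add: norm_mult)
    then have "ennreal (norm (v x * a x)) \<le> ennreal (2 * (osc z r x * norm (a x)))" by (rule ennreal_leI)
    also have "\<dots> = 2 * ennreal (osc z r x * norm (a x))" by (subst ennreal_mult') auto
    finally show "ennreal (norm (v x * a x)) \<le> 2 * ennreal (osc z r x * norm (a x))" .
  qed
  also have "\<dots> = 2 * (\<integral>\<^sup>+x. ennreal (osc z r x * norm (a x)) \<partial>M)" by (rule nn_integral_cmult) measurable
  also have "\<dots> \<le> 2 * ennreal C" by (rule mult_left_mono[OF C(2)]) simp
  also have "\<dots> = ennreal (2 * C)" by (subst ennreal_mult') auto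
  finally have le: "(\<integral>\<^sup>+x. ennreal (norm (v x * a x)) \<partial>M) \<le> ennreal (2 * C)" .
  then show i: "integrable M (\<lambda>x. v x * a x)"
    by (intro integrableI_bounded) (auto intro: le_less_trans)
  have "ennreal (\<integral>x. norm (v x * a x) \<partial>M) = (\<integral>\<^sup>+x. ennreal (norm (v x * a x)) \<partial>M)"
    using i by (intro nn_integral_eq_integral[symmetric] integrable_norm) auto
  then have "ennreal (\<integral>x. norm (v x * a x) \<partial>M) \<le> ennreal (2 * C)" using le by (simp only:)
  then show "(\<integral>x. norm (v x * a x) \<partial>M) \<le> 2 * C" using C(1) by (subst (asm) ennreal_le_iff) auto
qed

text \<open>By Young's inequality with exponents \<open>E = p / e\<close> and \<open>E'\<close>, the
  scaled product of \<open>v\<close> and the atom is integrable with an exponent \<open>e\<close>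
  strictly between 1 and \<open>p\<close>. That leaves room for \<open>S_near\<close> to end at
  exponent 1.\<close>

lemma near_product:
  obtains C where "0 < C" "\<And>z r a v. natom z r a \<Longrightarrow> v \<in> borel_measurable M \<Longrightarrow> (\<And>x. norm (v x) \<le> 2 * osc z r x) \<Longrightarrow>
    integrable M (\<lambda>x. v x * a x) \<Longrightarrow>
    (\<integral>\<^sup>+x\<in>B z (2 * \<kappa> * r). ennreal (norm (S (\<lambda>x. v x * a x) x)) \<partial>M) \<le> ennreal C"
proof -
  define e where "e = (1 + p) / 2"
  have e: "1 < e" "e < p" using p by (auto simp: e_def)
  define E where "E = p / e"
  have E: "1 < E" using e by (simp add: E_def)
  define E' where "E' = E / (E - 1)"
  have E': "1 < E'" "1 / E' + 1 / E = 1" using conjugate_exponent[OF E] by (auto simp: E'_def)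
  have eE: "1 \<le> e * E'" using e E' mult_mono[of 1 e 1 E'] by auto
  obtain Co where Co: "0 < Co" "\<And>z r k. 0 < r \<Longrightarrow> r < \<rho> z \<Longrightarrow>
    (\<integral>\<^sup>+y\<in>B z (rad r k). ennreal (osc z r y powr (e * E')) \<partial>M)
    \<le> ennreal ((Co * (real k + 1) * ((2 * \<kappa>) powr \<tau>) ^ k) powr (e * E') * V z (rad r k))"
    by (rule oscillation_growth[OF eE]) blast
  define Q where "Q = 2 powr (e * E') * Co powr (e * E') + 2"
  have Q: "0 \<le> Q" by (simp add: Q_def)
  obtain C where C: "0 < C" "\<And>z r f. 0 < r \<Longrightarrow> integrable M f \<Longrightarrow>
    (\<integral>\<^sup>+x. ennreal ((V z r * norm (f x)) powr e) \<partial>M) \<le> ennreal (Q * V z r) \<Longrightarrow>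
    (\<integral>\<^sup>+x\<in>B z (2 * \<kappa> * r). ennreal ((V z r * norm (S f x)) powr 1) \<partial>M) \<le> ennreal (C * V z r)"
    by (rule S_near[of e 1 Q]) (use p e Q in auto)
  have "(\<integral>\<^sup>+x\<in>B z (2 * \<kappa> * r). ennreal (norm (S (\<lambda>x. v x * a x) x)) \<partial>M) \<le> ennreal C"
    if a: "natom z r a" and vm[measurable]: "v \<in> borel_measurable M" and v: "\<And>x. norm (v x) \<le> 2 * osc z r x"
      and fi: "integrable M (\<lambda>x. v x * a x)" for z r a v
  proof -
    define f where "f x = v x * a x" for x
    have [measurable]: "a \<in> borel_measurable M" and r: "0 < r" "r < \<rho> z" and out: "\<And>x. x \<notin> B z r \<Longrightarrow> a x = 0"
      and ap: "(\<integral>\<^sup>+x. ennreal ((V z r * norm (a x)) powr p) \<partial>M) \<le> ennreal (2 * V z r)"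
      using a unfolding natom_def by blast+
    have f: "integrable M f" unfolding f_def by (rule fi)
    note [measurable] = S_measurable[OF f]
    have V: "0 < V z r" by (rule V_pos[OF r(1)])
    have "(\<integral>\<^sup>+x. ennreal ((V z r * norm (f x)) powr e) \<partial>M)
      \<le> (\<integral>\<^sup>+x. ennreal (2 powr (e * E')) * (ennreal (osc z r x powr (e * E')) * indicator (B z r) x) + ennreal ((V z r * norm (a x)) powr p) \<partial>M)"
    proof (rule nn_integral_mono)
      fix x
      show "ennreal ((V z r * norm (f x)) powr e) \<le> ennreal (2 powr (e * E')) * (ennreal (osc z r x powr (e * E')) * indicator (B z r) x) + ennreal ((V z r * norm (a x)) powr p)"
      proof (cases "x \<in> B z r")
        case True
        have "V z r * norm (f x) = norm (v x) * (V z r * norm (a x))" by (simp add: f_def norm_mult)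
        also have "\<dots> \<le> (2 * osc z r x) * (V z r * norm (a x))" using V by (intro mult_right_mono v) auto
        finally have "(V z r * norm (f x)) powr e \<le> ((2 * osc z r x) * (V z r * norm (a x))) powr e"
          using V e by (intro powr_mono2) auto
        also have "\<dots> = (2 * osc z r x) powr e * (V z r * norm (a x)) powr e" by (rule powr_mult)
        also have "\<dots> \<le> ((2 * osc z r x) powr e) powr E' + ((V z r * norm (a x)) powr e) powr E"
          using E E' by (intro Young_le) auto
        also have "((2 * osc z r x) powr e) powr E' = 2 powr (e * E') * osc z r x powr (e * E')"
          by (simp only: powr_powr powr_mult)
        also have "((V z r * norm (a x)) powr e) powr E = (V z r * norm (a x)) powr p"
          using e by (simp add: powr_powr E_def)
        finally have "ennreal ((V z r * norm (f x)) powr e) \<le> ennreal (2 powr (e * E') * osc z r x powr (e * E') + (V z r * norm (a x)) powr p)"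
          by (rule ennreal_leI)
        also have "\<dots> = ennreal (2 powr (e * E')) * ennreal (osc z r x powr (e * E')) + ennreal ((V z r * norm (a x)) powr p)"
          by (subst ennreal_plus) (auto simp: ennreal_mult')
        finally show ?thesis using True by simp
      next
        case False
        then show ?thesis using out[of x] by (simp add: f_def)
      qed
    qed
    also have "\<dots> = ennreal (2 powr (e * E')) * (\<integral>\<^sup>+x\<in>B z r. ennreal (osc z r x powr (e * E')) \<partial>M) + (\<integral>\<^sup>+x. ennreal ((V z r * norm (a x)) powr p) \<partial>M)"
      by (subst nn_integral_add) (auto simp: nn_integral_cmult)
    also have "\<dots> \<le> ennreal (2 powr (e * E')) * ennreal (Co powr (e * E') * V z r) + ennreal (2 * V z r)"
      using Co(2)[OF r, of 0] by (intro add_mono mult_left_mono ap) auto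
    also have "\<dots> = ennreal (Q * V z r)"
      using V by (simp add: Q_def ennreal_mult'[symmetric] ennreal_plus[symmetric] algebra_simps del: ennreal_plus)
    finally have "(\<integral>\<^sup>+x\<in>B z (2 * \<kappa> * r). ennreal ((V z r * norm (S f x)) powr 1) \<partial>M) \<le> ennreal (C * V z r)"
      by (rule C(2)[OF r(1) f])
    then have scaled: "(\<integral>\<^sup>+x\<in>B z (2 * \<kappa> * r). ennreal (V z r * norm (S f x)) \<partial>M) \<le> ennreal (C * V z r)"
      using V by simp
    have "(\<integral>\<^sup>+x\<in>B z (2 * \<kappa> * r). ennreal (norm (S f x)) \<partial>M) \<le> ennreal C"
      by (rule nn_integral_unscale[OF _ V scaled]) measurable
    then show ?thesis by (simp only: f_def[abs_def])
  qed
  with C(1) show ?thesis by (rule that)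
qed

text \<open>The logarithmic oscillation bound on balls of atoms. There \<open>r < \<rho> z\<close>,
  so the polynomial factor of the norm is bounded and only the logarithm remains.\<close>

definition log_osc :: "real \<Rightarrow> bool" where
  "log_osc A \<longleftrightarrow> 0 < A \<and> (\<forall>z r. 0 < r \<longrightarrow> r < \<rho> z \<longrightarrow> MO_le b (A / ln (exp 1 + \<rho> z / r)) z r)"

lemma ln_weight_ge_1: "0 < r \<Longrightarrow> 1 \<le> ln (exp 1 + \<rho> z / r)"
proof -
  assume "0 < r"
  then have "ln (exp 1) \<le> ln (exp 1 + \<rho> z / r)"
    using rho_pos[of z] by (intro ln_mono) (auto intro: add_pos_pos)
  then show ?thesis by simp
qed

text \<open>The bound in \<open>natom_product\<close> is not homogeneous in the weight: its summand
  2 stays even for a small weight. So the oscillation is multiplied by the logarithm before the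
  pairing, and the logarithm is divided out afterwards.\<close>

lemma natom_log_mean:
  assumes log: "log_osc A"
  obtains C where "0 < C" "\<And>z r a. natom z r a \<Longrightarrow>
    (\<integral>\<^sup>+x. ennreal (osc z r x * norm (a x)) \<partial>M) \<le> ennreal (C / ln (exp 1 + \<rho> z / r))"
proof -
  define p' where "p' = p / (p - 1)"
  have p': "1 < p'" using conjugate_exponent(1)[OF p(1)] by (simp add: p'_def)
  have "0 < p'" using p' by simp
  from John_Nirenberg[OF this, where 'k = 'k]
  obtain CJ where CJ: "0 < CJ" "\<And>A x R. 0 < A \<Longrightarrow> 0 < R \<Longrightarrow> MO_le b A x R \<Longrightarrow>
    (\<integral>\<^sup>+y\<in>B x R. ennreal (norm (b y - ball_mean d M b x R) powr p') \<partial>M) \<le> ennreal (CJ * A powr p' * V x R)"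
    using b by blast
  have A: "0 < A" using log by (simp add: log_osc_def)
  define Q where "Q = CJ * A powr p'"
  have Q: "0 \<le> Q" using CJ(1) by (simp add: Q_def)
  have "(\<integral>\<^sup>+x. ennreal (osc z r x * norm (a x)) \<partial>M) \<le> ennreal ((Q + 2) / ln (exp 1 + \<rho> z / r))" if a: "natom z r a" for z r a
  proof -
    have am[measurable]: "a \<in> borel_measurable M" and r: "0 < r" "r < \<rho> z" using a unfolding natom_def by blast+
    define l where "l = ln (exp 1 + \<rho> z / r)"
    have l: "1 \<le> l" unfolding l_def by (rule ln_weight_ge_1[OF r(1)])
    then have l0: "0 < l" by simp
    have "(\<integral>\<^sup>+x. ennreal ((l * osc z r x) * norm (a x)) \<partial>M) \<le> ennreal (Q + 2)"
    proof (rule natom_product[OF a _ _ Q])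
      have "MO_le b (A / l) z r" using log r unfolding log_osc_def l_def by blast
      then have J: "(\<integral>\<^sup>+y\<in>B z r. ennreal (osc z r y powr p') \<partial>M) \<le> ennreal (CJ * (A / l) powr p' * V z r)"
        using A l0 r by (intro CJ(2)) auto
      have "(\<integral>\<^sup>+x\<in>B z r. ennreal ((l * osc z r x) powr p') \<partial>M) = ennreal (l powr p') * (\<integral>\<^sup>+y\<in>B z r. ennreal (osc z r y powr p') \<partial>M)"
        by (subst nn_integral_cmult[symmetric]) (auto simp: powr_mult ennreal_mult' mult.assoc)
      also have "\<dots> \<le> ennreal (l powr p') * ennreal (CJ * (A / l) powr p' * V z r)" by (rule mult_left_mono[OF J]) simp
      also have "\<dots> = ennreal (l powr p' * (CJ * (A / l) powr p' * V z r))" by (rule ennreal_mult'[symmetric]) simp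
      also have "l powr p' * (CJ * (A / l) powr p' * V z r) = Q * V z r"
        using l0 A by (simp add: Q_def powr_divide)
      finally show "(\<integral>\<^sup>+x\<in>B z r. ennreal ((l * osc z r x) powr (p / (p - 1))) \<partial>M) \<le> ennreal (Q * V z r)"
        by (simp only: p'_def)
    qed (use l0 in auto)
    then have scaled: "(\<integral>\<^sup>+x\<in>space M. ennreal (l * (osc z r x * norm (a x))) \<partial>M) \<le> ennreal ((Q + 2) / l * l)"
      using l0 by (simp add: space_eq mult.assoc)
    have "(\<integral>\<^sup>+x\<in>space M. ennreal (osc z r x * norm (a x)) \<partial>M) \<le> ennreal ((Q + 2) / l)"
      by (rule nn_integral_unscale[OF _ l0 scaled]) measurable
    then show ?thesis by (simp add: space_eq l_def)
  qed
  moreover have "0 < Q + 2" using Q by simp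
  ultimately show ?thesis using that by blast
qed

text \<open>The product \<open>v a\<close> is supported like an atom, but its mean need not vanish
  even if that of \<open>a\<close> does. Its norm is summed against the smoothness gains; its mean
  meets the size bound with \<open>N = 1\<close>, whose sum over the annuli is at most four times
  the logarithm that the mean carries in its denominator.\<close>

theorem atom_log_bound:
  assumes log: "log_osc A"
  obtains C where "0 < C" "\<And>z r a v. natom z r a \<Longrightarrow> v \<in> borel_measurable M \<Longrightarrow> (\<And>x. norm (v x) \<le> 2 * osc z r x) \<Longrightarrow>
    (\<integral>\<^sup>+x. ennreal (norm (S (\<lambda>x. v x * a x) x)) \<partial>M) \<le> ennreal C"
proof -
  obtain C0 where C0: "0 < C0" "\<And>z r a. natom z r a \<Longrightarrow> (\<integral>\<^sup>+x. ennreal (osc z r x * norm (a x)) \<partial>M) \<le> ennreal C0"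
    by (rule atom_bounds) blast
  obtain Cm where Cm: "0 < Cm" "\<And>z r a. natom z r a \<Longrightarrow>
    (\<integral>\<^sup>+x. ennreal (osc z r x * norm (a x)) \<partial>M) \<le> ennreal (Cm / ln (exp 1 + \<rho> z / r))"
    by (rule natom_log_mean[OF log]) blast
  obtain Cn where Cn: "0 < Cn" "\<And>z r a v. natom z r a \<Longrightarrow> v \<in> borel_measurable M \<Longrightarrow> (\<And>x. norm (v x) \<le> 2 * osc z r x) \<Longrightarrow>
    integrable M (\<lambda>x. v x * a x) \<Longrightarrow>
    (\<integral>\<^sup>+x\<in>B z (2 * \<kappa> * r). ennreal (norm (S (\<lambda>x. v x * a x) x)) \<partial>M) \<le> ennreal Cn"
    by (rule near_product) blast
  define q where "q = (2 * \<kappa>) powr (- \<delta>)"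
  have q: "0 < q" using kappa_pos by (simp add: q_def)
  define Sq where "Sq = (\<Sum>k. q ^ Suc k)"
  have Sq: "(\<Sum>k<n. q ^ Suc k) \<le> Sq" for n
    unfolding Sq_def using summable_decay q by (intro sum_le_suminf) (auto simp: q_def)
  have Sq0: "0 \<le> Sq" using Sq[of 0] by simp
  define D where "D = dbl (2 * \<kappa>)"
  have D: "0 < D" unfolding D_def by (rule dbl_pos)
  have c2: "2 \<le> 2 * \<kappa>" using kappa_ge_1 by simp
  \<comment> \<open>\<open>2 * C0\<close> bounds the L1 norm of the product, \<open>2 * Cm\<close>
    its mean times the logarithm, and 4 is the constant of the logarithmic sum.\<close>
  define Cf where "Cf = 2 * D * (C1 * (2 * C0) * Sq + CN 1 * (2 * Cm) * 4)"
  have Cf: "0 \<le> Cf" using D C1 C0(1) Sq0 CN[of 1] Cm(1) by (simp add: Cf_def)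
  show ?thesis
  proof (rule that[of "Cn + Cf"])
    show "0 < Cn + Cf" using Cn(1) Cf by simp
    fix z r a and v :: "'a \<Rightarrow> 'k"
    assume a: "natom z r a" and vm[measurable]: "v \<in> borel_measurable M" and v: "\<And>x. norm (v x) \<le> 2 * osc z r x"
    have am[measurable]: "a \<in> borel_measurable M" and r: "0 < r" "r < \<rho> z" and out: "\<And>x. x \<notin> B z r \<Longrightarrow> a x = 0"
      using a unfolding natom_def by blast+
    define l where "l = ln (exp 1 + \<rho> z / r)"
    have l: "1 \<le> l" unfolding l_def by (rule ln_weight_ge_1[OF r(1)])
    define f where "f x = v x * a x" for x
    have fi: "integrable M f" and f1: "(\<integral>x. norm (f x) \<partial>M) \<le> 2 * C0"
      unfolding f_def using natom_times_integrable[OF a vm v _ C0(2)[OF a]] C0(1) by auto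
    have "0 \<le> Cm / l" using Cm(1) l by simp
    from natom_times_integrable(2)[OF a vm v this] Cm(2)[OF a]
    have f2: "(\<integral>x. norm (f x) \<partial>M) \<le> 2 * (Cm / l)" by (simp add: f_def l_def)
    have m: "norm (\<integral>x. f x \<partial>M) \<le> 2 * (Cm / l)" using integral_norm_bound[of M f] f2 by linarith
    note [measurable] = S_measurable[OF fi]
    have near: "(\<integral>\<^sup>+x\<in>B z (2 * \<kappa> * r). ennreal (norm (S f x)) \<partial>M) \<le> ennreal Cn"
      using Cn(2)[OF a vm v] fi by (simp add: f_def[abs_def])
    have far: "(\<integral>\<^sup>+x\<in>{x. 2 * \<kappa> * r \<le> d x z}. ennreal (norm (S f x)) \<partial>M) \<le> ennreal Cf"
    proof -
      have s': "1 \<le> s / (s - 1)" using conjugate_exponent(1)[OF s] by simp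
      have "(\<integral>\<^sup>+x\<in>{x. 2 * \<kappa> * r \<le> d x z}. ennreal (1 * norm (S f x)) \<partial>M)
        \<le> (\<Sum>k. ennreal (2 * D * (C1 * q ^ Suc k * (\<integral>x. norm (f x) \<partial>M)
          + CN 1 * (1 + rad r (Suc k) / \<rho> z) powr (- 1) * norm (\<integral>x. f x \<partial>M))))"
        unfolding q_def D_def
        by (intro S_far[OF fi _ r(1)] nn_integral_ann_one_le s' dbl_pos less_imp_le[OF rad_pos[OF r(1)]]) (auto simp: f_def out)
      also have "\<dots> \<le> ennreal Cf"
      proof (rule suminf_le_const)
        fix n
        have nn: "0 \<le> 1 + rad r (Suc k) / \<rho> z" for k
          using rad_pos[OF r(1), of "Suc k"] rho_pos[of z] by (intro add_nonneg_nonneg divide_nonneg_nonneg) auto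
        have "(\<Sum>k<n. ennreal (2 * D * (C1 * q ^ Suc k * (\<integral>x. norm (f x) \<partial>M)
          + CN 1 * (1 + rad r (Suc k) / \<rho> z) powr (- 1) * norm (\<integral>x. f x \<partial>M))))
          = ennreal (\<Sum>k<n. 2 * D * (C1 * q ^ Suc k * (\<integral>x. norm (f x) \<partial>M)
          + CN 1 * (1 + rad r (Suc k) / \<rho> z) powr (- 1) * norm (\<integral>x. f x \<partial>M)))"
          using D C1 q CN[of 1] by (intro sum_ennreal mult_nonneg_nonneg add_nonneg_nonneg) auto
        also have "\<dots> \<le> ennreal Cf"
        proof (rule ennreal_leI)
          have "(\<Sum>k<n. 2 * D * (C1 * q ^ Suc k * (\<integral>x. norm (f x) \<partial>M)
            + CN 1 * (1 + rad r (Suc k) / \<rho> z) powr (- 1) * norm (\<integral>x. f x \<partial>M)))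
            = (\<Sum>k<n. 2 * D * (C1 * (\<integral>x. norm (f x) \<partial>M)) * q ^ Suc k + 2 * D * (CN 1 * norm (\<integral>x. f x \<partial>M)) * (1 / (1 + (2 * \<kappa>) ^ Suc k * (r / \<rho> z))))"
          proof (rule sum.cong[OF refl])
            fix k
            have "(1 + rad r (Suc k) / \<rho> z) powr (- 1) = 1 / (1 + (2 * \<kappa>) ^ Suc k * (r / \<rho> z))"
              using nn[of k] by (simp add: powr_minus_divide)
            then show "2 * D * (C1 * q ^ Suc k * (\<integral>x. norm (f x) \<partial>M) + CN 1 * (1 + rad r (Suc k) / \<rho> z) powr (- 1) * norm (\<integral>x. f x \<partial>M))
              = 2 * D * (C1 * (\<integral>x. norm (f x) \<partial>M)) * q ^ Suc k + 2 * D * (CN 1 * norm (\<integral>x. f x \<partial>M)) * (1 / (1 + (2 * \<kappa>) ^ Suc k * (r / \<rho> z)))"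
              by (simp only: distrib_left mult_ac)
          qed
          also have "\<dots> = 2 * D * (C1 * (\<integral>x. norm (f x) \<partial>M)) * (\<Sum>k<n. q ^ Suc k)
            + 2 * D * (CN 1 * norm (\<integral>x. f x \<partial>M)) * (\<Sum>k<n. 1 / (1 + (2 * \<kappa>) ^ Suc k * (r / \<rho> z)))"
            by (simp only: sum.distrib sum_distrib_left)
          also have "\<dots> \<le> 2 * D * (C1 * (2 * C0)) * Sq + 2 * D * (CN 1 * (2 * (Cm / l))) * (4 * l)"
          proof (rule add_mono)
            show "2 * D * (C1 * (\<integral>x. norm (f x) \<partial>M)) * (\<Sum>k<n. q ^ Suc k) \<le> 2 * D * (C1 * (2 * C0)) * Sq"
              using D C1 C0(1) q f1 Sq by (intro mult_mono mult_left_mono sum_nonneg) auto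
            have "(\<Sum>k<n. 1 / (1 + (2 * \<kappa>) ^ Suc k * (r / \<rho> z))) \<le> 4 * ln (exp 1 + 1 / (r / \<rho> z))"
              using r rho_pos[of z] by (intro sum_inverse_geometric_le_ln c2) auto
            then have le: "(\<Sum>k<n. 1 / (1 + (2 * \<kappa>) ^ Suc k * (r / \<rho> z))) \<le> 4 * l" by (simp add: l_def)
            have "0 \<le> (\<Sum>k<n. 1 / (1 + (2 * \<kappa>) ^ Suc k * (r / \<rho> z)))"
              using nn by (intro sum_nonneg) simp
            then show "2 * D * (CN 1 * norm (\<integral>x. f x \<partial>M)) * (\<Sum>k<n. 1 / (1 + (2 * \<kappa>) ^ Suc k * (r / \<rho> z))) \<le> 2 * D * (CN 1 * (2 * (Cm / l))) * (4 * l)"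
              using D CN[of 1] m le Cm(1) l by (intro mult_mono mult_left_mono) auto
          qed
          also have "\<dots> = Cf" using l by (simp add: Cf_def distrib_left)
          finally show "(\<Sum>k<n. 2 * D * (C1 * q ^ Suc k * (\<integral>x. norm (f x) \<partial>M)
            + CN 1 * (1 + rad r (Suc k) / \<rho> z) powr (- 1) * norm (\<integral>x. f x \<partial>M))) \<le> Cf" .
        qed
        finally show "(\<Sum>k<n. ennreal (2 * D * (C1 * q ^ Suc k * (\<integral>x. norm (f x) \<partial>M)
          + CN 1 * (1 + rad r (Suc k) / \<rho> z) powr (- 1) * norm (\<integral>x. f x \<partial>M)))) \<le> ennreal Cf" .
      qed simp
      finally show ?thesis by simp
    qed
    have "(\<integral>\<^sup>+x. ennreal (norm (S f x)) \<partial>M) \<le> (\<integral>\<^sup>+x\<in>B z (2 * \<kappa> * r). ennreal (norm (S f x)) \<partial>M) + (\<integral>\<^sup>+x\<in>{x. 2 * \<kappa> * r \<le> d x z}. ennreal (norm (S f x)) \<partial>M)"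
      by (intro nn_integral_Un_le cover_near_far) measurable
    also have "\<dots> \<le> ennreal Cn + ennreal Cf" by (rule add_mono[OF near far])
    also have "\<dots> = ennreal (Cn + Cf)" using Cn(1) Cf by (intro ennreal_plus[symmetric]) auto
    finally show "(\<integral>\<^sup>+x. ennreal (norm (S (\<lambda>x. v x * a x) x)) \<partial>M) \<le> ennreal (Cn + Cf)"
      by (simp only: f_def[abs_def])
  qed
qed

end

section \<open>The commutator as a limit of truncations\<close>

lemma L1_series_AE_summable:
  fixes F :: "nat \<Rightarrow> 'a \<Rightarrow> 'k::{banach, second_countable_topology}"
  assumes [measurable]: "\<And>j. F j \<in> borel_measurable M"
    and le: "\<And>j. (\<integral>\<^sup>+y. ennreal (norm (F j y)) \<partial>M) \<le> ennreal (x j)" and x: "\<And>j. 0 \<le> x j" "summable x"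
  shows "AE y in M. summable (\<lambda>j. norm (F j y))"
proof -
  have "(\<integral>\<^sup>+y. (\<Sum>j. ennreal (norm (F j y))) \<partial>M) = (\<Sum>j. \<integral>\<^sup>+y. ennreal (norm (F j y)) \<partial>M)"
    by (rule nn_integral_suminf) measurable
  also have "\<dots> \<le> (\<Sum>j. ennreal (x j))" by (intro suminf_le allI le) auto
  also have "\<dots> = ennreal (suminf x)" by (rule suminf_ennreal2[OF x])
  finally have "(\<integral>\<^sup>+y. (\<Sum>j. ennreal (norm (F j y))) \<partial>M) < \<infinity>" by (auto intro: le_less_trans)
  then have "AE y in M. (\<Sum>j. ennreal (norm (F j y))) \<noteq> \<infinity>"
    by (intro nn_integral_PInf_AE) auto
  then show ?thesis
  proof eventually_elim
    fix y assume "(\<Sum>j. ennreal (norm (F j y))) \<noteq> \<infinity>"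
    then show "summable (\<lambda>j. norm (F j y))" by (intro summable_suminf_not_top) auto
  qed
qed

lemma ennreal_norm_suminf_le:
  fixes f :: "nat \<Rightarrow> 'k::banach"
  assumes "summable (\<lambda>j. norm (f j))"
  shows "ennreal (norm (suminf f)) \<le> (\<Sum>j. ennreal (norm (f j)))"
proof -
  have "ennreal (norm (suminf f)) \<le> ennreal (\<Sum>j. norm (f j))" by (intro ennreal_leI summable_norm assms)
  also have "\<dots> = (\<Sum>j. ennreal (norm (f j)))" using assms by (intro suminf_ennreal2[symmetric]) auto
  finally show ?thesis .
qed

lemma L1_series_norm_le:
  fixes F :: "nat \<Rightarrow> 'a \<Rightarrow> 'k::{banach, second_countable_topology}"
  assumes [measurable]: "\<And>j. F j \<in> borel_measurable M"
    and le: "\<And>j. (\<integral>\<^sup>+y. ennreal (norm (F j y)) \<partial>M) \<le> ennreal (x j)" and x: "\<And>j. 0 \<le> x j" "summable x"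
  shows "(\<integral>\<^sup>+y. ennreal (norm (\<Sum>j. F j y)) \<partial>M) \<le> ennreal (suminf x)"
proof -
  have "(\<integral>\<^sup>+y. ennreal (norm (\<Sum>j. F j y)) \<partial>M) \<le> (\<integral>\<^sup>+y. (\<Sum>j. ennreal (norm (F j y))) \<partial>M)"
  proof (rule nn_integral_mono_AE)
    show "AE y in M. ennreal (norm (\<Sum>j. F j y)) \<le> (\<Sum>j. ennreal (norm (F j y)))"
      using L1_series_AE_summable[OF assms] by eventually_elim (rule ennreal_norm_suminf_le)
  qed
  also have "\<dots> = (\<Sum>j. \<integral>\<^sup>+y. ennreal (norm (F j y)) \<partial>M)" by (rule nn_integral_suminf) measurable
  also have "\<dots> \<le> (\<Sum>j. ennreal (x j))" by (intro suminf_le allI le) auto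
  also have "\<dots> = ennreal (suminf x)" by (rule suminf_ennreal2[OF x])
  finally show ?thesis .
qed

lemma L1_series_partial_sums:
  fixes F :: "nat \<Rightarrow> 'a \<Rightarrow> 'k::{banach, second_countable_topology}"
  assumes [measurable]: "\<And>j. F j \<in> borel_measurable M"
    and le: "\<And>j. (\<integral>\<^sup>+y. ennreal (norm (F j y)) \<partial>M) \<le> ennreal (x j)" and x: "\<And>j. 0 \<le> x j" "summable x"
  shows "(\<lambda>m. \<integral>\<^sup>+y. ennreal (norm ((\<Sum>j<m. F j y) - (\<Sum>j. F j y))) \<partial>M) \<longlonglongrightarrow> 0"
proof (rule tendsto_sandwich[OF _ _ tendsto_const])
  have "(\<lambda>m. ennreal (\<Sum>j. x (j + m))) \<longlonglongrightarrow> ennreal 0" by (intro tendsto_ennrealI suminf_exist_split2 x)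
  then show "(\<lambda>m. ennreal (\<Sum>j. x (j + m))) \<longlonglongrightarrow> 0" by simp
  show "\<forall>\<^sub>F m in sequentially. (\<integral>\<^sup>+y. ennreal (norm ((\<Sum>j<m. F j y) - (\<Sum>j. F j y))) \<partial>M) \<le> ennreal (\<Sum>j. x (j + m))"
  proof (intro always_eventually allI)
    fix m
    have "(\<integral>\<^sup>+y. ennreal (norm ((\<Sum>j<m. F j y) - (\<Sum>j. F j y))) \<partial>M) = (\<integral>\<^sup>+y. ennreal (norm (\<Sum>j. F (j + m) y)) \<partial>M)"
    proof (rule nn_integral_cong_AE)
      show "AE y in M. ennreal (norm ((\<Sum>j<m. F j y) - (\<Sum>j. F j y))) = ennreal (norm (\<Sum>j. F (j + m) y))"
        using L1_series_AE_summable[OF assms]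
      proof eventually_elim
        fix y assume "summable (\<lambda>j. norm (F j y))"
        then have "summable (\<lambda>j. F j y)" by (rule summable_norm_cancel)
        from suminf_split_initial_segment[OF this, of m]
        show "ennreal (norm ((\<Sum>j<m. F j y) - (\<Sum>j. F j y))) = ennreal (norm (\<Sum>j. F (j + m) y))"
          by (simp add: norm_minus_commute)
      qed
    qed
    also have "\<dots> \<le> ennreal (\<Sum>j. x (j + m))"
      by (rule L1_series_norm_le) (use le x in \<open>auto simp: summable_iff_shift\<close>)
    finally show "(\<integral>\<^sup>+y. ennreal (norm ((\<Sum>j<m. F j y) - (\<Sum>j. F j y))) \<partial>M) \<le> ennreal (\<Sum>j. x (j + m))" .
  qed
qed auto

text \<open>Two dominated convergences on top of each other: Tannery's theorem for the series at
  almost every point, and Lebesgue's theorem for the integral with twice the summed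
  majorant.\<close>

lemma L1_series_dominated:
  fixes F :: "nat \<Rightarrow> nat \<Rightarrow> 'a \<Rightarrow> 'k::{banach, real_normed_field, second_countable_topology}" and A :: "nat \<Rightarrow> 'a \<Rightarrow> real"
  assumes [measurable]: "\<And>n j. F n j \<in> borel_measurable M" "\<And>j. F' j \<in> borel_measurable M" "\<And>j. A j \<in> borel_measurable M"
    and A0: "\<And>j y. 0 \<le> A j y"
    and le: "\<And>j. (\<integral>\<^sup>+y. ennreal (A j y) \<partial>M) \<le> ennreal (x j)" and x: "\<And>j. 0 \<le> x j" "summable x"
    and dom: "\<And>n j y. norm (F n j y) \<le> A j y" "\<And>j y. norm (F' j y) \<le> A j y"
    and lim: "\<And>j y. (\<lambda>n. F n j y) \<longlonglongrightarrow> F' j y"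
  shows "(\<lambda>n. \<integral>\<^sup>+y. ennreal (norm ((\<Sum>j. F n j y) - (\<Sum>j. F' j y))) \<partial>M) \<longlonglongrightarrow> 0"
proof -
  have sA: "AE y in M. summable (\<lambda>j. norm (A j y))"
    by (rule L1_series_AE_summable[where x = x]) (use A0 le x in auto)
  have "(\<lambda>n. \<integral>\<^sup>+y. ennreal (norm ((\<Sum>j. F n j y) - (\<Sum>j. F' j y))) \<partial>M) \<longlonglongrightarrow> (\<integral>\<^sup>+y. 0 \<partial>M)"
  proof (rule nn_integral_dominated_convergence[where w = "\<lambda>y. 2 * (\<Sum>j. ennreal (A j y))"])
    have "(\<integral>\<^sup>+y. (\<Sum>j. ennreal (A j y)) \<partial>M) = (\<Sum>j. \<integral>\<^sup>+y. ennreal (A j y) \<partial>M)" by (rule nn_integral_suminf) measurable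
    also have "\<dots> \<le> (\<Sum>j. ennreal (x j))" by (intro suminf_le allI le) auto
    also have "\<dots> = ennreal (suminf x)" by (rule suminf_ennreal2[OF x])
    also have "\<dots> < \<infinity>" by simp
    finally show "(\<integral>\<^sup>+y. 2 * (\<Sum>j. ennreal (A j y)) \<partial>M) < \<infinity>" by (simp add: nn_integral_cmult ennreal_mult_less_top)
    show "AE y in M. ennreal (norm ((\<Sum>j. F n j y) - (\<Sum>j. F' j y))) \<le> 2 * (\<Sum>j. ennreal (A j y))" for n
      using sA
    proof eventually_elim
      fix y assume s: "summable (\<lambda>j. norm (A j y))"
      have sF: "summable (\<lambda>j. norm (f j))" and nF: "ennreal (norm (suminf f)) \<le> (\<Sum>j. ennreal (A j y))"
        if "\<And>j. norm (f j) \<le> A j y" for f :: "nat \<Rightarrow> 'k"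
      proof -
        show sf: "summable (\<lambda>j. norm (f j))"
          by (rule summable_comparison_test[OF _ s]) (use that A0 in auto)
        have "ennreal (norm (suminf f)) \<le> (\<Sum>j. ennreal (norm (f j)))" by (rule ennreal_norm_suminf_le[OF sf])
        also have "\<dots> \<le> (\<Sum>j. ennreal (A j y))" by (intro suminf_le allI ennreal_leI that) auto
        finally show "ennreal (norm (suminf f)) \<le> (\<Sum>j. ennreal (A j y))" .
      qed
      have "ennreal (norm ((\<Sum>j. F n j y) - (\<Sum>j. F' j y))) \<le> ennreal (norm (\<Sum>j. F n j y) + norm (\<Sum>j. F' j y))"
        by (intro ennreal_leI norm_triangle_ineq4)
      also have "\<dots> = ennreal (norm (\<Sum>j. F n j y)) + ennreal (norm (\<Sum>j. F' j y))" by simp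
      also have "\<dots> \<le> (\<Sum>j. ennreal (A j y)) + (\<Sum>j. ennreal (A j y))" by (intro add_mono nF dom)
      finally show "ennreal (norm ((\<Sum>j. F n j y) - (\<Sum>j. F' j y))) \<le> 2 * (\<Sum>j. ennreal (A j y))" by (simp only: mult_2)
    qed
    show "AE y in M. (\<lambda>n. ennreal (norm ((\<Sum>j. F n j y) - (\<Sum>j. F' j y)))) \<longlonglongrightarrow> 0"
      using sA
    proof eventually_elim
      fix y assume s: "summable (\<lambda>j. norm (A j y))"
      have "(\<lambda>n. \<Sum>j. F n j y) \<longlonglongrightarrow> (\<Sum>j. F' j y)"
      proof (rule tannerys_theorem[THEN conjunct2, THEN conjunct2])
        show "(\<lambda>n. F n j y) \<longlonglongrightarrow> F' j y" for j by (rule lim)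
        show "\<forall>\<^sub>F (j, n) in at_top \<times>\<^sub>F sequentially. norm (F n j y) \<le> norm (A j y)"
          using dom A0 by (intro always_eventually) auto
      qed (use s in auto)
      then have "(\<lambda>n. norm ((\<Sum>j. F n j y) - (\<Sum>j. F' j y))) \<longlonglongrightarrow> 0" by (intro tendsto_norm_zero LIM_zero)
      then have "(\<lambda>n. ennreal (norm ((\<Sum>j. F n j y) - (\<Sum>j. F' j y)))) \<longlonglongrightarrow> ennreal 0" by (rule tendsto_ennrealI)
      then show "(\<lambda>n. ennreal (norm ((\<Sum>j. F n j y) - (\<Sum>j. F' j y)))) \<longlonglongrightarrow> 0" by simp
    qed
  qed measurable
  then show ?thesis by simp
qed

section \<open>Radial projections\<close>

definition pr :: "nat \<Rightarrow> 'k::real_normed_vector \<Rightarrow> 'k" where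
  "pr n x = (if norm x \<le> real n then x else (real n / norm x) *\<^sub>R x)"

lemma norm_pr_le: "norm (pr n x) \<le> real n"
  by (auto simp: pr_def)

lemma norm_pr_le_self: "norm (pr n x) \<le> norm x"
  by (auto simp: pr_def)

lemma pr_measurable [measurable]:
  "pr n \<in> borel_measurable (borel :: 'k::{real_normed_vector, second_countable_topology} measure)"
  unfolding pr_def by measurable

lemma pr_eventually: "\<forall>\<^sub>F n in sequentially. pr n x = x"
proof -
  obtain k :: nat where k: "norm x < real k" using reals_Archimedean2 by blast
  show ?thesis using eventually_ge_at_top[of k]
  proof eventually_elim
    fix n assume "k \<le> n"
    then have "real k \<le> real n" by simp
    then show "pr n x = x" using k by (auto simp: pr_def)
  qed
qed

lemma pr_lipschitz_aux:
  assumes "norm x \<le> real n" "real n < norm y"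
  shows "norm (x - (real n / norm y) *\<^sub>R y) \<le> 2 * norm (x - y)"
proof -
  have y: "0 < norm y" using assms by (smt (verit) of_nat_0_le_iff)
  have "y - (real n / norm y) *\<^sub>R y = (1 - real n / norm y) *\<^sub>R y" by (simp add: scaleR_diff_left)
  then have "norm (y - (real n / norm y) *\<^sub>R y) = \<bar>1 - real n / norm y\<bar> * norm y" by simp
  also have "\<dots> = norm y - real n" using assms y by (simp add: field_simps abs_of_nonneg)
  also have "\<dots> \<le> norm y - norm x" using assms by simp
  also have "\<dots> \<le> norm (x - y)" using norm_triangle_ineq2[of y x] by (simp add: norm_minus_commute)
  finally have 1: "norm (y - (real n / norm y) *\<^sub>R y) \<le> norm (x - y)" .
  have "norm (x - (real n / norm y) *\<^sub>R y) \<le> norm (x - y) + norm (y - (real n / norm y) *\<^sub>R y)"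
    using norm_triangle_ineq[of "x - y" "y - (real n / norm y) *\<^sub>R y"] by simp
  then show ?thesis using 1 by simp
qed

text \<open>For two vectors outside the ball, \<open>norm x *\<^sub>R (pr n x - pr n y)\<close> is
  \<open>real n\<close> times the sum of \<open>x - y\<close> and a multiple of \<open>y\<close>
  whose norm is the difference of the two norms. Each summand is at most
  \<open>norm (x - y)\<close>, and \<open>real n < norm x\<close>. The argument needs no inner
  product.\<close>

lemma pr_lipschitz: "norm (pr n x - pr n y) \<le> 2 * norm (x - y)"
proof -
  consider "norm x \<le> real n" "norm y \<le> real n" | "norm x \<le> real n" "real n < norm y"
    | "real n < norm x" "norm y \<le> real n" | "real n < norm x" "real n < norm y" by linarith
  then show ?thesis
  proof cases
    case 1
    then show ?thesis by (simp add: pr_def)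
  next
    case 2
    then show ?thesis using pr_lipschitz_aux[of x n y] by (simp add: pr_def)
  next
    case 3
    then show ?thesis using pr_lipschitz_aux[of y n x] by (simp add: pr_def norm_minus_commute)
  next
    case 4
    have x: "0 < norm x" and y: "0 < norm y" using 4 by (smt (verit) of_nat_0_le_iff)+
    have "norm x *\<^sub>R (pr n x - pr n y) = real n *\<^sub>R ((x - y) + ((norm y - norm x) / norm y) *\<^sub>R y)"
      using 4 x y by (simp add: pr_def scaleR_diff_right scaleR_add_right scaleR_diff_left diff_divide_distrib algebra_simps)
    then have "norm x * norm (pr n x - pr n y) = real n * norm ((x - y) + ((norm y - norm x) / norm y) *\<^sub>R y)"
      by (metis abs_norm_cancel abs_of_nat norm_scaleR)
    also have "\<dots> \<le> norm x * (norm (x - y) + norm (((norm y - norm x) / norm y) *\<^sub>R y))"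
      using 4 by (intro mult_mono norm_triangle_ineq) auto
    also have "norm (((norm y - norm x) / norm y) *\<^sub>R y) = \<bar>norm y - norm x\<bar>" using y by simp
    also have "norm x * (norm (x - y) + \<bar>norm y - norm x\<bar>) \<le> norm x * (norm (x - y) + norm (x - y))"
      using norm_triangle_ineq3[of y x] x by (intro mult_left_mono add_left_mono) (auto simp: norm_minus_commute)
    finally show ?thesis using x by (simp add: mult_le_cancel_left_pos)
  qed
qed

section \<open>Truncated commutators and their limit\<close>

context cz_commutator
begin

text \<open>Atomic decompositions in the form used by the estimates: the atoms vanish at every point
  off their balls. When a decomposition is brought into this form the coefficients stay the same, so
  their sum can still be compared with the Hardy norm.\<close>

definition ndec :: "('a \<Rightarrow> 'k) \<Rightarrow> (nat \<Rightarrow> 'k) \<Rightarrow> (nat \<Rightarrow> 'a) \<Rightarrow> (nat \<Rightarrow> real) \<Rightarrow> (nat \<Rightarrow> 'a \<Rightarrow> 'k) \<Rightarrow> bool" where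
  "ndec f c z r a \<longleftrightarrow> integrable M f \<and> (\<forall>j. natom (z j) (r j) (a j)) \<and> summable (\<lambda>j. norm (c j)) \<and>
    (\<lambda>m. \<integral>x. norm ((\<Sum>j<m. c j * a j x) - f x) \<partial>M) \<longlonglongrightarrow> 0"

definition Ut :: "nat \<Rightarrow> ('a \<Rightarrow> 'k) \<Rightarrow> 'a \<Rightarrow> 'k" where
  "Ut n f x = pr n (b x) * S f x - S (\<lambda>y. pr n (b y) * f y) x"

lemma pr_b_integrable: "integrable M f \<Longrightarrow> integrable M (\<lambda>y. pr n (b y) * f y)"
proof -
  assume f: "integrable M f"
  have "integrable M (\<lambda>y. real n * norm (f y))" using f by simp
  then show ?thesis
  proof (rule Bochner_Integration.integrable_bound)
    show "(\<lambda>y. pr n (b y) * f y) \<in> borel_measurable M" using f by measurable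
    show "AE y in M. norm (pr n (b y) * f y) \<le> norm (real n * norm (f y))"
      by (intro AE_I2) (simp add: norm_mult mult_right_mono norm_pr_le)
  qed
qed

lemma Ut_measurable: "integrable M f \<Longrightarrow> Ut n f \<in> borel_measurable M"
  unfolding Ut_def[abs_def] using S_measurable[of f] S_measurable[OF pr_b_integrable[of f n]] by measurable

lemma Ut_lin:
  assumes f: "integrable M f" and g: "integrable M g"
  shows "AE x in M. Ut n (\<lambda>y. c * f y + g y) x = c * Ut n f x + Ut n g x"
proof -
  have "AE x in M. S (\<lambda>y. c * (pr n (b y) * f y) + pr n (b y) * g y) x = c * S (\<lambda>y. pr n (b y) * f y) x + S (\<lambda>y. pr n (b y) * g y) x"
    by (intro S_lin pr_b_integrable f g)
  moreover have "(\<lambda>y. c * (pr n (b y) * f y) + pr n (b y) * g y) = (\<lambda>y. pr n (b y) * (c * f y + g y))"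
    by (simp add: fun_eq_iff algebra_simps)
  ultimately have "AE x in M. S (\<lambda>y. pr n (b y) * (c * f y + g y)) x = c * S (\<lambda>y. pr n (b y) * f y) x + S (\<lambda>y. pr n (b y) * g y) x" by simp
  then show ?thesis using S_lin[OF f g, of c]
    by eventually_elim (simp add: Ut_def algebra_simps)
qed

lemma Ut_zero: "AE x in M. Ut n (\<lambda>_. 0) x = 0"
  using Ut_lin[of "\<lambda>_. 0" "\<lambda>_. 0" n 1] by simp

lemma Ut_sum:
  assumes "finite I" "\<And>i. i \<in> I \<Longrightarrow> integrable M (f i)"
  shows "AE x in M. Ut n (\<lambda>y. \<Sum>i\<in>I. c i * f i y) x = (\<Sum>i\<in>I. c i * Ut n (f i) x)"
  using assms
proof (induction I)
  case empty
  then show ?case using Ut_zero by simp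
next
  case (insert i I)
  have "AE x in M. Ut n (\<lambda>y. c i * f i y + (\<Sum>i\<in>I. c i * f i y)) x = c i * Ut n (f i) x + Ut n (\<lambda>y. \<Sum>i\<in>I. c i * f i y) x"
    using insert.prems by (intro Ut_lin Bochner_Integration.integrable_sum integrable_mult_right) auto
  moreover have "AE x in M. Ut n (\<lambda>y. \<Sum>i\<in>I. c i * f i y) x = (\<Sum>i\<in>I. c i * Ut n (f i) x)"
    using insert.prems by (intro insert.IH) auto
  ultimately show ?case by eventually_elim (use insert.hyps in simp)
qed

text \<open>Constants commute with \<open>S\<close>, so \<open>\<beta>\<close> is free. On an atom
  it will be \<open>pr n\<close> of the mean of \<open>b\<close> over the ball of the atom.\<close>

lemma Ut_shift:
  assumes f: "integrable M f"
  shows "AE x in M. Ut n f x = (pr n (b x) - \<beta>) * S f x - S (\<lambda>y. (pr n (b y) - \<beta>) * f y) x"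
proof -
  have "AE x in M. S (\<lambda>y. pr n (b y) * f y - \<beta> * f y) x = S (\<lambda>y. pr n (b y) * f y) x - S (\<lambda>y. \<beta> * f y) x"
    using f by (intro S_diff pr_b_integrable) auto
  then show ?thesis using S_cmult[OF f, of \<beta>]
    by eventually_elim (simp add: Ut_def algebra_simps)
qed

text \<open>What truncation achieves: with \<open>n\<close> fixed, multiplication by
  \<open>pr n (b x)\<close> preserves L1 convergence as well as convergence in measure, so
  \<open>Ut n\<close> may be applied to an L1 convergent series term by term. No uniformity in
  \<open>n\<close> is claimed here.\<close>

lemma Ut_conv_measure:
  assumes f: "\<And>m. integrable M (f m)" "integrable M g"
    and lim: "(\<lambda>m. \<integral>x. norm (f m x - g x) \<partial>M) \<longlonglongrightarrow> 0"
  shows "conv_measure M (\<lambda>m. Ut n (f m)) (Ut n g)"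
proof -
  note [measurable] = S_measurable[OF f(1)] S_measurable[OF f(2)] S_measurable[OF pr_b_integrable[OF f(1)]] S_measurable[OF pr_b_integrable[OF f(2)]]
  have "(\<lambda>m. \<integral>x. norm (pr n (b x) * f m x - pr n (b x) * g x) \<partial>M) \<longlonglongrightarrow> 0"
  proof (rule tendsto_sandwich[OF _ _ tendsto_const])
    show "(\<lambda>m. real n * (\<integral>x. norm (f m x - g x) \<partial>M)) \<longlonglongrightarrow> 0"
      using tendsto_mult_left[OF lim, of "real n"] by simp
    show "\<forall>\<^sub>F m in sequentially. (\<integral>x. norm (pr n (b x) * f m x - pr n (b x) * g x) \<partial>M) \<le> real n * (\<integral>x. norm (f m x - g x) \<partial>M)"
    proof (intro always_eventually allI)
      fix m
      have i: "integrable M (\<lambda>x. norm (f m x - g x))" using f by simp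
      have "(\<integral>x. norm (pr n (b x) * f m x - pr n (b x) * g x) \<partial>M) \<le> (\<integral>x. real n * norm (f m x - g x) \<partial>M)"
      proof (rule integral_mono)
        show "integrable M (\<lambda>x. norm (pr n (b x) * f m x - pr n (b x) * g x))"
          using pr_b_integrable[OF f(1)] pr_b_integrable[OF f(2)] by simp
        show "integrable M (\<lambda>x. real n * norm (f m x - g x))" using i by simp
        fix x
        have "norm (pr n (b x) * f m x - pr n (b x) * g x) = norm (pr n (b x)) * norm (f m x - g x)"
          by (simp add: right_diff_distrib[symmetric] norm_mult)
        also have "\<dots> \<le> real n * norm (f m x - g x)" by (intro mult_right_mono norm_pr_le) simp
        finally show "norm (pr n (b x) * f m x - pr n (b x) * g x) \<le> real n * norm (f m x - g x)" .
      qed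
      then show "(\<integral>x. norm (pr n (b x) * f m x - pr n (b x) * g x) \<partial>M) \<le> real n * (\<integral>x. norm (f m x - g x) \<partial>M)" by simp
    qed
  qed auto
  then have "conv_measure M (\<lambda>m. S (\<lambda>x. pr n (b x) * f m x)) (S (\<lambda>x. pr n (b x) * g x))"
    by (intro S_conv_measure pr_b_integrable f)
  moreover have "conv_measure M (\<lambda>m x. pr n (b x) * S (f m) x) (\<lambda>x. pr n (b x) * S g x)"
    by (rule conv_measure_mult_bounded[where C = "real n"]) (auto intro: S_conv_measure f lim norm_pr_le)
  ultimately show ?thesis
    unfolding Ut_def[abs_def] by (intro conv_measure_diff) auto
qed

text \<open>Limits in measure are unique up to null sets, so the choice is harmless: by
  \<open>U_props\<close> any limit that is known explicitly may stand in for
  \<open>U f\<close>.\<close>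

definition U :: "('a \<Rightarrow> 'k) \<Rightarrow> 'a \<Rightarrow> 'k" where
  "U f = (SOME h. h \<in> borel_measurable M \<and> conv_measure M (\<lambda>n. Ut n f) h)"

lemma U_props:
  assumes "h \<in> borel_measurable M" "conv_measure M (\<lambda>n. Ut n f) h" "integrable M f"
  shows "U f \<in> borel_measurable M" "conv_measure M (\<lambda>n. Ut n f) (U f)" "AE x in M. U f x = h x"
proof -
  have *: "U f \<in> borel_measurable M \<and> conv_measure M (\<lambda>n. Ut n f) (U f)"
    unfolding U_def by (rule someI[of _ h]) (use assms in auto)
  then show "U f \<in> borel_measurable M" "conv_measure M (\<lambda>n. Ut n f) (U f)" by auto
  show "AE x in M. U f x = h x"
    by (rule conv_measure_unique[of M "\<lambda>n. Ut n f"]) (use * assms Ut_measurable[OF assms(3)] in auto)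
qed

lemma U_lin:
  assumes f: "integrable M f" "hf \<in> borel_measurable M" "conv_measure M (\<lambda>n. Ut n f) hf"
    and g: "integrable M g" "hg \<in> borel_measurable M" "conv_measure M (\<lambda>n. Ut n g) hg"
  shows "AE x in M. U (\<lambda>y. c * f y + g y) x = c * U f x + U g x"
proof (rule U_props(3))
  note Uf = U_props[OF f(2,3,1)] and Ug = U_props[OF g(2,3,1)]
  note [measurable] = Uf(1) Ug(1) Ut_measurable[OF f(1)] Ut_measurable[OF g(1)]
  show "(\<lambda>x. c * U f x + U g x) \<in> borel_measurable M" by measurable
  show i: "integrable M (\<lambda>y. c * f y + g y)" using f(1) g(1) by simp
  have "conv_measure M (\<lambda>n x. c * Ut n f x + Ut n g x) (\<lambda>x. c * U f x + U g x)"
    by (intro conv_measure_add conv_measure_cmult Uf Ug) measurable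
  then show "conv_measure M (\<lambda>n. Ut n (\<lambda>y. c * f y + g y)) (\<lambda>x. c * U f x + U g x)"
  proof (rule conv_measure_cong_AE)
    show "AE x in M. c * Ut n f x + Ut n g x = Ut n (\<lambda>y. c * f y + g y) x" for n
      using Ut_lin[OF f(1) g(1), of n c] by eventually_elim simp
  qed (use Ut_measurable[OF i] in measurable)
qed

text \<open>If \<open>f\<close> and \<open>b f\<close> lie in the domain, the truncated products
  converge to \<open>b f\<close> with exponent \<open>s\<close> by domination. Along a subsequence
  of a subsequence, both the truncated commutators and the images under \<open>T\<close> then
  converge almost everywhere, and the limits can be compared pointwise.\<close>

lemma U_eq_commutator:
  assumes f: "integrable M f" "h \<in> borel_measurable M" "conv_measure M (\<lambda>n. Ut n f) h"
    and fs: "f \<in> Ls" and bf: "(\<lambda>x. b x * f x) \<in> Ls"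
  shows "AE x in M. U f x = commutator b T f x"
proof -
  note Uf = U_props[OF f(2,3,1)]
  have [measurable]: "f \<in> borel_measurable M" using f(1) by auto
  have pf: "(\<lambda>x. pr n (b x) * f x) \<in> Ls" for n
    by (rule Ls_mono[OF _ bf]) (auto simp: norm_mult intro: mult_right_mono norm_pr_le_self)
  obtain r where r: "strict_mono r" "AE x in M. (\<lambda>n. Ut (r n) f x) \<longlonglongrightarrow> U f x"
    by (rule conv_measure_AE_subseq[OF Uf(2) Ut_measurable[OF f(1)] Uf(1)])
  have "(\<lambda>n. \<integral>\<^sup>+x. ennreal (norm (pr n (b x) * f x - b x * f x) powr s) \<partial>M) \<longlonglongrightarrow> (\<integral>\<^sup>+x. 0 \<partial>M)"
  proof (rule nn_integral_dominated_convergence[where w = "\<lambda>x. ennreal (2 powr s) * ennreal (norm (b x * f x) powr s)"])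
    show "(\<integral>\<^sup>+x. ennreal (2 powr s) * ennreal (norm (b x * f x) powr s) \<partial>M) < \<infinity>"
      using bf by (simp add: nn_integral_cmult ennreal_mult_less_top Ls_iff)
    show "AE x in M. ennreal (norm (pr n (b x) * f x - b x * f x) powr s) \<le> ennreal (2 powr s) * ennreal (norm (b x * f x) powr s)" for n
    proof (rule AE_I2)
      fix x
      have "norm (pr n (b x) - b x) \<le> 2 * norm (b x)"
        using norm_triangle_ineq4[of "pr n (b x)" "b x"] norm_pr_le_self[of n "b x"] by simp
      then have "norm (pr n (b x) - b x) * norm (f x) \<le> 2 * norm (b x) * norm (f x)" by (rule mult_right_mono) simp
      then have "norm (pr n (b x) * f x - b x * f x) \<le> 2 * norm (b x * f x)"
        by (simp add: left_diff_distrib[symmetric] norm_mult)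
      then have "norm (pr n (b x) * f x - b x * f x) powr s \<le> (2 * norm (b x * f x)) powr s" using s_pos by (intro powr_mono2) auto
      then show "ennreal (norm (pr n (b x) * f x - b x * f x) powr s) \<le> ennreal (2 powr s) * ennreal (norm (b x * f x) powr s)"
        by (simp add: ennreal_mult'[symmetric] powr_mult ennreal_leI)
    qed
    show "AE x in M. (\<lambda>n. ennreal (norm (pr n (b x) * f x - b x * f x) powr s)) \<longlonglongrightarrow> 0"
    proof (rule AE_I2)
      fix x
      have "\<forall>\<^sub>F n in sequentially. ennreal (norm (pr n (b x) * f x - b x * f x) powr s) = 0"
        using pr_eventually[of "b x"] by eventually_elim (use s_pos in simp)
      then show "(\<lambda>n. ennreal (norm (pr n (b x) * f x - b x * f x) powr s)) \<longlonglongrightarrow> 0" by (rule tendsto_eventually)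
    qed
  qed auto
  then have conv: "conv_measure M (\<lambda>n. T (\<lambda>x. pr n (b x) * f x)) (T (\<lambda>x. b x * f x))"
    by (intro T_conv_measure pf bf) simp
  obtain r' where r': "strict_mono r'" "AE x in M. (\<lambda>n. T (\<lambda>x. pr (r (r' n)) (b x) * f x) x) \<longlonglongrightarrow> T (\<lambda>x. b x * f x) x"
    by (rule conv_measure_AE_subseq[OF conv_measure_subseq[OF conv r(1)] T_meas[OF pf] T_meas[OF bf]])
  have AE_all: "AE x in M. \<forall>n. S (\<lambda>y. pr n (b y) * f y) x = T (\<lambda>y. pr n (b y) * f y) x"
    unfolding AE_all_countable by (intro allI S_eq_T pr_b_integrable f pf)
  show ?thesis using r(2) r'(2) AE_all S_eq_T[OF f(1) fs]
  proof eventually_elim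
    fix x assume x: "(\<lambda>n. Ut (r n) f x) \<longlonglongrightarrow> U f x" "(\<lambda>n. T (\<lambda>x. pr (r (r' n)) (b x) * f x) x) \<longlonglongrightarrow> T (\<lambda>x. b x * f x) x"
      "\<forall>n. S (\<lambda>y. pr n (b y) * f y) x = T (\<lambda>y. pr n (b y) * f y) x" "S f x = T f x"
    have "(\<lambda>n. pr n (b x)) \<longlonglongrightarrow> b x" by (rule tendsto_eventually[OF pr_eventually])
    then have "(\<lambda>n. pr (r (r' n)) (b x)) \<longlonglongrightarrow> b x"
      using LIMSEQ_subseq_LIMSEQ[of "\<lambda>n. pr n (b x)" "b x" "r \<circ> r'"] strict_mono_o[OF r(1) r'(1)] by (simp add: comp_def)
    then have "(\<lambda>n. pr (r (r' n)) (b x) * S f x - T (\<lambda>x. pr (r (r' n)) (b x) * f x) x) \<longlonglongrightarrow> b x * S f x - T (\<lambda>x. b x * f x) x"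
      by (intro tendsto_intros x(2))
    then have "(\<lambda>n. Ut (r (r' n)) f x) \<longlonglongrightarrow> b x * S f x - T (\<lambda>x. b x * f x) x"
      unfolding Ut_def using x(3) by simp
    moreover have "(\<lambda>n. Ut (r (r' n)) f x) \<longlonglongrightarrow> U f x"
      using LIMSEQ_subseq_LIMSEQ[OF x(1) r'(1)] by (simp add: comp_def)
    ultimately have "U f x = b x * S f x - T (\<lambda>x. b x * f x) x" using LIMSEQ_unique by blast
    then show "U f x = commutator b T f x" by (simp add: commutator_def x(4))
  qed
qed

definition atom_const :: "real \<Rightarrow> bool" where
  "atom_const C \<longleftrightarrow> 0 < C \<and> (\<forall>z r a. natom z r a \<longrightarrow>
    (\<integral>\<^sup>+x. ennreal (osc z r x * norm (a x)) \<partial>M) \<le> ennreal C \<and>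
    (\<integral>\<^sup>+x. ennreal (osc z r x * norm (S a x)) \<partial>M) \<le> ennreal C)"

lemma atom_const_exists: obtains C where "atom_const C"
  by (rule atom_bounds) (use that in \<open>unfold atom_const_def, blast\<close>)

text \<open>For fixed \<open>n\<close> the continuity of \<open>Ut n\<close> and of \<open>S\<close>
  gives \<open>Ut n f = Hn n - S (Gn n)\<close> with two series that converge in L1. Their majorants
  do not depend on \<open>n\<close>, so \<open>n\<close> may tend to infinity inside both. In
  \<open>G\<close> the summation precedes the application of \<open>S\<close>, which is why weak
  type (1,1) suffices for part (i).\<close>

theorem U_decomposition:
  assumes dec: "ndec f c z r a" and AC: "atom_const C"
  defines "\<beta> \<equiv> \<lambda>j. ball_mean d M b (z j) (r j)"
  defines "H \<equiv> \<lambda>x. \<Sum>j. c j * ((b x - \<beta> j) * S (a j) x)"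
  defines "G \<equiv> \<lambda>x. \<Sum>j. c j * ((b x - \<beta> j) * a j x)"
  shows "H \<in> borel_measurable M" "integrable M G"
    "(\<integral>\<^sup>+x. ennreal (norm (H x)) \<partial>M) \<le> ennreal (2 * C * (\<Sum>j. norm (c j)))"
    "(\<integral>x. norm (G x) \<partial>M) \<le> 2 * C * (\<Sum>j. norm (c j))"
    "(\<lambda>m. \<integral>x. norm ((\<Sum>j<m. c j * ((b x - \<beta> j) * a j x)) - G x) \<partial>M) \<longlonglongrightarrow> 0"
    "conv_measure M (\<lambda>n. Ut n f) (\<lambda>x. H x - S G x)"
proof -
  have C: "0 < C" "\<And>z r a. natom z r a \<Longrightarrow> (\<integral>\<^sup>+x. ennreal (osc z r x * norm (a x)) \<partial>M) \<le> ennreal C"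
      "\<And>z r a. natom z r a \<Longrightarrow> (\<integral>\<^sup>+x. ennreal (osc z r x * norm (S a x)) \<partial>M) \<le> ennreal C"
    using AC unfolding atom_const_def by blast+
  have f: "integrable M f" and a: "\<And>j. natom (z j) (r j) (a j)" and c: "summable (\<lambda>j. norm (c j))"
    and lim: "(\<lambda>m. \<integral>x. norm ((\<Sum>j<m. c j * a j x) - f x) \<partial>M) \<longlonglongrightarrow> 0"
    using dec unfolding ndec_def by auto
  have ai: "integrable M (a j)" for j by (rule natom_integrable(1)[OF a])
  have [measurable]: "a j \<in> borel_measurable M" for j using a[of j] unfolding natom_def by blast
  note [measurable] = S_measurable[OF ai]
  define x where "x j = 2 * C * norm (c j)" for j
  have x: "0 \<le> x j" "summable x" "suminf x = 2 * C * (\<Sum>j. norm (c j))" for j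
    using C(1) c unfolding x_def by (auto intro: summable_mult suminf_mult)
  define v where "v n j y = pr n (b y) - pr n (\<beta> j)" for n j y
  define v' where "v' j y = b y - \<beta> j" for j y
  have [measurable]: "v n j \<in> borel_measurable M" "v' j \<in> borel_measurable M" for n j
    unfolding v_def v'_def by measurable
  have v_le: "norm (v n j y) \<le> 2 * osc (z j) (r j) y" for n j y
    unfolding v_def \<beta>_def by (rule pr_lipschitz)
  have v'_le: "norm (v' j y) \<le> 2 * osc (z j) (r j) y" for j y
    unfolding v'_def \<beta>_def by simp
  have v_lim: "(\<lambda>n. v n j y) \<longlonglongrightarrow> v' j y" for j y
    unfolding v_def v'_def by (intro tendsto_diff tendsto_eventually pr_eventually)
  \<comment> \<open>A majorant for the truncated and the limiting terms alike; \<open>w\<close>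
    stands for the atoms or for their images under \<open>S\<close>.\<close>
  define A where "A w j y = norm (c j) * (2 * osc (z j) (r j) y * norm (w j y))" for w :: "nat \<Rightarrow> 'a \<Rightarrow> 'k" and j y
  have A0: "0 \<le> A w j y" for w j y by (simp add: A_def)
  have A_meas: "A w j \<in> borel_measurable M" if [measurable]: "\<And>j. w j \<in> borel_measurable M" for w j
    unfolding A_def by measurable
  have dom: "norm (c j * (v n j y * w j y)) \<le> A w j y" for w n j y
    unfolding A_def norm_mult by (intro mult_left_mono mult_right_mono v_le) auto
  have dom': "norm (c j * (v' j y * w j y)) \<le> A w j y" for w j y
    unfolding A_def norm_mult by (intro mult_left_mono mult_right_mono v'_le) auto
  have A_int: "(\<integral>\<^sup>+y. ennreal (A w j y) \<partial>M) \<le> ennreal (x j)"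
    if [measurable]: "w j \<in> borel_measurable M" and w: "(\<integral>\<^sup>+y. ennreal (osc (z j) (r j) y * norm (w j y)) \<partial>M) \<le> ennreal C" for w j
  proof -
    have "(\<integral>\<^sup>+y. ennreal (A w j y) \<partial>M) = (\<integral>\<^sup>+y. ennreal (2 * norm (c j)) * ennreal (osc (z j) (r j) y * norm (w j y)) \<partial>M)"
      by (intro nn_integral_cong) (simp add: A_def ennreal_mult'[symmetric] mult_ac)
    also have "\<dots> = ennreal (2 * norm (c j)) * (\<integral>\<^sup>+y. ennreal (osc (z j) (r j) y * norm (w j y)) \<partial>M)" by (rule nn_integral_cmult) measurable
    also have "\<dots> \<le> ennreal (2 * norm (c j)) * ennreal C" by (rule mult_left_mono[OF w]) simp
    also have "\<dots> = ennreal (2 * norm (c j) * C)" by (rule ennreal_mult'[symmetric]) simp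
    also have "2 * norm (c j) * C = x j" by (simp add: x_def)
    finally show ?thesis .
  qed
  have A_a: "(\<integral>\<^sup>+y. ennreal (A a j y) \<partial>M) \<le> ennreal (x j)" for j by (intro A_int C(2) a) measurable
  have A_Sa: "(\<integral>\<^sup>+y. ennreal (A (\<lambda>j. S (a j)) j y) \<partial>M) \<le> ennreal (x j)" for j by (intro A_int C(3) a) measurable
  have Am_a[measurable]: "A a j \<in> borel_measurable M" for j by (intro A_meas) measurable
  have Am_Sa[measurable]: "A (\<lambda>j. S (a j)) j \<in> borel_measurable M" for j by (intro A_meas) measurable
  have le_A: "(\<integral>\<^sup>+y. ennreal (norm (F y)) \<partial>M) \<le> ennreal (x j)"
    if "(\<integral>\<^sup>+y. ennreal (A w j y) \<partial>M) \<le> ennreal (x j)" "\<And>y. norm (F y) \<le> A w j y" for F :: "'a \<Rightarrow> 'k" and w j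
    using that(1) by (rule order_trans[rotated]) (intro nn_integral_mono ennreal_leI that(2))
  define Hn where "Hn n y = (\<Sum>j. c j * (v n j y * S (a j) y))" for n y
  define Gn where "Gn n y = (\<Sum>j. c j * (v n j y * a j y))" for n y
  have H_eq: "H = (\<lambda>y. \<Sum>j. c j * (v' j y * S (a j) y))" and G_eq: "G = (\<lambda>y. \<Sum>j. c j * (v' j y * a j y))"
    by (simp_all add: H_def G_def v'_def)
  show Hm[measurable]: "H \<in> borel_measurable M" unfolding H_eq by measurable
  have Gm[measurable]: "G \<in> borel_measurable M" unfolding G_eq by measurable
  have [measurable]: "Hn n \<in> borel_measurable M" "Gn n \<in> borel_measurable M" for n unfolding Hn_def Gn_def by measurable
  have series: "(\<integral>\<^sup>+y. ennreal (norm (\<Sum>j. c j * (u j y * w j y))) \<partial>M) \<le> ennreal (2 * C * (\<Sum>j. norm (c j)))"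
    "(\<lambda>m. \<integral>\<^sup>+y. ennreal (norm ((\<Sum>j<m. c j * (u j y * w j y)) - (\<Sum>j. c j * (u j y * w j y)))) \<partial>M) \<longlonglongrightarrow> 0"
    if [measurable]: "\<And>j. u j \<in> borel_measurable M" "\<And>j. w j \<in> borel_measurable M"
      and "\<And>j. (\<integral>\<^sup>+y. ennreal (A w j y) \<partial>M) \<le> ennreal (x j)" "\<And>j y. norm (c j * (u j y * w j y)) \<le> A w j y"
    for u w :: "nat \<Rightarrow> 'a \<Rightarrow> 'k"
  proof -
    have le: "(\<integral>\<^sup>+y. ennreal (norm (c j * (u j y * w j y))) \<partial>M) \<le> ennreal (x j)" for j
      by (rule le_A[OF that(3,4)])
    show "(\<integral>\<^sup>+y. ennreal (norm (\<Sum>j. c j * (u j y * w j y))) \<partial>M) \<le> ennreal (2 * C * (\<Sum>j. norm (c j)))"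
      unfolding x(3)[symmetric] by (rule L1_series_norm_le[OF _ le x(1,2)]) measurable
    show "(\<lambda>m. \<integral>\<^sup>+y. ennreal (norm ((\<Sum>j<m. c j * (u j y * w j y)) - (\<Sum>j. c j * (u j y * w j y)))) \<partial>M) \<longlonglongrightarrow> 0"
      by (rule L1_series_partial_sums[OF _ le x(1,2)]) measurable
  qed
  note sH = series[of v' "\<lambda>j. S (a j)", OF _ _ A_Sa dom'] and sG = series[of v' a, OF _ _ A_a dom']
  show "(\<integral>\<^sup>+x. ennreal (norm (H x)) \<partial>M) \<le> ennreal (2 * C * (\<Sum>j. norm (c j)))"
    unfolding H_eq by (rule sH(1)) measurable
  have G_le: "(\<integral>\<^sup>+x. ennreal (norm (G x)) \<partial>M) \<le> ennreal (2 * C * (\<Sum>j. norm (c j)))"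
    unfolding G_eq by (rule sG(1)) measurable
  then show Gi: "integrable M G" by (intro integrableI_bounded) (auto intro: le_less_trans)
  have Gn_le: "(\<integral>\<^sup>+x. ennreal (norm (Gn n x)) \<partial>M) \<le> ennreal (2 * C * (\<Sum>j. norm (c j)))" for n
    unfolding Gn_def by (rule series(1)[OF _ _ A_a dom]) measurable
  have Gni: "integrable M (Gn n)" for n
    using le_less_trans[OF Gn_le[of n] ennreal_less_top] by (intro integrableI_bounded) auto
  have "0 \<le> 2 * C * (\<Sum>j. norm (c j))" using C(1) c by (simp add: suminf_nonneg)
  moreover have "ennreal (\<integral>x. norm (G x) \<partial>M) \<le> ennreal (2 * C * (\<Sum>j. norm (c j)))"
    using G_le Gi by (subst nn_integral_eq_integral[symmetric]) auto
  ultimately show "(\<integral>x. norm (G x) \<partial>M) \<le> 2 * C * (\<Sum>j. norm (c j))" by (simp only: ennreal_le_iff)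
  have va_i: "integrable M (\<lambda>y. v n j y * a j y)" "integrable M (\<lambda>y. v' j y * a j y)" for n j
    using natom_times_integrable(1)[OF a _ v_le less_imp_le[OF C(1)] C(2)[OF a]]
      natom_times_integrable(1)[OF a _ v'_le less_imp_le[OF C(1)] C(2)[OF a]] by auto
  have to_real: "(\<lambda>m. \<integral>y. norm (F m y) \<partial>M) \<longlonglongrightarrow> 0"
    if "(\<lambda>m. \<integral>\<^sup>+y. ennreal (norm (F m y)) \<partial>M) \<longlonglongrightarrow> 0" "\<And>m. integrable M (F m)" for F :: "nat \<Rightarrow> 'a \<Rightarrow> 'k"
  proof -
    have "(\<integral>\<^sup>+y. ennreal (norm (F m y)) \<partial>M) = ennreal (\<integral>y. norm (F m y) \<partial>M)" for m
      using that(2)[of m] by (intro nn_integral_eq_integral integrable_norm) auto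
    then show ?thesis using that(1) by (simp add: tendsto_ennreal_iff[of _ _ 0, simplified])
  qed
  show "(\<lambda>m. \<integral>x. norm ((\<Sum>j<m. c j * ((b x - \<beta> j) * a j x)) - G x) \<partial>M) \<longlonglongrightarrow> 0"
  proof (rule to_real)
    show "(\<lambda>m. \<integral>\<^sup>+x. ennreal (norm ((\<Sum>j<m. c j * ((b x - \<beta> j) * a j x)) - G x)) \<partial>M) \<longlonglongrightarrow> 0"
      using sG(2) unfolding G_eq by (simp add: v'_def)
    show "integrable M (\<lambda>x. (\<Sum>j<m. c j * ((b x - \<beta> j) * a j x)) - G x)" for m
      using va_i(2) Gi by (simp add: v'_def)
  qed
  \<comment> \<open>Both sides are limits in measure of the same partial sums: finite sums are
    handled by \<open>Ut_shift\<close> atom by atom, and then the number of terms tends to infinity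
    while \<open>n\<close> stays fixed.\<close>
  have Ut_eq: "AE y in M. Ut n f y = Hn n y - S (Gn n) y" for n
  proof -
    have sHn: "(\<lambda>m. \<integral>\<^sup>+y. ennreal (norm ((\<Sum>j<m. c j * (v n j y * S (a j) y)) - Hn n y)) \<partial>M) \<longlonglongrightarrow> 0"
      unfolding Hn_def by (rule series(2)[OF _ _ A_Sa dom]) measurable
    have sGn: "(\<lambda>m. \<integral>\<^sup>+y. ennreal (norm ((\<Sum>j<m. c j * (v n j y * a j y)) - Gn n y)) \<partial>M) \<longlonglongrightarrow> 0"
      unfolding Gn_def by (rule series(2)[OF _ _ A_a dom]) measurable
    define gm where "gm m y = (\<Sum>j<m. c j * (v n j y * a j y))" for m y
    have gmi: "integrable M (gm m)" for m unfolding gm_def using va_i(1) by auto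
    have fm: "integrable M (\<lambda>y. \<Sum>j<m. c j * a j y)" for m using ai by auto
    have 1: "conv_measure M (\<lambda>m y. (\<Sum>j<m. c j * (v n j y * S (a j) y))) (Hn n)"
      by (rule conv_measure_L1[OF _ _ sHn]) measurable
    have 2: "conv_measure M (\<lambda>m. S (gm m)) (S (Gn n))"
      using sGn gmi Gni[of n] unfolding gm_def by (intro S_conv_measure to_real) auto
    have "conv_measure M (\<lambda>m y. (\<Sum>j<m. c j * (v n j y * S (a j) y)) - S (gm m) y) (\<lambda>y. Hn n y - S (Gn n) y)"
      using S_measurable[OF gmi] S_measurable[OF Gni[of n]] by (intro conv_measure_diff 1 2) measurable
    then have "conv_measure M (\<lambda>m. Ut n (\<lambda>y. \<Sum>j<m. c j * a j y)) (\<lambda>y. Hn n y - S (Gn n) y)"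
    proof (rule conv_measure_cong_AE)
      show "(\<lambda>y. (\<Sum>j<m. c j * (v n j y * S (a j) y)) - S (gm m) y) \<in> borel_measurable M" for m
        using S_measurable[OF gmi[of m]] by measurable
      show "(\<lambda>y. Hn n y - S (Gn n) y) \<in> borel_measurable M" using S_measurable[OF Gni[of n]] by measurable
      then show "(\<lambda>y. Hn n y - S (Gn n) y) \<in> borel_measurable M" .
      show "Ut n (\<lambda>y. \<Sum>j<m. c j * a j y) \<in> borel_measurable M" for m by (rule Ut_measurable[OF fm])
      fix m
      have e1: "AE y in M. Ut n (\<lambda>y. \<Sum>j<m. c j * a j y) y = (\<Sum>j<m. c j * Ut n (a j) y)"
        by (rule Ut_sum) (use ai in auto)
      have e2: "AE y in M. \<forall>j. Ut n (a j) y = v n j y * S (a j) y - S (\<lambda>y. v n j y * a j y) y"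
        unfolding AE_all_countable v_def by (intro allI Ut_shift ai)
      have e3: "AE y in M. S (gm m) y = (\<Sum>j<m. c j * S (\<lambda>y. v n j y * a j y) y)"
        unfolding gm_def by (rule S_sum) (use va_i in auto)
      show "AE y in M. (\<Sum>j<m. c j * (v n j y * S (a j) y)) - S (gm m) y = Ut n (\<lambda>y. \<Sum>j<m. c j * a j y) y"
        using e1 e2 e3 by eventually_elim (simp add: right_diff_distrib sum_subtractf)
    qed auto
    then show ?thesis
      using Ut_conv_measure[OF fm f lim, of n] Ut_measurable[OF fm] Ut_measurable[OF f] S_measurable[OF Gni[of n]]
      by (intro conv_measure_unique[of M "\<lambda>m. Ut n (\<lambda>y. \<Sum>j<m. c j * a j y)"]) auto
  qed
  have lims: "(\<lambda>n. c j * (v n j y * w)) \<longlonglongrightarrow> c j * (v' j y * w)" for j y w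
    by (intro tendsto_mult tendsto_const v_lim)
  have dH: "(\<lambda>n. \<integral>\<^sup>+y. ennreal (norm (Hn n y - H y)) \<partial>M) \<longlonglongrightarrow> 0"
    unfolding Hn_def H_eq
    by (rule L1_series_dominated[where A = "A (\<lambda>j. S (a j))" and x = x])
      (auto intro: A0 A_Sa x dom dom' lims)
  have dG: "(\<lambda>n. \<integral>\<^sup>+y. ennreal (norm (Gn n y - G y)) \<partial>M) \<longlonglongrightarrow> 0"
    unfolding Gn_def G_eq
    by (rule L1_series_dominated[where A = "A a" and x = x])
      (auto intro: A0 A_a x dom dom' lims)
  have "conv_measure M (\<lambda>n. Hn n) H" by (rule conv_measure_L1[OF _ _ dH]) measurable
  moreover have "conv_measure M (\<lambda>n. S (Gn n)) (S G)"
    using dG Gni Gi by (intro S_conv_measure to_real) auto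
  ultimately have "conv_measure M (\<lambda>n y. Hn n y - S (Gn n) y) (\<lambda>y. H y - S G y)"
    using S_measurable[OF Gni] S_measurable[OF Gi] by (intro conv_measure_diff) measurable
  then show "conv_measure M (\<lambda>n. Ut n f) (\<lambda>x. H x - S G x)"
  proof (rule conv_measure_cong_AE)
    show "AE y in M. Hn n y - S (Gn n) y = Ut n f y" for n using Ut_eq[of n] by eventually_elim simp
    show "(\<lambda>y. Hn n y - S (Gn n) y) \<in> borel_measurable M" for n using S_measurable[OF Gni[of n]] by measurable
    show "(\<lambda>y. H y - S G y) \<in> borel_measurable M" using S_measurable[OF Gi] by measurable
    then show "(\<lambda>y. H y - S G y) \<in> borel_measurable M" .
    show "Ut n f \<in> borel_measurable M" for n by (rule Ut_measurable[OF f])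
  qed auto
qed

end

section \<open>Atomic decompositions\<close>

lemma enn_powr_1 [simp]: "enn_powr X 1 = X"
  by (cases X) (auto simp: enn_powr_def)

lemma Lp_norm_1: "Lp_norm M 1 f = (\<integral>\<^sup>+x. ennreal (norm (f x)) \<partial>M)"
  by (simp add: Lp_norm_def)

lemma enn_powr_leD:
  assumes "enn_powr X (1 / s) \<le> ennreal y" "0 < s" "0 \<le> y"
  shows "X \<le> ennreal (y powr s)"
proof (cases X)
  case (real x)
  then have "x powr (1 / s) \<le> y" using assms by (simp add: enn_powr_def)
  then have "(x powr (1 / s)) powr s \<le> y powr s" using assms by (intro powr_mono2) auto
  then show ?thesis using real assms by (simp add: powr_powr ennreal_leI)
next
  case top
  then show ?thesis using assms by (simp add: enn_powr_def top_unique)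
qed

lemma enn_powr_leI:
  assumes "X \<le> ennreal (y powr s)" "0 < s" "0 \<le> y"
  shows "enn_powr X (1 / s) \<le> ennreal y"
proof (cases X)
  case (real x)
  then have "x \<le> y powr s" using assms by simp
  then have "x powr (1 / s) \<le> (y powr s) powr (1 / s)" using assms real by (intro powr_mono2) auto
  then show ?thesis using real assms by (simp add: powr_powr enn_powr_def ennreal_leI)
next
  case top
  then show ?thesis using assms by (simp add: top_unique)
qed

lemma ennreal_le_mult_Inf:
  assumes "X \<noteq> {}" "\<And>x. x \<in> X \<Longrightarrow> 0 \<le> x" "0 < C" and le: "\<And>x. x \<in> X \<Longrightarrow> w \<le> ennreal (C * x)"
  shows "w \<le> ennreal (C * Inf X)"
proof -
  obtain x where x: "x \<in> X" using assms(1) by blast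
  then have "w < top" using le[of x] by (auto intro: le_less_trans)
  then obtain wr where wr: "w = ennreal wr" "0 \<le> wr" by (cases w) auto
  have "wr / C \<le> Inf X"
  proof (rule cInf_greatest[OF assms(1)])
    fix x assume "x \<in> X"
    then have "wr \<le> C * x" using le[of x] wr assms(2)[of x] \<open>0 < C\<close> by simp
    then show "wr / C \<le> x" using \<open>0 < C\<close> by (simp add: pos_divide_le_eq mult.commute)
  qed
  then show ?thesis using wr \<open>0 < C\<close> by (simp add: pos_divide_le_eq mult.commute ennreal_leI)
qed

context homogeneous_type_space
begin

text \<open>A correction on a ball enlarges the support at most by the closed ball, because every
  point off the closed ball has a neighbourhood that misses it.\<close>

lemma supp_subset_Un:
  assumes g: "g \<in> borel_measurable M" "a \<in> borel_measurable M"
    and ne: "\<And>y. g y \<noteq> 0 \<Longrightarrow> a y \<noteq> 0 \<or> y \<in> B z r"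
  shows "supp d M g \<subseteq> supp d M a \<union> {x. d z x \<le> r}"
proof (rule subsetI, rule ccontr)
  fix x assume x: "x \<in> supp d M g" "x \<notin> supp d M a \<union> {x. d z x \<le> r}"
  then obtain e1 where e1: "0 < e1" "emeasure M {y \<in> B x e1. a y \<noteq> 0} = 0"
    by (auto simp: supp_def)
  have "x \<in> {y. r < d z y}" using x by simp
  then obtain e2 where e2: "0 < e2" "B x e2 \<subseteq> {y. r < d z y}"
    using qopen_greater[of r z] unfolding qopen_def by blast
  define e where "e = min e1 e2"
  have sub: "{y \<in> B x e. g y \<noteq> 0} \<subseteq> {y \<in> B x e1. a y \<noteq> 0}"
  proof
    fix y assume y: "y \<in> {y \<in> B x e. g y \<noteq> 0}"
    then have "y \<in> B x e2" "y \<in> B x e1" by (auto simp: e_def)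
    then have "y \<notin> B z r" using e2(2) by auto
    then show "y \<in> {y \<in> B x e1. a y \<noteq> 0}" using ne[of y] y \<open>y \<in> B x e1\<close> by blast
  qed
  have "{y \<in> B x e1. a y \<noteq> 0} = {y \<in> space M. d x y < e1 \<and> a y \<noteq> 0}" by (auto simp: space_eq)
  also have "\<dots> \<in> sets M" using g by measurable
  finally have "emeasure M {y \<in> B x e. g y \<noteq> 0} \<le> emeasure M {y \<in> B x e1. a y \<noteq> 0}" by (rule emeasure_mono[OF sub])
  then have "emeasure M {y \<in> B x e. g y \<noteq> 0} = 0" unfolding e1(2) by simp
  moreover have "0 < emeasure M {y \<in> B x e. g y \<noteq> 0}"
  proof -
    have "0 < e" using e1(1) e2(1) by (simp add: e_def)
    then show ?thesis using x(1) unfolding supp_def by blast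
  qed
  ultimately show False by simp
qed

end

context cz_commutator
begin

abbreviation H1atom :: "ennreal \<Rightarrow> 'a \<Rightarrow> real \<Rightarrow> ('a \<Rightarrow> 'k) \<Rightarrow> bool" where
  "H1atom q z r a \<equiv> H1_atom d M \<rho> q z r a"

lemma H1atom_AE_zero:
  assumes "H1atom q z r a"
  shows "AE x in M. x \<notin> B z r \<longrightarrow> a x = 0"
proof -
  have "a \<in> borel_measurable M" and sub: "supp d M a \<subseteq> B z r" using assms by (auto simp: H1_atom_def)
  from AE_in_supp[OF this(1)] show ?thesis
  proof eventually_elim
    fix x assume "a x \<noteq> 0 \<longrightarrow> x \<in> supp d M a"
    then show "x \<notin> B z r \<longrightarrow> a x = 0" using sub by blast
  qed
qed

lemma H1atom_top_bound:
  assumes "H1atom top z r a"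
  shows "AE x in M. norm (a x) \<le> 1 / V z r"
proof -
  have a: "a \<in> borel_measurable M" and r: "0 < r"
    and le: "Lp_norm M top a \<le> ennreal (V z r powr (enn2real (1 / top) - 1))"
    using assms by (auto simp: H1_atom_def)
  have V: "0 < V z r" by (rule V_pos[OF r])
  have "esssup M (\<lambda>x. ennreal (norm (a x))) \<le> ennreal (1 / V z r)"
    using le V by (simp add: Lp_norm_def powr_minus_divide)
  note le' = this
  have "AE x in M. ennreal (norm (a x)) \<le> esssup M (\<lambda>x. ennreal (norm (a x)))" by (rule esssup_AE)
  then show ?thesis
  proof eventually_elim
    fix x assume "ennreal (norm (a x)) \<le> esssup M (\<lambda>x. ennreal (norm (a x)))"
    then have "ennreal (norm (a x)) \<le> ennreal (1 / V z r)" using le' by (rule order_trans)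
    then show "norm (a x) \<le> 1 / V z r" using V by (subst (asm) ennreal_le_iff) auto
  qed
qed

lemma H1atom_finite_iff:
  assumes q: "1 < q"
  shows "H1atom (ennreal q) z r a \<longleftrightarrow> 0 < r \<and> r < \<rho> z \<and> a \<in> borel_measurable M \<and> supp d M a \<subseteq> B z r \<and>
    (\<integral>\<^sup>+x. ennreal (norm (a x) powr q) \<partial>M) \<le> ennreal (V z r powr (1 - q)) \<and> (r < \<rho> z / 4 \<longrightarrow> (\<integral>x. a x \<partial>M) = 0)"
proof -
  have e: "enn2real (1 / ennreal q) = 1 / q" using q by (simp add: divide_ennreal[symmetric] flip: ennreal_1)
  have pw: "(V z r powr (1 / q - 1)) powr q = V z r powr (1 - q)"
    using q by (simp add: powr_powr algebra_simps)
  have "Lp_norm M (ennreal q) a \<le> ennreal (V z r powr (1 / q - 1)) \<longleftrightarrow> (\<integral>\<^sup>+x. ennreal (norm (a x) powr q) \<partial>M) \<le> ennreal (V z r powr (1 - q))"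
    using q enn_powr_leD[of "\<integral>\<^sup>+x. ennreal (norm (a x) powr q) \<partial>M" q "V z r powr (1 / q - 1)"]
      enn_powr_leI[of "\<integral>\<^sup>+x. ennreal (norm (a x) powr q) \<partial>M" "V z r powr (1 / q - 1)" q]
    unfolding pw by (auto simp: Lp_norm_def)
  then show ?thesis unfolding H1_atom_def e by blast
qed

text \<open>Multiplication by the indicator replaces almost everywhere vanishing off the ball by
  vanishing at every point. Only a null set is affected, so the mean is unchanged.\<close>

lemma H1atom_natom:
  assumes a: "H1atom q z r a" and q: "1 < q" "ennreal p \<le> q"
  shows "natom z r (\<lambda>x. indicator (B z r) x *\<^sub>R a x)" "AE x in M. a x = indicator (B z r) x *\<^sub>R a x"
proof -
  have am[measurable]: "a \<in> borel_measurable M" and r: "0 < r" "r < \<rho> z" and mean: "r < \<rho> z / 4 \<longrightarrow> (\<integral>x. a x \<partial>M) = 0"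
    using a by (auto simp: H1_atom_def)
  have V: "0 < V z r" by (rule V_pos[OF r(1)])
  show AE: "AE x in M. a x = indicator (B z r) x *\<^sub>R a x"
    using H1atom_AE_zero[OF a] by eventually_elim (auto split: split_indicator)
  have int: "(\<integral>x. indicator (B z r) x *\<^sub>R a x \<partial>M) = (\<integral>x. a x \<partial>M)"
    by (rule integral_cong_AE) (use AE in \<open>auto elim: eventually_mono\<close>)
  have "(\<integral>\<^sup>+x. ennreal ((V z r * norm (indicator (B z r) x *\<^sub>R a x)) powr p) \<partial>M) \<le> ennreal (2 * V z r)"
  proof (cases q)
    case top
    have "(\<integral>\<^sup>+x. ennreal ((V z r * norm (indicator (B z r) x *\<^sub>R a x)) powr p) \<partial>M) \<le> (\<integral>\<^sup>+x. indicator (B z r) x \<partial>M)"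
    proof (rule nn_integral_mono_AE)
      show "AE x in M. ennreal ((V z r * norm (indicator (B z r) x *\<^sub>R a x)) powr p) \<le> indicator (B z r) x"
        using H1atom_top_bound[OF a[unfolded top]]
      proof eventually_elim
        fix x assume "norm (a x) \<le> 1 / V z r"
        then have "V z r * norm (a x) \<le> 1" using V by (simp add: pos_le_divide_eq mult.commute)
        then have "(V z r * norm (a x)) powr p \<le> 1 powr p" using V p by (intro powr_mono2) auto
        then show "ennreal ((V z r * norm (indicator (B z r) x *\<^sub>R a x)) powr p) \<le> indicator (B z r) x"
          using p by (auto split: split_indicator simp: ennreal_le_1)
      qed
    qed
    also have "\<dots> = ennreal (V z r)" by (simp add: emeasure_qball)
    also have "\<dots> \<le> ennreal (2 * V z r)" using V by (intro ennreal_leI) auto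
    finally show ?thesis .
  next
    case (real q')
    have q': "1 < q'" "p \<le> q'" using q real p by (auto simp: ennreal_le_iff2)
    have aq: "(\<integral>\<^sup>+x. ennreal (norm (a x) powr q') \<partial>M) \<le> ennreal (V z r powr (1 - q'))"
      using a H1atom_finite_iff[OF q'(1)] real by blast
    have "(\<integral>\<^sup>+x. ennreal ((V z r * norm (indicator (B z r) x *\<^sub>R a x)) powr p) \<partial>M)
      \<le> (\<integral>\<^sup>+x. indicator (B z r) x + ennreal (V z r powr q') * ennreal (norm (a x) powr q') \<partial>M)"
    proof (rule nn_integral_mono)
      fix x
      have "(V z r * norm (a x)) powr p \<le> 1 + V z r powr q' * norm (a x) powr q'"
      proof (cases "V z r * norm (a x) \<le> 1")
        case True
        then have "(V z r * norm (a x)) powr p \<le> 1 powr p" using V p by (intro powr_mono2) auto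
        then show ?thesis by (simp add: add_increasing2)
      next
        case False
        then have "(V z r * norm (a x)) powr p \<le> (V z r * norm (a x)) powr q'" using q' by (intro powr_mono) auto
        then show ?thesis by (simp add: powr_mult)
      qed
      then have "ennreal ((V z r * norm (a x)) powr p) \<le> ennreal (1 + V z r powr q' * norm (a x) powr q')" by (rule ennreal_leI)
      also have "\<dots> = 1 + ennreal (V z r powr q') * ennreal (norm (a x) powr q')"
        by (subst ennreal_plus) (auto simp: ennreal_mult')
      finally show "ennreal ((V z r * norm (indicator (B z r) x *\<^sub>R a x)) powr p) \<le> indicator (B z r) x + ennreal (V z r powr q') * ennreal (norm (a x) powr q')"
        using p by (auto split: split_indicator)
    qed
    also have "\<dots> = ennreal (V z r) + ennreal (V z r powr q') * (\<integral>\<^sup>+x. ennreal (norm (a x) powr q') \<partial>M)"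
      by (subst nn_integral_add) (auto simp: nn_integral_cmult emeasure_qball)
    also have "\<dots> \<le> ennreal (V z r) + ennreal (V z r powr q') * ennreal (V z r powr (1 - q'))"
      by (intro add_left_mono mult_left_mono aq) simp
    also have "\<dots> = ennreal (V z r) + ennreal (V z r powr q' * V z r powr (1 - q'))" by (simp add: ennreal_mult')
    also have "V z r powr q' * V z r powr (1 - q') = V z r" using V by (simp add: powr_add[symmetric])
    also have "ennreal (V z r) + ennreal (V z r) = ennreal (2 * V z r)" using V by (simp add: ennreal_plus[symmetric] del: ennreal_plus)
    finally show ?thesis .
  qed
  then show "natom z r (\<lambda>x. indicator (B z r) x *\<^sub>R a x)"
    using r mean unfolding natom_def int by auto
qed

lemma H1atom_integrable:
  assumes "H1atom q z r a" "1 < q" "ennreal p \<le> q"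
  shows "integrable M a"
proof -
  have [measurable]: "a \<in> borel_measurable M" using assms by (auto simp: H1_atom_def)
  have "integrable M (\<lambda>x. indicator (B z r) x *\<^sub>R a x)" by (rule natom_integrable(1)[OF H1atom_natom(1)[OF assms]])
  moreover have "AE x in M. indicator (B z r) x *\<^sub>R a x = a x" using H1atom_natom(2)[OF assms] by eventually_elim simp
  ultimately show ?thesis using integrable_cong_AE_imp[of M "\<lambda>x. indicator (B z r) x *\<^sub>R a x" a] by simp
qed

lemma decomposition_ndec:
  assumes f: "f \<in> Lp M 1" and dec: "H1_decomposition d M \<rho> q f c a" and q: "1 < q" "ennreal p \<le> q"
  obtains z r a' where "ndec f c z r a'"
proof -
  have "\<forall>j. \<exists>z r. H1atom q z r (a j)" and c: "summable (\<lambda>j. norm (c j))"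
    and lim: "(\<lambda>n. \<integral>\<^sup>+x. ennreal (norm (f x - (\<Sum>j<n. c j * a j x))) \<partial>M) \<longlonglongrightarrow> 0"
    using dec unfolding H1_decomposition_def Lp_norm_1 by auto
  then obtain z r where at: "\<And>j. H1atom q (z j) (r j) (a j)" by metis
  define a' where "a' j x = indicator (B (z j) (r j)) x *\<^sub>R a j x" for j x
  have na: "natom (z j) (r j) (a' j)" for j unfolding a'_def by (rule H1atom_natom(1)[OF at q])
  have AE: "AE x in M. \<forall>j. a j x = a' j x"
    unfolding AE_all_countable a'_def by (intro allI H1atom_natom(2)[OF at q])
  have fi: "integrable M f" using f by (auto simp: Lp_def Lp_norm_1 intro: integrableI_bounded)
  have [measurable]: "f \<in> borel_measurable M" using fi by auto
  have ai: "integrable M (a' j)" for j by (rule natom_integrable(1)[OF na])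
  have "(\<integral>\<^sup>+x. ennreal (norm (f x - (\<Sum>j<n. c j * a j x))) \<partial>M) = ennreal (\<integral>x. norm ((\<Sum>j<n. c j * a' j x) - f x) \<partial>M)" for n
  proof -
    have "(\<integral>\<^sup>+x. ennreal (norm (f x - (\<Sum>j<n. c j * a j x))) \<partial>M) = (\<integral>\<^sup>+x. ennreal (norm ((\<Sum>j<n. c j * a' j x) - f x)) \<partial>M)"
      by (rule nn_integral_cong_AE) (use AE in \<open>eventually_elim, simp add: norm_minus_commute\<close>)
    also have "\<dots> = ennreal (\<integral>x. norm ((\<Sum>j<n. c j * a' j x) - f x) \<partial>M)"
      using fi ai by (intro nn_integral_eq_integral integrable_norm Bochner_Integration.integrable_diff Bochner_Integration.integrable_sum integrable_mult_right) auto
    finally show ?thesis .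
  qed
  then have "(\<lambda>n. \<integral>x. norm ((\<Sum>j<n. c j * a' j x) - f x) \<partial>M) \<longlonglongrightarrow> 0"
    using lim by (simp add: tendsto_ennreal_iff[of _ _ 0, simplified])
  then have "ndec f c z r a'" unfolding ndec_def using fi na c by blast
  then show ?thesis by (rule that)
qed

text \<open>At half the level, \<open>H\<close> is handled by Chebyshev's inequality and
  \<open>S G\<close> by weak type (1,1). Since \<open>H\<close> and \<open>G\<close> both have L1
  norm at most \<open>2 * C\<close> times the coefficient sum, halving the level yields the factors
  4.\<close>

lemma U_weak_bound:
  obtains C where "0 < C" "\<And>f c z r a. ndec f c z r a \<Longrightarrow> weak_Lp_norm M 1 (U f) \<le> ennreal (C * (\<Sum>j. norm (c j)))"
proof -
  obtain C where AC: "atom_const C" by (rule atom_const_exists)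
  have C: "0 < C" "\<And>z r a. natom z r a \<Longrightarrow> (\<integral>\<^sup>+x. ennreal (osc z r x * norm (a x)) \<partial>M) \<le> ennreal C"
    using AC unfolding atom_const_def by blast+
  define C' where "C' = 4 * C + 4 * CS * C"
  have "weak_Lp_norm M 1 (U f) \<le> ennreal (C' * (\<Sum>j. norm (c j)))" if dec: "ndec f c z r a" for f c z r a
  proof -
    define X where "X = (\<Sum>j. norm (c j))"
    have X: "0 \<le> X" unfolding X_def using dec by (intro suminf_nonneg) (auto simp: ndec_def)
    have fi: "integrable M f" using dec by (simp add: ndec_def)
    define H where "H x = (\<Sum>j. c j * ((b x - ball_mean d M b (z j) (r j)) * S (a j) x))" for x
    define G where "G x = (\<Sum>j. c j * ((b x - ball_mean d M b (z j) (r j)) * a j x))" for x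
    note D = U_decomposition[OF dec AC, folded H_def, folded G_def, folded X_def]
    note [measurable] = D(1) S_measurable[OF D(2)]
    have m: "(\<lambda>x. H x - S G x) \<in> borel_measurable M" by measurable
    note Uf = U_props[OF m D(6) fi]
    have "ennreal t * emeasure M {x \<in> space M. t < norm (U f x)} \<le> ennreal (C' * X)" if t: "0 < t" for t
    proof -
      have "emeasure M {x \<in> space M. t < norm (U f x)} \<le> emeasure M {x \<in> space M. t / 2 + t / 2 < norm (H x + (- S G x))}"
      proof (rule emeasure_mono_AE)
        show "AE x in M. x \<in> {x \<in> space M. t < norm (U f x)} \<longrightarrow> x \<in> {x \<in> space M. t / 2 + t / 2 < norm (H x + (- S G x))}"
          using Uf(3) by eventually_elim auto
      qed measurable
      also have "\<dots> \<le> emeasure M {x \<in> space M. t / 2 < norm (H x)} + emeasure M {x \<in> space M. t / 2 < norm (- S G x)}"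
        by (rule emeasure_norm_add_le) measurable
      also have "\<dots> \<le> ennreal (4 * C * X / t) + ennreal (4 * CS * C * X / t)"
      proof (rule add_mono)
        have "emeasure M {x \<in> space M. t / 2 < norm (H x)} \<le> ennreal (1 / (t / 2)) * (\<integral>\<^sup>+x. ennreal (norm (H x)) \<partial>M)"
          using t by (intro emeasure_norm_gt_le_nn_integral) auto
        also have "\<dots> \<le> ennreal (1 / (t / 2)) * ennreal (2 * C * X)" by (rule mult_left_mono[OF D(3)]) simp
        also have "\<dots> = ennreal (1 / (t / 2) * (2 * C * X))" by (rule ennreal_mult'[symmetric]) (use t in simp)
        also have "1 / (t / 2) * (2 * C * X) = 4 * C * X / t" by simp
        finally show "emeasure M {x \<in> space M. t / 2 < norm (H x)} \<le> ennreal (4 * C * X / t)" .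
        have "emeasure M {x \<in> space M. t / 2 < norm (S G x)} \<le> ennreal (CS * (\<integral>x. norm (G x) \<partial>M) / (t / 2))"
          using t by (intro S_weak_11 D(2)) auto
        also have "\<dots> \<le> ennreal (CS * (2 * C * X) / (t / 2))"
          using t CS_pos D(4) by (intro ennreal_leI divide_right_mono mult_left_mono) auto
        also have "CS * (2 * C * X) / (t / 2) = 4 * CS * C * X / t" by simp
        finally show "emeasure M {x \<in> space M. t / 2 < norm (- S G x)} \<le> ennreal (4 * CS * C * X / t)" by simp
      qed
      also have "\<dots> = ennreal (4 * C * X / t + 4 * CS * C * X / t)"
        using C(1) X t CS_pos by (intro ennreal_plus[symmetric]) auto
      also have "4 * C * X / t + 4 * CS * C * X / t = C' * X / t"
        by (simp add: C'_def add_divide_distrib distrib_right)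
      finally have "ennreal t * emeasure M {x \<in> space M. t < norm (U f x)} \<le> ennreal t * ennreal (C' * X / t)"
        by (rule mult_left_mono) simp
      also have "\<dots> = ennreal (t * (C' * X / t))" by (rule ennreal_mult'[symmetric]) (use t in simp)
      finally show ?thesis using t by simp
    qed
    then show ?thesis unfolding weak_Lp_norm_def X_def[symmetric] by (intro SUP_least) simp
  qed
  moreover have "0 < C'" using C(1) CS_pos by (simp add: C'_def add_pos_pos)
  ultimately show ?thesis using that by blast
qed

text \<open>\<open>H\<close> is integrable already. For \<open>S G\<close> the images of the single
  pieces are now bounded in L1, where norms of infinitely many terms can be added; Fatou's lemma
  passes from the partial sums to \<open>S G\<close>.\<close>

lemma U_L1_bound:
  assumes log: "log_osc A"
  obtains C where "0 < C" "\<And>f c z r a. ndec f c z r a \<Longrightarrow> Lp_norm M 1 (U f) \<le> ennreal (C * (\<Sum>j. norm (c j)))"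
proof -
  obtain C where AC: "atom_const C" by (rule atom_const_exists)
  have C: "0 < C" "\<And>z r a. natom z r a \<Longrightarrow> (\<integral>\<^sup>+x. ennreal (osc z r x * norm (a x)) \<partial>M) \<le> ennreal C"
    using AC unfolding atom_const_def by blast+
  obtain Cl where Cl: "0 < Cl" "\<And>z r a v. natom z r a \<Longrightarrow> v \<in> borel_measurable M \<Longrightarrow> (\<And>x. norm (v x) \<le> 2 * osc z r x) \<Longrightarrow>
    (\<integral>\<^sup>+x. ennreal (norm (S (\<lambda>x. v x * a x) x)) \<partial>M) \<le> ennreal Cl"
    by (rule atom_log_bound[OF log]) blast
  have "Lp_norm M 1 (U f) \<le> ennreal ((2 * C + Cl) * (\<Sum>j. norm (c j)))" if dec: "ndec f c z r a" for f c z r a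
  proof -
    define X where "X = (\<Sum>j. norm (c j))"
    have c: "summable (\<lambda>j. norm (c j))" and a: "\<And>j. natom (z j) (r j) (a j)" using dec by (auto simp: ndec_def)
    have X: "0 \<le> X" unfolding X_def by (intro suminf_nonneg c) auto
    have fi: "integrable M f" using dec by (simp add: ndec_def)
    define v where "v j x = b x - ball_mean d M b (z j) (r j)" for j x
    have vm[measurable]: "v j \<in> borel_measurable M" for j unfolding v_def by measurable
    have v: "norm (v j x) \<le> 2 * osc (z j) (r j) x" for j x by (simp add: v_def)
    define H where "H x = (\<Sum>j. c j * (v j x * S (a j) x))" for x
    define G where "G x = (\<Sum>j. c j * (v j x * a j x))" for x
    note D = U_decomposition[OF dec AC, folded v_def, folded H_def, folded G_def, folded X_def]
    note [measurable] = D(1) S_measurable[OF D(2)]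
    have m: "(\<lambda>x. H x - S G x) \<in> borel_measurable M" by measurable
    note Uf = U_props[OF m D(6) fi]
    have vai: "integrable M (\<lambda>x. v j x * a j x)" for j
      by (rule natom_times_integrable(1)[OF a vm v less_imp_le[OF C(1)] C(2)[OF a]])
    have vas: "integrable M (\<lambda>x. \<Sum>j<m. c j * (v j x * a j x))" for m using vai by auto
    note [measurable] = S_measurable[OF vai] S_measurable[OF vas]
    have "(\<integral>\<^sup>+x\<in>space M. ennreal (1 * norm (S G x)) \<partial>M) \<le> ennreal (Cl * X)"
    proof (rule conv_measure_Fatou)
      show "conv_measure M (\<lambda>m. S (\<lambda>x. \<Sum>j<m. c j * (v j x * a j x))) (S G)"
        by (rule S_conv_measure[OF vas D(2) D(5)])
      fix m
      have "(\<integral>\<^sup>+x\<in>space M. ennreal (1 * norm (S (\<lambda>x. \<Sum>j<m. c j * (v j x * a j x)) x)) \<partial>M)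
        \<le> (\<integral>\<^sup>+x. (\<Sum>j<m. ennreal (norm (c j)) * ennreal (norm (S (\<lambda>x. v j x * a j x) x))) \<partial>M)"
      proof (rule nn_integral_mono_AE)
        have "AE x in M. S (\<lambda>x. \<Sum>j<m. c j * (v j x * a j x)) x = (\<Sum>j<m. c j * S (\<lambda>x. v j x * a j x) x)"
          by (rule S_sum) (use vai in auto)
        then show "AE x in M. ennreal (1 * norm (S (\<lambda>x. \<Sum>j<m. c j * (v j x * a j x)) x)) * indicator (space M) x
          \<le> (\<Sum>j<m. ennreal (norm (c j)) * ennreal (norm (S (\<lambda>x. v j x * a j x) x)))"
        proof eventually_elim
          fix x assume x: "S (\<lambda>x. \<Sum>j<m. c j * (v j x * a j x)) x = (\<Sum>j<m. c j * S (\<lambda>x. v j x * a j x) x)"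
          have "ennreal (norm (\<Sum>j<m. c j * S (\<lambda>x. v j x * a j x) x)) \<le> ennreal (\<Sum>j<m. norm (c j) * norm (S (\<lambda>x. v j x * a j x) x))"
            by (intro ennreal_leI sum_norm_le) (simp add: norm_mult)
          also have "\<dots> = (\<Sum>j<m. ennreal (norm (c j)) * ennreal (norm (S (\<lambda>x. v j x * a j x) x)))"
            by (subst sum_ennreal[symmetric]) (auto simp: ennreal_mult')
          finally show "ennreal (1 * norm (S (\<lambda>x. \<Sum>j<m. c j * (v j x * a j x)) x)) * indicator (space M) x
            \<le> (\<Sum>j<m. ennreal (norm (c j)) * ennreal (norm (S (\<lambda>x. v j x * a j x) x)))"
            unfolding x by (simp add: space_eq)
        qed
      qed
      also have "\<dots> = (\<Sum>j<m. \<integral>\<^sup>+x. ennreal (norm (c j)) * ennreal (norm (S (\<lambda>x. v j x * a j x) x)) \<partial>M)"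
        by (rule nn_integral_sum) measurable
      also have "\<dots> \<le> (\<Sum>j<m. ennreal (norm (c j) * Cl))"
      proof (rule sum_mono)
        fix j
        have "(\<integral>\<^sup>+x. ennreal (norm (c j)) * ennreal (norm (S (\<lambda>x. v j x * a j x) x)) \<partial>M)
          = ennreal (norm (c j)) * (\<integral>\<^sup>+x. ennreal (norm (S (\<lambda>x. v j x * a j x) x)) \<partial>M)" by (rule nn_integral_cmult) measurable
        also have "\<dots> \<le> ennreal (norm (c j)) * ennreal Cl" by (intro mult_left_mono Cl(2)[OF a vm v]) simp
        also have "\<dots> = ennreal (norm (c j) * Cl)" by (rule ennreal_mult'[symmetric]) simp
        finally show "(\<integral>\<^sup>+x. ennreal (norm (c j)) * ennreal (norm (S (\<lambda>x. v j x * a j x) x)) \<partial>M) \<le> ennreal (norm (c j) * Cl)" .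
      qed
      also have "\<dots> = ennreal (\<Sum>j<m. norm (c j) * Cl)" by (rule sum_ennreal) (use Cl(1) in auto)
      also have "\<dots> \<le> ennreal (Cl * X)"
      proof (rule ennreal_leI)
        have "(\<Sum>j<m. norm (c j)) \<le> X" unfolding X_def by (rule sum_le_suminf[OF c]) auto
        then have "(\<Sum>j<m. norm (c j)) * Cl \<le> X * Cl" using Cl(1) by (intro mult_right_mono) auto
        then show "(\<Sum>j<m. norm (c j) * Cl) \<le> Cl * X" by (simp only: sum_distrib_right mult.commute[of Cl X])
      qed
      finally show "(\<integral>\<^sup>+x\<in>space M. ennreal (1 * norm (S (\<lambda>x. \<Sum>j<m. c j * (v j x * a j x)) x)) \<partial>M) \<le> ennreal (Cl * X)" .
    qed auto
    then have SG: "(\<integral>\<^sup>+x. ennreal (norm (S G x)) \<partial>M) \<le> ennreal (Cl * X)" by (simp add: space_eq)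
    have "Lp_norm M 1 (U f) \<le> (\<integral>\<^sup>+x. ennreal (norm (H x)) + ennreal (norm (S G x)) \<partial>M)"
      unfolding Lp_norm_1
    proof (rule nn_integral_mono_AE)
      show "AE x in M. ennreal (norm (U f x)) \<le> ennreal (norm (H x)) + ennreal (norm (S G x))"
        using Uf(3)
      proof eventually_elim
        fix x assume x: "U f x = H x - S G x"
        have "ennreal (norm (U f x)) \<le> ennreal (norm (H x) + norm (S G x))" unfolding x by (intro ennreal_leI norm_triangle_ineq4)
        then show "ennreal (norm (U f x)) \<le> ennreal (norm (H x)) + ennreal (norm (S G x))" by simp
      qed
    qed
    also have "\<dots> = (\<integral>\<^sup>+x. ennreal (norm (H x)) \<partial>M) + (\<integral>\<^sup>+x. ennreal (norm (S G x)) \<partial>M)" by (rule nn_integral_add) measurable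
    also have "\<dots> \<le> ennreal (2 * C * X) + ennreal (Cl * X)" by (rule add_mono[OF D(3) SG])
    also have "\<dots> = ennreal (2 * C * X + Cl * X)" using C(1) Cl(1) X by (intro ennreal_plus[symmetric]) auto
    finally show ?thesis by (simp only: X_def distrib_right)
  qed
  moreover have "0 < 2 * C + Cl" using C(1) Cl(1) by simp
  ultimately show ?thesis using that by blast
qed

section \<open>Density of the domain of the commutator\<close>

text \<open>The John-Nirenberg inequality raises the local integrability of \<open>b\<close> from
  exponent 1 to exponent \<open>s\<close>.\<close>

lemma b_powr_finite_on_ball:
  assumes "0 < r"
  shows "(\<integral>\<^sup>+x\<in>B z r. ennreal (norm (b x) powr s) \<partial>M) < top"
proof -
  from John_Nirenberg[OF s_pos, where 'k = 'k]
  obtain CJ where CJ: "0 < CJ" "\<And>A x R. 0 < A \<Longrightarrow> 0 < R \<Longrightarrow> MO_le b A x R \<Longrightarrow>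
    (\<integral>\<^sup>+y\<in>B x R. ennreal (norm (b y - ball_mean d M b x R) powr s) \<partial>M) \<le> ennreal (CJ * A powr s * V x R)"
    using b by blast
  have "0 < 1 + r / \<rho> z" using assms rho_pos[of z] by (simp add: add_pos_pos)
  then have "0 < A0 * (1 + r / \<rho> z) powr \<tau>" using A0 by simp
  from le_less_trans[OF CJ(2)[OF this assms MO_growth[OF assms]] ennreal_less_top]
  have osc: "(\<integral>\<^sup>+x\<in>B z r. ennreal (osc z r x powr s) \<partial>M) < top" .
  define m where "m = ball_mean d M b z r"
  have "(\<integral>\<^sup>+x\<in>B z r. ennreal (norm (b x) powr s) \<partial>M)
    \<le> (\<integral>\<^sup>+x. ennreal (2 powr s) * (ennreal (osc z r x powr s) * indicator (B z r) x + ennreal (norm m powr s) * indicator (B z r) x) \<partial>M)"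
  proof (rule nn_integral_mono)
    fix x
    have "norm (b x) \<le> osc z r x + norm m" using norm_triangle_ineq[of "b x - m" m] by (simp add: m_def)
    then have "norm (b x) powr s \<le> (osc z r x + norm m) powr s" using s_pos by (intro powr_mono2) auto
    also have "\<dots> \<le> 2 powr s * (osc z r x powr s + norm m powr s)" using s_pos by (intro powr_sum_le) auto
    finally have "ennreal (norm (b x) powr s) \<le> ennreal (2 powr s * (osc z r x powr s + norm m powr s))" by (rule ennreal_leI)
    also have "\<dots> = ennreal (2 powr s) * (ennreal (osc z r x powr s) + ennreal (norm m powr s))"
      by (subst ennreal_mult') (auto simp: ennreal_plus)
    finally show "ennreal (norm (b x) powr s) * indicator (B z r) x
      \<le> ennreal (2 powr s) * (ennreal (osc z r x powr s) * indicator (B z r) x + ennreal (norm m powr s) * indicator (B z r) x)"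
      by (auto split: split_indicator)
  qed
  also have "\<dots> = ennreal (2 powr s) * ((\<integral>\<^sup>+x\<in>B z r. ennreal (osc z r x powr s) \<partial>M) + ennreal (norm m powr s) * ennreal (V z r))"
    by (subst nn_integral_cmult, measurable, subst nn_integral_add) (auto simp: nn_integral_cmult_indicator emeasure_qball)
  also have "\<dots> < top" using osc by (simp add: ennreal_mult_less_top)
  finally show ?thesis .
qed

text \<open>Both \<open>b\<close> and the constant 1 have finite integrals of their power
  \<open>s\<close> over the ball, and multiplication by a bounded function that vanishes almost
  everywhere off it preserves this; hence one argument for a general factor
  \<open>w\<close>.\<close>

lemma bounded_in_commutator_domain:
  assumes gm[measurable]: "g \<in> borel_measurable M" and bd: "AE x in M. norm (g x) \<le> A"
    and out: "AE x in M. x \<notin> B z r \<longrightarrow> g x = 0" and r: "0 < r"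
  shows "g \<in> commutator_domain M s b"
proof -
  have "(\<integral>\<^sup>+x. ennreal (norm (w x * g x) powr s) \<partial>M) < top"
    if [measurable]: "w \<in> borel_measurable M" and fin: "(\<integral>\<^sup>+x\<in>B z r. ennreal (norm (w x) powr s) \<partial>M) < top" for w :: "'a \<Rightarrow> 'k"
  proof -
    have "(\<integral>\<^sup>+x. ennreal (norm (w x * g x) powr s) \<partial>M) \<le> (\<integral>\<^sup>+x. ennreal (\<bar>A\<bar> powr s) * (ennreal (norm (w x) powr s) * indicator (B z r) x) \<partial>M)"
    proof (rule nn_integral_mono_AE)
      show "AE x in M. ennreal (norm (w x * g x) powr s) \<le> ennreal (\<bar>A\<bar> powr s) * (ennreal (norm (w x) powr s) * indicator (B z r) x)"
        using bd out
      proof eventually_elim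
        fix x assume x: "norm (g x) \<le> A" "x \<notin> B z r \<longrightarrow> g x = 0"
        show "ennreal (norm (w x * g x) powr s) \<le> ennreal (\<bar>A\<bar> powr s) * (ennreal (norm (w x) powr s) * indicator (B z r) x)"
        proof (cases "x \<in> B z r")
          case True
          have "norm (g x) powr s \<le> \<bar>A\<bar> powr s" using x s_pos by (intro powr_mono2) auto
          then have "norm (w x * g x) powr s \<le> \<bar>A\<bar> powr s * norm (w x) powr s"
            by (simp add: norm_mult powr_mult mult.commute mult_right_mono)
          then have "ennreal (norm (w x * g x) powr s) \<le> ennreal (\<bar>A\<bar> powr s * norm (w x) powr s)" by (rule ennreal_leI)
          then show ?thesis using True by (simp add: ennreal_mult')
        next
          case False
          then show ?thesis using x s_pos by simp
        qed
      qed
    qed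
    also have "\<dots> = ennreal (\<bar>A\<bar> powr s) * (\<integral>\<^sup>+x\<in>B z r. ennreal (norm (w x) powr s) \<partial>M)" by (rule nn_integral_cmult) measurable
    also have "\<dots> < top" using fin by (simp add: ennreal_mult_less_top)
    finally show ?thesis .
  qed
  from this[of "\<lambda>_. 1"] this[of b] b_powr_finite_on_ball[OF r] show ?thesis
    by (auto simp: commutator_domain_def Ls_iff emeasure_qball)
qed

lemma H1atom_top_zero:
  assumes "0 < r" "r < \<rho> z"
  shows "H1atom top z r (\<lambda>_. 0)"
proof -
  have "supp d M (\<lambda>_. 0::'k) = {}" unfolding supp_def by (auto intro: exI[of _ "1::real"])
  moreover have "esssup M (\<lambda>x. 0::ennreal) \<le> 0" by (intro esssup_I) auto
  ultimately show ?thesis using assms by (auto simp: H1_atom_def Lp_norm_def)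
qed

lemma approximate_atom_top:
  assumes a: "H1atom top z r a"
  shows "a \<in> commutator_domain M s b"
  by (rule bounded_in_commutator_domain[OF _ H1atom_top_bound[OF a] H1atom_AE_zero[OF a]])
    (use a in \<open>auto simp: H1_atom_def\<close>)

text \<open>For finite \<open>q\<close> an atom is truncated, and the mean lost in the truncation is put back on a
  smaller concentric ball so that the closed support stays inside the open ball of the atom.\<close>

lemma approximate_atom_finite:
  assumes a: "H1atom (ennreal q) z r a" and q: "1 < q" "p \<le> q" and \<eta>: "0 < \<eta>"
  obtains g e h A where "H1atom (ennreal q) z r e" "H1atom (ennreal q) z r h"
    "\<And>x. a x - g x = of_real \<eta> * e x" "\<And>x. g x = A * h x" "g \<in> commutator_domain M s b"
proof -
  have am[measurable]: "a \<in> borel_measurable M" and r: "0 < r" "r < \<rho> z" and sa: "supp d M a \<subseteq> B z r"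
    and aq: "(\<integral>\<^sup>+x. ennreal (norm (a x) powr q) \<partial>M) \<le> ennreal (V z r powr (1 - q))"
    and mean: "r < \<rho> z / 4 \<longrightarrow> (\<integral>x. a x \<partial>M) = 0"
    using a H1atom_finite_iff[OF q(1)] by blast+
  have "ennreal 1 < ennreal q" using q by (intro ennreal_lessI) auto
  then have ai: "integrable M a" using H1atom_integrable[OF a _ ennreal_leI[OF q(2)]] by simp
  have q0: "0 < q" using q by simp
  define V' where "V' = V z (r / 2)"
  have V': "0 < V'" unfolding V'_def using r by (intro V_pos) auto
  have V: "0 < V z r" by (rule V_pos[OF r(1)])
  define t where "t n x = (if norm (a x) \<le> real n then 0 else a x)" for n :: nat and x
  have tm[measurable]: "t n \<in> borel_measurable M" for n unfolding t_def by measurable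
  have t_le: "norm (t n x) \<le> norm (a x)" for n x by (simp add: t_def)
  have t_ev: "\<forall>\<^sub>F n in sequentially. t n x = 0" for x
  proof -
    obtain k :: nat where k: "norm (a x) < real k" using reals_Archimedean2 by blast
    show ?thesis using eventually_ge_at_top[of k] by eventually_elim (use k in \<open>auto simp: t_def\<close>)
  qed
  have ti: "integrable M (t n)" for n by (rule Bochner_Integration.integrable_bound[OF ai]) (auto simp: t_le)
  define m where "m n = (\<integral>x. t n x \<partial>M)" for n
  have m0: "m \<longlonglongrightarrow> 0"
  proof -
    have "(\<lambda>n. \<integral>x. t n x \<partial>M) \<longlonglongrightarrow> (\<integral>x. 0 \<partial>M)"
    proof (rule integral_dominated_convergence[where w = "\<lambda>x. norm (a x)"])
      show "AE x in M. (\<lambda>n. t n x) \<longlonglongrightarrow> 0" by (intro AE_I2 tendsto_eventually t_ev)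
    qed (use ai t_le in auto)
    then show ?thesis by (simp add: m_def[abs_def])
  qed
  have tq: "(\<lambda>n. \<integral>\<^sup>+x. ennreal (norm (t n x) powr q) \<partial>M) \<longlonglongrightarrow> 0"
  proof -
    have "(\<lambda>n. \<integral>\<^sup>+x. ennreal (norm (t n x) powr q) \<partial>M) \<longlonglongrightarrow> (\<integral>\<^sup>+x. 0 \<partial>M)"
    proof (rule nn_integral_dominated_convergence[where w = "\<lambda>x. ennreal (norm (a x) powr q)"])
      show "(\<integral>\<^sup>+x. ennreal (norm (a x) powr q) \<partial>M) < \<infinity>" using aq by (auto intro: le_less_trans)
      show "AE x in M. ennreal (norm (t n x) powr q) \<le> ennreal (norm (a x) powr q)" for n
        using q0 by (intro AE_I2 ennreal_leI powr_mono2 t_le) auto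
      show "AE x in M. (\<lambda>n. ennreal (norm (t n x) powr q)) \<longlonglongrightarrow> 0"
      proof (rule AE_I2)
        fix x
        have "\<forall>\<^sub>F n in sequentially. ennreal (norm (t n x) powr q) = 0" using t_ev[of x] by eventually_elim (use q0 in simp)
        then show "(\<lambda>n. ennreal (norm (t n x) powr q)) \<longlonglongrightarrow> 0" by (rule tendsto_eventually)
      qed
    qed auto
    then show ?thesis by simp
  qed
  define c where "c n = m n /\<^sub>R V'" for n
  define D where "D n x = t n x - indicator (B z (r / 2)) x *\<^sub>R c n" for n x
  have Dm[measurable]: "D n \<in> borel_measurable M" for n unfolding D_def by measurable
  define bd where "bd n = ennreal (2 powr q) * ((\<integral>\<^sup>+x. ennreal (norm (t n x) powr q) \<partial>M) + ennreal (norm (c n) powr q * V'))" for n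
  have D_le: "(\<integral>\<^sup>+x. ennreal (norm (D n x) powr q) \<partial>M) \<le> bd n" for n
  proof -
    have "(\<integral>\<^sup>+x. ennreal (norm (D n x) powr q) \<partial>M)
      \<le> (\<integral>\<^sup>+x. ennreal (2 powr q) * (ennreal (norm (t n x) powr q) + ennreal (norm (c n) powr q) * indicator (B z (r / 2)) x) \<partial>M)"
    proof (rule nn_integral_mono)
      fix x
      have "norm (D n x) \<le> norm (t n x) + norm (indicator (B z (r / 2)) x *\<^sub>R c n)" unfolding D_def by (rule norm_triangle_ineq4)
      then have "norm (D n x) powr q \<le> (norm (t n x) + norm (indicator (B z (r / 2)) x *\<^sub>R c n)) powr q" using q0 by (intro powr_mono2) auto
      also have "\<dots> \<le> 2 powr q * (norm (t n x) powr q + norm (indicator (B z (r / 2)) x *\<^sub>R c n) powr q)" using q0 by (intro powr_sum_le) auto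
      finally have "ennreal (norm (D n x) powr q) \<le> ennreal (2 powr q * (norm (t n x) powr q + norm (indicator (B z (r / 2)) x *\<^sub>R c n) powr q))" by (rule ennreal_leI)
      also have "\<dots> = ennreal (2 powr q) * (ennreal (norm (t n x) powr q) + ennreal (norm (indicator (B z (r / 2)) x *\<^sub>R c n) powr q))"
        by (subst ennreal_mult') (auto simp: ennreal_plus)
      also have "ennreal (norm (indicator (B z (r / 2)) x *\<^sub>R c n) powr q) = ennreal (norm (c n) powr q) * indicator (B z (r / 2)) x"
        using q0 by (auto split: split_indicator)
      finally show "ennreal (norm (D n x) powr q) \<le> ennreal (2 powr q) * (ennreal (norm (t n x) powr q) + ennreal (norm (c n) powr q) * indicator (B z (r / 2)) x)" .
    qed
    also have "\<dots> = bd n"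
      by (subst nn_integral_cmult, measurable, subst nn_integral_add)
        (auto simp: nn_integral_cmult_indicator emeasure_qball bd_def V'_def ennreal_mult')
    finally show ?thesis .
  qed
  have "(\<lambda>n. norm (c n) powr q * V') \<longlonglongrightarrow> 0"
  proof -
    have "c \<longlonglongrightarrow> 0 /\<^sub>R V'" unfolding c_def by (intro tendsto_scaleR tendsto_const m0)
    then have "(\<lambda>n. norm (c n)) \<longlonglongrightarrow> 0" by (simp add: tendsto_norm_zero)
    then have "(\<lambda>n. norm (c n) powr q) \<longlonglongrightarrow> 0" using q0 by (intro tendsto_zero_powrI[OF _ tendsto_const]) auto
    then show ?thesis by (rule tendsto_mult_left_zero)
  qed
  then have "(\<lambda>n. ennreal (norm (c n) powr q * V')) \<longlonglongrightarrow> ennreal 0" by (rule tendsto_ennrealI)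
  then have "(\<lambda>n. (\<integral>\<^sup>+x. ennreal (norm (t n x) powr q) \<partial>M) + ennreal (norm (c n) powr q * V')) \<longlonglongrightarrow> 0 + 0"
    by (intro tendsto_add tq) simp
  then have "bd \<longlonglongrightarrow> ennreal (2 powr q) * 0"
    unfolding bd_def[abs_def] by (intro ennreal_tendsto_cmult) auto
  then have "bd \<longlonglongrightarrow> 0" by simp
  moreover have "0 < ennreal (\<eta> powr q * V z r powr (1 - q))" using \<eta> V by simp
  ultimately have "\<forall>\<^sub>F n in sequentially. bd n < ennreal (\<eta> powr q * V z r powr (1 - q))" by (rule order_tendstoD(2))
  then obtain n where n: "bd n < ennreal (\<eta> powr q * V z r powr (1 - q))" by (auto simp: eventually_sequentially)
  have Dq: "(\<integral>\<^sup>+x. ennreal (norm (D n x) powr q) \<partial>M) \<le> ennreal (\<eta> powr q * V z r powr (1 - q))"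
    using D_le[of n] n by simp
  have Di: "integrable M (D n)" unfolding D_def using ti emeasure_qball_finite
    by (intro Bochner_Integration.integrable_diff integrable_scaleR_left integrable_real_indicator) auto
  have D0: "(\<integral>x. D n x \<partial>M) = 0"
  proof -
    have "(\<integral>x. D n x \<partial>M) = m n - (\<integral>x. indicator (B z (r / 2)) x *\<^sub>R c n \<partial>M)"
      unfolding D_def m_def using ti emeasure_qball_finite
      by (intro Bochner_Integration.integral_diff integrable_scaleR_left integrable_real_indicator) auto
    also have "(\<integral>x. indicator (B z (r / 2)) x *\<^sub>R c n \<partial>M) = V' *\<^sub>R c n"
      unfolding V'_def using emeasure_qball_finite by (subst integral_scaleR_left) (auto simp: space_eq)
    also have "V' *\<^sub>R c n = m n" using V' by (simp add: c_def)
    finally show ?thesis by simp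
  qed
  have sub: "{x. d z x \<le> r / 2} \<subseteq> B z r" using r by auto
  have D_ne: "a y \<noteq> 0 \<or> y \<in> B z (r / 2)" if "D n y \<noteq> 0" for y
    using that unfolding D_def t_def by (auto split: if_splits split_indicator_asm)
  define e where "e x = (1 / \<eta>) *\<^sub>R D n x" for x
  have [measurable]: "e \<in> borel_measurable M" unfolding e_def by measurable
  have "supp d M e \<subseteq> supp d M a \<union> {x. d z x \<le> r / 2}"
    by (rule supp_subset_Un) (use D_ne in \<open>auto simp: e_def\<close>)
  then have se: "supp d M e \<subseteq> B z r" using sa sub by blast
  have eq: "(\<integral>\<^sup>+x. ennreal (norm (e x) powr q) \<partial>M) \<le> ennreal (V z r powr (1 - q))"
  proof -
    have "(\<integral>\<^sup>+x. ennreal (norm (e x) powr q) \<partial>M) = (\<integral>\<^sup>+x. ennreal (1 / \<eta> powr q) * ennreal (norm (D n x) powr q) \<partial>M)"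
      using \<eta> by (intro nn_integral_cong) (simp add: e_def powr_divide ennreal_mult'[symmetric])
    also have "\<dots> = ennreal (1 / \<eta> powr q) * (\<integral>\<^sup>+x. ennreal (norm (D n x) powr q) \<partial>M)" by (rule nn_integral_cmult) measurable
    also have "\<dots> \<le> ennreal (1 / \<eta> powr q) * ennreal (\<eta> powr q * V z r powr (1 - q))" by (rule mult_left_mono[OF Dq]) simp
    also have "\<dots> = ennreal (1 / \<eta> powr q * (\<eta> powr q * V z r powr (1 - q)))" by (rule ennreal_mult'[symmetric]) simp
    also have "1 / \<eta> powr q * (\<eta> powr q * V z r powr (1 - q)) = V z r powr (1 - q)" using \<eta> by simp
    finally show ?thesis .
  qed
  have "(\<integral>x. e x \<partial>M) = 0" unfolding e_def using D0 by simp
  then have e_atom: "H1atom (ennreal q) z r e"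
    unfolding H1atom_finite_iff[OF q(1)] using r se eq by simp
  define g where "g x = a x - D n x" for x
  have [measurable]: "g \<in> borel_measurable M" unfolding g_def by measurable
  have "supp d M g \<subseteq> supp d M a \<union> {x. d z x \<le> r / 2}"
  proof (rule supp_subset_Un)
    fix y assume "g y \<noteq> 0"
    then have "a y \<noteq> 0 \<or> D n y \<noteq> 0" by (auto simp: g_def)
    then show "a y \<noteq> 0 \<or> y \<in> B z (r / 2)" using D_ne by blast
  qed auto
  then have sg: "supp d M g \<subseteq> B z r" using sa sub by blast
  have "norm (g x) \<le> real n + norm (c n)" for x
  proof -
    have "g x = (if norm (a x) \<le> real n then a x else 0) + indicator (B z (r / 2)) x *\<^sub>R c n" by (simp add: g_def D_def t_def)
    then have "norm (g x) \<le> norm (if norm (a x) \<le> real n then a x else 0) + norm (indicator (B z (r / 2)) x *\<^sub>R c n)"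
      by (simp only: norm_triangle_ineq)
    also have "\<dots> \<le> real n + norm (c n)" by (intro add_mono) (auto split: split_indicator)
    finally show ?thesis .
  qed
  then have g_bd: "AE x in M. norm (g x) \<le> real n + norm (c n)" by simp
  have g_out: "AE x in M. x \<notin> B z r \<longrightarrow> g x = 0"
    using AE_in_supp[of g, OF \<open>g \<in> borel_measurable M\<close>] by eventually_elim (use sg in blast)
  have g_dom: "g \<in> commutator_domain M s b" by (rule bounded_in_commutator_domain[OF _ g_bd g_out r(1)]) measurable
  have "(\<integral>\<^sup>+x. ennreal (norm (g x) powr q) \<partial>M) < top"
  proof -
    have "(\<integral>\<^sup>+x. ennreal (norm (- D n x) powr q) \<partial>M) < top" using Dq by (auto intro: le_less_trans)
    moreover have "(\<integral>\<^sup>+x. ennreal (norm (a x) powr q) \<partial>M) < top" using aq by (auto intro: le_less_trans)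
    ultimately have "(\<integral>\<^sup>+x. ennreal (norm (a x + (- D n x)) powr q) \<partial>M) < top"
      using q0 by (intro nn_integral_powr_add_finite) auto
    then show ?thesis by (simp add: g_def)
  qed
  then obtain X where X: "(\<integral>\<^sup>+x. ennreal (norm (g x) powr q) \<partial>M) = ennreal X" "0 \<le> X"
    by (cases "\<integral>\<^sup>+x. ennreal (norm (g x) powr q) \<partial>M") auto
  define W where "W = V z r powr (1 - q)"
  have W: "0 < W" using V by (simp add: W_def)
  \<comment> \<open>The summand 1 keeps \<open>A\<close> positive even when \<open>g\<close>
    vanishes, so that \<open>g / A\<close> is an atom in all cases.\<close>
  define A where "A = (X / W + 1) powr (1 / q)"
  have XW: "0 < X / W + 1" using X(2) W by (simp add: add_nonneg_pos)
  have A: "0 < A" "A powr q = X / W + 1" using XW q0 by (auto simp: A_def powr_powr)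
  define h where "h x = (1 / A) *\<^sub>R g x" for x
  have [measurable]: "h \<in> borel_measurable M" unfolding h_def by measurable
  have "supp d M h \<subseteq> supp d M g" unfolding supp_def h_def using A(1) by auto
  then have sh: "supp d M h \<subseteq> B z r" using sg by blast
  have hq: "(\<integral>\<^sup>+x. ennreal (norm (h x) powr q) \<partial>M) \<le> ennreal (V z r powr (1 - q))"
  proof -
    have "(\<integral>\<^sup>+x. ennreal (norm (h x) powr q) \<partial>M) = (\<integral>\<^sup>+x. ennreal (1 / A powr q) * ennreal (norm (g x) powr q) \<partial>M)"
      using A(1) by (intro nn_integral_cong) (simp add: h_def powr_divide ennreal_mult'[symmetric])
    also have "\<dots> = ennreal (1 / A powr q) * ennreal X" unfolding X(1)[symmetric] by (rule nn_integral_cmult) measurable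
    also have "\<dots> = ennreal (1 / A powr q * X)" by (rule ennreal_mult'[symmetric]) simp
    also have "\<dots> \<le> ennreal W"
    proof (rule ennreal_leI)
      have "X = W * (X / W)" using W by simp
      also have "\<dots> \<le> W * (X / W + 1)" using W by (intro mult_left_mono) auto
      finally show "1 / A powr q * X \<le> W" unfolding A(2) using XW by (simp add: pos_divide_le_eq)
    qed
    finally show ?thesis by (simp only: W_def)
  qed
  \<comment> \<open>As \<open>D n\<close> has mean zero, \<open>g\<close> inherits the mean of
    \<open>a\<close>, and with it the cancellation whenever that is required.\<close>
  have "(\<integral>x. g x \<partial>M) = (\<integral>x. a x \<partial>M)"
    unfolding g_def using ai Di D0 by (subst Bochner_Integration.integral_diff) auto
  then have "(\<integral>x. h x \<partial>M) = (1 / A) *\<^sub>R (\<integral>x. a x \<partial>M)" unfolding h_def by simp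
  then have h_atom: "H1atom (ennreal q) z r h"
    unfolding H1atom_finite_iff[OF q(1)] using r sh hq mean by simp
  show ?thesis
  proof (rule that[OF e_atom h_atom _ _ g_dom])
    show "a x - g x = of_real \<eta> * e x" for x using \<eta> by (simp add: g_def e_def scaleR_conv_of_real mult.assoc[symmetric] flip: of_real_mult)
    show "g x = of_real A * h x" for x using A(1) by (simp add: h_def scaleR_conv_of_real mult.assoc[symmetric] flip: of_real_mult)
  qed
qed

lemma approximate_atom:
  assumes a: "H1atom q z r a" and q: "1 < q" "ennreal p \<le> q" and \<eta>: "0 < \<eta>"
  shows "\<exists>g e h A. H1atom q z r e \<and> H1atom q z r h \<and> (\<forall>x. a x - g x = of_real \<eta> * e x) \<and> (\<forall>x. g x = A * h x)
    \<and> g \<in> commutator_domain M s b"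
proof (cases q)
  \<comment> \<open>Such an atom is bounded, so it approximates itself and the error is the zero
    atom.\<close>
  case top
  have "H1atom q z r (\<lambda>_. 0)" unfolding top using a by (intro H1atom_top_zero) (auto simp: H1_atom_def)
  then show ?thesis using a approximate_atom_top[OF a[unfolded top]]
    by (intro exI[of _ a] exI[of _ "\<lambda>_. 0"] exI[of _ 1]) auto
next
  case (real q')
  have q': "1 < q'" "p \<le> q'" using q real p by (auto simp: ennreal_le_iff2)
  obtain g e h A where "H1atom (ennreal q') z r e" "H1atom (ennreal q') z r h"
    "\<And>x. a x - g x = of_real \<eta> * e x" "\<And>x. g x = A * h x" "g \<in> commutator_domain M s b"
    by (rule approximate_atom_finite[OF _ q' \<eta>]) (use a real in auto)
  moreover have "q = ennreal q'" using real by simp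
  ultimately show ?thesis by blast
qed

lemma commutator_domain_sum:
  assumes "\<And>j. j \<in> I \<Longrightarrow> g j \<in> commutator_domain M s b"
  shows "(\<lambda>x. \<Sum>j\<in>I. c j * g j x) \<in> commutator_domain M s b"
proof -
  have "(\<lambda>x. \<Sum>j\<in>I. c j * g j x) \<in> Ls" using assms by (intro Ls_sum Ls_cmult) (auto simp: commutator_domain_def)
  moreover have "(\<lambda>x. \<Sum>j\<in>I. c j * (b x * g j x)) \<in> Ls" using assms by (intro Ls_sum Ls_cmult) (auto simp: commutator_domain_def)
  moreover have "(\<lambda>x. \<Sum>j\<in>I. c j * (b x * g j x)) = (\<lambda>x. b x * (\<Sum>j\<in>I. c j * g j x))"
    by (simp add: sum_distrib_left mult.left_commute)
  ultimately show ?thesis by (simp add: commutator_domain_def)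
qed

lemma H1_norm_le:
  assumes "H1_decomposition d M \<rho> q f c a"
  shows "H1_norm d M \<rho> q f \<le> (\<Sum>j. norm (c j))"
  unfolding H1_norm_def
proof (rule cInf_lower)
  show "(\<Sum>j. norm (c j)) \<in> {\<Sum>j. norm (c j) |c a. H1_decomposition d M \<rho> q f c a}" using assms by blast
  show "bdd_below {\<Sum>j. norm (c j) |c a. H1_decomposition d M \<rho> q f c a}"
    by (rule bdd_belowI[of _ 0]) (auto simp: H1_decomposition_def intro!: suminf_nonneg)
qed

text \<open>The series is cut at \<open>N\<close> and each of the first \<open>N\<close> atoms is
  replaced by its approximation. The difference then has an explicit atomic decomposition, with
  coefficients shrunk by \<open>\<eta>\<close> before \<open>N\<close> and unchanged after it, so
  its norm is at most \<open>\<eta> * X\<close> plus a tail.\<close>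

theorem commutator_domain_dense:
  assumes q: "1 < q" "ennreal p \<le> q" and f: "f \<in> H1 d M \<rho> q" and "0 < \<epsilon>"
  shows "\<exists>g \<in> H1 d M \<rho> q \<inter> commutator_domain M s b. H1_norm d M \<rho> q (\<lambda>x. f x - g x) < \<epsilon>"
proof -
  obtain c a where dec: "H1_decomposition d M \<rho> q f c a" using f by (auto simp: H1_def)
  have c: "summable (\<lambda>j. norm (c j))"
    and lim: "(\<lambda>n. Lp_norm M 1 (\<lambda>x. f x - (\<Sum>j<n. c j * a j x))) \<longlonglongrightarrow> 0"
    using dec unfolding H1_decomposition_def by auto
  obtain z r where at: "\<And>j. H1atom q (z j) (r j) (a j)" using dec unfolding H1_decomposition_def by metis
  define X where "X = (\<Sum>j. norm (c j))"
  have X: "0 \<le> X" unfolding X_def by (intro suminf_nonneg c) auto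
  \<comment> \<open>\<open>X + 1\<close> keeps the denominator positive when all coefficients
    vanish.\<close>
  define \<eta> where "\<eta> = \<epsilon> / (2 * (X + 1))"
  have \<eta>: "0 < \<eta>" using X \<open>0 < \<epsilon>\<close> by (simp add: \<eta>_def)
  have "(\<lambda>N. \<Sum>j. norm (c (j + N))) \<longlonglongrightarrow> 0" by (rule suminf_exist_split2[OF c])
  then have "\<forall>\<^sub>F N in sequentially. (\<Sum>j. norm (c (j + N))) < \<epsilon> / 2" using \<open>0 < \<epsilon>\<close> by (intro order_tendstoD(2)) auto
  then obtain N where N: "(\<Sum>j. norm (c (j + N))) < \<epsilon> / 2" by (auto simp: eventually_sequentially)
  have "\<forall>j. \<exists>g e h A. H1atom q (z j) (r j) e \<and> H1atom q (z j) (r j) h \<and> (\<forall>x. a j x - g x = of_real \<eta> * e x) \<and> (\<forall>x. g x = A * h x)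
    \<and> g \<in> commutator_domain M s b"
    using approximate_atom[OF at q \<eta>] by blast
  then obtain g e h A where ap: "\<And>j. H1atom q (z j) (r j) (e j)" "\<And>j. H1atom q (z j) (r j) (h j)"
    "\<And>j x. a j x - g j x = of_real \<eta> * e j x" "\<And>j x. g j x = A j * h j x" "\<And>j. g j \<in> commutator_domain M s b"
    by metis
  define G where "G x = (\<Sum>j<N. c j * g j x)" for x
  have G_dom: "G \<in> commutator_domain M s b" unfolding G_def by (rule commutator_domain_sum[OF ap(5)])
  \<comment> \<open>Beyond \<open>N\<close> the coefficients are 0, but a decomposition must carry
    an atom at every index; the original atoms fill these places.\<close>
  define c2 where "c2 j = (if j < N then c j * A j else 0)" for j
  define a2 where "a2 j = (if j < N then h j else a j)" for j
  have G_eq: "G x - (\<Sum>j<n. c2 j * a2 j x) = 0" if "N \<le> n" for n x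
  proof -
    have "(\<Sum>j<n. c2 j * a2 j x) = (\<Sum>j<N. c2 j * a2 j x)"
      using that by (intro sum.mono_neutral_right) (auto simp: c2_def)
    also have "\<dots> = G x" unfolding G_def by (intro sum.cong) (auto simp: c2_def a2_def ap(4) mult.assoc)
    finally show ?thesis by simp
  qed
  have G_H1: "G \<in> H1 d M \<rho> q"
  proof -
    have "integrable M (\<lambda>x. \<Sum>j<N. c j * g j x)"
      unfolding ap(4) using H1atom_integrable[OF ap(2) q] by auto
    then have Gi: "integrable M G" by (simp add: G_def[abs_def])
    then have "G \<in> Lp M 1" by (auto simp: Lp_def Lp_norm_1 integrable_iff_bounded)
    moreover have "H1_decomposition d M \<rho> q G c2 a2"
      unfolding H1_decomposition_def
    proof (intro conjI allI)
      show "\<exists>x0 r. H1atom q x0 r (a2 j)" for j using at ap(2) unfolding a2_def by auto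
      have "\<And>j. j \<notin> {..<N} \<Longrightarrow> norm (c2 j) = 0" by (simp add: c2_def)
      then show "summable (\<lambda>j. norm (c2 j))" by (intro summable_finite[of "{..<N}"]) auto
      have "\<forall>\<^sub>F n in sequentially. Lp_norm M 1 (\<lambda>x. G x - (\<Sum>j<n. c2 j * a2 j x)) = 0"
        using eventually_ge_at_top[of N] by eventually_elim (simp add: G_eq Lp_norm_1)
      then show "(\<lambda>n. Lp_norm M 1 (\<lambda>x. G x - (\<Sum>j<n. c2 j * a2 j x))) \<longlonglongrightarrow> 0" by (rule tendsto_eventually)
    qed
    ultimately show ?thesis by (auto simp: H1_def)
  qed
  define c3 where "c3 j = (if j < N then c j * of_real \<eta> else c j)" for j
  define a3 where "a3 j = (if j < N then e j else a j)" for j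
  have eq3: "f x - G x - (\<Sum>j<n. c3 j * a3 j x) = f x - (\<Sum>j<n. c j * a j x)" if "N \<le> n" for n x
  proof -
    have split: "(\<Sum>j<n. w j) = (\<Sum>j<N. w j) + (\<Sum>j=N..<n. w j)" for w :: "nat \<Rightarrow> 'k"
      using that by (simp add: lessThan_atLeast0 sum.atLeastLessThan_concat)
    have "(\<Sum>j<N. c3 j * a3 j x) = (\<Sum>j<N. c j * a j x) - G x"
      unfolding G_def sum_subtractf[symmetric]
      by (intro sum.cong) (auto simp: c3_def a3_def ap(3)[symmetric] mult.assoc right_diff_distrib[symmetric])
    moreover have "(\<Sum>j=N..<n. c3 j * a3 j x) = (\<Sum>j=N..<n. c j * a j x)" by (intro sum.cong) (auto simp: c3_def a3_def)
    ultimately show ?thesis unfolding split by simp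
  qed
  define y where "y j = \<eta> * norm (c j) + (if j < N then 0 else norm (c j))" for j
  have c3_le: "norm (c3 j) \<le> y j" for j using \<eta> by (simp add: c3_def y_def norm_mult)
  have s_tail: "summable (\<lambda>j. if j < N then 0 else norm (c j))"
    by (rule summable_comparison_test[OF _ c]) auto
  have sy: "summable y" unfolding y_def by (intro summable_add summable_mult c s_tail)
  have s3: "summable (\<lambda>j. norm (c3 j))" by (rule summable_comparison_test[OF _ sy]) (use c3_le in auto)
  have dec3: "H1_decomposition d M \<rho> q (\<lambda>x. f x - G x) c3 a3"
    unfolding H1_decomposition_def
  proof (intro conjI allI)
    show "\<exists>x0 r. H1atom q x0 r (a3 j)" for j using at ap(1) unfolding a3_def by auto
    show "summable (\<lambda>j. norm (c3 j))" by (rule s3)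
    have "\<forall>\<^sub>F n in sequentially. Lp_norm M 1 (\<lambda>x. f x - (\<Sum>j<n. c j * a j x)) = Lp_norm M 1 (\<lambda>x. f x - G x - (\<Sum>j<n. c3 j * a3 j x))"
      using eventually_ge_at_top[of N] by eventually_elim (simp add: eq3)
    then show "(\<lambda>n. Lp_norm M 1 (\<lambda>x. f x - G x - (\<Sum>j<n. c3 j * a3 j x))) \<longlonglongrightarrow> 0"
      by (rule Lim_transform_eventually[OF lim])
  qed
  have "(\<Sum>j. norm (c3 j)) \<le> suminf y" by (intro suminf_le c3_le s3 sy)
  also have "suminf y = \<eta> * X + (\<Sum>j. if j < N then 0 else norm (c j))"
    unfolding y_def X_def using c s_tail by (subst suminf_add[symmetric]) (auto intro: summable_mult simp: suminf_mult)
  also have "(\<Sum>j. if j < N then 0 else norm (c j)) = (\<Sum>j. norm (c (j + N)))"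
    using suminf_split_initial_segment[OF s_tail, of N] by simp
  also have "\<eta> * X + (\<Sum>j. norm (c (j + N))) < \<epsilon> / 2 + \<epsilon> / 2"
  proof (rule add_le_less_mono[OF _ N])
    have "\<eta> * X \<le> \<eta> * (X + 1)" using \<eta> by simp
    also have "\<dots> = \<epsilon> / 2" using X by (simp add: \<eta>_def field_simps)
    finally show "\<eta> * X \<le> \<epsilon> / 2" .
  qed
  finally have "H1_norm d M \<rho> q (\<lambda>x. f x - G x) < \<epsilon>" using H1_norm_le[OF dec3] by simp
  then show ?thesis using G_H1 G_dom by blast
qed

text \<open>The bound on \<open>U f\<close> holds for every decomposition with the same constant, so
  it survives the infimum that defines the Hardy norm. \<open>tnorm\<close> stays abstract so that
  parts (i) and (ii) share this step.\<close>

lemma commutator_bounded: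
  assumes q: "1 < q" "ennreal p \<le> q" and C: "0 < C"
    and bound: "\<And>f c z r a. ndec f c z r a \<Longrightarrow> tnorm (U f) \<le> ennreal (C * (\<Sum>j. norm (c j)))"
  shows "commutator_bounded_from_H1 d M \<rho> q s b T tnorm"
proof -
  obtain C0 where AC: "atom_const C0" by (rule atom_const_exists)
  have *: "\<exists>h. h \<in> borel_measurable M \<and> conv_measure M (\<lambda>n. Ut n f) h \<and> integrable M f" if f: "f \<in> H1 d M \<rho> q" for f :: "'a \<Rightarrow> 'k"
  proof -
    obtain c a where "f \<in> Lp M 1" "H1_decomposition d M \<rho> q f c a" using f by (auto simp: H1_def)
    then obtain z r a' where dec: "ndec f c z r a'" by (rule decomposition_ndec[OF _ _ q])
    note D = U_decomposition[OF dec AC]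
    note [measurable] = D(1) S_measurable[OF D(2)]
    show ?thesis
    proof (intro exI conjI)
      show "conv_measure M (\<lambda>n. Ut n f) (\<lambda>x. (\<Sum>j. c j * ((b x - ball_mean d M b (z j) (r j)) * S (a' j) x)) -
        S (\<lambda>x. \<Sum>j. c j * ((b x - ball_mean d M b (z j) (r j)) * a' j x)) x)" by (rule D(6))
      show "(\<lambda>x. (\<Sum>j. c j * ((b x - ball_mean d M b (z j) (r j)) * S (a' j) x)) -
        S (\<lambda>x. \<Sum>j. c j * ((b x - ball_mean d M b (z j) (r j)) * a' j x)) x) \<in> borel_measurable M" by measurable
      show "integrable M f" using dec by (simp add: ndec_def)
    qed
  qed
  show ?thesis
    unfolding commutator_bounded_from_H1_def
  proof (intro conjI exI[of _ U] ballI allI impI)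
    fix f :: "'a \<Rightarrow> 'k" and \<epsilon> :: real assume "f \<in> H1 d M \<rho> q" "0 < \<epsilon>"
    then show "\<exists>g \<in> H1 d M \<rho> q \<inter> commutator_domain M s b. H1_norm d M \<rho> q (\<lambda>x. f x - g x) < \<epsilon>"
      by (rule commutator_domain_dense[OF q])
  next
    show "ae_linear_on M (H1 d M \<rho> q) U"
      unfolding ae_linear_on_def
    proof (intro ballI allI)
      fix f g :: "'a \<Rightarrow> 'k" and c :: 'k assume "f \<in> H1 d M \<rho> q" "g \<in> H1 d M \<rho> q"
      then obtain hf hg where "hf \<in> borel_measurable M" "conv_measure M (\<lambda>n. Ut n f) hf" "integrable M f"
        "hg \<in> borel_measurable M" "conv_measure M (\<lambda>n. Ut n g) hg" "integrable M g" using * by meson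
      then show "AE x in M. U (\<lambda>y. c * f y + g y) x = c * U f x + U g x" by (intro U_lin)
    qed
  next
    fix f :: "'a \<Rightarrow> 'k" assume f: "f \<in> H1 d M \<rho> q \<inter> commutator_domain M s b"
    then obtain h where "h \<in> borel_measurable M" "conv_measure M (\<lambda>n. Ut n f) h" "integrable M f" using *[of f] by blast
    then show "AE x in M. U f x = commutator b T f x"
      using f by (intro U_eq_commutator) (auto simp: commutator_domain_def)
  next
    show "\<exists>C. \<forall>f\<in>H1 d M \<rho> q. U f \<in> borel_measurable M \<and> tnorm (U f) \<le> ennreal (C * H1_norm d M \<rho> q f)"
    proof (intro exI ballI conjI)
      fix f :: "'a \<Rightarrow> 'k" assume f: "f \<in> H1 d M \<rho> q"
      then obtain h where "h \<in> borel_measurable M" "conv_measure M (\<lambda>n. Ut n f) h" "integrable M f" using * by meson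
      then show "U f \<in> borel_measurable M" by (rule U_props(1))
      have f1: "f \<in> Lp M 1" and ex: "\<exists>c a. H1_decomposition d M \<rho> q f c a" using f by (auto simp: H1_def)
      show "tnorm (U f) \<le> ennreal (C * H1_norm d M \<rho> q f)"
        unfolding H1_norm_def
      proof (rule ennreal_le_mult_Inf[OF _ _ C])
        show "{\<Sum>j. norm (c j) |c a. H1_decomposition d M \<rho> q f c a} \<noteq> {}" using ex by blast
        fix x assume "x \<in> {\<Sum>j. norm (c j) |c a. H1_decomposition d M \<rho> q f c a}"
        then obtain c a where x: "x = (\<Sum>j. norm (c j))" and dec: "H1_decomposition d M \<rho> q f c a" by blast
        show "0 \<le> x" unfolding x using dec by (intro suminf_nonneg) (auto simp: H1_decomposition_def)
        obtain z r a' where "ndec f c z r a'" by (rule decomposition_ndec[OF f1 dec q])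
        then show "tnorm (U f) \<le> ennreal (C * x)" unfolding x by (rule bound)
      qed
    qed
  qed
qed

end

section \<open>From oscillation norms to growth conditions\<close>

text \<open>A change of form: norms become integrals of the power \<open>s\<close>, and the
  constants that exist for each \<open>N\<close> are collected in one function.\<close>

lemma CZ_operator_imp_cz_operator:
  fixes T :: "('a \<Rightarrow> 'k::{real_normed_field, banach, second_countable_topology}) \<Rightarrow> ('a \<Rightarrow> 'k)"
  assumes hts: "homogeneous_type_space d \<kappa> M" and \<rho>: "\<And>x. 0 < \<rho> x" and s: "1 < s" and \<delta>: "0 < \<delta>"
    and CZ: "CZ_operator d \<kappa> M \<rho> s \<delta> T"
  obtains K CT C1 CN where "cz_operator d \<kappa> M \<rho> s \<delta> T K CT C1 CN"
proof -
  interpret homogeneous_type_space d \<kappa> M by (rule hts)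
  let ?A = "\<lambda>z R. {x. R \<le> d x z \<and> d x z < 2 * \<kappa> * R}"
  have s0: "0 < s" using s by simp
  obtain C where C: "\<And>f. f \<in> Lp M (ennreal s) \<Longrightarrow> T f \<in> borel_measurable M"
    "\<And>f. f \<in> Lp M (ennreal s) \<Longrightarrow> weak_Lp_norm M s (T f) \<le> ennreal C * Lp_norm M (ennreal s) f"
  proof -
    from CZ[unfolded CZ_operator_def, THEN conjunct2, THEN conjunct1]
    obtain C where "\<forall>f\<in>Lp M (ennreal s). T f \<in> borel_measurable M \<and>
        weak_Lp_norm M s (T f) \<le> ennreal C * Lp_norm M (ennreal s) f" by (rule exE)
    then show ?thesis by (intro that[of C]) (drule (1) bspec, elim conjE, assumption)+
  qed
  obtain K where K: "has_kernel d M T K"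
    and size: "\<forall>N>0. \<exists>C>0. \<forall>x0 y R. 0 < R \<and> d y x0 \<le> R / (2 * \<kappa>) \<longrightarrow>
           enn_powr (\<integral>\<^sup>+ x\<in>?A x0 R. ennreal (norm (K x y) powr s) \<partial>M) (1 / s)
           \<le> ennreal (C / V x0 R powr (1 - 1 / s) * (1 + R / \<rho> x0) powr (- N))"
    and smooth: "\<exists>C>0. \<forall>x0 y R. 0 < R \<and> d y x0 \<le> R / (2 * \<kappa>) \<longrightarrow>
           enn_powr (\<integral>\<^sup>+ x\<in>?A x0 R. ennreal (norm (K x y - K x x0) powr s) \<partial>M) (1 / s)
           \<le> ennreal ((d y x0 / R) powr \<delta> * (C / V x0 R powr (1 - 1 / s)))"
    by (rule exE[OF CZ[unfolded CZ_operator_def, THEN conjunct2, THEN conjunct2]], elim conjE) (rule that)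
  obtain CN where CN: "\<And>N. 0 < N \<Longrightarrow> 0 < CN N" "\<And>N z y R. 0 < N \<Longrightarrow> 0 < R \<Longrightarrow> d y z \<le> R / (2 * \<kappa>) \<Longrightarrow>
      enn_powr (\<integral>\<^sup>+ x\<in>?A z R. ennreal (norm (K x y) powr s) \<partial>M) (1 / s)
      \<le> ennreal (CN N / V z R powr (1 - 1 / s) * (1 + R / \<rho> z) powr (- N))"
  proof -
    have "\<exists>c. 0 < N \<longrightarrow> 0 < c \<and> (\<forall>x0 y R. 0 < R \<and> d y x0 \<le> R / (2 * \<kappa>) \<longrightarrow>
           enn_powr (\<integral>\<^sup>+ x\<in>?A x0 R. ennreal (norm (K x y) powr s) \<partial>M) (1 / s)
           \<le> ennreal (c / V x0 R powr (1 - 1 / s) * (1 + R / \<rho> x0) powr (- N)))" for N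
      by (cases "0 < N") (use size in simp_all)
    from choice[OF allI[OF this]] obtain CN where "\<forall>N. 0 < N \<longrightarrow> 0 < CN N \<and> (\<forall>x0 y R. 0 < R \<and> d y x0 \<le> R / (2 * \<kappa>) \<longrightarrow>
           enn_powr (\<integral>\<^sup>+ x\<in>?A x0 R. ennreal (norm (K x y) powr s) \<partial>M) (1 / s)
           \<le> ennreal (CN N / V x0 R powr (1 - 1 / s) * (1 + R / \<rho> x0) powr (- N)))" by (rule exE)
    then show ?thesis by (intro that[of CN]) simp_all
  qed
  obtain C1 where C1: "0 < C1" "\<And>z y R. 0 < R \<Longrightarrow> d y z \<le> R / (2 * \<kappa>) \<Longrightarrow>
      enn_powr (\<integral>\<^sup>+ x\<in>?A z R. ennreal (norm (K x y - K x z) powr s) \<partial>M) (1 / s)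
      \<le> ennreal ((d y z / R) powr \<delta> * (C1 / V z R powr (1 - 1 / s)))"
    using smooth by blast
  \<comment> \<open>The operator bound is assumed with a constant of any sign, while the locale asks
    for a positive one.\<close>
  define C' where "C' = max C 1"
  have C': "0 < C'" "C \<le> C'" by (auto simp: C'_def)
  have V_powr: "(c / v powr (1 - 1 / s)) powr s = c powr s * v powr (1 - s)" if "0 < v" for c v :: real
  proof -
    have "(c / v powr (1 - 1 / s)) powr s = c powr s / v powr ((1 - 1 / s) * s)" by (simp add: powr_divide powr_powr)
    also have "(1 - 1 / s) * s = s - 1" using s0 by (simp add: field_simps)
    also have "c powr s / v powr (s - 1) = c powr s * v powr (1 - s)"
      using that by (simp add: powr_diff field_simps)
    finally show ?thesis .
  qed
  have "cz_operator d \<kappa> M \<rho> s \<delta> T K (C' powr s) C1 CN"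
  proof
    show "0 < \<rho> x" for x by (rule \<rho>)
    show "ae_linear_on M (Lp M (ennreal s)) T" using CZ by (simp add: CZ_operator_def)
    show "T f \<in> borel_measurable M" if "f \<in> Lp M (ennreal s)" for f by (rule C(1)[OF that])
    show "0 < C' powr s" using C' by simp
    show "emeasure M {x \<in> space M. t < norm (T f x)} \<le> ennreal (C' powr s / t powr s) * (\<integral>\<^sup>+x. ennreal (norm (f x) powr s) \<partial>M)"
      if f: "f \<in> Lp M (ennreal s)" and t: "0 < t" for f and t :: real
    proof -
      have "(\<integral>\<^sup>+x. ennreal (norm (f x) powr s) \<partial>M) < top" using f Lp_iff[OF s0] by blast
      then obtain j where j: "(\<integral>\<^sup>+x. ennreal (norm (f x) powr s) \<partial>M) = ennreal j" "0 \<le> j"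
        by (cases "\<integral>\<^sup>+x. ennreal (norm (f x) powr s) \<partial>M") auto
      have Lpn: "Lp_norm M (ennreal s) f = ennreal (j powr (1 / s))"
        using s0 j by (simp add: Lp_norm_def enn_powr_def)
      let ?m = "emeasure M {x \<in> space M. t < norm (T f x)}"
      have "ennreal t * enn_powr ?m (1 / s) \<le> weak_Lp_norm M s (T f)"
        unfolding weak_Lp_norm_def using t by (intro SUP_upper) simp
      also have "\<dots> \<le> ennreal C * ennreal (j powr (1 / s))" using C(2)[OF f] by (simp only: Lpn)
      also have "\<dots> \<le> ennreal C' * ennreal (j powr (1 / s))" using C' by (intro mult_right_mono ennreal_leI) auto
      finally have "ennreal (1 / t) * (ennreal t * enn_powr ?m (1 / s)) \<le> ennreal (1 / t) * (ennreal C' * ennreal (j powr (1 / s)))"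
        by (rule mult_left_mono) simp
      also have "ennreal (1 / t) * (ennreal t * enn_powr ?m (1 / s)) = enn_powr ?m (1 / s)"
        using t by (simp add: mult.assoc[symmetric] ennreal_mult'[symmetric])
      also have "ennreal (1 / t) * (ennreal C' * ennreal (j powr (1 / s))) = ennreal (C' * j powr (1 / s) / t)"
        using t C' by (simp add: ennreal_mult'[symmetric])
      finally have "?m \<le> ennreal ((C' * j powr (1 / s) / t) powr s)"
        using s0 C' t by (intro enn_powr_leD) auto
      also have "(C' * j powr (1 / s) / t) powr s = C' powr s / t powr s * j"
        using s0 j by (simp add: powr_divide powr_mult powr_powr)
      also have "ennreal (C' powr s / t powr s * j) = ennreal (C' powr s / t powr s) * ennreal j" by (rule ennreal_mult') (use j in simp)
      finally show ?thesis unfolding j(1) .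
    qed
    show "has_kernel d M T K" by (rule K)
    show "(\<integral>\<^sup>+x\<in>?A z R. ennreal (norm (K x y) powr s) \<partial>M) \<le> ennreal ((CN N * (1 + R / \<rho> z) powr (- N)) powr s * V z R powr (1 - s))"
      if "0 < N" "0 < R" "d y z \<le> R / (2 * \<kappa>)" for N R y z
    proof -
      have "(\<integral>\<^sup>+x\<in>?A z R. ennreal (norm (K x y) powr s) \<partial>M) \<le> ennreal ((CN N / V z R powr (1 - 1 / s) * (1 + R / \<rho> z) powr (- N)) powr s)"
        using CN(1)[OF that(1)] by (intro enn_powr_leD[OF CN(2)[OF that] s0]) simp
      also have "CN N / V z R powr (1 - 1 / s) * (1 + R / \<rho> z) powr (- N) = CN N * (1 + R / \<rho> z) powr (- N) / V z R powr (1 - 1 / s)" by simp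
      also have "\<dots> powr s = (CN N * (1 + R / \<rho> z) powr (- N)) powr s * V z R powr (1 - s)" by (rule V_powr[OF V_pos[OF that(2)]])
      finally show ?thesis .
    qed
    show "(\<integral>\<^sup>+x\<in>?A z R. ennreal (norm (K x y - K x z) powr s) \<partial>M) \<le> ennreal ((C1 * (d y z / R) powr \<delta>) powr s * V z R powr (1 - s))"
      if "0 < R" "d y z \<le> R / (2 * \<kappa>)" for R y z
    proof -
      have "(\<integral>\<^sup>+x\<in>?A z R. ennreal (norm (K x y - K x z) powr s) \<partial>M) \<le> ennreal (((d y z / R) powr \<delta> * (C1 / V z R powr (1 - 1 / s))) powr s)"
        using C1(1) by (intro enn_powr_leD[OF C1(2)[OF that] s0]) simp
      also have "(d y z / R) powr \<delta> * (C1 / V z R powr (1 - 1 / s)) = C1 * (d y z / R) powr \<delta> / V z R powr (1 - 1 / s)" by simp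
      also have "\<dots> powr s = (C1 * (d y z / R) powr \<delta>) powr s * V z R powr (1 - s)" by (rule V_powr[OF V_pos[OF that(1)]])
      finally show ?thesis .
    qed
  qed (use s \<delta> C1(1) CN(1) in auto)
  then show ?thesis by (rule that)
qed

section \<open>Growth of the mean oscillation under admissibility\<close>

context homogeneous_type_space
begin

lemma admissible_ball_comparison:
  assumes \<rho>: "\<And>x. 0 < \<rho> x" and k: "admissible_with d \<rho> k"
  obtains c where "1 \<le> c" "\<And>z w r. 0 < r \<Longrightarrow> d z w \<le> 2 * \<kappa> * r \<Longrightarrow> 1 / \<rho> w \<le> c / \<rho> z * (1 + r / \<rho> z) powr k"
proof -
  have k0: "0 < k" using k by (simp add: admissible_with_def)
  obtain c0 where c0: "0 < c0" "\<And>x y. 1 / \<rho> x \<le> c0 / \<rho> y * (1 + d x y / \<rho> y) powr k"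
    using k unfolding admissible_with_def by blast
  define c where "c = max 1 (c0 * (2 * \<kappa>) powr k)"
  have "1 / \<rho> w \<le> c / \<rho> z * (1 + r / \<rho> z) powr k" if r: "0 < r" and zw: "d z w \<le> 2 * \<kappa> * r" for z w r
  proof -
    have \<kappa>1: "1 \<le> 2 * \<kappa>" using kappa_ge_1 by simp
    have "d w z / \<rho> z \<le> 2 * \<kappa> * r / \<rho> z" using zw \<rho>[of z] by (intro divide_right_mono) (auto simp: d_sym)
    then have "1 + d w z / \<rho> z \<le> 2 * \<kappa> * (1 + r / \<rho> z)" using \<kappa>1 by (simp add: distrib_left)
    then have "(1 + d w z / \<rho> z) powr k \<le> (2 * \<kappa> * (1 + r / \<rho> z)) powr k"
      using k0 \<rho>[of z] d_nonneg[of w z] by (intro powr_mono2) (auto intro: add_nonneg_nonneg)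
    also have "\<dots> = (2 * \<kappa>) powr k * (1 + r / \<rho> z) powr k" by (rule powr_mult)
    finally have "c0 / \<rho> z * (1 + d w z / \<rho> z) powr k \<le> c0 / \<rho> z * ((2 * \<kappa>) powr k * (1 + r / \<rho> z) powr k)"
      using c0(1) \<rho>[of z] by (intro mult_left_mono) auto
    also have "\<dots> = (c0 * (2 * \<kappa>) powr k) / \<rho> z * (1 + r / \<rho> z) powr k" by simp
    also have "\<dots> \<le> c / \<rho> z * (1 + r / \<rho> z) powr k"
      using \<rho>[of z] by (intro mult_right_mono divide_right_mono) (auto simp: c_def)
    finally show ?thesis using c0(2)[of w z] by simp
  qed
  moreover have "1 \<le> c" by (simp add: c_def)
  ultimately show ?thesis using that by blast
qed

text \<open>The exponent \<open>k + 1\<close> splits into one power of \<open>r / \<rho> z\<close>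
  from the radius \<open>u\<close> and \<open>k\<close> powers from replacing
  \<open>1 / \<rho> w\<close> by \<open>1 / \<rho> z\<close>.\<close>

lemma radius_ratio_growth:
  assumes \<rho>: "\<And>x. 0 < \<rho> x" and c: "1 \<le> c" and r: "0 < r" and u: "0 < u" "u \<le> 2 * \<kappa> * r"
    and le: "1 / \<rho> w \<le> c / \<rho> z * (1 + r / \<rho> z) powr k" and k: "0 \<le> k"
  shows "1 + u / \<rho> w \<le> (1 + 2 * \<kappa> * c) * (1 + r / \<rho> z) powr (k + 1)"
proof -
  define X where "X = 1 + r / \<rho> z"
  have X: "1 \<le> X" using r \<rho>[of z] by (simp add: X_def)
  have "u / \<rho> w \<le> (2 * \<kappa> * r) * (1 / \<rho> w)" using u \<rho>[of w] by (simp add: divide_right_mono)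
  also have "\<dots> \<le> (2 * \<kappa> * r) * (c / \<rho> z * X powr k)"
    using le r kappa_pos unfolding X_def by (intro mult_left_mono) auto
  also have "\<dots> = 2 * \<kappa> * c * (r / \<rho> z * X powr k)" by simp
  also have "\<dots> \<le> 2 * \<kappa> * c * (X * X powr k)"
    using kappa_pos c by (intro mult_left_mono mult_right_mono) (auto simp: X_def)
  also have "X * X powr k = X powr (k + 1)" using X by (simp add: powr_add)
  finally have "u / \<rho> w \<le> 2 * \<kappa> * c * X powr (k + 1)" .
  moreover have "1 \<le> X powr (k + 1)" using X k by (intro ge_one_powr_ge_zero) auto
  ultimately show ?thesis by (simp add: X_def distrib_right)
qed

lemma BMO_bound:
  assumes "b \<in> BMO d M \<rho> \<theta>" and \<rho>: "\<And>x. 0 < \<rho> x"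
  obtains N0 where "0 < N0" "\<And>x r. 0 < r \<Longrightarrow> MO d M b x r \<le> N0 * (1 + r / \<rho> x) powr \<theta>"
proof -
  have "BMO_norm d M \<rho> \<theta> b < top" using assms by (simp add: BMO_def)
  then obtain N0 where N0: "BMO_norm d M \<rho> \<theta> b = ennreal N0" "0 \<le> N0" by (cases "BMO_norm d M \<rho> \<theta> b") auto
  \<comment> \<open>\<open>N0\<close> is 0 for constant \<open>b\<close>; adding 1 gives the
    positive constant that is asked for.\<close>
  have "MO d M b x r \<le> (N0 + 1) * (1 + r / \<rho> x) powr \<theta>" if r: "0 < r" for x r
  proof -
    have pos: "0 < 1 + r / \<rho> x" using r \<rho>[of x] by (simp add: add_pos_pos)
    have "ennreal ((1 + r / \<rho> x) powr (- \<theta>) * MO d M b x r) \<le> ennreal N0"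
      unfolding N0(1)[symmetric] BMO_norm_def using r by (intro SUP_upper2[of x] SUP_upper2[of r]) auto
    then have "(1 + r / \<rho> x) powr (- \<theta>) * MO d M b x r \<le> N0" using N0(2) by (simp add: ennreal_le_iff)
    then have "MO d M b x r \<le> N0 * (1 + r / \<rho> x) powr \<theta>"
      using pos by (simp add: powr_minus_divide pos_divide_le_eq)
    also have "\<dots> \<le> (N0 + 1) * (1 + r / \<rho> x) powr \<theta>" by (intro mult_right_mono) auto
    finally show ?thesis .
  qed
  then show ?thesis using that[of "N0 + 1"] N0(2) by auto
qed

lemma BMO_log_bound:
  assumes "b \<in> BMO_log d M \<rho> \<theta>" and \<rho>: "\<And>x. 0 < \<rho> x"
  obtains N0 where "0 < N0" "\<And>x r. 0 < r \<Longrightarrow> MO d M b x r \<le> N0 * (1 + r / \<rho> x) powr \<theta> / ln (exp 1 + \<rho> x / r)"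
proof -
  have "BMO_log_norm d M \<rho> \<theta> b < top" using assms by (simp add: BMO_log_def)
  then obtain N0 where N0: "BMO_log_norm d M \<rho> \<theta> b = ennreal N0" "0 \<le> N0" by (cases "BMO_log_norm d M \<rho> \<theta> b") auto
  have "MO d M b x r \<le> (N0 + 1) * (1 + r / \<rho> x) powr \<theta> / ln (exp 1 + \<rho> x / r)" if r: "0 < r" for x r
  proof -
    have pos: "0 < 1 + r / \<rho> x" using r \<rho>[of x] by (simp add: add_pos_pos)
    have "ln (exp 1) \<le> ln (exp 1 + \<rho> x / r)" using r \<rho>[of x] by (intro ln_mono) (auto intro: add_pos_pos)
    then have l: "0 < ln (exp 1 + \<rho> x / r)" by simp
    have "ennreal (ln (exp 1 + \<rho> x / r) * (1 + r / \<rho> x) powr (- \<theta>) * MO d M b x r) \<le> ennreal N0"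
      unfolding N0(1)[symmetric] BMO_log_norm_def using r by (intro SUP_upper2[of x] SUP_upper2[of r]) auto
    then have "ln (exp 1 + \<rho> x / r) * (1 + r / \<rho> x) powr (- \<theta>) * MO d M b x r \<le> N0" using N0(2) by (simp add: ennreal_le_iff)
    then have "MO d M b x r \<le> N0 * (1 + r / \<rho> x) powr \<theta> / ln (exp 1 + \<rho> x / r)"
      using pos l by (simp add: powr_minus_divide pos_divide_le_eq pos_le_divide_eq mult.commute)
    also have "\<dots> \<le> (N0 + 1) * (1 + r / \<rho> x) powr \<theta> / ln (exp 1 + \<rho> x / r)"
      using l by (intro divide_right_mono mult_right_mono) auto
    finally show ?thesis .
  qed
  then show ?thesis using that[of "N0 + 1"] N0(2) by auto
qed

lemma BMO_growth:
  assumes \<rho>: "\<And>x. 0 < \<rho> x" and k: "admissible_with d \<rho> k" and \<theta>: "0 \<le> \<theta>" and A: "0 < A"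
    and MO: "\<And>x r. 0 < r \<Longrightarrow> MO d M b x r \<le> A * (1 + r / \<rho> x) powr \<theta>"
  obtains A0 where "0 < A0" "\<And>z r. 0 < r \<Longrightarrow> MO_le b (A0 * (1 + r / \<rho> z) powr (\<theta> * (k + 1))) z r"
proof -
  have k0: "0 \<le> k" using k by (simp add: admissible_with_def)
  obtain c where c: "1 \<le> c" "\<And>z w r. 0 < r \<Longrightarrow> d z w \<le> 2 * \<kappa> * r \<Longrightarrow> 1 / \<rho> w \<le> c / \<rho> z * (1 + r / \<rho> z) powr k"
    by (rule admissible_ball_comparison[OF \<rho> k]) blast
  define E where "E = 1 + 2 * \<kappa> * c"
  have E: "0 < E" using c kappa_pos by (simp add: E_def add_pos_pos)
  have "MO_le b (A * E powr \<theta> * (1 + r / \<rho> z) powr (\<theta> * (k + 1))) z r" if r: "0 < r" for z r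
    unfolding MO_le_def
  proof (intro allI impI)
    fix w u assume w: "d z w \<le> 2 * \<kappa> * r" "0 < u" "u \<le> 2 * \<kappa> * r"
    have "1 + u / \<rho> w \<le> E * (1 + r / \<rho> z) powr (k + 1)"
      unfolding E_def by (rule radius_ratio_growth[where \<rho> = \<rho>, OF \<rho> c(1) r w(2,3) c(2)[OF r w(1)] k0])
    then have "(1 + u / \<rho> w) powr \<theta> \<le> (E * (1 + r / \<rho> z) powr (k + 1)) powr \<theta>"
      using \<theta> w(2) \<rho>[of w] by (intro powr_mono2) (auto intro: add_nonneg_nonneg)
    also have "\<dots> = E powr \<theta> * (1 + r / \<rho> z) powr (\<theta> * (k + 1))" by (simp add: powr_mult powr_powr mult.commute)
    finally have "A * (1 + u / \<rho> w) powr \<theta> \<le> A * (E powr \<theta> * (1 + r / \<rho> z) powr (\<theta> * (k + 1)))" using A by (intro mult_left_mono) auto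
    then show "MO d M b w u \<le> A * E powr \<theta> * (1 + r / \<rho> z) powr (\<theta> * (k + 1))" using MO[OF w(2), of w] by (simp add: mult.assoc)
  qed
  moreover have "0 < A * E powr \<theta>" using A E by simp
  ultimately show ?thesis using that by blast
qed

text \<open>The logarithm varies slowly: a bound of \<open>\<rho> z / r\<close> by
  \<open>F * (\<rho> w / u)\<close> costs only the summand \<open>ln F\<close>, which is at most
  \<open>ln F\<close> times the second logarithm since the latter is at least 1. So the logarithmic
  gain at \<open>z\<close> persists on the neighbouring balls, up to the factor
  \<open>1 + ln F\<close>.\<close>

lemma BMO_log_growth:
  assumes \<rho>: "\<And>x. 0 < \<rho> x" and k: "admissible_with d \<rho> k" and \<theta>: "0 \<le> \<theta>" and A: "0 < A"
    and MO: "\<And>x r. 0 < r \<Longrightarrow> MO d M b x r \<le> A * (1 + r / \<rho> x) powr \<theta> / ln (exp 1 + \<rho> x / r)"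
  obtains A1 where "0 < A1" "\<And>z r. 0 < r \<Longrightarrow> r < \<rho> z \<Longrightarrow> MO_le b (A1 / ln (exp 1 + \<rho> z / r)) z r"
proof -
  have k0: "0 \<le> k" using k by (simp add: admissible_with_def)
  obtain c where c: "1 \<le> c" "\<And>z w r. 0 < r \<Longrightarrow> d z w \<le> 2 * \<kappa> * r \<Longrightarrow> 1 / \<rho> w \<le> c / \<rho> z * (1 + r / \<rho> z) powr k"
    by (rule admissible_ball_comparison[OF \<rho> k]) blast
  define E where "E = (1 + 2 * \<kappa> * c) * 2 powr (k + 1)"
  have E: "0 < E" using c kappa_pos by (simp add: E_def add_pos_pos)
  define F where "F = 2 * \<kappa> * c * 2 powr k"
  have F: "1 \<le> F"
  proof -
    have "1 \<le> 2 * \<kappa>" using kappa_ge_1 by simp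
    then have "1 * 1 * 1 \<le> 2 * \<kappa> * c * 2 powr k" using c(1) k0 by (intro mult_mono ge_one_powr_ge_zero) auto
    then show ?thesis by (simp add: F_def)
  qed
  have "MO_le b (A * E powr \<theta> * (1 + ln F) / ln (exp 1 + \<rho> z / r)) z r" if r: "0 < r" "r < \<rho> z" for z r
    unfolding MO_le_def
  proof (intro allI impI)
    fix w u assume w: "d z w \<le> 2 * \<kappa> * r" "0 < u" "u \<le> 2 * \<kappa> * r"
    have X: "1 + r / \<rho> z \<le> 2" "0 \<le> 1 + r / \<rho> z" using r \<rho>[of z] by (auto intro: add_nonneg_nonneg)
    have cw: "1 / \<rho> w \<le> c / \<rho> z * (1 + r / \<rho> z) powr k" by (rule c(2)[OF r(1) w(1)])
    have "1 + u / \<rho> w \<le> (1 + 2 * \<kappa> * c) * (1 + r / \<rho> z) powr (k + 1)"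
      by (rule radius_ratio_growth[where \<rho> = \<rho>, OF \<rho> c(1) r(1) w(2,3) cw k0])
    also have "\<dots> \<le> E"
      unfolding E_def using X k0 c kappa_pos by (intro mult_left_mono powr_mono2) auto
    finally have "(1 + u / \<rho> w) powr \<theta> \<le> E powr \<theta>"
      using \<theta> w(2) \<rho>[of w] by (intro powr_mono2) (auto intro: add_nonneg_nonneg)
    have "u / \<rho> w \<le> (2 * \<kappa> * r) * (1 / \<rho> w)" using w(3) \<rho>[of w] by (simp add: divide_right_mono)
    also have "\<dots> \<le> (2 * \<kappa> * r) * (c / \<rho> z * 2 powr k)"
    proof (rule mult_left_mono)
      have "c / \<rho> z * (1 + r / \<rho> z) powr k \<le> c / \<rho> z * 2 powr k"
        using X k0 c(1) \<rho>[of z] by (intro mult_left_mono powr_mono2) auto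
      then show "1 / \<rho> w \<le> c / \<rho> z * 2 powr k" using cw by simp
    qed (use kappa_pos r in auto)
    also have "\<dots> = F * (r / \<rho> z)" by (simp add: F_def)
    finally have uw: "u / \<rho> w \<le> F * (r / \<rho> z)" .
    have zr: "0 < \<rho> z / r" and wu: "0 < \<rho> w / u" using r w(2) \<rho> by auto
    have "\<rho> z / r \<le> F * (\<rho> w / u)"
      using uw r w(2) \<rho>[of z] \<rho>[of w] by (simp add: field_simps)
    then have "exp 1 + \<rho> z / r \<le> F * exp 1 + F * (\<rho> w / u)"
      using F mult_right_mono[of 1 F "exp 1"] by (intro add_mono) auto
    then have "ln (exp 1 + \<rho> z / r) \<le> ln (F * (exp 1 + \<rho> w / u))"
      using zr by (intro ln_mono) (auto simp: distrib_left intro: add_pos_pos)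
    also have "\<dots> = ln F + ln (exp 1 + \<rho> w / u)" using F wu by (intro ln_mult_pos) (auto intro: add_pos_pos)
    also have "\<dots> \<le> ln F * ln (exp 1 + \<rho> w / u) + ln (exp 1 + \<rho> w / u)"
    proof -
      have "ln (exp 1) \<le> ln (exp 1 + \<rho> w / u)" using wu by (intro ln_mono) (auto intro: add_pos_pos)
      then have "ln F * 1 \<le> ln F * ln (exp 1 + \<rho> w / u)" using F by (intro mult_left_mono) auto
      then show ?thesis by simp
    qed
    finally have ln_le: "ln (exp 1 + \<rho> z / r) \<le> (1 + ln F) * ln (exp 1 + \<rho> w / u)" by (simp add: distrib_right)
    have "ln (exp 1) \<le> ln (exp 1 + \<rho> z / r)" using zr by (intro ln_mono) (auto intro: add_pos_pos)
    then have lz: "0 < ln (exp 1 + \<rho> z / r)" by simp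
    have "ln (exp 1) \<le> ln (exp 1 + \<rho> w / u)" using wu by (intro ln_mono) (auto intro: add_pos_pos)
    then have lw: "0 < ln (exp 1 + \<rho> w / u)" by simp
    have "1 / ln (exp 1 + \<rho> w / u) \<le> (1 + ln F) / ln (exp 1 + \<rho> z / r)"
      using ln_le lz lw by (simp add: divide_simps mult.commute)
    then have "A * (1 + u / \<rho> w) powr \<theta> * (1 / ln (exp 1 + \<rho> w / u)) \<le> A * E powr \<theta> * ((1 + ln F) / ln (exp 1 + \<rho> z / r))"
      using A \<open>(1 + u / \<rho> w) powr \<theta> \<le> E powr \<theta>\<close> lw by (intro mult_mono mult_left_mono) auto
    then show "MO d M b w u \<le> A * E powr \<theta> * (1 + ln F) / ln (exp 1 + \<rho> z / r)" using MO[OF w(2), of w] by simp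
  qed
  moreover have "0 < A * E powr \<theta> * (1 + ln F)" using A E F by (simp add: add_pos_nonneg)
  ultimately show ?thesis using that by blast
qed

end

theorem corollary1p1:
  fixes d :: "'a \<Rightarrow> 'a \<Rightarrow> real" and \<kappa> :: real and M :: "'a measure"
    and \<rho> :: "'a \<Rightarrow> real" and q :: ennreal and s \<delta> \<theta> :: real
    and T :: "('a \<Rightarrow> 'k::{real_normed_field, banach, second_countable_topology}) \<Rightarrow> ('a \<Rightarrow> 'k)"
    and b :: "'a \<Rightarrow> 'k"
  assumes "homogeneous_type_space d \<kappa> M"
    and "admissible d \<rho>"
    and "1 < q"
    and "1 < s"
    and "0 < \<delta>" and "\<delta> \<le> 1"
    and "0 \<le> \<theta>" and "\<theta> < \<delta> / (admissibility_index d \<rho> + 1)"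
    and "CZ_operator d \<kappa> M \<rho> s \<delta> T"
  shows "(b \<in> BMO d M \<rho> \<theta> \<longrightarrow>
            commutator_bounded_from_H1 d M \<rho> q s b T (weak_Lp_norm M 1)) \<and>
         (b \<in> BMO_log d M \<rho> \<theta> \<longrightarrow>
            commutator_bounded_from_H1 d M \<rho> q s b T (Lp_norm M 1))"
proof -
  interpret homogeneous_type_space d \<kappa> M by (rule assms(1))
  have \<rho>: "\<And>x. 0 < \<rho> x" and ex: "\<exists>k. admissible_with d \<rho> k" using assms(2) by (auto simp: admissible_def)
  let ?i = "admissibility_index d \<rho>"
  have "0 \<le> ?i" unfolding admissibility_index_def using ex
    by (intro cInf_greatest) (auto simp: admissible_with_def)
  \<comment> \<open>The index is an infimum that need not be attained, but the strict inequality
    leaves room above it. For \<theta> = 0 any admissible exponent will do.\<close>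
  have "\<exists>k. admissible_with d \<rho> k \<and> \<theta> * (k + 1) < \<delta>"
  proof (cases "\<theta> = 0")
    case True
    then show ?thesis using ex assms(5) by auto
  next
    case False
    then have "0 < \<theta>" using assms(7) by simp
    have "\<theta> * (?i + 1) < \<delta>" using assms(8) \<open>0 \<le> ?i\<close> by (simp add: pos_less_divide_eq)
    then have "?i < \<delta> / \<theta> - 1" using \<open>0 < \<theta>\<close> by (simp add: field_simps)
    then obtain k where "admissible_with d \<rho> k" "k < \<delta> / \<theta> - 1"
      unfolding admissibility_index_def using cInf_lessD[of "{k. admissible_with d \<rho> k}"] ex by blast
    then show ?thesis using \<open>0 < \<theta>\<close> by (intro exI[of _ k]) (auto simp: field_simps)
  qed
  then obtain k where k: "admissible_with d \<rho> k" "\<theta> * (k + 1) < \<delta>" by blast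
  have "0 \<le> k" using k(1) by (simp add: admissible_with_def)
  then have \<tau>: "0 \<le> \<theta> * (k + 1)" using assms(7) by simp
  \<comment> \<open>The midpoint of 1 and \<open>s\<close>, lowered to \<open>q\<close> where
    necessary, so that every atom is integrable with exponent \<open>p\<close>.\<close>
  obtain p where pq: "1 < p" "p < s" "ennreal p \<le> q"
  proof (cases q)
    case (real q')
    then have "ennreal 1 < ennreal q'" using assms(3) real by simp
    then have q': "1 < q'" by (subst (asm) ennreal_less_iff) auto
    show ?thesis
    proof (rule that[of "min q' ((1 + s) / 2)"])
      show "ennreal (min q' ((1 + s) / 2)) \<le> q" using real by (auto intro: ennreal_leI)
    qed (use q' assms(4) in \<open>auto simp: min_def\<close>)
  next
    case top
    then show ?thesis using that[of "(1 + s) / 2"] assms(4) by auto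
  qed
  obtain K CT C1 CN where cz: "cz_operator d \<kappa> M \<rho> s \<delta> T K CT C1 CN"
    by (rule CZ_operator_imp_cz_operator[OF assms(1) \<rho> assms(4,5,9)]) blast
  have setting: "\<exists>A0. cz_commutator d \<kappa> M \<rho> s \<delta> T K CT C1 CN b (\<theta> * (k + 1)) A0 p"
    if b: "b \<in> L1_loc d M" and A: "0 < A" "\<And>x r. 0 < r \<Longrightarrow> MO d M b x r \<le> A * (1 + r / \<rho> x) powr \<theta>" for A
  proof -
    obtain A0 where A0: "0 < A0" "\<And>z r. 0 < r \<Longrightarrow> MO_le b (A0 * (1 + r / \<rho> z) powr (\<theta> * (k + 1))) z r"
      by (rule BMO_growth[where \<rho> = \<rho> and b = b, OF \<rho> k(1) assms(7) A]) (assumption, rule that)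
    interpret cz_operator d \<kappa> M \<rho> s \<delta> T K CT C1 CN by (rule cz)
    have "cz_commutator d \<kappa> M \<rho> s \<delta> T K CT C1 CN b (\<theta> * (k + 1)) A0 p"
      by unfold_locales (use b \<tau> k(2) A0 pq in auto)
    then show ?thesis by blast
  qed
  have "commutator_bounded_from_H1 d M \<rho> q s b T (weak_Lp_norm M 1)" if b: "b \<in> BMO d M \<rho> \<theta>"
  proof -
    obtain A where A: "0 < A" "\<And>x r. 0 < r \<Longrightarrow> MO d M b x r \<le> A * (1 + r / \<rho> x) powr \<theta>"
      by (rule BMO_bound[where \<rho> = \<rho>, OF b \<rho>]) blast
    have "b \<in> L1_loc d M" using b by (simp add: BMO_def)
    from setting[OF this A] obtain A0 where "cz_commutator d \<kappa> M \<rho> s \<delta> T K CT C1 CN b (\<theta> * (k + 1)) A0 p" by blast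
    then interpret cz_commutator d \<kappa> M \<rho> s \<delta> T K CT C1 CN b "\<theta> * (k + 1)" A0 p .
    obtain C where C: "0 < C" "\<And>f c z r a. ndec f c z r a \<Longrightarrow> weak_Lp_norm M 1 (U f) \<le> ennreal (C * (\<Sum>j. norm (c j)))"
      by (rule U_weak_bound) blast
    show ?thesis by (rule commutator_bounded[OF assms(3) pq(3) C(1)]) (rule C(2))
  qed
  moreover have "commutator_bounded_from_H1 d M \<rho> q s b T (Lp_norm M 1)" if b: "b \<in> BMO_log d M \<rho> \<theta>"
  proof -
    obtain A where A: "0 < A" "\<And>x r. 0 < r \<Longrightarrow> MO d M b x r \<le> A * (1 + r / \<rho> x) powr \<theta> / ln (exp 1 + \<rho> x / r)"
      by (rule BMO_log_bound[where \<rho> = \<rho>, OF b \<rho>]) blast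
    \<comment> \<open>The logarithm is at least 1, so the logarithmic condition implies the plain
      one and the setting of part (i) is available.\<close>
    have A': "MO d M b x r \<le> A * (1 + r / \<rho> x) powr \<theta>" if r: "0 < r" for x r
    proof -
      have "ln (exp 1) \<le> ln (exp 1 + \<rho> x / r)" using r \<rho>[of x] by (intro ln_mono) (auto intro: add_pos_pos)
      then have "A * (1 + r / \<rho> x) powr \<theta> / ln (exp 1 + \<rho> x / r) \<le> A * (1 + r / \<rho> x) powr \<theta> / 1"
        using A(1) by (intro divide_left_mono) auto
      then show ?thesis using A(2)[OF r, of x] by simp
    qed
    obtain A1 where A1: "0 < A1" "\<And>z r. 0 < r \<Longrightarrow> r < \<rho> z \<Longrightarrow> MO_le b (A1 / ln (exp 1 + \<rho> z / r)) z r"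
      by (rule BMO_log_growth[where \<rho> = \<rho> and b = b, OF \<rho> k(1) assms(7) A]) (assumption, rule that)
    have "b \<in> L1_loc d M" using b by (simp add: BMO_log_def)
    from setting[OF this A(1) A'] obtain A0 where "cz_commutator d \<kappa> M \<rho> s \<delta> T K CT C1 CN b (\<theta> * (k + 1)) A0 p" by blast
    then interpret cz_commutator d \<kappa> M \<rho> s \<delta> T K CT C1 CN b "\<theta> * (k + 1)" A0 p .
    have "log_osc A1" using A1 by (simp add: log_osc_def)
    from U_L1_bound[OF this] obtain C where C: "0 < C" "\<And>f c z r a. ndec f c z r a \<Longrightarrow> Lp_norm M 1 (U f) \<le> ennreal (C * (\<Sum>j. norm (c j)))"
      by blast
    show ?thesis by (rule commutator_bounded[OF assms(3) pq(3) C(1)]) (rule C(2))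
  qed
  ultimately show ?thesis by blast
qed

end
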